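(* Let $R$ be an integral domain containing $\omega_1$ and $2^{-1}$, let $r,t$ be positive integers, and let $BC^{\rm aff}_{r,t}$ be the affine walled Brauer-Clifford superalgebra over $R$. For any positive integer $k$ there is a superalgebra homomorphism $\Phi_k:BC^{\rm aff}_{r,t}\to BC_{r+k,t+k}$ sending $s_i,\ \bar s_j,\ e_1,\ x_1,\ \bar x_1,\ c_l,\ \bar c_m,\ \omega_a,\ \bar\omega_a$ to $s_{k+i},\ \bar s_{k+j},\ e_{k+1},\ y_{k+1},\ \bar y_{k+1},\ c_{k+l},\ \bar c_{k+m},\ \omega_{a,k+1},\ \bar\omega_{a,k+1}$ respectively, for all admissible $a,i,j,l,m$.
   Context: **Walled Brauer-Clifford superalgebra.** $\Sigma_r$ acts on $\{1,\dots,r\}$ on the right, $s_i=(i,i+1)$, $\bar s_i=(\bar i,\overline{i+1})$. $BC_{r,t}$ is the associative $R$-superalgebra generated by even $e_1,s_1,\dots,s_{r-1},\bar s_1,\dots,\bar s_{t-1}$ and odd $c_1,\dots,c_r,\bar c_1,\dots,\bar c_t$ with relations (all admissible indices): (W1) $s_i^2=1$, $s_is_{i+1}s_i=s_{i+1}s_is_{i+1}$, $s_is_j=s_js_i$ if $|i-j|>1$; $c_i^2=-1$, $c_ic_j=-c_jc_i$ ($i\ne j$), $w^{-1}c_iw=c_{(i)w}$ for $w\in\Sigma_r$; (W2) the same relations for $\bar s_i,\bar c_i$, except that $\bar c_i^2=1$; (W3) $e_1c_1=e_1\bar c_1$, $c_1e_1=\bar c_1e_1$; $\bar s_jc_i=c_i\bar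 s_j$, $s_i\bar c_j=\bar c_js_i$; $c_i\bar c_j=-\bar c_jc_i$, $s_i\bar s_j=\bar s_js_i$; $e_1^2=0$; $e_1s_1e_1=e_1=e_1\bar s_1e_1$; $s_ie_1=e_1s_i$, $\bar s_ie_1=e_1\bar s_i$, $c_ie_1=e_1c_i$, $\bar c_ie_1=e_1\bar c_i$ for $i\ne1$; $e_1s_1\bar s_1e_1s_1=e_1s_1\bar s_1e_1\bar s_1$; $s_1e_1s_1\bar s_1e_1=\bar s_1e_1s_1\bar s_1e_1$; $e_1c_1e_1=0=e_1\bar c_1e_1$. **Elements of walled Brauer-Clifford superalgebras.** $e_{i,j}=(\bar1,\bar j)(1,i)e_1(1,i)(\bar1,\bar j)$, $e_i=e_{i,i}$, $\bar e_{i,j}=c_ie_{i,j}c_i$; $L_1=\bar L_1=0$, $L_i=\sum_{j<i}(j,i)+c_i\big(\sum_{j<i}(j,i)\big)c_i$, $\bar L_i=\sum_{j<i}(\bar j,\bar i)-\bar c_i\big(\sum_{j<i}(\bar j,\bar i)\big)\bar c_i$; $y_i=\sum_{j=1}^{i-1}(e_{i,j}+\bar e_{i,j})-L_i$, $\bar y_i=\sum_{j=1}^{i-1}(e_{j,i}-\bar e_{j,i})-\bar L_i$. Let $BC_{k,k}$ also denote the subalgebra of $BC_{r+k,t+k}$ generated by $e_1,s_1,\dots,s_{k-1},\bar s_1,\dots,\bar s_{k-1},c_1,\bar c_1$. Then $\omega_{a,k+1}$ (resp. $\bar\omega_{a,k+1}$) is the unique element of this subalgebra with $e_{k+1}y_{k+1}^ae_{k+1}=\omega_{a,k+1}e_{k+1}$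 (resp. $e_{k+1}\bar y_{k+1}^ae_{k+1}=\bar\omega_{a,k+1}e_{k+1}$). **Affine version.** $BC_{r,t}^{\rm aff}$ (with $\omega_1\in R$ fixed) is the associative $R$-superalgebra generated by the generators of $BC_{r,t}$, even $x_1,\bar x_1$, and even central elements $\omega_{2n+1},\bar\omega_n$ ($n\ge1$), with relations (W1)-(W3) and (put $\bar e_1=c_1e_1c_1$, $\omega_{2n}=0$): (A1) $x_1x_2=x_2x_1$ where $x_2=s_1x_1s_1-(1-c_1c_2)s_1$; $x_1c_i=(-1)^{\delta_{i,1}}c_ix_1$ (here $\delta_{i,1}$ is the Kronecker symbol); $s_jx_1=x_1s_j$ for $j\ne1$; $\bar x_1\bar x_2=\bar x_2\bar x_1$ where $\bar x_2=\bar s_1\bar x_1\bar s_1-(1+\bar c_1\bar c_2)\bar s_1$; $\bar x_1\bar c_i=(-1)^{\delta_{i,1}}\bar c_i\bar x_1$; $\bar s_j\bar x_1=\bar x_1\bar s_j$ for $j\neq1$; (A2) $e_1(x_1+\bar x_1)=(x_1+\bar x_1)e_1=0$; $e_1s_1x_1s_1=s_1x_1s_1e_1$; $e_1\bar s_1\bar x_1\bar s_1=\bar s_1\bar x_1\bar s_1e_1$; $x_1(e_1+\bar x_1-\bar e_1)=(e_1+\bar x_1-\bar e_1)x_1$; $x_1\bar c_i=\bar c_ix_1$, $\bar x_1c_i=c_i\bar x_1$, $x_1\bar s_i=\bar s_ix_1$, $\bar x_1s_i=s_i\bar x_1$; (A3) $e_1x_1^{2n+1}e_1=\omega_{2n+1}e_1$,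 $e_1x_1^{2n}e_1=0$ ($n\ge0$), $e_1\bar x_1^ne_1=\bar\omega_ne_1$ ($n\ge1$). Standing assumption: $\bar\omega_{2n}=0$ and $\bar\omega_{2n+1}=\sum_{i=0}^na_{2n+1,i}\,\omega_{2i+1}$, where $a_{2n+1,n}=-1$, $a_{2n+1,j}=a_{2n-1,j-1}$ for $1\le j\le n-1$, and $a_{2n+1,0}=\sum_{j=0}^{n-1}a_{2n-1,j}\omega_{2j+1}$ for $n\ge1$.
   Formalization: The formal theorem adds the hypothesis ω_1 = 0; this is necessary, since e_{k+1}y_{k+1}e_{k+1} = 0 while e_1x_1e_1 = ω_1e_1 would force ω_1e_{k+1} = 0, which is false for every nonzero ω_1 in the domain R. *)

theory Defs
  imports
    "HOL-Algebra.QuotRing"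
    "HOL-Algebra.Module"
    "HOL-Library.Poly_Mapping"
    "HOL-Combinatorics.Transposition"
begin

section \<open>Superalgebras given by generators and relations\<close>

record ('a, 'b) superalgebra = "('a, 'b) module" +
  even_part :: "'b set"
  odd_part :: "'b set"

definition superalgebra_hom ::
  "('a, 'b, 'm) superalgebra_scheme \<Rightarrow> ('a, 'c, 'n) superalgebra_scheme \<Rightarrow> ('b \<Rightarrow> 'c) set" where
  "superalgebra_hom A B = {\<phi> \<in> ring_hom A B.
     (\<forall>a. \<forall>x\<in>carrier A. \<phi> (a \<odot>\<^bsub>A\<^esub> x) = a \<odot>\<^bsub>B\<^esub> \<phi> x) \<and>
     \<phi> ` even_part A \<subseteq> even_part B \<and>
     \<phi> ` odd_part A \<subseteq> odd_part B}"

inductive_set generated_subalgebra ::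
  "('a, 'b, 'm) superalgebra_scheme \<Rightarrow> 'b set \<Rightarrow> 'b set" for A and H where
  one: "\<one>\<^bsub>A\<^esub> \<in> generated_subalgebra A H"
| incl: "h \<in> H \<Longrightarrow> h \<in> generated_subalgebra A H"
| add: "x \<in> generated_subalgebra A H \<Longrightarrow> y \<in> generated_subalgebra A H
    \<Longrightarrow> x \<oplus>\<^bsub>A\<^esub> y \<in> generated_subalgebra A H"
| mult: "x \<in> generated_subalgebra A H \<Longrightarrow> y \<in> generated_subalgebra A H
    \<Longrightarrow> x \<otimes>\<^bsub>A\<^esub> y \<in> generated_subalgebra A H"
| smult: "x \<in> generated_subalgebra A H \<Longrightarrow> a \<odot>\<^bsub>A\<^esub> x \<in> generated_subalgebra A H"

text \<open>The free associative algebra on \<open>'g\<close> is the monoid algebra (\<^verbatim>\<open>Poly_Mapping\<close>) of the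
  free monoid on \<open>'g\<close>. The free monoid is written additively because the multiplication of
  \<^verbatim>\<open>Poly_Mapping\<close> is the convolution over an additive, not necessarily commutative, monoid.\<close>

datatype 'g free_word = Word (letters: "'g list")

instantiation free_word :: (type) monoid_add
begin
definition zero_free_word :: "'a free_word" where "0 = Word []"
definition plus_free_word :: "'a free_word \<Rightarrow> 'a free_word \<Rightarrow> 'a free_word" where
  "u + v = Word (letters u @ letters v)"
instance by standard (simp_all add: zero_free_word_def plus_free_word_def)
end

type_synonym ('g, 'a) free_algebra = "'g free_word \<Rightarrow>\<^sub>0 'a"

definition scalar :: "'a::comm_ring_1 \<Rightarrow> ('g, 'a) free_algebra" where
  "scalar a = Poly_Mapping.single 0 a"

definition var :: "'g \<Rightarrow> ('g, 'a::comm_ring_1) free_algebra" where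
  "var g = Poly_Mapping.single (Word [g]) 1"

text \<open>\<^term>\<open>G\<close> is the set of generators in use; \<^term>\<open>par g\<close> says that the generator \<^term>\<open>g\<close> is
  odd. A word is odd if it has an odd number of odd letters.\<close>

definition free_superalgebra ::
  "('g \<Rightarrow> bool) \<Rightarrow> 'g set \<Rightarrow> ('a::comm_ring_1, ('g, 'a) free_algebra) superalgebra" where
  "free_superalgebra par G =
    (let F = {p. \<forall>w\<in>Poly_Mapping.keys p. set (letters w) \<subseteq> G} in
     \<lparr>carrier = F, mult = (*), one = 1, zero = 0, add = (+), smult = (\<lambda>a p. scalar a * p),
      even_part = {p \<in> F. \<forall>w\<in>Poly_Mapping.keys p. even (length (filter par (letters w)))},
      odd_part = {p \<in> F. \<forall>w\<in>Poly_Mapping.keys p. odd (length (filter par (letters w)))}\<rparr>)"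

definition quotient_superalgebra ::
  "('a, 'b, 'm) superalgebra_scheme \<Rightarrow> 'b set \<Rightarrow> ('a, 'b set) superalgebra" where
  "quotient_superalgebra A I =
    \<lparr>carrier = carrier (A Quot I), mult = mult (A Quot I), one = one (A Quot I),
     zero = zero (A Quot I), add = add (A Quot I),
     smult = (\<lambda>a X. \<Union>x\<in>X. I +>\<^bsub>A\<^esub> (a \<odot>\<^bsub>A\<^esub> x)),
     even_part = (\<lambda>x. I +>\<^bsub>A\<^esub> x) ` even_part A,
     odd_part = (\<lambda>x. I +>\<^bsub>A\<^esub> x) ` odd_part A\<rparr>"

text \<open>A set of relations is a set of pairs (left-hand side, right-hand side). The pairs have to lie
  in the carrier of the free superalgebra, as \<^const>\<open>genideal\<close> is meaningless otherwise; this is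
  proved below for the relations in use.\<close>

definition relation_ideal ::
  "('g \<Rightarrow> bool) \<Rightarrow> 'g set \<Rightarrow> (('g, 'a::comm_ring_1) free_algebra \<times> ('g, 'a) free_algebra) set
    \<Rightarrow> ('g, 'a) free_algebra set" where
  "relation_ideal par G Rel = Idl\<^bsub>free_superalgebra par G\<^esub> {p - q |p q. (p, q) \<in> Rel}"

definition presented_superalgebra ::
  "('g \<Rightarrow> bool) \<Rightarrow> 'g set \<Rightarrow> (('g, 'a::comm_ring_1) free_algebra \<times> ('g, 'a) free_algebra) set
    \<Rightarrow> ('a, ('g, 'a) free_algebra set) superalgebra" where
  "presented_superalgebra par G Rel =
     quotient_superalgebra (free_superalgebra par G) (relation_ideal par G Rel)"

definition presented_class ::
  "('g \<Rightarrow> bool) \<Rightarrow> 'g set \<Rightarrow> (('g, 'a::comm_ring_1) free_algebra \<times> ('g, 'a) free_algebra) set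
    \<Rightarrow> ('g, 'a) free_algebra \<Rightarrow> ('g, 'a) free_algebra set" where
  "presented_class par G Rel p = relation_ideal par G Rel +>\<^bsub>free_superalgebra par G\<^esub> p"


section \<open>Walled Brauer-Clifford superalgebras\<close>

text \<open>All indices start at 1. \<open>Sbar\<close> and \<open>Cbar\<close> are the barred generators.\<close>

datatype bc_gen = S nat | Sbar nat | E1 | C nat | Cbar nat

fun bc_odd :: "bc_gen \<Rightarrow> bool" where
  "bc_odd (C i) = True"
| "bc_odd (Cbar i) = True"
| "bc_odd _ = False"

definition bc_gens :: "nat \<Rightarrow> nat \<Rightarrow> bc_gen set" where
  "bc_gens r t = {E1} \<union> S ` {1..<r} \<union> Sbar ` {1..<t} \<union> C ` {1..r} \<union> Cbar ` {1..t}"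

text \<open>An element of the symmetric group is represented by a list \<^term>\<open>js\<close> of indices, standing for
  the product of the simple transpositions \<open>s\<^sub>j\<close> in the given order. Permutations act on
  the right, so the first letter of \<^term>\<open>js\<close> acts first.\<close>

definition perm_act :: "nat \<Rightarrow> nat list \<Rightarrow> nat" where
  "perm_act i js = fold (\<lambda>j. Transposition.transpose j (Suc j)) js i"

definition perm_prod :: "(nat \<Rightarrow> 'b::ring_1) \<Rightarrow> nat list \<Rightarrow> 'b" where
  "perm_prod s js = prod_list (map s js)"

text \<open>The transposition \<open>(i, j)\<close> as a product of simple ones:
  \<open>s\<^sub>a s\<^bsub>a+1\<^esub> \<dots> s\<^bsub>b-1\<^esub> \<dots> s\<^bsub>a+1\<^esub> s\<^sub>a\<close> with
  \<open>a = min i j\<close> and \<open>b = max i j\<close>.\<close>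

definition transp_word :: "nat \<Rightarrow> nat \<Rightarrow> nat list" where
  "transp_word i j = [min i j..<max i j] @ rev [min i j..<max i j - 1]"

definition transp :: "(nat \<Rightarrow> 'b::ring_1) \<Rightarrow> nat \<Rightarrow> nat \<Rightarrow> 'b" where
  "transp s i j = perm_prod s (transp_word i j)"

text \<open>The parameter \<open>q\<close> is \<open>-1\<close> for the unbarred and \<open>1\<close> for the barred generators. In \<open>conj\<close>, the
  reversed list represents the inverse permutation.\<close>

inductive_set clifford_rels ::
  "nat \<Rightarrow> 'b::ring_1 \<Rightarrow> (nat \<Rightarrow> 'b) \<Rightarrow> (nat \<Rightarrow> 'b) \<Rightarrow> ('b \<times> 'b) set" for n q s c where
  s_square: "1 \<le> i \<Longrightarrow> i < n \<Longrightarrow> (s i * s i, 1) \<in> clifford_rels n q s c"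
| s_braid: "1 \<le> i \<Longrightarrow> i + 1 < n \<Longrightarrow>
    (s i * s (i + 1) * s i, s (i + 1) * s i * s (i + 1)) \<in> clifford_rels n q s c"
| s_comm: "1 \<le> i \<Longrightarrow> i < n \<Longrightarrow> 1 \<le> j \<Longrightarrow> j < n \<Longrightarrow> i + 1 < j \<or> j + 1 < i \<Longrightarrow>
    (s i * s j, s j * s i) \<in> clifford_rels n q s c"
| c_square: "1 \<le> i \<Longrightarrow> i \<le> n \<Longrightarrow> (c i * c i, q) \<in> clifford_rels n q s c"
| c_anticomm: "1 \<le> i \<Longrightarrow> i \<le> n \<Longrightarrow> 1 \<le> j \<Longrightarrow> j \<le> n \<Longrightarrow> i \<noteq> j \<Longrightarrow>
    (c i * c j, - (c j * c i)) \<in> clifford_rels n q s c"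
| conj: "1 \<le> i \<Longrightarrow> i \<le> n \<Longrightarrow> set js \<subseteq> {1..<n} \<Longrightarrow>
    (perm_prod s (rev js) * c i * perm_prod s js, c (perm_act i js)) \<in> clifford_rels n q s c"

inductive_set mixed_rels ::
  "nat \<Rightarrow> nat \<Rightarrow> (nat \<Rightarrow> 'b::ring_1) \<Rightarrow> (nat \<Rightarrow> 'b) \<Rightarrow> 'b \<Rightarrow> (nat \<Rightarrow> 'b) \<Rightarrow> (nat \<Rightarrow> 'b) \<Rightarrow> ('b \<times> 'b) set"
  for r t s sb e c cb where
  ec: "(e * c 1, e * cb 1) \<in> mixed_rels r t s sb e c cb"
| ce: "(c 1 * e, cb 1 * e) \<in> mixed_rels r t s sb e c cb"
| sb_c: "1 \<le> j \<Longrightarrow> j < t \<Longrightarrow> 1 \<le> i \<Longrightarrow> i \<le> r \<Longrightarrow>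
    (sb j * c i, c i * sb j) \<in> mixed_rels r t s sb e c cb"
| s_cb: "1 \<le> i \<Longrightarrow> i < r \<Longrightarrow> 1 \<le> j \<Longrightarrow> j \<le> t \<Longrightarrow>
    (s i * cb j, cb j * s i) \<in> mixed_rels r t s sb e c cb"
| c_cb: "1 \<le> i \<Longrightarrow> i \<le> r \<Longrightarrow> 1 \<le> j \<Longrightarrow> j \<le> t \<Longrightarrow>
    (c i * cb j, - (cb j * c i)) \<in> mixed_rels r t s sb e c cb"
| s_sb: "1 \<le> i \<Longrightarrow> i < r \<Longrightarrow> 1 \<le> j \<Longrightarrow> j < t \<Longrightarrow>
    (s i * sb j, sb j * s i) \<in> mixed_rels r t s sb e c cb"
| e_square: "(e * e, 0) \<in> mixed_rels r t s sb e c cb"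
| e_s_e: "2 \<le> r \<Longrightarrow> (e * s 1 * e, e) \<in> mixed_rels r t s sb e c cb"
| e_sb_e: "2 \<le> t \<Longrightarrow> (e * sb 1 * e, e) \<in> mixed_rels r t s sb e c cb"
| s_e: "1 < i \<Longrightarrow> i < r \<Longrightarrow> (s i * e, e * s i) \<in> mixed_rels r t s sb e c cb"
| sb_e: "1 < i \<Longrightarrow> i < t \<Longrightarrow> (sb i * e, e * sb i) \<in> mixed_rels r t s sb e c cb"
| c_e: "1 < i \<Longrightarrow> i \<le> r \<Longrightarrow> (c i * e, e * c i) \<in> mixed_rels r t s sb e c cb"
| cb_e: "1 < i \<Longrightarrow> i \<le> t \<Longrightarrow> (cb i * e, e * cb i) \<in> mixed_rels r t s sb e c cb"
| wall_left: "2 \<le> r \<Longrightarrow> 2 \<le> t \<Longrightarrow>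
    (e * s 1 * sb 1 * e * s 1, e * s 1 * sb 1 * e * sb 1) \<in> mixed_rels r t s sb e c cb"
| wall_right: "2 \<le> r \<Longrightarrow> 2 \<le> t \<Longrightarrow>
    (s 1 * e * s 1 * sb 1 * e, sb 1 * e * s 1 * sb 1 * e) \<in> mixed_rels r t s sb e c cb"
| e_c_e: "(e * c 1 * e, 0) \<in> mixed_rels r t s sb e c cb"
| e_cb_e: "(e * cb 1 * e, 0) \<in> mixed_rels r t s sb e c cb"

text \<open>The map \<^term>\<open>f\<close> assigns to the generators elements of some ring, so that the relations can be
  reused in the affine algebra.\<close>

definition bc_rels :: "nat \<Rightarrow> nat \<Rightarrow> (bc_gen \<Rightarrow> 'b::ring_1) \<Rightarrow> ('b \<times> 'b) set" where
  "bc_rels r t f =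
     clifford_rels r (- 1) (\<lambda>i. f (S i)) (\<lambda>i. f (C i)) \<union>
     clifford_rels t 1 (\<lambda>i. f (Sbar i)) (\<lambda>i. f (Cbar i)) \<union>
     mixed_rels r t (\<lambda>i. f (S i)) (\<lambda>i. f (Sbar i)) (f E1) (\<lambda>i. f (C i)) (\<lambda>i. f (Cbar i))"

definition BC :: "nat \<Rightarrow> nat \<Rightarrow> ('a::comm_ring_1, (bc_gen, 'a) free_algebra set) superalgebra" where
  "BC r t = presented_superalgebra bc_odd (bc_gens r t) (bc_rels r t var)"

definition BC_class ::
  "nat \<Rightarrow> nat \<Rightarrow> (bc_gen, 'a::comm_ring_1) free_algebra \<Rightarrow> (bc_gen, 'a) free_algebra set" where
  "BC_class r t = presented_class bc_odd (bc_gens r t) (bc_rels r t var)"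

text \<open>The following elements are defined in the free algebra; the elements of \<^term>\<open>BC r t\<close> which
  they represent are obtained by applying \<^term>\<open>BC_class r t\<close>.\<close>

definition bc_transp :: "nat \<Rightarrow> nat \<Rightarrow> (bc_gen, 'a::comm_ring_1) free_algebra" where
  "bc_transp i j = transp (\<lambda>l. var (S l)) i j"

definition bc_transp_bar :: "nat \<Rightarrow> nat \<Rightarrow> (bc_gen, 'a::comm_ring_1) free_algebra" where
  "bc_transp_bar i j = transp (\<lambda>l. var (Sbar l)) i j"

definition bc_e2 :: "nat \<Rightarrow> nat \<Rightarrow> (bc_gen, 'a::comm_ring_1) free_algebra" where
  "bc_e2 i j = bc_transp_bar 1 j * bc_transp 1 i * var E1 * bc_transp 1 i * bc_transp_bar 1 j"

definition bc_ebar2 :: "nat \<Rightarrow> nat \<Rightarrow> (bc_gen, 'a::comm_ring_1) free_algebra" where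
  "bc_ebar2 i j = var (C i) * bc_e2 i j * var (C i)"

definition bc_e :: "nat \<Rightarrow> (bc_gen, 'a::comm_ring_1) free_algebra" where
  "bc_e i = bc_e2 i i"

definition bc_L :: "nat \<Rightarrow> (bc_gen, 'a::comm_ring_1) free_algebra" where
  "bc_L i = (\<Sum>j=1..<i. bc_transp j i) + var (C i) * (\<Sum>j=1..<i. bc_transp j i) * var (C i)"

definition bc_L_bar :: "nat \<Rightarrow> (bc_gen, 'a::comm_ring_1) free_algebra" where
  "bc_L_bar i =
     (\<Sum>j=1..<i. bc_transp_bar j i) - var (Cbar i) * (\<Sum>j=1..<i. bc_transp_bar j i) * var (Cbar i)"

definition bc_y :: "nat \<Rightarrow> (bc_gen, 'a::comm_ring_1) free_algebra" where
  "bc_y i = (\<Sum>j=1..<i. bc_e2 i j + bc_ebar2 i j) - bc_L i"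

definition bc_y_bar :: "nat \<Rightarrow> (bc_gen, 'a::comm_ring_1) free_algebra" where
  "bc_y_bar i = (\<Sum>j=1..<i. bc_e2 j i - bc_ebar2 j i) - bc_L_bar i"

text \<open>The copy of \<^term>\<open>BC k k\<close> inside \<^term>\<open>BC m n\<close>, where \<open>k \<le> m\<close> and \<open>k \<le> n\<close>.\<close>

definition BC_sub :: "nat \<Rightarrow> nat \<Rightarrow> nat \<Rightarrow> (bc_gen, 'a::comm_ring_1) free_algebra set set" where
  "BC_sub m n k = generated_subalgebra (BC m n)
     ((\<lambda>g. BC_class m n (var g)) ` ({E1, C 1, Cbar 1} \<union> S ` {1..<k} \<union> Sbar ` {1..<k}))"

text \<open>The elements \<open>\<omega>\<^bsub>a,k+1\<^esub>\<close> and their barred versions, in \<^term>\<open>BC m n\<close> with \<open>m = r + k\<close>, \<open>n = t + k\<close>.\<close>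

definition BC_omega ::
  "nat \<Rightarrow> nat \<Rightarrow> nat \<Rightarrow> nat \<Rightarrow> (bc_gen, 'a::comm_ring_1) free_algebra set" where
  "BC_omega m n k a = (THE w. w \<in> BC_sub m n k \<and>
     BC_class m n (bc_e (k + 1) * bc_y (k + 1) ^ a * bc_e (k + 1)) =
       w \<otimes>\<^bsub>BC m n\<^esub> BC_class m n (bc_e (k + 1)))"

definition BC_omega_bar ::
  "nat \<Rightarrow> nat \<Rightarrow> nat \<Rightarrow> nat \<Rightarrow> (bc_gen, 'a::comm_ring_1) free_algebra set" where
  "BC_omega_bar m n k a = (THE w. w \<in> BC_sub m n k \<and>
     BC_class m n (bc_e (k + 1) * bc_y_bar (k + 1) ^ a * bc_e (k + 1)) =
       w \<otimes>\<^bsub>BC m n\<^esub> BC_class m n (bc_e (k + 1)))"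


section \<open>Affine walled Brauer-Clifford superalgebras\<close>

text \<open>\<open>Om a\<close> is a generator only for odd \<open>a \<ge> 3\<close>, and \<open>Ombar a\<close> for all \<open>a \<ge> 1\<close>.\<close>

datatype aff_gen = Fin bc_gen | X1 | X1bar | Om nat | Ombar nat

fun aff_odd :: "aff_gen \<Rightarrow> bool" where
  "aff_odd (Fin g) = bc_odd g"
| "aff_odd _ = False"

definition aff_central_gens :: "aff_gen set" where
  "aff_central_gens = (\<lambda>n. Om (2 * n + 1)) ` {1..} \<union> Ombar ` {1..}"

definition aff_gens :: "nat \<Rightarrow> nat \<Rightarrow> aff_gen set" where
  "aff_gens r t = Fin ` bc_gens r t \<union> {X1, X1bar} \<union> aff_central_gens"

text \<open>\<open>\<omega>\<^sub>a\<close> for all \<open>a\<close>: zero if \<open>a\<close> is even, the given scalar \<open>w1\<close> for \<open>a = 1\<close>.\<close>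

definition aff_omega :: "'a::comm_ring_1 \<Rightarrow> nat \<Rightarrow> (aff_gen, 'a) free_algebra" where
  "aff_omega w1 a = (if even a then 0 else if a = 1 then scalar w1 else var (Om a))"

text \<open>\<open>bar_coeff om n i\<close> is the coefficient \<open>a\<^bsub>2n+1,i\<^esub>\<close>, where \<open>om a\<close> is \<open>\<omega>\<^sub>a\<close>.\<close>

fun bar_coeff :: "(nat \<Rightarrow> 'b::ring_1) \<Rightarrow> nat \<Rightarrow> nat \<Rightarrow> 'b" where
  "bar_coeff om 0 i = (if i = 0 then - 1 else 0)"
| "bar_coeff om (Suc n) i =
    (if i = Suc n then - 1
     else if i = 0 then (\<Sum>j\<le>n. bar_coeff om n j * om (2 * j + 1))
     else if i \<le> n then bar_coeff om n (i - 1)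
     else 0)"

text \<open>Here \<open>x\<close>, \<open>xb\<close>, \<open>om\<close> and \<open>omb\<close> stand for
  \<open>x\<^sub>1\<close>, its barred version, \<open>\<omega>\<close> and its barred version.
  The last two rules express the barred \<open>\<omega>\<close> in terms of
  the unbarred ones. Centrality of both families is added in \<open>aff_rels\<close>.\<close>

inductive_set affine_rels ::
  "nat \<Rightarrow> nat \<Rightarrow> (nat \<Rightarrow> 'b::ring_1) \<Rightarrow> (nat \<Rightarrow> 'b) \<Rightarrow> 'b \<Rightarrow> (nat \<Rightarrow> 'b) \<Rightarrow> (nat \<Rightarrow> 'b) \<Rightarrow>
    'b \<Rightarrow> 'b \<Rightarrow> (nat \<Rightarrow> 'b) \<Rightarrow> (nat \<Rightarrow> 'b) \<Rightarrow> ('b \<times> 'b) set"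
  for r t s sb e c cb x xb om omb where
  x1_x2: "2 \<le> r \<Longrightarrow> x2 = s 1 * x * s 1 - (1 - c 1 * c 2) * s 1 \<Longrightarrow>
    (x * x2, x2 * x) \<in> affine_rels r t s sb e c cb x xb om omb"
| x_c: "1 \<le> i \<Longrightarrow> i \<le> r \<Longrightarrow>
    (x * c i, (if i = 1 then - (c i * x) else c i * x)) \<in> affine_rels r t s sb e c cb x xb om omb"
| s_x: "1 < j \<Longrightarrow> j < r \<Longrightarrow> (s j * x, x * s j) \<in> affine_rels r t s sb e c cb x xb om omb"
| xb1_xb2: "2 \<le> t \<Longrightarrow> xb2 = sb 1 * xb * sb 1 - (1 + cb 1 * cb 2) * sb 1 \<Longrightarrow>
    (xb * xb2, xb2 * xb) \<in> affine_rels r t s sb e c cb x xb om omb"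
| xb_cb: "1 \<le> i \<Longrightarrow> i \<le> t \<Longrightarrow>
    (xb * cb i, (if i = 1 then - (cb i * xb) else cb i * xb))
      \<in> affine_rels r t s sb e c cb x xb om omb"
| sb_xb: "1 < j \<Longrightarrow> j < t \<Longrightarrow> (sb j * xb, xb * sb j) \<in> affine_rels r t s sb e c cb x xb om omb"
| e_x_xb: "(e * (x + xb), 0) \<in> affine_rels r t s sb e c cb x xb om omb"
| x_xb_e: "((x + xb) * e, 0) \<in> affine_rels r t s sb e c cb x xb om omb"
| e_sxs: "2 \<le> r \<Longrightarrow>
    (e * s 1 * x * s 1, s 1 * x * s 1 * e) \<in> affine_rels r t s sb e c cb x xb om omb"
| e_sbxbsb: "2 \<le> t \<Longrightarrow>
    (e * sb 1 * xb * sb 1, sb 1 * xb * sb 1 * e) \<in> affine_rels r t s sb e c cb x xb om omb"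
| x_xb: "eb = c 1 * e * c 1 \<Longrightarrow>
    (x * (e + xb - eb), (e + xb - eb) * x) \<in> affine_rels r t s sb e c cb x xb om omb"
| x_cb: "1 \<le> i \<Longrightarrow> i \<le> t \<Longrightarrow> (x * cb i, cb i * x) \<in> affine_rels r t s sb e c cb x xb om omb"
| xb_c: "1 \<le> i \<Longrightarrow> i \<le> r \<Longrightarrow> (xb * c i, c i * xb) \<in> affine_rels r t s sb e c cb x xb om omb"
| x_sb: "1 \<le> i \<Longrightarrow> i < t \<Longrightarrow> (x * sb i, sb i * x) \<in> affine_rels r t s sb e c cb x xb om omb"
| xb_s: "1 \<le> i \<Longrightarrow> i < r \<Longrightarrow> (xb * s i, s i * xb) \<in> affine_rels r t s sb e c cb x xb om omb"
| e_xodd_e: "(e * x ^ (2 * n + 1) * e, om (2 * n + 1) * e)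
    \<in> affine_rels r t s sb e c cb x xb om omb"
| e_xeven_e: "(e * x ^ (2 * n) * e, 0) \<in> affine_rels r t s sb e c cb x xb om omb"
| e_xb_e: "1 \<le> n \<Longrightarrow> (e * xb ^ n * e, omb n * e) \<in> affine_rels r t s sb e c cb x xb om omb"
| omb_even: "1 \<le> n \<Longrightarrow> (omb (2 * n), 0) \<in> affine_rels r t s sb e c cb x xb om omb"
| omb_odd: "(omb (2 * n + 1), \<Sum>i\<le>n. bar_coeff om n i * om (2 * i + 1))
    \<in> affine_rels r t s sb e c cb x xb om omb"

definition aff_rels ::
  "'a::comm_ring_1 \<Rightarrow> nat \<Rightarrow> nat \<Rightarrow> ((aff_gen, 'a) free_algebra \<times> (aff_gen, 'a) free_algebra) set" where
  "aff_rels w1 r t =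
     bc_rels r t (\<lambda>g. var (Fin g)) \<union>
     {(var z * var g, var g * var z) |z g. z \<in> aff_central_gens \<and> g \<in> aff_gens r t} \<union>
     affine_rels r t (\<lambda>i. var (Fin (S i))) (\<lambda>i. var (Fin (Sbar i))) (var (Fin E1))
       (\<lambda>i. var (Fin (C i))) (\<lambda>i. var (Fin (Cbar i))) (var X1) (var X1bar)
       (aff_omega w1) (\<lambda>a. var (Ombar a))"

definition BC_aff ::
  "'a::comm_ring_1 \<Rightarrow> nat \<Rightarrow> nat \<Rightarrow> ('a, (aff_gen, 'a) free_algebra set) superalgebra" where
  "BC_aff w1 r t = presented_superalgebra aff_odd (aff_gens r t) (aff_rels w1 r t)"

definition BC_aff_class ::
  "'a::comm_ring_1 \<Rightarrow> nat \<Rightarrow> nat \<Rightarrow> (aff_gen, 'a) free_algebra \<Rightarrow> (aff_gen, 'a) free_algebra set" where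
  "BC_aff_class w1 r t = presented_class aff_odd (aff_gens r t) (aff_rels w1 r t)"

section \<open>Well-formedness\<close>

lemma carrier_free_superalgebra:
  "carrier (free_superalgebra par G) = {p. \<forall>w\<in>Poly_Mapping.keys p. set (letters w) \<subseteq> G}"
  by (simp add: free_superalgebra_def Let_def)

lemma free_superalgebra_simps:
  "mult (free_superalgebra par G) = (*)" "one (free_superalgebra par G) = 1"
  "zero (free_superalgebra par G) = 0" "add (free_superalgebra par G) = (+)"
  by (simp_all add: free_superalgebra_def Let_def)

lemma free_carrier_0: "0 \<in> carrier (free_superalgebra par G)"
  and free_carrier_1: "1 \<in> carrier (free_superalgebra par G)"
  and free_carrier_scalar: "scalar a \<in> carrier (free_superalgebra par G)"
  by (auto simp: carrier_free_superalgebra scalar_def zero_free_word_def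
      simp flip: single_one split: if_splits)

lemma free_carrier_var: "g \<in> G \<Longrightarrow> var g \<in> carrier (free_superalgebra par G)"
  by (auto simp: carrier_free_superalgebra var_def split: if_splits)

lemma free_carrier_add:
  assumes "p \<in> carrier (free_superalgebra par G)" "q \<in> carrier (free_superalgebra par G)"
  shows "p + q \<in> carrier (free_superalgebra par G)"
  using assms Poly_Mapping.keys_add[of p q] unfolding carrier_free_superalgebra by blast

lemma free_carrier_uminus:
  assumes "p \<in> carrier (free_superalgebra par G)"
  shows "- p \<in> carrier (free_superalgebra par G)"
  using assms unfolding carrier_free_superalgebra by simp

lemma free_carrier_mult:
  assumes "p \<in> carrier (free_superalgebra par G)" "q \<in> carrier (free_superalgebra par G)"
  shows "p * q \<in> carrier (free_superalgebra par G)"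
  using assms keys_mult[of p q] unfolding carrier_free_superalgebra
  by (fastforce simp: plus_free_word_def)

lemma ring_free_superalgebra: "ring (free_superalgebra par G)"
proof (rule ringI)
  show "abelian_group (free_superalgebra par G)"
  proof (rule abelian_groupI)
    fix x assume "x \<in> carrier (free_superalgebra par G)"
    then show "\<exists>y\<in>carrier (free_superalgebra par G).
        y \<oplus>\<^bsub>free_superalgebra par G\<^esub> x = \<zero>\<^bsub>free_superalgebra par G\<^esub>"
      by (intro bexI[of _ "- x"]) (simp_all add: free_superalgebra_simps free_carrier_uminus)
  qed (simp_all add: free_superalgebra_simps free_carrier_0 free_carrier_add algebra_simps)
  show "monoid (free_superalgebra par G)"
    by (rule monoidI)
      (simp_all add: free_superalgebra_simps free_carrier_1 free_carrier_mult mult.assoc)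
qed (simp_all add: free_superalgebra_simps algebra_simps)

definition ring_closed :: "'b::ring_1 set \<Rightarrow> bool" where
  "ring_closed P \<longleftrightarrow> 0 \<in> P \<and> 1 \<in> P \<and> (\<forall>x\<in>P. - x \<in> P) \<and> (\<forall>x\<in>P. \<forall>y\<in>P. x + y \<in> P \<and> x * y \<in> P)"

lemma ring_closed_free: "ring_closed (carrier (free_superalgebra par G))"
  by (simp add: ring_closed_def free_carrier_0 free_carrier_1 free_carrier_uminus
      free_carrier_add free_carrier_mult)

context
  fixes P :: "'b::ring_1 set"
  assumes P: "ring_closed P"
begin

lemma rc_basic:
  "0 \<in> P" "1 \<in> P" "x \<in> P \<Longrightarrow> - x \<in> P" "x \<in> P \<Longrightarrow> y \<in> P \<Longrightarrow> x + y \<in> P"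
  "x \<in> P \<Longrightarrow> y \<in> P \<Longrightarrow> x * y \<in> P"
  using P by (auto simp: ring_closed_def)

lemma rc_diff: "x \<in> P \<Longrightarrow> y \<in> P \<Longrightarrow> x - y \<in> P"
  using rc_basic(3)[of y] rc_basic(4)[of x "- y"] by simp

lemma rc_power: "x \<in> P \<Longrightarrow> x ^ n \<in> P"
  by (induction n) (simp_all add: rc_basic)

lemma rc_sum: "(\<And>i. i \<in> A \<Longrightarrow> f i \<in> P) \<Longrightarrow> sum f A \<in> P"
  by (induction A rule: infinite_finite_induct) (simp_all add: rc_basic)

lemmas rc = rc_basic rc_diff rc_power

lemma rc_perm_prod: "(\<And>j. j \<in> set js \<Longrightarrow> s j \<in> P) \<Longrightarrow> perm_prod s js \<in> P"
  by (induction js) (simp_all add: perm_prod_def rc_basic)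

lemma perm_act_range:
  "i \<in> {1..n} \<Longrightarrow> set js \<subseteq> {1..<n} \<Longrightarrow> perm_act i js \<in> {1..n}"
  by (induction js arbitrary: i) (auto simp: perm_act_def Transposition.transpose_def)

lemma clifford_rels_closed:
  assumes "(a, b) \<in> clifford_rels n q s c" "q \<in> P"
    and s: "\<And>i. i \<in> {1..<n} \<Longrightarrow> s i \<in> P" and c: "\<And>i. i \<in> {1..n} \<Longrightarrow> c i \<in> P"
  shows "a \<in> P \<and> b \<in> P"
  using assms(1)
proof cases
  case (conj i js)
  then have "perm_prod s js \<in> P" "perm_prod s (rev js) \<in> P"
    using s by (auto intro!: rc_perm_prod)
  then show ?thesis using conj perm_act_range[of i n js] c by (auto intro!: rc)
qed (use assms(2) s c in \<open>auto intro!: rc\<close>)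

lemma mixed_rels_closed:
  assumes "(a, b) \<in> mixed_rels r t s sb e c cb" "0 < r" "0 < t" "e \<in> P"
    and "\<And>i. i \<in> {1..<r} \<Longrightarrow> s i \<in> P" "\<And>i. i \<in> {1..r} \<Longrightarrow> c i \<in> P"
    and "\<And>i. i \<in> {1..<t} \<Longrightarrow> sb i \<in> P" "\<And>i. i \<in> {1..t} \<Longrightarrow> cb i \<in> P"
  shows "a \<in> P \<and> b \<in> P"
  using assms(1) by cases (use assms(2-) in \<open>auto intro!: rc\<close>)

lemma bc_rels_closed:
  assumes "(a, b) \<in> bc_rels r t f" "0 < r" "0 < t" "\<And>g. g \<in> bc_gens r t \<Longrightarrow> f g \<in> P"
  shows "a \<in> P \<and> b \<in> P"
proof -
  have f: "\<And>i. i \<in> {1..<r} \<Longrightarrow> f (S i) \<in> P" "\<And>i. i \<in> {1..r} \<Longrightarrow> f (C i) \<in> P"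
    "\<And>i. i \<in> {1..<t} \<Longrightarrow> f (Sbar i) \<in> P" "\<And>i. i \<in> {1..t} \<Longrightarrow> f (Cbar i) \<in> P" "f E1 \<in> P"
    using assms(4) by (auto simp: bc_gens_def)
  from assms(1) consider "(a, b) \<in> clifford_rels r (- 1) (\<lambda>i. f (S i)) (\<lambda>i. f (C i))"
    | "(a, b) \<in> clifford_rels t 1 (\<lambda>i. f (Sbar i)) (\<lambda>i. f (Cbar i))"
    | "(a, b) \<in> mixed_rels r t (\<lambda>i. f (S i)) (\<lambda>i. f (Sbar i)) (f E1)
        (\<lambda>i. f (C i)) (\<lambda>i. f (Cbar i))"
    unfolding bc_rels_def by blast
  then show ?thesis
    by cases (erule clifford_rels_closed mixed_rels_closed; use assms(2,3) f in \<open>auto intro: rc\<close>)+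
qed

lemma bar_coeff_closed: "(\<And>a. odd a \<Longrightarrow> om a \<in> P) \<Longrightarrow> bar_coeff om n i \<in> P"
  by (induction om n i rule: bar_coeff.induct) (auto intro!: rc rc_sum)

lemma affine_rels_closed:
  assumes "(a, b) \<in> affine_rels r t s sb e c cb x xb om omb" "0 < r" "0 < t"
    and P: "e \<in> P" "x \<in> P" "xb \<in> P"
      "\<And>i. i \<in> {1..<r} \<Longrightarrow> s i \<in> P" "\<And>i. i \<in> {1..r} \<Longrightarrow> c i \<in> P"
      "\<And>i. i \<in> {1..<t} \<Longrightarrow> sb i \<in> P" "\<And>i. i \<in> {1..t} \<Longrightarrow> cb i \<in> P"
    and om: "\<And>a. odd a \<Longrightarrow> om a \<in> P" and omb: "\<And>a. 1 \<le> a \<Longrightarrow> omb a \<in> P"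
  shows "a \<in> P \<and> b \<in> P"
  using assms(1)
proof cases
  case (omb_odd n)
  then show ?thesis using om omb by (auto intro!: rc rc_sum bar_coeff_closed)
qed (use assms(2,3) P om omb in \<open>auto intro!: rc\<close>)

end

text \<open>The relations lie in the free superalgebra, so \<^const>\<open>relation_ideal\<close> is an ideal.\<close>

lemma bc_rels_carrier:
  assumes "0 < r" "0 < t" "(p, q) \<in> bc_rels r t var"
  shows "p - q \<in> carrier (free_superalgebra par (bc_gens r t))"
proof (rule rc_diff[OF ring_closed_free])
  have "p \<in> carrier (free_superalgebra par (bc_gens r t)) \<and>
      q \<in> carrier (free_superalgebra par (bc_gens r t))"
    by (rule bc_rels_closed[OF ring_closed_free assms(3,1,2)]) (rule free_carrier_var)
  then show "p \<in> carrier (free_superalgebra par (bc_gens r t))"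
    "q \<in> carrier (free_superalgebra par (bc_gens r t))" by blast+
qed

lemma aff_rels_carrier:
  assumes rt: "0 < r" "0 < t" and pq: "(p, q) \<in> aff_rels w1 r t"
  shows "p - q \<in> carrier (free_superalgebra par (aff_gens r t))" (is "_ \<in> ?F")
proof -
  have bc: "var (Fin g) \<in> ?F" if "g \<in> bc_gens r t" for g
    using that by (intro free_carrier_var) (auto simp: aff_gens_def)
  have om: "aff_omega w1 a \<in> ?F" if "odd a" for a
  proof (cases "a = 1")
    case False
    from \<open>odd a\<close> obtain n where "a = 2 * n + 1" by (rule oddE)
    with False have "a = 2 * n + 1" "n \<ge> 1" by auto
    then show ?thesis
      using False by (auto simp: aff_omega_def aff_gens_def aff_central_gens_def
          intro!: free_carrier_var)
  qed (simp add: aff_omega_def free_carrier_scalar)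
  have X: "var X1 \<in> ?F" "var X1bar \<in> ?F" "\<And>a. 1 \<le> a \<Longrightarrow> var (Ombar a) \<in> ?F"
    by (auto simp: aff_gens_def aff_central_gens_def intro!: free_carrier_var)
  from pq consider "(p, q) \<in> bc_rels r t (\<lambda>g. var (Fin g))"
    | z g where "z \<in> aff_central_gens" "g \<in> aff_gens r t" "p = var z * var g" "q = var g * var z"
    | "(p, q) \<in> affine_rels r t (\<lambda>i. var (Fin (S i))) (\<lambda>i. var (Fin (Sbar i))) (var (Fin E1))
       (\<lambda>i. var (Fin (C i))) (\<lambda>i. var (Fin (Cbar i))) (var X1) (var X1bar)
       (aff_omega w1) (\<lambda>a. var (Ombar a))"
    unfolding aff_rels_def by blast
  then have "p \<in> ?F \<and> q \<in> ?F"
  proof cases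
    case 1
    then show ?thesis using bc by (intro bc_rels_closed[OF ring_closed_free _ rt])
  next
    case 2
    then show ?thesis by (auto intro!: free_carrier_mult free_carrier_var simp: aff_gens_def)
  next
    case 3
    then show ?thesis
      by (rule affine_rels_closed[OF ring_closed_free _ rt])
        (auto intro!: bc om X simp: bc_gens_def)
  qed
  then show ?thesis by (simp add: rc_diff[OF ring_closed_free])
qed

lemma ring_presented_superalgebra:
  assumes "\<And>p q. (p, q) \<in> Rel \<Longrightarrow> p - q \<in> carrier (free_superalgebra par G)"
  shows "ideal (relation_ideal par G Rel) (free_superalgebra par G)"
    and "ring (presented_superalgebra par G Rel)"
proof -
  show I: "ideal (relation_ideal par G Rel) (free_superalgebra par G)"
    unfolding relation_ideal_def using assms
    by (intro ring.genideal_ideal[OF ring_free_superalgebra]) auto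
  define Q where "Q = free_superalgebra par G Quot relation_ideal par G Rel"
  interpret Q: ring Q
    unfolding Q_def by (rule ideal.quotient_is_ring[OF I])
  have eqs: "carrier (presented_superalgebra par G Rel) = carrier Q"
    "mult (presented_superalgebra par G Rel) = mult Q"
    "one (presented_superalgebra par G Rel) = one Q"
    "zero (presented_superalgebra par G Rel) = zero Q"
    "add (presented_superalgebra par G Rel) = add Q"
    by (simp_all add: presented_superalgebra_def quotient_superalgebra_def Q_def)
  show "ring (presented_superalgebra par G Rel)"
  proof (rule ringI)
    show "abelian_group (presented_superalgebra par G Rel)"
    proof (rule abelian_groupI)
      fix x assume "x \<in> carrier (presented_superalgebra par G Rel)"
      then show "\<exists>y\<in>carrier (presented_superalgebra par G Rel).
          y \<oplus>\<^bsub>presented_superalgebra par G Rel\<^esub> x = \<zero>\<^bsub>presented_superalgebra par G Rel\<^esub>"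
        unfolding eqs using Q.l_neg Q.a_inv_closed by blast
    qed (simp_all add: eqs Q.a_ac)
    show "monoid (presented_superalgebra par G Rel)"
      by (rule monoidI) (simp_all add: eqs Q.m_assoc)
  qed (simp_all add: eqs Q.l_distr Q.r_distr)
qed

lemma ring_BC: "0 < r \<Longrightarrow> 0 < t \<Longrightarrow> ring (BC r t)"
  unfolding BC_def by (intro ring_presented_superalgebra bc_rels_carrier)

lemma ring_BC_aff: "0 < r \<Longrightarrow> 0 < t \<Longrightarrow> ring (BC_aff w1 r t)"
  unfolding BC_aff_def by (intro ring_presented_superalgebra aff_rels_carrier)

lemma perm_act_transp_word:
  "perm_act l (transp_word i j) = Transposition.transpose i j l"
proof -
  have *: "perm_act l ([a..<a + d] @ rev [a..<a + d - 1]) = Transposition.transpose a (a + d) l"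
    for a d :: nat
  proof (induction d arbitrary: a l)
    case (Suc d)
    show ?case
    proof (cases d)
      case 0
      then show ?thesis by (simp add: perm_act_def)
    next
      case (Suc d')
      have "[a..<a + Suc d] @ rev [a..<a + Suc d - 1]
          = a # ([Suc a..<Suc a + d] @ rev [Suc a..<Suc a + d - 1]) @ [a]"
        using Suc by (simp add: upt_conv_Cons del: upt_Suc)
      then have "perm_act l ([a..<a + Suc d] @ rev [a..<a + Suc d - 1])
          = Transposition.transpose a (Suc a) (perm_act (Transposition.transpose a (Suc a) l)
              ([Suc a..<Suc a + d] @ rev [Suc a..<Suc a + d - 1]))"
        by (simp add: perm_act_def)
      also have "\<dots> = Transposition.transpose a (a + Suc d) l"
        using Suc by (subst Suc.IH) (auto simp: Transposition.transpose_def)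
      finally show ?thesis .
    qed
  qed (simp add: perm_act_def)
  show ?thesis
    using *[of "min i j" "max i j - min i j"]
    by (cases "i \<le> j") (simp_all add: transp_word_def min_def max_def
        Transposition.transpose_commute)
qed

end

theory Submission
  imports Defs "HOL-Combinatorics.Perm"
begin

text \<open>A monomial in the generators of \<open>BC\<^bsub>m,n\<^esub>\<close> is reduced to a normal form by peeling off the last
  strand, and normal forms are separated by their action on decorated matchings which send all
  strands in question far away. Hence \<open>BC\<^bsub>m,n\<^esub>\<close> acts faithfully on the functions on such matchings, and
  equations may be checked in the ring of these operators.

  Closing the strand \<open>k + 1\<close> on both sides of the wall maps \<open>BC\<^bsub>k+1,k+1\<^esub>\<close> to \<open>BC\<^bsub>k,k\<^esub>\<close>, and \<open>w \<mapsto> w e\<^bsub>k+1\<^esub>\<close> is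
  injective on \<open>BC\<^bsub>k,k\<^esub>\<close> by faithfulness; this gives existence and uniqueness of the \<open>\<omega>\<^bsub>a,k+1\<^esub>\<close>.

  Writing \<open>e, y, z\<close> for \<open>e\<^bsub>k+1\<^esub>\<close>, \<open>y\<^bsub>k+1\<^esub>\<close> and its barred version, the Jucys-Murphy type elements
  \<open>y\<close>, \<open>z\<close> and \<open>z + e - c e c\<close> commute with the smaller walled Brauer-Clifford algebras; in particular
  \<open>z + e - c e c\<close> commutes with \<open>y\<close>. Multiplying its commutator with \<open>y\<^sup>p\<close> by \<open>e\<close> on the left yields
  \<open>e y\<^sup>p z = - e y\<^bsup>p+1\<^esup> - \<omega>\<^sub>p e\<close>, which is the recursion for the coefficients \<open>a\<^bsub>2n+1,i\<^esub>\<close>.\<close>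

section \<open>Generators of symmetric groups\<close>

text \<open>The algebra is known by generators and relations only, while uniqueness of the
  \<omega>'s asks that w e = 0 imply w = 0 for w in BC_{k,k}; so some independence of monomials has
  to be proved. No basis is exhibited. It is enough that two words sending one generic matching to
  the same matching, up to sign, represent the same element up to sign: a polynomial that acts there
  by zero can then be shortened word by word modulo the relations. This comparison concerns words
  and not sums, so it takes place in monoids with a sign and a zero, and the algebra enters through
  left multiplications on its quotient, paired with signed partial maps of matchings.

  Invertibility of two enters where a vanishing result appears as x = - x, obtained by carrying
  elements through a product in two ways. It also serves parity: the \<omega>'s have to commute with
  odd generators, which is guaranteed for even elements of BC_{k,k}. Evenness comes from a second
  representation, with signs on the odd generators, that kills the same ideal.\<close>

lemma mult_eq_left: "a * b = c \<Longrightarrow> a * (b * x) = c * x" for a :: "'b::monoid_mult"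
  by (simp flip: mult.assoc)

locale symmetric_generators =
  fixes n :: nat and s :: "nat \<Rightarrow> 'b::monoid_mult"
  assumes s_square: "1 \<le> i \<Longrightarrow> i < n \<Longrightarrow> s i * s i = 1"
    and s_braid: "1 \<le> i \<Longrightarrow> i + 1 < n \<Longrightarrow> s i * s (i + 1) * s i = s (i + 1) * s i * s (i + 1)"
    and s_comm: "1 \<le> i \<Longrightarrow> i + 1 < j \<Longrightarrow> j < n \<Longrightarrow> s i * s j = s j * s i"
begin

definition tr :: "nat \<Rightarrow> nat \<Rightarrow> 'b" where
  "tr i j = prod_list (map s (transp_word i j))"

lemma s_square': "1 \<le> i \<Longrightarrow> i < n \<Longrightarrow> s i * (s i * x) = x"
  using s_square by (simp flip: mult.assoc)

lemma s_comm2: "1 \<le> i \<Longrightarrow> i < n \<Longrightarrow> 1 \<le> j \<Longrightarrow> j < n \<Longrightarrow> i + 1 < j \<or> j + 1 < i \<Longrightarrow> s i * s j = s j * s i"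
  using s_comm[of i j] s_comm[of j i] by auto

lemma tr_commute: "tr i j = tr j i"
  by (simp add: tr_def transp_word_def min.commute max.commute)

lemma tr_same: "tr i i = 1"
  by (simp add: tr_def transp_word_def)

lemma tr_Suc: "tr i (Suc i) = s i"
  by (simp add: tr_def transp_word_def)

lemma tr_rec_left:
  assumes "i + 1 < j"
  shows "tr i j = s i * tr (Suc i) j * s i"
proof -
  obtain d where d: "j = Suc (Suc (i + d))"
    using assms less_iff_Suc_add[of "i+1" j] by auto
  have "[i..<j] @ rev [i..<j - 1] = i # ([Suc i..<j] @ rev [Suc i..<j - 1]) @ [i]"
    unfolding d by (simp add: upt_conv_Cons del: upt_Suc)
  then show ?thesis
    using assms by (simp add: tr_def transp_word_def min_def max_def mult.assoc)
qed

text \<open>The recursion \<open>tr_rec_left\<close> peels off the smaller end. That the larger end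
  can be peeled off as well is the braid relation, used once, at distance two; beyond that distance
  the two outer letters commute.\<close>

lemma tr_rec_right:
  assumes "1 \<le> i" "i + 1 < j" "j \<le> n"
  shows "tr i j = s (j - 1) * tr i (j - 1) * s (j - 1)"
  using assms
proof (induction "j - i" arbitrary: i rule: less_induct)
  case less
  show ?case
  proof (cases "j = i + 2")
    case True
    then show ?thesis
      using less.prems tr_rec_left[of i j] s_braid[of i] by (simp add: tr_Suc)
  next
    case False
    then have ij: "Suc i + 1 < j" using less.prems by auto
    have c: "s i * s (j - 1) = s (j - 1) * s i"
      using less.prems ij by (intro s_comm) auto
    have "tr i j = s i * tr (Suc i) j * s i"
      using ij by (intro tr_rec_left) auto
    also have "tr (Suc i) j = s (j - 1) * tr (Suc i) (j - 1) * s (j - 1)"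
      using less.prems ij by (intro less.hyps) auto
    also have "s i * (s (j - 1) * tr (Suc i) (j - 1) * s (j - 1)) * s i
        = s (j - 1) * (s i * tr (Suc i) (j - 1) * s i) * s (j - 1)"
      by (simp add: mult.assoc c[simplified] mult_eq_left[OF c, simplified])
    also have "s i * tr (Suc i) (j - 1) * s i = tr i (j - 1)"
      using ij by (intro tr_rec_left[symmetric]) auto
    finally show ?thesis .
  qed
qed

lemma s_tr_disjoint:
  assumes "1 \<le> i" "i < j" "j \<le> n" "1 \<le> l" "l < n" "Suc l < i \<or> j < l"
  shows "s l * tr i j = tr i j * s l"
  using assms
proof (induction "j - i" arbitrary: i rule: less_induct)
  case less
  show ?case
  proof (cases "j = i + 1")
    case True
    then show ?thesis using less.prems by (auto simp: tr_Suc intro!: s_comm2)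
  next
    case False
    show ?thesis
    proof (cases "Suc l < i")
      case True
      have 1: "s l * s i = s i * s l" using less.prems True by (intro s_comm2) auto
      have 2: "s l * tr (Suc i) j = tr (Suc i) j * s l"
        using less.prems False True by (intro less.hyps) auto
      show ?thesis using tr_rec_left[of i j] less.prems False
        by (simp add: mult.assoc 1 2 mult_eq_left[OF 1] mult_eq_left[OF 2])
    next
      case f: False
      have 1: "s l * s i = s i * s l" using less.prems f by (intro s_comm2) auto
      have 2: "s l * tr (Suc i) j = tr (Suc i) j * s l"
        using less.prems False f by (intro less.hyps) auto
      show ?thesis using tr_rec_left[of i j] less.prems False
        by (simp add: mult.assoc 1 2 mult_eq_left[OF 1] mult_eq_left[OF 2])
    qed
  qed
qed

text \<open>Ends are peeled off as long as they commute with s_l. What remains is b (a b c b a) = (a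
  b c b a) b for three consecutive generators a, b, c: the braid relation of a and b, applied before
  and after a commutation of a with c.\<close>

lemma s_tr_inside:
  assumes "1 \<le> i" "i < l" "l + 1 < j" "j \<le> n"
  shows "s l * tr i j = tr i j * s l"
  using assms
proof (induction "j - i" arbitrary: i j rule: less_induct)
  case less
  have sl: "s l * s l = 1" using less.prems by (intro s_square) auto
  show ?case
  proof (cases "l = i + 1")
    case False
    have 1: "s l * s i = s i * s l" using less.prems False by (intro s_comm2) auto
    have 2: "s l * tr (Suc i) j = tr (Suc i) j * s l"
      using less.prems False by (intro less.hyps) auto
    show ?thesis using tr_rec_left[of i j] less.prems
      by (simp add: mult.assoc 1 2 mult_eq_left[OF 1] mult_eq_left[OF 2])
  next
    case True
    show ?thesis
    proof (cases "j = l + 2")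
      case False
      then have j1: "l + 1 < j - 1" using less.prems by auto
      have 1: "s l * s (j-1) = s (j-1) * s l" using less.prems j1 by (intro s_comm2) auto
      have 2: "s l * tr i (j-1) = tr i (j-1) * s l"
        using less.prems j1 by (intro less.hyps) auto
      show ?thesis using tr_rec_right[of i j] less.prems
        by (simp add: mult.assoc 1[simplified] 2[simplified] mult_eq_left[OF 1, simplified] mult_eq_left[OF 2, simplified])
    next
      case j: True
      let ?a = "s i" and ?b = "s (Suc i)" and ?c = "s (Suc (Suc i))"
      have t: "tr i j = ?a * (?b * ?c * ?b) * ?a"
        using j True tr_rec_left[of i j] tr_rec_left[of "Suc i" j] tr_Suc[of "Suc (Suc i)"]
        by (simp add: mult.assoc)
      have aba: "?a * ?b * ?a = ?b * ?a * ?b" using less.prems True s_braid[of i] by simp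
      have ac: "?a * ?c = ?c * ?a" using less.prems True j by (intro s_comm2) auto
      have "?b * tr i j = (?b * ?a * ?b) * ?c * ?b * ?a" unfolding t by (simp only: mult.assoc)
      also have "\<dots> = ?a * ?b * (?a * ?c) * ?b * ?a" using arg_cong[OF aba, of "\<lambda>x. x * ?c * ?b * ?a"] by (simp add: mult.assoc)
      also have "\<dots> = ?a * ?b * ?c * (?a * ?b * ?a)" unfolding ac by (simp only: mult.assoc)
      also have "\<dots> = tr i j * ?b" unfolding aba t by (simp only: mult.assoc)
      finally show ?thesis using True by simp
    qed
  qed
qed

lemma s_conj_tr_less:
  assumes "1 \<le> i" "i < j" "j \<le> n" "1 \<le> l" "l < n"
  shows "s l * tr i j * s l
    = tr (Transposition.transpose l (Suc l) i) (Transposition.transpose l (Suc l) j)"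
proof -
  note sl = s_square[OF assms(4,5)] s_square'[OF assms(4,5)]
  consider "Suc l < i \<or> j < l \<or> (i < l \<and> l + 1 < j)" | "Suc l = i" | "l = i" "j = Suc i"
    | "l = i" "i + 1 < j" | "i < l" "Suc l = j" | "l = j" using assms by linarith
  then show ?thesis
  proof cases
    case 1
    then have "s l * tr i j = tr i j * s l"
      using s_tr_disjoint[of i j l] s_tr_inside[of i l j] assms by blast
    then have "s l * tr i j * s l = tr i j" by (simp add: mult.assoc sl)
    then show ?thesis using 1 assms by (auto simp: Transposition.transpose_def)
  next
    case 2
    then show ?thesis using tr_rec_left[of l j] assms by (simp add: Transposition.transpose_def)
  next
    case 3
    then show ?thesis using assms sl tr_commute[of l "Suc l"]
      by (simp add: tr_Suc Transposition.transpose_def)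
  next
    case 4
    have "s l * tr i j * s l = (s i * s i) * tr (Suc i) j * (s i * s i)"
      using tr_rec_left[of i j] 4 by (simp add: mult.assoc)
    then show ?thesis using 4 sl by (simp add: Transposition.transpose_def)
  next
    case 5
    have "s l * tr i j * s l = (s l * s l) * tr i l * (s l * s l)"
      using tr_rec_right[of i "Suc l"] 5 assms by (auto simp: mult.assoc)
    then show ?thesis using 5 sl assms by (simp add: Transposition.transpose_def)
  next
    case 6
    then show ?thesis using tr_rec_right[of i "Suc l"] assms
      by (simp add: Transposition.transpose_def)
  qed
qed

lemma s_conj_tr:
  assumes "i \<in> {1..n}" "j \<in> {1..n}" "1 \<le> l" "l < n"
  shows "s l * tr i j * s l
    = tr (Transposition.transpose l (Suc l) i) (Transposition.transpose l (Suc l) j)"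
proof -
  consider "i < j" | "i = j" | "j < i" by linarith
  then show ?thesis
  proof cases
    case 1 then show ?thesis using assms s_conj_tr_less by simp
  next
    case 2 then show ?thesis using assms by (simp add: tr_same s_square)
  next
    case 3
    then have "s l * tr j i * s l
      = tr (Transposition.transpose l (Suc l) j) (Transposition.transpose l (Suc l) i)"
      using assms by (intro s_conj_tr_less) auto
    then show ?thesis by (metis tr_commute)
  qed
qed

text \<open>The first letter of \<open>js\<close> stands innermost in the conjugation and therefore
  acts first, in agreement with \<open>fold\<close> and with the right action of
  permutations.\<close>

lemma conj_word:
  assumes "\<And>l x. 1 \<le> l \<Longrightarrow> l < n \<Longrightarrow> x \<in> X \<Longrightarrow> s l * f x * s l = f (a l x)"
    and "\<And>l x. 1 \<le> l \<Longrightarrow> l < n \<Longrightarrow> x \<in> X \<Longrightarrow> a l x \<in> X"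
    and "set js \<subseteq> {1..<n}" "x \<in> X"
  shows "prod_list (map s (rev js)) * f x * prod_list (map s js) = f (fold a js x)"
  using assms(3,4)
proof (induction js arbitrary: x)
  case (Cons j js)
  then have "prod_list (map s (rev (j # js))) * f x * prod_list (map s (j # js))
     = prod_list (map s (rev js)) * (s j * f x * s j) * prod_list (map s js)"
    by (simp add: mult.assoc)
  then show ?case using Cons assms(1,2)[of j x] by simp
qed simp

lemma word_inverse:
  assumes "set js \<subseteq> {1..<n}"
  shows "prod_list (map s (rev js)) * prod_list (map s js) = 1"
    "prod_list (map s js) * prod_list (map s (rev js)) = 1"
proof -
  have *: "prod_list (map s (rev js)) * prod_list (map s js) = 1" if "set js \<subseteq> {1..<n}" for js
    using conj_word[of UNIV "\<lambda>_. 1" "\<lambda>_ x. x" js undefined] that s_square by simp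
  show "prod_list (map s (rev js)) * prod_list (map s js) = 1"
    "prod_list (map s js) * prod_list (map s (rev js)) = 1"
    using *[of js] *[of "rev js"] assms by auto
qed

lemma transp_word_valid: "i \<in> {1..n} \<Longrightarrow> j \<in> {1..n} \<Longrightarrow> set (transp_word i j) \<subseteq> {1..<n}"
  by (auto simp: transp_word_def)

lemma rev_transp_word: "rev (transp_word i j) = transp_word i j"
proof (cases "i = j")
  case False
  then have "min i j < max i j" by auto
  then obtain d where "max i j = Suc (min i j + d)" using less_iff_Suc_add by blast
  then show ?thesis by (simp add: transp_word_def)
qed (simp add: transp_word_def)

lemma tr_square:
  assumes "i \<in> {1..n}" "j \<in> {1..n}" shows "tr i j * tr i j = 1"
  using word_inverse(1)[OF transp_word_valid[OF assms]] by (simp add: rev_transp_word tr_def)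

lemma tr_square':
  assumes "i \<in> {1..n}" "j \<in> {1..n}" shows "tr i j * (tr i j * x) = x"
  using tr_square[OF assms] by (simp flip: mult.assoc)

text \<open>The word of a transposition is a palindrome, so multiplying by it on both sides is the
  conjugation of \<open>conj_word\<close>; \<open>tr_square\<close> turns this into a commutation
  rule.\<close>

lemma equivariant_tr:
  assumes f: "\<And>l x. 1 \<le> l \<Longrightarrow> l < n \<Longrightarrow> x \<in> {1..n} \<Longrightarrow>
      s l * f x * s l = f (Transposition.transpose l (Suc l) x)"
    and ij: "i \<in> {1..n}" "j \<in> {1..n}" "x \<in> {1..n}"
  shows "tr i j * f x = f (Transposition.transpose i j x) * tr i j"
proof -
  have "tr i j * f x * tr i j = f (perm_act x (transp_word i j))"
    using conj_word[of "{1..n}" f "\<lambda>l. Transposition.transpose l (Suc l)" "transp_word i j" x]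
      transp_word_valid[OF ij(1,2)] f ij(3)
    by (simp add: rev_transp_word tr_def perm_act_def Transposition.transpose_def)
  then have "tr i j * f x * tr i j = f (Transposition.transpose i j x)"
    by (simp add: perm_act_transp_word)
  then have "tr i j * f x * tr i j * tr i j = f (Transposition.transpose i j x) * tr i j" by simp
  then show ?thesis by (simp add: mult.assoc tr_square[OF ij(1,2)])
qed

lemma equivariant2_tr:
  assumes f: "\<And>l x y. 1 \<le> l \<Longrightarrow> l < n \<Longrightarrow> x \<in> {1..n} \<Longrightarrow> y \<in> {1..n} \<Longrightarrow>
      s l * f x y * s l = f (Transposition.transpose l (Suc l) x) (Transposition.transpose l (Suc l) y)"
    and ij: "i \<in> {1..n}" "j \<in> {1..n}" "x \<in> {1..n}" "y \<in> {1..n}"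
  shows "tr i j * f x y = f (Transposition.transpose i j x) (Transposition.transpose i j y) * tr i j"
proof -
  have fold: "fold (\<lambda>l. map_prod (Transposition.transpose l (Suc l)) (Transposition.transpose l (Suc l))) js (x,y)
      = (perm_act x js, perm_act y js)" for js x y
    by (induction js arbitrary: x y) (auto simp: perm_act_def)
  have "tr i j * f x y * tr i j = f (perm_act x (transp_word i j)) (perm_act y (transp_word i j))"
    using conj_word[of "{1..n} \<times> {1..n}" "\<lambda>(x,y). f x y"
        "\<lambda>l. map_prod (Transposition.transpose l (Suc l)) (Transposition.transpose l (Suc l))"
        "transp_word i j" "(x,y)"]
      transp_word_valid[OF ij(1,2)] f ij(3,4)
    by (auto simp: rev_transp_word tr_def fold Transposition.transpose_def)
  then have "tr i j * f x y * tr i j = f (Transposition.transpose i j x) (Transposition.transpose i j y)"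
    by (simp add: perm_act_transp_word)
  then have "tr i j * f x y * tr i j * tr i j
      = f (Transposition.transpose i j x) (Transposition.transpose i j y) * tr i j" by simp
  then show ?thesis by (simp add: mult.assoc tr_square[OF ij(1,2)])
qed

lemma tr_tr:
  assumes "i \<in> {1..n}" "j \<in> {1..n}" "x \<in> {1..n}" "y \<in> {1..n}"
  shows "tr i j * tr x y = tr (Transposition.transpose i j x) (Transposition.transpose i j y) * tr i j"
  using assms by (intro equivariant2_tr s_conj_tr) auto

lemma commute_tr:
  assumes "\<And>l. min i j \<le> l \<Longrightarrow> l < max i j \<Longrightarrow> s l * x = x * s l"
  shows "tr i j * x = x * tr i j"
proof -
  have "prod_list (map s js) * x = x * prod_list (map s js)"
    if "set js \<subseteq> {min i j..<max i j}" for js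
    using that
  proof (induction js)
    case (Cons l js)
    then have 1: "prod_list (map s js) * x = x * prod_list (map s js)" and 2: "s l * x = x * s l"
      using assms[of l] by simp_all
    show ?case by (simp add: mult.assoc 1 2 mult_eq_left[OF 2])
  qed simp
  from this[of "transp_word i j"] show ?thesis
    unfolding tr_def by (auto simp: transp_word_def)
qed

end

section \<open>The walled Brauer-Clifford relations in a monoid\<close>

declare One_nat_def [simp del]

text \<open>\<open>N\<close> and \<open>z\<close> play the roles of \<open>- 1\<close> and \<open>0\<close>, as the relations are also needed in monoids of signed
  partial maps, where there is no addition. The parameters \<open>q\<close> and \<open>qb\<close> make the relations symmetric
  under exchanging the two sides of the wall.\<close>

locale wbc =
  fixes R T :: nat and s sb c cb :: "nat \<Rightarrow> 'b::monoid_mult" and e N z q qb :: 'b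
  assumes s_gens: "symmetric_generators R s" and sb_gens: "symmetric_generators T sb"
    and c_square: "1 \<le> i \<Longrightarrow> i \<le> R \<Longrightarrow> c i * c i = q"
    and cb_square: "1 \<le> i \<Longrightarrow> i \<le> T \<Longrightarrow> cb i * cb i = qb"
    and c_anticomm: "1 \<le> i \<Longrightarrow> i \<le> R \<Longrightarrow> 1 \<le> j \<Longrightarrow> j \<le> R \<Longrightarrow> i \<noteq> j \<Longrightarrow> c i * c j = N * (c j * c i)"
    and cb_anticomm: "1 \<le> i \<Longrightarrow> i \<le> T \<Longrightarrow> 1 \<le> j \<Longrightarrow> j \<le> T \<Longrightarrow> i \<noteq> j \<Longrightarrow> cb i * cb j = N * (cb j * cb i)"
    and s_c_s: "1 \<le> j \<Longrightarrow> j < R \<Longrightarrow> 1 \<le> i \<Longrightarrow> i \<le> R \<Longrightarrow> s j * c i * s j = c (Transposition.transpose j (Suc j) i)"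
    and sb_cb_sb: "1 \<le> j \<Longrightarrow> j < T \<Longrightarrow> 1 \<le> i \<Longrightarrow> i \<le> T \<Longrightarrow> sb j * cb i * sb j = cb (Transposition.transpose j (Suc j) i)"
    and e_c: "e * c 1 = e * cb 1" and c_e1: "c 1 * e = cb 1 * e"
    and sb_c: "1 \<le> j \<Longrightarrow> j < T \<Longrightarrow> 1 \<le> i \<Longrightarrow> i \<le> R \<Longrightarrow> sb j * c i = c i * sb j"
    and s_cb: "1 \<le> i \<Longrightarrow> i < R \<Longrightarrow> 1 \<le> j \<Longrightarrow> j \<le> T \<Longrightarrow> s i * cb j = cb j * s i"
    and c_cb: "1 \<le> i \<Longrightarrow> i \<le> R \<Longrightarrow> 1 \<le> j \<Longrightarrow> j \<le> T \<Longrightarrow> c i * cb j = N * (cb j * c i)"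
    and s_sb: "1 \<le> i \<Longrightarrow> i < R \<Longrightarrow> 1 \<le> j \<Longrightarrow> j < T \<Longrightarrow> s i * sb j = sb j * s i"
    and e_square: "e * e = z"
    and e_s_e: "2 \<le> R \<Longrightarrow> e * s 1 * e = e" and e_sb_e: "2 \<le> T \<Longrightarrow> e * sb 1 * e = e"
    and s_e: "1 < i \<Longrightarrow> i < R \<Longrightarrow> s i * e = e * s i" and sb_e: "1 < i \<Longrightarrow> i < T \<Longrightarrow> sb i * e = e * sb i"
    and c_e: "1 < i \<Longrightarrow> i \<le> R \<Longrightarrow> c i * e = e * c i" and cb_e: "1 < i \<Longrightarrow> i \<le> T \<Longrightarrow> cb i * e = e * cb i"
    and wall_left: "2 \<le> R \<Longrightarrow> 2 \<le> T \<Longrightarrow> e * s 1 * sb 1 * e * s 1 = e * s 1 * sb 1 * e * sb 1"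
    and wall_right: "2 \<le> R \<Longrightarrow> 2 \<le> T \<Longrightarrow> s 1 * e * s 1 * sb 1 * e = sb 1 * e * s 1 * sb 1 * e"
    and e_c_e: "e * c 1 * e = z"
    and N_N: "N * N = 1"
    and N_s: "1 \<le> i \<Longrightarrow> i < R \<Longrightarrow> s i * N = N * s i" and N_sb: "1 \<le> i \<Longrightarrow> i < T \<Longrightarrow> sb i * N = N * sb i"
    and N_c: "1 \<le> i \<Longrightarrow> i \<le> R \<Longrightarrow> c i * N = N * c i" and N_cb: "1 \<le> i \<Longrightarrow> i \<le> T \<Longrightarrow> cb i * N = N * cb i"
    and N_e: "e * N = N * e"
    and z_s: "1 \<le> i \<Longrightarrow> i < R \<Longrightarrow> s i * z = z" "1 \<le> i \<Longrightarrow> i < R \<Longrightarrow> z * s i = z"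
    and z_sb: "1 \<le> i \<Longrightarrow> i < T \<Longrightarrow> sb i * z = z" "1 \<le> i \<Longrightarrow> i < T \<Longrightarrow> z * sb i = z"
    and z_c: "1 \<le> i \<Longrightarrow> i \<le> R \<Longrightarrow> c i * z = z" "1 \<le> i \<Longrightarrow> i \<le> R \<Longrightarrow> z * c i = z"
    and z_cb: "1 \<le> i \<Longrightarrow> i \<le> T \<Longrightarrow> cb i * z = z" "1 \<le> i \<Longrightarrow> i \<le> T \<Longrightarrow> z * cb i = z"
    and z_e: "e * z = z" "z * e = z" and z_N: "N * z = z" "z * N = z" and z_z: "z * z = z"
    and qs: "q = 1 \<and> qb = N \<or> q = N \<and> qb = 1"
    and RT: "1 \<le> R" "1 \<le> T"
begin

sublocale V: symmetric_generators R s by (rule s_gens)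
sublocale W: symmetric_generators T sb by (rule sb_gens)

abbreviation "t \<equiv> V.tr"
abbreviation "tb \<equiv> W.tr"

text \<open>The mirror image in the wall: from here on each statement about one side is available
  for the other. The mirror of e c_1 e = z comes from e c_1 = e cb_1, that of the wall relations
  from s_1 sb_1 = sb_1 s_1.\<close>

lemma swap: "wbc T R sb s cb c e N z qb q"
proof
  show "e * cb 1 * e = z" using e_c_e e_c by simp
  show "e * sb 1 * s 1 * e * sb 1 = e * sb 1 * s 1 * e * s 1" if "2 \<le> T" "2 \<le> R"
    using wall_left[OF that(2,1)] s_sb[of 1 1] mult_eq_left[OF s_sb[of 1 1]] that
    by (simp add: mult.assoc)
  show "sb 1 * e * sb 1 * s 1 * e = s 1 * e * sb 1 * s 1 * e" if "2 \<le> T" "2 \<le> R"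
    using wall_right[OF that(2,1)] s_sb[of 1 1] mult_eq_left[OF s_sb[of 1 1]] that
    by (simp add: mult.assoc)
  show "cb i * c j = N * (c j * cb i)" if "1 \<le> i" "i \<le> T" "1 \<le> j" "j \<le> R" for i j
    using c_cb[of j i] that by (simp add: mult_eq_left[OF N_N])
  show "sb i * s j = s j * sb i" if "1 \<le> i" "i < T" "1 \<le> j" "j < R" for i j
    using s_sb[of j i] that by simp
  show "qb = 1 \<and> q = N \<or> qb = N \<and> q = 1" using qs by blast
qed (rule s_gens sb_gens c_square cb_square c_anticomm cb_anticomm s_c_s sb_cb_sb
    e_c[symmetric] c_e1[symmetric] sb_c s_cb sb_c[symmetric] s_cb[symmetric] e_square e_s_e e_sb_e
    s_e sb_e c_e cb_e N_N N_s N_sb N_c N_cb N_e z_s z_sb z_c z_cb z_e z_N z_z RT; assumption)+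

lemma t_c:
  "i \<in> {1..R} \<Longrightarrow> j \<in> {1..R} \<Longrightarrow> x \<in> {1..R} \<Longrightarrow>
    t i j * c x = c (Transposition.transpose i j x) * t i j"
  by (rule V.equivariant_tr) (auto intro: s_c_s)

lemma t_cb: "i \<in> {1..R} \<Longrightarrow> j \<in> {1..R} \<Longrightarrow> x \<in> {1..T} \<Longrightarrow> t i j * cb x = cb x * t i j"
  by (rule V.commute_tr) (auto intro!: s_cb)

lemma tb_cb:
  "i \<in> {1..T} \<Longrightarrow> j \<in> {1..T} \<Longrightarrow> x \<in> {1..T} \<Longrightarrow>
    tb i j * cb x = cb (Transposition.transpose i j x) * tb i j"
  by (rule W.equivariant_tr) (auto intro: sb_cb_sb)

lemma tb_c: "i \<in> {1..T} \<Longrightarrow> j \<in> {1..T} \<Longrightarrow> x \<in> {1..R} \<Longrightarrow> tb i j * c x = c x * tb i j"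
  by (rule W.commute_tr) (auto intro!: sb_c)

lemma t_sb: "i \<in> {1..R} \<Longrightarrow> j \<in> {1..R} \<Longrightarrow> 1 \<le> l \<Longrightarrow> l < T \<Longrightarrow> t i j * sb l = sb l * t i j"
  by (rule V.commute_tr) (auto intro!: s_sb)

lemma t_tb:
  "i \<in> {1..R} \<Longrightarrow> j \<in> {1..R} \<Longrightarrow> x \<in> {1..T} \<Longrightarrow> y \<in> {1..T} \<Longrightarrow> t i j * tb x y = tb x y * t i j"
  by (rule W.commute_tr[symmetric]) (auto intro!: t_sb[symmetric])

lemma t_e: "i \<in> {2..R} \<Longrightarrow> j \<in> {2..R} \<Longrightarrow> t i j * e = e * t i j"
  by (rule V.commute_tr) (auto intro!: s_e)

section \<open>The elements e_{i,j} and their equivariance under both symmetric groups\<close>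

definition e2 :: "nat \<Rightarrow> nat \<Rightarrow> 'b" where
  "e2 i j = tb 1 j * t 1 i * e * t 1 i * tb 1 j"

lemma e2_swap:
  assumes "i \<in> {1..R}" "j \<in> {1..T}"
  shows "wbc.e2 sb s e j i = e2 i j"
proof -
  interpret sw: wbc T R sb s cb c e N z qb q by (rule swap)
  have *: "t 1 i * tb 1 j = tb 1 j * t 1 i" using assms RT by (intro t_tb) auto
  show ?thesis unfolding e2_def sw.e2_def
    by (simp add: mult.assoc * mult_eq_left[OF *])
qed

text \<open>It suffices to conjugate by s_l. For l > 1 it can be moved past e; for l = 1 and x > 2
  one writes (1 2)(1 x) = (1 x)(2 x) and moves (2 x) past e instead; for l = 1 and x at most 2 it is
  the definition.\<close>

lemma t_e2:
  assumes ab: "a \<in> {1..R}" "b \<in> {1..R}" and ij: "i \<in> {1..R}" "j \<in> {1..T}"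
  shows "t a b * e2 i j = e2 (Transposition.transpose a b i) j * t a b"
proof -
  define E where "E i = t 1 i * e * t 1 i" for i
  have E: "s l * E x * s l = E (Transposition.transpose l (Suc l) x)"
    if l: "1 \<le> l" "l < R" and x: "x \<in> {1..R}" for l x
  proof -
    have R1: "(1::nat) \<in> {1..R}" using l by auto
    have sl: "s l = t l (Suc l)" by (simp add: V.tr_Suc)
    consider "l \<ge> 2" | "l = 1" "x = 1" | "l = 1" "x = 2" | "l = 1" "x \<ge> 3" using l x by force
    then show ?thesis
    proof cases
      case 1
      have m: "t l (Suc l) * t 1 x = t 1 (Transposition.transpose l (Suc l) x) * t l (Suc l)"
        using V.tr_tr[of l "Suc l" 1 x] l x 1 R1 by (auto simp: Transposition.transpose_def)
      have m': "t 1 x * t l (Suc l) = t l (Suc l) * t 1 (Transposition.transpose l (Suc l) x)"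
        using V.tr_tr[of l "Suc l" 1 "Transposition.transpose l (Suc l) x"] l x 1 R1
        by (auto simp: Transposition.transpose_def)
      have le: "t l (Suc l) * e = e * t l (Suc l)" using l 1 by (intro t_e) auto
      have ll: "t l (Suc l) * t l (Suc l) = 1" using l by (intro V.tr_square) auto
      show ?thesis unfolding E_def sl
        by (simp add: mult.assoc m m' le mult_eq_left[OF m] mult_eq_left[OF m']
            mult_eq_left[OF le] mult_eq_left[OF ll] ll)
    next
      case 2
      have "s l = t 1 2" using 2 sl by (simp add: numeral_2_eq_2)
      then show ?thesis using 2 by (simp add: E_def V.tr_same)
    next
      case 3
      have ll: "t 1 2 * t 1 2 = 1" using l x 3 by (intro V.tr_square) auto
      have "s l = t 1 2" using 3 sl by (simp add: numeral_2_eq_2)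
      then show ?thesis using 3 
        by (simp add: E_def V.tr_same mult.assoc ll mult_eq_left[OF ll])
    next
      case 4
      have t1: "(1::nat) \<in> {1..R}" "2 \<in> {1..R}" "x \<in> {1..R}" using 4 x l by auto
      have m: "t 1 2 * t 1 x = t 1 x * t 2 x"
        using V.tr_tr[of 1 x 2 x] t1 4 V.tr_commute[of 2 1] by (auto simp: Transposition.transpose_def)
      have m': "t 1 x * t 1 2 = t 2 x * t 1 x"
        using V.tr_tr[of 1 x 1 2] t1 4 V.tr_commute[of 2 x] by (auto simp: Transposition.transpose_def)
      have le: "t 2 x * e = e * t 2 x" using x 4 by (intro t_e) auto
      have ll: "t 2 x * t 2 x = 1" using t1 by (intro V.tr_square) auto
      have "s l = t 1 2" using 4 sl by (simp add: numeral_2_eq_2)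
      then show ?thesis using 4 unfolding E_def
        by (simp add: mult.assoc m m' le mult_eq_left[OF m] mult_eq_left[OF m']
            mult_eq_left[OF le] mult_eq_left[OF ll] ll Transposition.transpose_def)
    qed
  qed
  have 1: "t a b * E i = E (Transposition.transpose a b i) * t a b"
    using E ab ij by (intro V.equivariant_tr)
  have 2: "t a b * tb 1 j = tb 1 j * t a b" using ab ij RT by (intro t_tb) auto
  have 3: "e2 x j = tb 1 j * (E x * tb 1 j)" for x by (simp add: e2_def E_def mult.assoc)
  show ?thesis unfolding 3
    by (simp add: mult.assoc 1 2 mult_eq_left[OF 1] mult_eq_left[OF 2])
qed

lemma tb_e2:
  assumes "a \<in> {1..T}" "b \<in> {1..T}" "i \<in> {1..R}" "j \<in> {1..T}"
  shows "tb a b * e2 i j = e2 i (Transposition.transpose a b j) * tb a b"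
proof -
  interpret sw: wbc T R sb s cb c e N z qb q by (rule swap)
  have "Transposition.transpose a b j \<in> {1..T}" using assms by (auto simp: Transposition.transpose_def)
  then show ?thesis using sw.t_e2[of a b j i] assms by (simp add: e2_swap)
qed

lemma e2_1_1: "e2 1 1 = e"
  by (simp add: e2_def V.tr_same W.tr_same)

end

lemma transpose_in: "i \<in> {1..n} \<Longrightarrow> j \<in> {1..n} \<Longrightarrow> x \<in> {1..n} \<Longrightarrow> Transposition.transpose i j x \<in> {1..n::nat}"
  by (auto simp: Transposition.transpose_def)

text \<open>With \<open>two_transitive\<close>: a relation among the e_{i,j} that survives
  simultaneous transposition of its indices has to be checked only at the index 1, or at the pair 1,
  2, where it is one of the defining relations.\<close>

lemma one_transitive:
  assumes "\<And>a b i. a \<in> {1..n} \<Longrightarrow> b \<in> {1..n} \<Longrightarrow> i \<in> {1..n} \<Longrightarrow> P i \<Longrightarrow> P (Transposition.transpose a b i)"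
    and "P (1::nat)" "i \<in> {1..n}"
  shows "P i"
  using assms(1)[of 1 i 1] assms(2,3) by (auto simp: Transposition.transpose_def)

lemma two_transitive:
  assumes "\<And>a b i i'. a \<in> {1..n} \<Longrightarrow> b \<in> {1..n} \<Longrightarrow> i \<in> {1..n} \<Longrightarrow> i' \<in> {1..n} \<Longrightarrow> i \<noteq> i' \<Longrightarrow> P i i' \<Longrightarrow>
      P (Transposition.transpose a b i) (Transposition.transpose a b i')"
    and "2 \<le> n \<Longrightarrow> P (1::nat) 2" "i \<in> {1..n}" "i' \<in> {1..n}" "i \<noteq> i'"
  shows "P i i'"
proof -
  have n: "2 \<le> n" using assms(3-5) by auto
  \<comment> \<open>(1 i) carries the pair 1, 2 to i, b, and then (b i') carries it to i,
    i'.\<close>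
  define b where "b = Transposition.transpose 1 i 2"
  have b: "b \<in> {1..n}" "b \<noteq> i" using n assms(3) by (auto simp: b_def Transposition.transpose_def)
  have "P i b" using assms(1)[of 1 i 1 2] assms(2)[OF n] assms(3) n by (simp add: b_def)
  then show ?thesis using assms(1)[of b i' i b] b assms(3-5) by (simp add: Transposition.transpose_def)
qed

section \<open>Relations among the e_{i,j}, transported from small indices by conjugation\<close>

context wbc begin

lemma e2_2_1: "e2 2 1 = s 1 * e * s 1" and e2_1_2: "e2 1 2 = sb 1 * e * sb 1"
  and e2_2_2: "e2 2 2 = sb 1 * s 1 * e * s 1 * sb 1"
  using V.tr_Suc[of 1] W.tr_Suc[of 1]
  by (simp_all add: e2_def V.tr_same W.tr_same numeral_2_eq_2)

text \<open>Conjugation as a function, so that applying it to both sides of a relation and rewriting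
  with \<open>cj\<close> renames the indices in the whole relation at once.\<close>

definition cj :: "nat \<Rightarrow> nat \<Rightarrow> 'b \<Rightarrow> 'b" where "cj a b x = t a b * x * t a b"
definition cjb :: "nat \<Rightarrow> nat \<Rightarrow> 'b \<Rightarrow> 'b" where "cjb a b x = tb a b * x * tb a b"

lemma cj_I: "a \<in> {1..R} \<Longrightarrow> b \<in> {1..R} \<Longrightarrow> t a b * x = y * t a b \<Longrightarrow> cj a b x = y"
  unfolding cj_def by (metis V.tr_square mult.assoc mult.right_neutral)

lemma cjb_I: "a \<in> {1..T} \<Longrightarrow> b \<in> {1..T} \<Longrightarrow> tb a b * x = y * tb a b \<Longrightarrow> cjb a b x = y"
  unfolding cjb_def by (metis W.tr_square mult.assoc mult.right_neutral)

lemma cj: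
  assumes ab: "a \<in> {1..R}" "b \<in> {1..R}"
  shows "cj a b (x * y) = cj a b x * cj a b y"
    "i \<in> {1..R} \<Longrightarrow> i' \<in> {1..R} \<Longrightarrow> cj a b (t i i') = t (Transposition.transpose a b i) (Transposition.transpose a b i')"
    "j \<in> {1..T} \<Longrightarrow> j' \<in> {1..T} \<Longrightarrow> cj a b (tb j j') = tb j j'"
    "i \<in> {1..R} \<Longrightarrow> j \<in> {1..T} \<Longrightarrow> cj a b (e2 i j) = e2 (Transposition.transpose a b i) j"
    "i \<in> {1..R} \<Longrightarrow> cj a b (c i) = c (Transposition.transpose a b i)"
    "j \<in> {1..T} \<Longrightarrow> cj a b (cb j) = cb j"
    "cj a b N = N" "cj a b z = z"
proof -
  show "cj a b (x * y) = cj a b x * cj a b y"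
    unfolding cj_def by (simp add: mult.assoc V.tr_square'[OF ab])
  have "t a b * N = N * t a b" by (rule V.commute_tr) (use ab in \<open>auto intro!: N_s\<close>)
  then show "cj a b N = N" by (rule cj_I[OF ab])
  have "z * prod_list (map s js) = z \<and> prod_list (map s js) * z = z" if "set js \<subseteq> {1..<R}" for js
    using that
  proof (induction js)
    case (Cons l js)
    then have "z * s l = z" "s l * z = z" using z_s[of l] by auto
    then show ?case using Cons by (simp add: mult.assoc mult_eq_left[of z "s l" z])
  qed simp
  from this[OF V.transp_word_valid[OF ab]] show "cj a b z = z" by (simp add: cj_def V.tr_def)
qed (auto intro!: cj_I ab V.tr_tr t_tb t_e2 t_c t_cb simp del: atLeastAtMost_iff)

lemma cjb:
  assumes ab: "a \<in> {1..T}" "b \<in> {1..T}"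
  shows "cjb a b (x * y) = cjb a b x * cjb a b y"
    "i \<in> {1..R} \<Longrightarrow> i' \<in> {1..R} \<Longrightarrow> cjb a b (t i i') = t i i'"
    "j \<in> {1..T} \<Longrightarrow> j' \<in> {1..T} \<Longrightarrow> cjb a b (tb j j') = tb (Transposition.transpose a b j) (Transposition.transpose a b j')"
    "i \<in> {1..R} \<Longrightarrow> j \<in> {1..T} \<Longrightarrow> cjb a b (e2 i j) = e2 i (Transposition.transpose a b j)"
    "i \<in> {1..R} \<Longrightarrow> cjb a b (c i) = c i"
    "j \<in> {1..T} \<Longrightarrow> cjb a b (cb j) = cb (Transposition.transpose a b j)"
    "cjb a b N = N" "cjb a b z = z"
proof -
  interpret sw: wbc T R sb s cb c e N z qb q by (rule swap)
  have cjb_eq: "cjb = sw.cj" by (simp add: fun_eq_iff cjb_def sw.cj_def)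
  show "cjb a b (x * y) = cjb a b x * cjb a b y" "cjb a b N = N" "cjb a b z = z"
    unfolding cjb_eq using sw.cj(1,7,8)[OF ab] by auto
  show "cjb a b (e2 i j) = e2 i (Transposition.transpose a b j)" if "i \<in> {1..R}" "j \<in> {1..T}"
    using that ab by (intro cjb_I tb_e2)
qed (auto intro!: cjb_I ab W.tr_tr t_tb[symmetric] tb_c tb_cb simp del: atLeastAtMost_iff)

text \<open>For i = 1, i' = 2 and j = 1 these are e s_1 e = e multiplied by s_1 on the right and on
  the left.\<close>

lemma e2_e2_bar:
  assumes "i \<in> {1..R}" "i' \<in> {1..R}" "i \<noteq> i'" "j \<in> {1..T}"
  shows "e2 i j * e2 i' j = e2 i j * t i i'" "e2 i' j * e2 i j = t i i' * e2 i j"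
proof -
  have "e2 i j * e2 i' j = e2 i j * t i i' \<and> e2 i' j * e2 i j = t i i' * e2 i j"
  proof (rule one_transitive[OF _ _ assms(4)])
    show "e2 i 1 * e2 i' 1 = e2 i 1 * t i i' \<and> e2 i' 1 * e2 i 1 = t i i' * e2 i 1"
    proof (rule two_transitive[OF _ _ assms(1-3)])
      assume R: "2 \<le> R"
      have "t 1 2 = s 1" using V.tr_Suc[of 1] by (simp add: numeral_2_eq_2)
      moreover have "s 1 * (s 1 * x) = x" for x using R V.s_square'[of 1] by simp
      ultimately show "e2 1 1 * e2 2 1 = e2 1 1 * t 1 2 \<and> e2 2 1 * e2 1 1 = t 1 2 * e2 1 1"
        using e_s_e[OF R, unfolded mult.assoc] mult_eq_left[OF e_s_e[OF R, unfolded mult.assoc]]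
        by (simp add: e2_1_1 e2_2_1 mult.assoc)
    next
      fix a b i i' assume h: "a \<in> {1..R}" "b \<in> {1..R}" "i \<in> {1..R}" "i' \<in> {1..R}"
        "e2 i 1 * e2 i' 1 = e2 i 1 * t i i' \<and> e2 i' 1 * e2 i 1 = t i i' * e2 i 1"
      have "1 \<in> {1..T}" using RT by simp
      then show "e2 (Transposition.transpose a b i) 1 * e2 (Transposition.transpose a b i') 1 =
          e2 (Transposition.transpose a b i) 1 * t (Transposition.transpose a b i) (Transposition.transpose a b i') \<and>
          e2 (Transposition.transpose a b i') 1 * e2 (Transposition.transpose a b i) 1 =
          t (Transposition.transpose a b i) (Transposition.transpose a b i') * e2 (Transposition.transpose a b i) 1"
        using arg_cong[OF conjunct1[OF h(5)], of "cj a b"] arg_cong[OF conjunct2[OF h(5)], of "cj a b"] h(1-4)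
        by (simp only: cj)
    qed
  next
    fix a b j assume h: "a \<in> {1..T}" "b \<in> {1..T}" "j \<in> {1..T}"
      "e2 i j * e2 i' j = e2 i j * t i i' \<and> e2 i' j * e2 i j = t i i' * e2 i j"
    show "e2 i (Transposition.transpose a b j) * e2 i' (Transposition.transpose a b j)
          = e2 i (Transposition.transpose a b j) * t i i' \<and>
        e2 i' (Transposition.transpose a b j) * e2 i (Transposition.transpose a b j)
          = t i i' * e2 i (Transposition.transpose a b j)"
      using arg_cong[OF conjunct1[OF h(4)], of "cjb a b"] arg_cong[OF conjunct2[OF h(4)], of "cjb a b"]
        h(1-3) assms(1,2)
      by (simp only: cjb)
  qed
  then show "e2 i j * e2 i' j = e2 i j * t i i'" "e2 i' j * e2 i j = t i i' * e2 i j" by auto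
qed

lemma e2_e2_bar':
  assumes "j \<in> {1..T}" "j' \<in> {1..T}" "j \<noteq> j'" "i \<in> {1..R}"
  shows "e2 i j * e2 i j' = e2 i j * tb j j'" "e2 i j' * e2 i j = tb j j' * e2 i j"
proof -
  interpret sw: wbc T R sb s cb c e N z qb q by (rule swap)
  show "e2 i j * e2 i j' = e2 i j * tb j j'" "e2 i j' * e2 i j = tb j j' * e2 i j"
    using sw.e2_e2_bar[OF assms] assms by (simp_all add: e2_swap del: atLeastAtMost_iff)
qed

text \<open>This is the content of the wall relations: at the indices 1 and 2, each of them reduces
  one of the two products to e s_1 sb_1 e.\<close>

lemma e2_commute:
  assumes i: "i \<in> {1..R}" "i' \<in> {1..R}" "i \<noteq> i'" and j: "j \<in> {1..T}" "j' \<in> {1..T}" "j \<noteq> j'"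
  shows "e2 i j * e2 i' j' = e2 i' j' * e2 i j"
proof (rule two_transitive[OF _ _ j])
  have RT2: "2 \<le> R" "2 \<le> T" using i j by auto
  show "e2 i 1 * e2 i' 2 = e2 i' 2 * e2 i 1"
  proof (rule two_transitive[OF _ _ i])
    have ss: "s 1 * (s 1 * x) = x" "sb 1 * (sb 1 * x) = x" "s 1 * s 1 = 1" "sb 1 * sb 1 = 1" for x
      using RT2 V.s_square'[of 1] W.s_square'[of 1] V.s_square[of 1] W.s_square[of 1] by auto
    have sc: "sb 1 * s 1 = s 1 * sb 1" using RT2 s_sb[of 1 1] by simp
    have "e2 1 1 * e2 2 2 = (e * s 1 * sb 1 * e * s 1) * sb 1"
      by (simp only: e2_1_1 e2_2_2 mult.assoc sc mult_eq_left[OF sc])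
    also have "\<dots> = e * s 1 * sb 1 * e"
      unfolding wall_left[OF RT2] by (simp add: mult.assoc ss)
    finally have 1: "e2 1 1 * e2 2 2 = e * s 1 * sb 1 * e" .
    have "e2 2 2 * e2 1 1 = sb 1 * (s 1 * e * s 1 * sb 1 * e)"
      by (simp only: e2_1_1 e2_2_2 mult.assoc)
    also have "\<dots> = e * s 1 * sb 1 * e"
      unfolding wall_right[OF RT2] by (simp add: mult.assoc ss)
    finally show "e2 1 1 * e2 2 2 = e2 2 2 * e2 1 1" using 1 by simp
  next
    fix a b i i' assume h: "a \<in> {1..R}" "b \<in> {1..R}" "i \<in> {1..R}" "i' \<in> {1..R}"
      "e2 i 1 * e2 i' 2 = e2 i' 2 * e2 i 1"
    have T: "1 \<in> {1..T}" "2 \<in> {1..T}" using RT2 by auto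
    show "e2 (Transposition.transpose a b i) 1 * e2 (Transposition.transpose a b i') 2 =
       e2 (Transposition.transpose a b i') 2 * e2 (Transposition.transpose a b i) 1"
      using arg_cong[OF h(5), of "cj a b"] by (simp (no_asm_use) only: cj h(1-4) T; assumption)
  qed
next
  fix a b j j' assume h: "a \<in> {1..T}" "b \<in> {1..T}" "j \<in> {1..T}" "j' \<in> {1..T}"
      "e2 i j * e2 i' j' = e2 i' j' * e2 i j"
  show "e2 i (Transposition.transpose a b j) * e2 i' (Transposition.transpose a b j') =
      e2 i' (Transposition.transpose a b j') * e2 i (Transposition.transpose a b j)"
    using arg_cong[OF h(5), of "cjb a b"] by (simp (no_asm_use) only: cjb i h(1-4); assumption)
qed

lemma e2_single:
  assumes ij: "i \<in> {1..R}" "j \<in> {1..T}"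
  shows "e2 i j * e2 i j = z" "e2 i j * c i = e2 i j * cb j" "c i * e2 i j = cb j * e2 i j"
    "e2 i j * (c i * e2 i j) = z"
    "e2 i j * N = N * e2 i j" "e2 i j * z = z" "z * e2 i j = z"
proof -
  define P where "P i j \<longleftrightarrow> e2 i j * e2 i j = z \<and> e2 i j * c i = e2 i j * cb j \<and> c i * e2 i j = cb j * e2 i j
    \<and> e2 i j * (c i * e2 i j) = z \<and> e2 i j * N = N * e2 i j \<and> e2 i j * z = z \<and> z * e2 i j = z" for i j
  \<comment> \<open>Applies one map to both sides of all seven relations, so that a single
    conjugation transports the conjunction \<open>P\<close>.\<close>
  have P_cong: "a = a' \<and> b = b' \<and> d = d' \<and> f = f' \<and> g = g' \<and> h = h' \<and> k = k' \<Longrightarrow>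
      F a = F a' \<and> F b = F b' \<and> F d = F d' \<and> F f = F f' \<and> F g = F g' \<and> F h = F h' \<and> F k = F k'"
    for a a' b b' d d' f f' g g' h h' k k' :: 'b and F :: "'b \<Rightarrow> 'b" by simp
  have "P i j"
  proof (rule one_transitive[OF _ _ ij(2)])
    show "P i 1"
    proof (rule one_transitive[OF _ _ ij(1)])
      show "P 1 1" unfolding P_def e2_1_1
        using e_square e_c c_e1 e_c_e N_e z_e by (simp add: mult.assoc)
    next
      fix a b i assume h: "a \<in> {1..R}" "b \<in> {1..R}" "i \<in> {1..R}" and P: "P i 1"
      have T: "1 \<in> {1..T}" using RT by auto
      show "P (Transposition.transpose a b i) 1"
        using P[unfolded P_def, THEN P_cong[of _ _ _ _ _ _ _ _ _ _ _ _ _ _ "cj a b"]]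
        unfolding P_def by (simp (no_asm_use) only: cj h T; assumption)
    qed
  next
    fix a b j assume h: "a \<in> {1..T}" "b \<in> {1..T}" "j \<in> {1..T}" and P: "P i j"
    show "P i (Transposition.transpose a b j)"
      using P[unfolded P_def, THEN P_cong[of _ _ _ _ _ _ _ _ _ _ _ _ _ _ "cjb a b"]]
      unfolding P_def by (simp (no_asm_use) only: cjb h ij; assumption)
  qed
  then show "e2 i j * e2 i j = z" "e2 i j * c i = e2 i j * cb j" "c i * e2 i j = cb j * e2 i j"
    "e2 i j * (c i * e2 i j) = z" "e2 i j * N = N * e2 i j" "e2 i j * z = z" "z * e2 i j = z"
    by (auto simp: P_def)
qed

lemma c_e2:
  assumes "i \<in> {1..R}" "i' \<in> {1..R}" "i \<noteq> i'" "j \<in> {1..T}"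
  shows "c i' * e2 i j = e2 i j * c i'"
proof (rule one_transitive[OF _ _ assms(4)])
  show "c i' * e2 i 1 = e2 i 1 * c i'"
  proof (rule two_transitive[OF _ _ assms(1-3)])
    show "2 \<le> R \<Longrightarrow> c 2 * e2 1 1 = e2 1 1 * c 2" by (simp add: e2_1_1 c_e)
  next
    fix a b i i' assume h: "a \<in> {1..R}" "b \<in> {1..R}" "i \<in> {1..R}" "i' \<in> {1..R}"
      "c i' * e2 i 1 = e2 i 1 * c i'"
    have T: "1 \<in> {1..T}" using RT by auto
    show "c (Transposition.transpose a b i') * e2 (Transposition.transpose a b i) 1
       = e2 (Transposition.transpose a b i) 1 * c (Transposition.transpose a b i')"
      using arg_cong[OF h(5), of "cj a b"] by (simp (no_asm_use) only: cj h(1-4) T; assumption)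
  qed
next
  fix a b j assume h: "a \<in> {1..T}" "b \<in> {1..T}" "j \<in> {1..T}" "c i' * e2 i j = e2 i j * c i'"
  show "c i' * e2 i (Transposition.transpose a b j) = e2 i (Transposition.transpose a b j) * c i'"
    using arg_cong[OF h(4), of "cjb a b"] by (simp (no_asm_use) only: cjb assms(1-2) h(1-3); assumption)
qed

lemma cb_e2:
  assumes "j \<in> {1..T}" "j' \<in> {1..T}" "j \<noteq> j'" "i \<in> {1..R}"
  shows "cb j' * e2 i j = e2 i j * cb j'"
proof -
  interpret sw: wbc T R sb s cb c e N z qb q by (rule swap)
  show ?thesis using sw.c_e2[OF assms] assms by (simp add: e2_swap del: atLeastAtMost_iff)
qed

lemma e2_t_e2:
  assumes "i \<in> {1..R}" "i' \<in> {1..R}" "i \<noteq> i'" "j \<in> {1..T}"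
  shows "e2 i j * (t i i' * e2 i j) = e2 i j"
proof -
  have "e2 i j * (t i i' * e2 i j) = e2 i j * e2 i' j * t i i'"
    using t_e2[of i i' i j] assms by (simp add: mult.assoc)
  also have "\<dots> = e2 i j"
    using e2_e2_bar(1)[OF assms] V.tr_square[OF assms(1,2)] by (simp add: mult.assoc)
  finally show ?thesis .
qed

lemma e2_e2_e2:
  assumes "i \<in> {1..R}" "i' \<in> {1..R}" "i \<noteq> i'" "j \<in> {1..T}"
  shows "e2 i j * (e2 i' j * e2 i j) = e2 i j"
  using e2_e2_bar(2)[OF assms] e2_t_e2[OF assms] by simp

lemma e2_tb_e2:
  assumes "j \<in> {1..T}" "j' \<in> {1..T}" "j \<noteq> j'" "i \<in> {1..R}"
  shows "e2 i j * (tb j j' * e2 i j) = e2 i j"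
proof -
  interpret sw: wbc T R sb s cb c e N z qb q by (rule swap)
  show ?thesis using sw.e2_t_e2[OF assms] assms by (simp add: e2_swap del: atLeastAtMost_iff)
qed

end

section \<open>Monomials and their normal forms\<close>

context wbc begin

text \<open>The generator e needs a strand on each side. The inductions on strands end at m = 0 or n
  = 0, where it has to be absent.\<close>

definition gens :: "nat \<Rightarrow> nat \<Rightarrow> 'b set" where
  "gens m n = s ` {1..<m} \<union> sb ` {1..<n} \<union> c ` {1..m} \<union> cb ` {1..n} \<union> {x. x = e \<and> 1 \<le> m \<and> 1 \<le> n}"

inductive_set Mon :: "nat \<Rightarrow> nat \<Rightarrow> 'b set" for m n where
  one: "1 \<in> Mon m n"
| zero: "z \<in> Mon m n"
| neg: "x \<in> Mon m n \<Longrightarrow> N * x \<in> Mon m n"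
| gen: "g \<in> gens m n \<Longrightarrow> x \<in> Mon m n \<Longrightarrow> g * x \<in> Mon m n"

lemma gens_cases:
  assumes "g \<in> gens m n"
  obtains (s) i where "1 \<le> i" "i < m" "g = s i" | (sb) i where "1 \<le> i" "i < n" "g = sb i"
    | (c) i where "1 \<le> i" "i \<le> m" "g = c i" | (cb) i where "1 \<le> i" "i \<le> n" "g = cb i"
    | (e) "g = e" "1 \<le> m" "1 \<le> n"
  using assms unfolding gens_def by auto

lemma gens_mono: "m \<le> m' \<Longrightarrow> n \<le> n' \<Longrightarrow> gens m n \<subseteq> gens m' n'"
  by (auto simp: gens_def)

lemma gens_I:
  "1 \<le> i \<Longrightarrow> i < m \<Longrightarrow> s i \<in> gens m n" "1 \<le> i \<Longrightarrow> i < n \<Longrightarrow> sb i \<in> gens m n"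
  "1 \<le> i \<Longrightarrow> i \<le> m \<Longrightarrow> c i \<in> gens m n" "1 \<le> i \<Longrightarrow> i \<le> n \<Longrightarrow> cb i \<in> gens m n"
  "1 \<le> m \<Longrightarrow> 1 \<le> n \<Longrightarrow> e \<in> gens m n"
  by (auto simp: gens_def)

lemma Mon_mono:
  assumes "m \<le> m'" "n \<le> n'" "x \<in> Mon m n" shows "x \<in> Mon m' n'"
  using assms(3) by induction (use gens_mono[OF assms(1,2)] in \<open>auto intro: Mon.intros\<close>)

lemma gen_N_z:
  assumes "g \<in> gens m n" "m \<le> R" "n \<le> T"
  shows "g * N = N * g" "g * z = z" "z * g = z"
  using assms by (auto elim!: gens_cases simp: N_s N_sb N_c N_cb N_e z_s z_sb z_c z_cb z_e)

lemma Mon_N_z: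
  assumes "x \<in> Mon m n" "m \<le> R" "n \<le> T"
  shows "x * N = N * x" "x * z = z" "z * x = z"
proof -
  have "x * N = N * x \<and> x * z = z \<and> z * x = z"
    using assms(1)
  proof induction
    case (neg x)
    then show ?case using mult_eq_left[of z N z x] by (simp add: mult.assoc z_N)
  next
    case (gen g x)
    note g = gen_N_z[OF gen(1) assms(2,3)]
    show ?case using gen g by (simp add: mult.assoc mult_eq_left[OF g(1)] mult_eq_left[OF g(3)])
  qed (simp_all add: z_z z_N)
  then show "x * N = N * x" "x * z = z" "z * x = z" by auto
qed

lemma N_N': "N * (N * x) = x"
  using mult_eq_left[OF N_N] by simp

lemma Mon_mult:
  assumes "x \<in> Mon m n" "y \<in> Mon m n" "m \<le> R" "n \<le> T"
  shows "x * y \<in> Mon m n"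
  using assms(1)
  by induction (use assms(2-4) Mon_N_z in \<open>auto simp: mult.assoc intro: Mon.intros\<close>)

lemma Mon_gen: "g \<in> gens m n \<Longrightarrow> g \<in> Mon m n"
  using Mon.gen[OF _ Mon.one, of g m n] by simp

lemma Mon_word: "(\<And>j. j \<in> set js \<Longrightarrow> f j \<in> gens m n) \<Longrightarrow> prod_list (map f js) \<in> Mon m n"
  by (induction js) (auto intro: Mon.intros)

lemma Mon_t: "i \<in> {1..m} \<Longrightarrow> j \<in> {1..m} \<Longrightarrow> t i j \<in> Mon m n"
  unfolding V.tr_def by (rule Mon_word) (auto simp: transp_word_def intro!: gens_I)

lemma Mon_tb: "i \<in> {1..n} \<Longrightarrow> j \<in> {1..n} \<Longrightarrow> tb i j \<in> Mon m n"
  unfolding W.tr_def by (rule Mon_word) (auto simp: transp_word_def intro!: gens_I)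

lemma Mon_e2:
  assumes "i \<in> {1..m}" "j \<in> {1..n}" "m \<le> R" "n \<le> T"
  shows "e2 i j \<in> Mon m n"
proof -
  have "e \<in> Mon m n" "t 1 i \<in> Mon m n" "tb 1 j \<in> Mon m n"
    using assms by (auto intro!: Mon_t Mon_tb Mon_gen[OF gens_I(5)])
  then show ?thesis unfolding e2_def by (simp add: Mon_mult assms)
qed

definition cp :: "bool \<Rightarrow> nat \<Rightarrow> 'b" where "cp a i = (if a then c i else 1)"

lemma Mon_cp: "i \<in> {1..m} \<Longrightarrow> cp a i \<in> Mon m n"
  by (auto simp: cp_def intro!: Mon_gen[OF gens_I(3)] Mon.one)

text \<open>Equality up to sign, which is the precision at which a Clifford generator can be moved
  past a monomial.\<close>

definition pm :: "'b \<Rightarrow> 'b \<Rightarrow> bool" where "pm x y \<longleftrightarrow> x = y \<or> x = N * y"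

lemma pm_refl: "pm x x" by (simp add: pm_def)

lemma pm_trans: "pm x y \<Longrightarrow> pm y w \<Longrightarrow> pm x w"
  by (auto simp: pm_def N_N')

lemma pm_sym: "pm x y \<Longrightarrow> pm y x"
  by (auto simp: pm_def N_N')

lemma pm_left: "pm x y \<Longrightarrow> pm (x * w) (y * w)"
  by (auto simp: pm_def mult.assoc)

lemma pm_right: "pm x y \<Longrightarrow> w * N = N * w \<Longrightarrow> pm (w * x) (w * y)"
  unfolding pm_def by (metis mult.assoc)

lemma pm_right': "pm x y \<Longrightarrow> w \<in> Mon R T \<Longrightarrow> pm (w * x) (w * y)"
  by (auto intro: pm_right Mon_N_z)

lemma c_Mon:
  assumes "u \<in> Mon m n" "m < i" "i \<le> R" "n \<le> T"
  shows "pm (c i * u) (u * c i)"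
  using assms(1)
proof induction
  case one show ?case by (simp add: pm_refl)
next
  case zero then show ?case using assms by (simp add: z_c pm_refl)
next
  case (neg x)
  have "c i * N = N * c i" using assms by (intro N_c) auto
  then have "c i * (N * x) = N * (c i * x)" by (metis mult.assoc)
  then show ?case using neg by (auto simp: pm_def mult.assoc N_N')
next
  case (gen g x)
  have g: "pm (c i * g) (g * c i)"
    using gen(1)
  proof (cases rule: gens_cases)
    case (s l)
    then have "s l * c i * s l = c i" "s l * s l = 1"
      using s_c_s[of l i] V.s_square[of l] assms by (auto simp: Transposition.transpose_def)
    then have "s l * c i = c i * s l" by (metis mult.assoc mult.right_neutral)
    then show ?thesis using s by (simp add: pm_refl)
  next
    case (sb l)
    then show ?thesis using sb_c[of l i] assms by (simp add: pm_refl)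
  next
    case (c l)
    then show ?thesis using c_anticomm[of i l] assms by (simp add: pm_def)
  next
    case (cb l)
    then show ?thesis using c_cb[of i l] assms by (simp add: pm_def)
  next
    case e
    then show ?thesis using c_e[of i] assms by (simp add: pm_refl)
  qed
  have gN: "g * N = N * g" using gen_N_z(1)[OF gen(1)] assms by auto
  show ?case
    using pm_trans[OF pm_left[OF g, of x, unfolded mult.assoc] pm_right[OF gen(3) gN]]
    by (simp add: mult.assoc)
qed

lemma cp_Mon: "u \<in> Mon m n \<Longrightarrow> m < i \<Longrightarrow> i \<le> R \<Longrightarrow> n \<le> T \<Longrightarrow> pm (cp a i * u) (u * cp a i)"
  using c_Mon by (auto simp: cp_def pm_refl)

lemma s_Mon:
  assumes "u \<in> Mon m n" "m < i" "i < R" "n \<le> T"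
  shows "s i * u = u * s i"
  using assms(1)
proof induction
  case zero then show ?case using assms z_s[of i] by simp
next
  case (neg x)
  have "s i * N = N * s i" using assms by (intro N_s) auto
  then show ?case using neg by (simp add: mult.assoc mult_eq_left[of "s i" N "N * s i"])
next
  case (gen g x)
  have "s i * g = g * s i"
    using gen(1)
  proof (cases rule: gens_cases)
    case (s l)
    then show ?thesis using V.s_comm2[of i l] assms by auto
  next
    case (sb l)
    then show ?thesis using s_sb[of i l] assms by auto
  next
    case (c l)
    then have "s i * c l * s i = c l" "s i * s i = 1"
      using s_c_s[of i l] V.s_square[of i] assms by (auto simp: Transposition.transpose_def)
    then show ?thesis using c by (metis mult.assoc mult.right_neutral)
  next
    case (cb l)
    then show ?thesis using s_cb[of i l] assms by auto
  next
    case e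
    then show ?thesis using s_e[of i] assms by auto
  qed
  then show ?case using gen by (simp add: mult.assoc mult_eq_left[of "s i" g "g * s i"])
qed simp

text \<open>Normal forms of monomials: the strand \<open>m\<close> runs through in \<open>DI\<close>, and it is joined to the strand \<open>j\<close> on
  the other side of the wall in \<open>DII\<close>.\<close>

definition DI :: "nat \<Rightarrow> nat \<Rightarrow> 'b set" where
  "DI m n = {u * (t i m * cp a i) | u i a. u \<in> Mon (m - 1) n \<and> i \<in> {1..m}}"

definition DII :: "nat \<Rightarrow> nat \<Rightarrow> 'b set" where
  "DII m n = {cp a m * (e2 m j * u) | u j a. u \<in> Mon (m - 1) n \<and> j \<in> {1..n}}"

definition D :: "nat \<Rightarrow> nat \<Rightarrow> 'b set" where "D m n = {z} \<union> DI m n \<union> DII m n"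

lemma DI_I: "u \<in> Mon (m - 1) n \<Longrightarrow> i \<in> {1..m} \<Longrightarrow> u * (t i m * cp a i) \<in> DI m n"
  unfolding DI_def by blast

lemma DII_I: "u \<in> Mon (m - 1) n \<Longrightarrow> j \<in> {1..n} \<Longrightarrow> cp a m * (e2 m j * u) \<in> DII m n"
  unfolding DII_def by blast

lemma cp_e2: "i \<in> {1..R} \<Longrightarrow> i' \<in> {1..R} \<Longrightarrow> i \<noteq> i' \<Longrightarrow> j \<in> {1..T} \<Longrightarrow> cp a i' * (e2 i j * x) = e2 i j * (cp a i' * x)"
  using c_e2[of i i' j] by (simp add: cp_def mult_eq_left[of "c i'" "e2 i j" "e2 i j * c i'"] mult.assoc)

definition cbp :: "bool \<Rightarrow> nat \<Rightarrow> 'b" where "cbp a j = (if a then cb j else 1)"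

text \<open>A decoration slides along the strand that joins i and j. For i = m this makes it a
  factor from the generators of \<open>Mon (m - 1) n\<close>, which contain cb_j but not
  c_m.\<close>

lemma e2_cp: "i \<in> {1..R} \<Longrightarrow> j \<in> {1..T} \<Longrightarrow> e2 i j * (cp a i * x) = e2 i j * (cbp a j * x)"
  using e2_single(2)[of i j] by (simp add: cp_def cbp_def flip: mult.assoc)

lemma cbp_e2: "j \<in> {1..T} \<Longrightarrow> j' \<in> {1..T} \<Longrightarrow> j \<noteq> j' \<Longrightarrow> i \<in> {1..R} \<Longrightarrow>
    cbp a j' * (e2 i j * x) = e2 i j * (cbp a j' * x)"
  using cb_e2[of j j' i] by (simp add: cbp_def mult_eq_left[of "cb j'" "e2 i j" "e2 i j * cb j'"] mult.assoc)

lemma Mon_cbp: "j \<in> {1..n'} \<Longrightarrow> cbp a j \<in> Mon m' n'"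
  by (auto simp: cbp_def intro!: Mon_gen[OF gens_I(4)] Mon.one)

section \<open>The normal forms are closed under left multiplication by generators\<close>

context
  fixes m n :: nat
  assumes mn: "1 \<le> m" "m \<le> R" "n \<le> T"
begin

lemma mR: "m - 1 \<le> R" using mn by simp

lemma cp_N: "i \<in> {1..R} \<Longrightarrow> cp a i * N = N * cp a i"
  by (simp add: cp_def N_c)

lemma DI_left:
  assumes v: "v \<in> Mon (m - 1) n" and x: "x \<in> DI m n" shows "v * x \<in> DI m n"
proof -
  from x obtain u i a where u: "u \<in> Mon (m - 1) n" "i \<in> {1..m}" "x = u * (t i m * cp a i)"
    unfolding DI_def by blast
  have "v * x = (v * u) * (t i m * cp a i)" using u by (simp add: mult.assoc)
  then show ?thesis using DI_I[OF Mon_mult[OF v u(1) mR mn(3)] u(2)] by simp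
qed

lemma DI_neg: "x \<in> DI m n \<Longrightarrow> N * x \<in> DI m n"
  using DI_left[of N] Mon.neg[OF Mon.one] by simp

lemma DI_pm: "pm x y \<Longrightarrow> y \<in> DI m n \<Longrightarrow> x \<in> DI m n"
  by (auto simp: pm_def DI_neg)

lemma DII_neg: assumes "x \<in> DII m n" shows "N * x \<in> DII m n"
proof -
  from assms obtain u j a where u: "u \<in> Mon (m - 1) n" "j \<in> {1..n}" "x = cp a m * (e2 m j * u)"
    unfolding DII_def by blast
  have "cp a m * N = N * cp a m" using mn by (intro cp_N) auto
  moreover have "e2 m j * N = N * e2 m j" using mn u by (intro e2_single) auto
  ultimately have "N * x = cp a m * (e2 m j * (N * u))" using u by (metis mult.assoc)
  then show ?thesis using DII_I[OF Mon.neg[OF u(1)] u(2)] by simp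
qed

lemma DII_pm: "pm x y \<Longrightarrow> y \<in> DII m n \<Longrightarrow> x \<in> DII m n"
  by (auto simp: pm_def DII_neg)

lemma D_neg: "x \<in> D m n \<Longrightarrow> N * x \<in> D m n"
  unfolding D_def using DI_neg DII_neg z_N by auto

text \<open>The transposition is absorbed into the index i, or moved to the left where it no longer
  involves m and joins u, or both.\<close>

lemma DI_t:
  assumes x: "x \<in> DI m n" and ab: "a \<in> {1..m}" "b \<in> {1..m}"
  shows "x * t a b \<in> DI m n"
proof -
  from x obtain u i p where u: "u \<in> Mon (m - 1) n" "i \<in> {1..m}" "x = u * (t i m * cp p i)"
    unfolding DI_def by blast
  have R: "a \<in> {1..R}" "b \<in> {1..R}" "i \<in> {1..R}" "m \<in> {1..R}" using ab u mn by auto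
  have cpt: "cp p i * t a b = t a b * cp p (Transposition.transpose a b i)"
    if "a \<in> {1..R}" "b \<in> {1..R}" for a b
    using t_c[of a b "Transposition.transpose a b i"] that R transpose_in[OF that R(3)]
    by (simp add: cp_def)
  have *: "x * t a b \<in> DI m n" if "b = m" "a < m" "a \<in> {1..m}" for a b
  proof -
    have a: "a \<in> {1..R}" using that mn by auto
    consider "i = m" | "i = a" "i \<noteq> m" | "i \<noteq> a" "i \<noteq> m" by blast
    then show ?thesis
    proof cases
      case 1
      then have "x * t a b = u * (t a m * cp p a)"
        using u cpt[OF a R(4)] that
        by (simp add: V.tr_same mult.assoc)
      then show ?thesis using DI_I u that by simp
    next
      case 2
      then have "x * t a b = u * (t m m * cp p m)"
        using u cpt[OF a R(4)] that V.tr_square'[OF R(3,4)]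
        by (simp add: V.tr_same mult.assoc)
      then show ?thesis using DI_I[OF u(1), of m] mn by simp
    next
      case 3
      have "t i m * t a m = t a i * t i m"
        using V.tr_tr[of i m a m] R a 3 that by (simp add: Transposition.transpose_def)
      then have "x * t a b = (u * t a i) * (t i m * cp p i)"
        using u cpt[OF a R(4)] that 3
        by (simp add: mult.assoc Transposition.transpose_def mult_eq_left[of "t i m" "t a m" "t a i * t i m"])
      moreover have "t a i \<in> Mon (m - 1) n" using that 3 u by (intro Mon_t) auto
      ultimately show ?thesis using DI_I[OF Mon_mult[OF u(1) _ mR mn(3)] u(2)] by simp
    qed
  qed
  show ?thesis
  proof (cases "a = m \<or> b = m")
    case True
    then consider "a = b" | "b = m" "a < m" | "a = m" "b < m" using ab by force
    then show ?thesis
    proof cases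
      case 3
      then have "x * t b a \<in> DI m n" using * ab by blast
      then show ?thesis using V.tr_commute[of a b] by simp
    qed (use * ab x in \<open>auto simp: V.tr_same\<close>)
  next
    case False
    have "t i m * t a b = t a b * t (Transposition.transpose a b i) m"
      using V.tr_tr[of a b "Transposition.transpose a b i" m] R False transpose_in[OF R(1-3)]
      by (simp add: Transposition.transpose_def)
    then have "x * t a b = (u * t a b) * (t (Transposition.transpose a b i) m * cp p (Transposition.transpose a b i))"
      using u cpt[OF R(1,2)]
      by (simp add: mult.assoc mult_eq_left[of "t i m" "t a b" "t a b * t (Transposition.transpose a b i) m"])
    moreover have "t a b \<in> Mon (m - 1) n" using ab False by (intro Mon_t) auto
    ultimately show ?thesis
      using DI_I[OF Mon_mult[OF u(1) _ mR mn(3)] transpose_in[OF ab u(2)]] by simp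
  qed
qed

lemma pm_q: "pm q 1" "pm qb 1"
  using qs by (auto simp: pm_def)

lemma DI_c:
  assumes x: "x \<in> DI m n" and b: "b \<in> {1..m}"
  shows "x * c b \<in> DI m n"
proof -
  from x obtain u i p where u: "u \<in> Mon (m - 1) n" "i \<in> {1..m}" "x = u * (t i m * cp p i)"
    unfolding DI_def by blast
  have uM: "u \<in> Mon R T" using Mon_mono[OF _ _ u(1)] mn by auto
  have R: "b \<in> {1..R}" "i \<in> {1..R}" "m \<in> {1..R}" using b u mn by auto
  have tM: "t i m \<in> Mon R T" using R by (intro Mon_t)
  show ?thesis
  proof (cases "b = i")
    case True
    have "pm (cp p i * c b) (cp (\<not> p) i)"
      using pm_q c_square R True by (auto simp: cp_def pm_refl)
    then have "pm (x * c b) (u * (t i m * cp (\<not> p) i))"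
      using u by (auto simp: mult.assoc intro!: pm_right' uM tM)
    then show ?thesis using DI_pm DI_I u by blast
  next
    case False
    let ?b = "Transposition.transpose i m b"
    have b': "?b \<in> {1..m - 1}" using False b u by (auto simp: Transposition.transpose_def)
    have "pm (cp p i * c b) (c b * cp p i)"
      using c_anticomm[of i b] R False by (auto simp: cp_def pm_def)
    then have "pm (x * c b) (u * (t i m * (c b * cp p i)))"
      using u by (auto simp: mult.assoc intro!: pm_right' uM tM)
    also have "u * (t i m * (c b * cp p i)) = u * c ?b * (t i m * cp p i)"
      using t_c[OF R(2,3,1)] by (simp add: mult.assoc mult_eq_left[of "t i m" "c b" "c ?b * t i m"])
    finally show ?thesis
      using DI_pm DI_I[OF Mon_mult[OF u(1) _ mR mn(3)] u(2), of "c ?b"] Mon_cp[OF b', of True n]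
      by (auto simp: cp_def)
  qed
qed

lemma DI_cp: "x \<in> DI m n \<Longrightarrow> b \<in> {1..m} \<Longrightarrow> x * cp a b \<in> DI m n"
  using DI_c by (auto simp: cp_def)

lemma DI_Mon: "u \<in> Mon (m - 1) n \<Longrightarrow> u \<in> DI m n"
  using DI_I[of u m n m False] mn by (simp add: V.tr_same cp_def)

lemma Mon_R: "u \<in> Mon (m - 1) n \<Longrightarrow> u \<in> Mon R T"
  using Mon_mono[of "m - 1" R n T u] mn by auto

lemma cp_R: "i \<in> {1..R} \<Longrightarrow> cp a i \<in> Mon R T"
  by (rule Mon_cp)

lemma cp_cp: "i \<in> {1..R} \<Longrightarrow> pm (cp a i * cp b i) (cp (a \<noteq> b) i)"
  using c_square[of i] pm_q by (auto simp: cp_def pm_refl)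

lemma cp_cp': "i \<in> {1..R} \<Longrightarrow> pm (cp a i * (cp b i * x)) (cp (a \<noteq> b) i * x)"
  using pm_left[OF cp_cp, of i a b x] by (simp add: mult.assoc)

lemma cp_swap: "i \<in> {1..R} \<Longrightarrow> j \<in> {1..R} \<Longrightarrow> i \<noteq> j \<Longrightarrow> pm (cp a i * (cp b j * x)) (cp b j * (cp a i * x))"
  using c_anticomm[of i j]
  by (auto simp: cp_def pm_def mult.assoc simp flip: mult.assoc[of "c i" "c j"])

lemma DII_cp:
  assumes "x \<in> DII m n" shows "cp a m * x \<in> DII m n"
proof -
  from assms obtain u j b where u: "u \<in> Mon (m - 1) n" "j \<in> {1..n}" "x = cp b m * (e2 m j * u)"
    unfolding DII_def by blast
  have "pm (cp a m * x) (cp (a \<noteq> b) m * (e2 m j * u))"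
    unfolding u(3) using mn by (intro cp_cp') auto
  then show ?thesis using DII_pm DII_I[OF u(1,2)] by blast
qed

lemma DI_cp_left:
  assumes "x \<in> DI m n" shows "cp a m * x \<in> DI m n"
proof (cases a)
  case True
  from assms obtain u i b where u: "u \<in> Mon (m - 1) n" "i \<in> {1..m}" "x = u * (t i m * cp b i)"
    unfolding DI_def by blast
  have R: "i \<in> {1..R}" "m \<in> {1..R}" using u mn by auto
  have "pm (c m * u) (u * c m)" using c_Mon[OF u(1)] mn by simp
  then have "pm (c m * x) (u * (c m * (t i m * cp b i)))"
    using pm_left[of "c m * u" "u * c m" "t i m * cp b i"] by (simp add: u(3) mult.assoc)
  also have "c m * (t i m * cp b i) = t i m * (c i * cp b i)"
    using t_c[of i m i] R by (simp flip: mult.assoc)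
  also have "c i * cp b i = cp b i * c i" by (simp add: cp_def)
  finally have "pm (c m * x) (x * c i)" by (simp add: u mult.assoc)
  then show ?thesis using True DI_pm[OF _ DI_c[OF assms u(2)]] by (simp add: cp_def)
qed (use assms in \<open>simp add: cp_def\<close>)

lemma D_cp_left: "x \<in> D m n \<Longrightarrow> cp a m * x \<in> D m n"
  using DI_cp_left DII_cp Mon_N_z(2)[OF cp_R] mn by (auto simp: D_def)

context
  assumes m2: "2 \<le> m" and IH: "\<And>u. u \<in> Mon (m - 1) n \<Longrightarrow> u \<in> D (m - 1) n"
begin

lemma s_t: "s (m - 1) = t (m - 1) m" "t m (m - 1) = t (m - 1) m"
  using m2 V.tr_Suc[of "m - 1"] V.tr_commute[of m] by auto

lemma t_rewrite: "i \<in> {1..m - 1} \<Longrightarrow> t i m = t i (m - 1) * (s (m - 1) * t i (m - 1))"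
  "i \<in> {1..m - 1} \<Longrightarrow> s (m - 1) * t i (m - 1) = t i (m - 1) * t i m"
proof -
  assume i: "i \<in> {1..m - 1}"
  then have R: "i \<in> {1..R}" "m - 1 \<in> {1..R}" "m \<in> {1..R}" using mn m2 by auto
  show 1: "s (m - 1) * t i (m - 1) = t i (m - 1) * t i m"
    using V.tr_tr[of i "m - 1" i m] R i by (auto simp: s_t Transposition.transpose_def)
  show "t i m = t i (m - 1) * (s (m - 1) * t i (m - 1))"
    unfolding 1 using V.tr_square'[OF R(1,2)] by simp
qed

text \<open>By the induction hypothesis strand m - 1 can be peeled off u. In the third outcome v
  avoids this strand too and e_{m-1,l} is kept visible; both are needed when a second s_{m-1}, or
  some e_{m-1,j}, meets the result.\<close>

lemma s_step:
  assumes u: "u \<in> Mon (m - 1) n"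
  shows "s (m - 1) * u = z \<or> s (m - 1) * u \<in> DI m n \<or>
    (\<exists>l\<in>{1..n}. \<exists>a. \<exists>v\<in>Mon (m - 2) n. s (m - 1) * u = cp a m * (e2 m l * (e2 (m - 1) l * v)))"
proof -
  have m12: "m - 1 - 1 = m - 2" by simp
  have R: "m - 1 \<in> {1..R}" "m \<in> {1..R}" "m - 1 \<noteq> m" using mn m2 by auto
  from IH[OF u] consider "u = z" | "u \<in> DI (m - 1) n" | "u \<in> DII (m - 1) n" unfolding D_def by blast
  then show ?thesis
  proof cases
    case 1
    then show ?thesis using z_s[of "m - 1"] m2 mn by simp
  next
    case 2
    then obtain v i a where v: "v \<in> Mon (m - 2) n" "i \<in> {1..m - 1}" "u = v * (t i (m - 1) * cp a i)"
      unfolding DI_def m12 by blast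
    have "s (m - 1) * v = v * s (m - 1)" using v m2 mn by (intro s_Mon) auto
    then have "s (m - 1) * u = v * (s (m - 1) * t i (m - 1)) * cp a i"
      unfolding v(3) by (metis mult.assoc)
    also have "\<dots> = (v * t i (m - 1)) * (t i m * cp a i)"
      unfolding t_rewrite(2)[OF v(2)] by (simp add: mult.assoc)
    finally have "s (m - 1) * u \<in> DI m n"
      using DI_I[OF Mon_mult[OF Mon_mono[OF _ _ v(1)] Mon_t mR mn(3)], of i "m - 1" i a] v(2) by auto
    then show ?thesis by blast
  next
    case 3
    then obtain v l a where v: "v \<in> Mon (m - 2) n" "l \<in> {1..n}" "u = cp a (m - 1) * (e2 (m - 1) l * v)"
      unfolding DII_def m12 by blast
    have l: "l \<in> {1..T}" using v mn by auto
    have "s (m - 1) * cp a (m - 1) = cp a m * s (m - 1)"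
      using t_c[OF R(1,2,1)] by (simp add: cp_def s_t)
    then have "s (m - 1) * u = cp a m * (s (m - 1) * e2 (m - 1) l) * v"
      unfolding v(3) by (metis mult.assoc)
    also have "\<dots> = cp a m * (e2 m l * (e2 (m - 1) l * v))"
      using mult_eq_left[OF e2_e2_bar(2)[OF R l], of v] by (simp add: s_t mult.assoc)
    finally show ?thesis using v by blast
  qed
qed

text \<open>The critical generator, as it mixes strand m with the strands of u. A factor (i m) of
  type \<open>DI\<close> contains s_{m-1} once more, and a factor e_{m,j} of type \<open>DII\<close>
  becomes e_{m-1,j}; in either case \<open>s_step\<close> is applied to a monomial without strand
  m.\<close>

lemma D_s_left:
  assumes x: "x \<in> D m n" shows "s (m - 1) * x \<in> D m n"
proof -
  have R: "m - 1 \<in> {1..R}" "m \<in> {1..R}" "m - 1 \<noteq> m" "m \<noteq> m - 1" using mn m2 by auto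
  from x consider "x = z" | "x \<in> DI m n" | "x \<in> DII m n" unfolding D_def by blast
  then show ?thesis
  proof cases
    case 1
    then show ?thesis using z_s[of "m - 1"] m2 mn by (simp add: D_def)
  next
    case 2
    then obtain u i a where u: "u \<in> Mon (m - 1) n" "i \<in> {1..m}" "x = u * (t i m * cp a i)"
      unfolding DI_def by blast
    show ?thesis
    proof (cases "i = m")
      case True
      then have x: "s (m - 1) * x = (s (m - 1) * u) * cp a m" using u by (simp add: V.tr_same mult.assoc)
      from s_step[OF u(1)] show ?thesis
      proof (elim disjE bexE exE)
        assume "s (m - 1) * u = z"
        then show ?thesis using x Mon_N_z(3)[OF cp_R] R by (simp add: D_def)
      next
        assume "s (m - 1) * u \<in> DI m n"
        then show ?thesis using x DI_cp mn by (simp add: D_def)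
      next
        fix l p v assume v: "l \<in> {1..n}" "v \<in> Mon (m - 2) n"
          "s (m - 1) * u = cp p m * (e2 m l * (e2 (m - 1) l * v))"
        have lT: "l \<in> {1..T}" using v mn by auto
        define w where "w = e2 (m - 1) l * v"
        have w: "w \<in> Mon (m - 1) n"
          unfolding w_def using v mn m2
          by (intro Mon_mult Mon_e2 Mon_mono[OF _ _ v(2)]) auto
        have "pm (w * cp a m) (cp a m * w)"
          using pm_sym[OF cp_Mon[OF w]] mn m2 by simp
        then have "pm (s (m - 1) * x) (cp p m * (e2 m l * (cp a m * w)))"
          unfolding x v(3) mult.assoc w_def[symmetric] using R lT
          by (intro pm_right' Mon_e2 cp_R) auto
        also have "cp p m * (e2 m l * (cp a m * w)) = cp p m * (e2 m l * (cbp a l * w))"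
          using e2_cp R lT by simp
        finally show ?thesis
          using DII_pm DII_I[OF Mon_mult[OF Mon_cbp w mR mn(3)] v(1)] v(1) by (auto simp: D_def)
      qed
    next
      case False
      then have i: "i \<in> {1..m - 1}" using u by auto
      \<comment> \<open>Splits (i m) as (i m-1) s_{m-1} (i m-1) and groups one half with u, so that
        both copies of s_{m-1} stand in front of a monomial without strand m.\<close>
      define u' where "u' = u * t i (m - 1)"
      define r where "r = t i (m - 1) * cp a i"
      have u': "u' \<in> Mon (m - 1) n" unfolding u'_def
        using i m2 mn u by (intro Mon_mult Mon_t) auto
      have r: "r \<in> Mon (m - 1) n" unfolding r_def
        using i m2 mn u by (intro Mon_mult Mon_t Mon_cp) auto
      have x: "s (m - 1) * x = (s (m - 1) * u') * (s (m - 1) * r)"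
        unfolding u(3) t_rewrite(1)[OF i] u'_def r_def by (simp add: mult.assoc)
      from s_step[OF u'] show ?thesis
      proof (elim disjE bexE exE)
        assume h: "s (m - 1) * u' = z"
        have "s (m - 1) * r \<in> Mon R T" using Mon_R[OF r] mn m2 by (intro Mon.gen gens_I) auto
        then show ?thesis using x h Mon_N_z(3) by (simp add: D_def)
      next
        assume "s (m - 1) * u' \<in> DI m n"
        then have "(s (m - 1) * u') * t (m - 1) m * t i (m - 1) * cp a i \<in> DI m n"
          using mn m2 i by (intro DI_cp DI_t) auto
        then show ?thesis using x by (simp add: D_def s_t r_def mult.assoc)
      next
        fix l p v assume v: "l \<in> {1..n}" "v \<in> Mon (m - 2) n"
          "s (m - 1) * u' = cp p m * (e2 m l * (e2 (m - 1) l * v))"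
        have lT: "l \<in> {1..T}" using v mn by auto
        have sv: "v * s (m - 1) = s (m - 1) * v"
          using v m2 mn by (intro s_Mon[symmetric]) auto
        \<comment> \<open>Since e_{m,l} e_{m-1,l} = e_{m,l} s_{m-1}, the remaining copy of s_{m-1},
          moved past v, is cancelled.\<close>
        have "s (m - 1) * x = cp p m * ((e2 m l * e2 (m - 1) l) * ((v * s (m - 1)) * r))"
          unfolding x v(3) by (simp add: mult.assoc)
        also have "\<dots> = cp p m * (e2 m l * (t (m - 1) m * (t (m - 1) m * (v * r))))"
          unfolding sv e2_e2_bar(1)[OF R(2,1,4) lT] by (simp add: s_t mult.assoc)
        also have "\<dots> = cp p m * (e2 m l * (v * r))" using V.tr_square'[OF R(1,2)] by simp
        finally show ?thesis
          using DII_I[OF Mon_mult[OF Mon_mono[OF _ _ v(2)] r mR mn(3)] v(1)] by (auto simp: D_def)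
      qed
    qed
  next
    case 3
    then obtain u j a where u: "u \<in> Mon (m - 1) n" "j \<in> {1..n}" "x = cp a m * (e2 m j * u)"
      unfolding DII_def by blast
    have jT: "j \<in> {1..T}" using u mn by auto
    have 1: "s (m - 1) * cp a m = cp a (m - 1) * s (m - 1)"
      using t_c[OF R(1,2,2)] by (simp add: cp_def s_t)
    have 2: "s (m - 1) * e2 m j = e2 (m - 1) j * s (m - 1)"
      using t_e2[OF R(1,2,2) jT] by (simp add: s_t)
    have x: "s (m - 1) * x = cp a (m - 1) * (e2 (m - 1) j * (s (m - 1) * u))"
      unfolding u(3) by (simp add: mult.assoc mult_eq_left[OF 1] mult_eq_left[OF 2])
    have ce: "cp a (m - 1) \<in> Mon (m - 1) n" "e2 (m - 1) j \<in> Mon (m - 1) n"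
      using m2 u mn by (auto intro!: Mon_cp Mon_e2)
    from s_step[OF u(1)] show ?thesis
    proof (elim disjE bexE exE)
      assume "s (m - 1) * u = z"
      then show ?thesis using x Mon_N_z(2)[OF Mon_R[OF ce(1)]] Mon_N_z(2)[OF Mon_R[OF ce(2)]]
        by (simp add: D_def)
    next
      assume "s (m - 1) * u \<in> DI m n"
      then show ?thesis unfolding x D_def using DI_left ce by blast
    next
      fix l p v assume v: "l \<in> {1..n}" "v \<in> Mon (m - 2) n"
        "s (m - 1) * u = cp p m * (e2 m l * (e2 (m - 1) l * v))"
      have lT: "l \<in> {1..T}" using v mn by auto
      define w where "w = e2 (m - 1) l * v"
      have w: "w \<in> Mon (m - 1) n"
        unfolding w_def using v mn m2
        by (intro Mon_mult Mon_e2 Mon_mono[OF _ _ v(2)]) auto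
      have "s (m - 1) * x = cp a (m - 1) * (cp p m * (e2 (m - 1) j * (e2 m l * w)))"
        unfolding x v(3) w_def[symmetric] using cp_e2[OF R(1,2,3) jT] by simp
      then have pm: "pm (s (m - 1) * x) (cp p m * (cp a (m - 1) * (e2 (m - 1) j * (e2 m l * w))))"
        using cp_swap[OF R(1,2,3)] by simp
      show ?thesis
      proof (cases "j = l")
        case True
        \<comment> \<open>A zigzag: e_{m-1,l} e_{m,l} e_{m-1,l} = e_{m-1,l}. Strand m is
          straightened, and the result has type \<open>DI\<close>.\<close>
        then have "e2 (m - 1) j * (e2 m l * w) = w"
          using mult_eq_left[OF e2_e2_e2[OF R(1-3) lT], of v] by (simp add: w_def mult.assoc)
        then show ?thesis using pm DI_pm[OF _ DI_cp_left[OF DI_Mon]] Mon_mult[OF ce(1) w mR mn(3)]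
          by (simp add: D_def)
      next
        case False
        have "e2 (m - 1) j * (e2 m l * w) = e2 m l * (e2 (m - 1) j * w)"
          using e2_commute[OF R(1-3) jT lT False] by (simp flip: mult.assoc)
        then have "cp a (m - 1) * (e2 (m - 1) j * (e2 m l * w)) = e2 m l * (cp a (m - 1) * (e2 (m - 1) j * w))"
          using cp_e2[OF R(2,1,4) lT] by simp
        then show ?thesis using pm DII_pm[OF _ DII_I]
            Mon_mult[OF ce(1) Mon_mult[OF ce(2) w mR mn(3)] mR mn(3)] v(1)
          by (simp add: D_def del: atLeastAtMost_iff)
      qed
    qed
  qed
qed

text \<open>This product arises when e meets type \<open>DII\<close> with j = 1, since e_{1,1}
  e_{m,1} = e (1 m).\<close>

lemma D_e_left_aux:
  assumes u: "u \<in> Mon (m - 1) n" and n: "1 \<le> n"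
  shows "e * (t 1 m * u) \<in> D m n"
proof -
  have R: "m - 1 \<in> {1..R}" "m \<in> {1..R}" "m - 1 \<noteq> m" "1 \<in> {1..R}" "1 \<noteq> m" "1 \<in> {1..T}"
    using mn m2 n by auto
  define h where "h = e * t 1 (m - 1)"
  have h': "h = e2 1 1 * t 1 (m - 1)" by (simp add: h_def e2_1_1)
  define u1 where "u1 = t 1 (m - 1) * u"
  have h: "h \<in> Mon (m - 1) n"
    unfolding h_def using m2 n mn by (intro Mon_mult Mon_t Mon_gen[OF gens_I(5)]) auto
  have u1: "u1 \<in> Mon (m - 1) n"
    unfolding u1_def using m2 n mn u by (intro Mon_mult Mon_t) auto
  have x: "e * (t 1 m * u) = h * (s (m - 1) * u1)"
    using t_rewrite(1)[of 1] m2 by (simp add: h_def u1_def mult.assoc)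
  from s_step[OF u1] show ?thesis
  proof (elim disjE bexE exE)
    assume "s (m - 1) * u1 = z"
    then show ?thesis using x Mon_N_z(2)[OF Mon_R[OF h]] by (simp add: D_def)
  next
    assume "s (m - 1) * u1 \<in> DI m n"
    then show ?thesis unfolding x D_def using DI_left h by blast
  next
    fix l p v assume v: "l \<in> {1..n}" "v \<in> Mon (m - 2) n"
        "s (m - 1) * u1 = cp p m * (e2 m l * (e2 (m - 1) l * v))"
    have lT: "l \<in> {1..T}" using v mn by auto
    define w where "w = e2 (m - 1) l * v"
    have w: "w \<in> Mon (m - 1) n"
      unfolding w_def using v mn m2
      by (intro Mon_mult Mon_e2 Mon_mono[OF _ _ v(2)]) auto
    have "pm (h * cp p m) (cp p m * h)" using pm_sym[OF cp_Mon[OF h]] mn m2 by simp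
    from pm_left[OF this, of "e2 m l * w"]
    have pm: "pm (e * (t 1 m * u)) (cp p m * (h * (e2 m l * w)))"
      unfolding x v(3) w_def[symmetric] by (simp add: mult.assoc)
    have te: "t 1 (m - 1) * e2 m l = e2 m l * t 1 (m - 1)"
      using t_e2[OF R(4,1,2) lT] R by (simp add: Transposition.transpose_def)
    show ?thesis
    proof (cases "l = 1")
      case True
      have "t 1 (m - 1) * e2 (m - 1) 1 = e2 1 1 * t 1 (m - 1)"
        using t_e2[OF R(4,1,1,6)] by simp
      then have "h * (e2 m l * w) = e2 1 1 * (e2 m 1 * e2 1 1) * (t 1 (m - 1) * v)"
        unfolding h' w_def True
        by (simp add: mult.assoc te[unfolded True] mult_eq_left[OF te[unfolded True]]
            mult_eq_left[of "t 1 (m - 1)" "e2 (m - 1) 1" "e2 1 1 * t 1 (m - 1)"])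
      also have "\<dots> = e2 1 1 * (t 1 (m - 1) * v)" by (simp only: e2_e2_e2[OF R(4,2,5,6)])
      also have "\<dots> = h * v" by (simp add: h_def e2_1_1 mult.assoc)
      finally show ?thesis
        using pm DI_pm[OF _ DI_cp_left[OF DI_Mon]] Mon_mult[OF h Mon_mono[OF _ _ v(2)] mR mn(3)]
        by (simp add: D_def)
    next
      case False
      have "e * e2 m l = e2 m l * e"
        using e2_commute[OF R(4,2,5,6) lT] False by (simp add: e2_1_1)
      then have "h * (e2 m l * w) = e2 m l * (h * w)"
        by (simp add: h_def mult.assoc mult_eq_left[OF te] mult_eq_left[of e "e2 m l" "e2 m l * e"])
      then show ?thesis using pm DII_pm[OF _ DII_I] Mon_mult[OF h w mR mn(3)] v(1)
        by (simp add: D_def del: atLeastAtMost_iff)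
    qed
  qed
qed

end

text \<open>For m = 1 the generator e involves the strand being peeled off, so it is not among the
  generators of the smaller algebra and is treated apart.\<close>

lemma D_e_left_one:
  assumes m1: "m = 1" and n: "1 \<le> n" and x: "x \<in> D m n"
  shows "e * x \<in> D m n"
proof -
  have R: "1 \<in> {1..R}" "1 \<in> {1..T}" "1 \<in> {1..n}" using mn n m1 by auto
  from x consider "x = z" | "x \<in> DI m n" | "x \<in> DII m n" unfolding D_def by blast
  then show ?thesis
  proof cases
    case 1
    then show ?thesis by (simp add: D_def z_e)
  next
    case 2
    then obtain u a where u: "u \<in> Mon (m - 1) n" "x = u * cp a 1"
      unfolding DI_def by (auto simp: m1 V.tr_same)
    have "pm (u * cp a 1) (cp a 1 * u)" using pm_sym[OF cp_Mon[OF u(1)]] mn m1 by simp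
    then have "pm (e * x) (e * (cp a 1 * u))" using u(2) by (simp add: pm_right N_e)
    also have "e * (cp a 1 * u) = cp False 1 * (e2 1 1 * (cbp a 1 * u))"
      using e2_cp[OF R(1,2)] by (simp add: e2_1_1 cp_def)
    finally show ?thesis
      using DII_pm[OF _ DII_I[OF Mon_mult[OF Mon_cbp u(1)] R(3)]] mn R m1 by (simp add: D_def)
  next
    case 3
    then obtain u j a where u: "u \<in> Mon (m - 1) n" "j \<in> {1..n}" "x = cp a 1 * (e2 1 j * u)"
      unfolding DII_def m1 by blast
    have jT: "j \<in> {1..T}" using u mn by auto
    show ?thesis
    proof (cases "j = 1")
      case True
      have "e2 1 1 * (cp a 1 * e2 1 1) = z" using e2_single[OF R(1,2)] by (simp add: cp_def)
      then have "e * x = z"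
        using u True Mon_N_z(3)[OF Mon_R[OF u(1)]]
        by (simp add: e2_1_1) (metis mult.assoc order_refl)
      then show ?thesis by (simp add: D_def)
    next
      case False
      have "e * x = e2 1 1 * (e2 1 j * (cbp a 1 * u))"
        using u e2_cp[OF R(1,2)] cbp_e2[OF jT R(2) False R(1)] by (simp add: e2_1_1)
      also have "\<dots> = cp False 1 * (e2 1 1 * (tb 1 j * (cbp a 1 * u)))"
        using e2_e2_bar'(1)[OF R(2) jT] False R(1) by (simp add: cp_def flip: mult.assoc)
      finally show ?thesis
        using DII_I[OF Mon_mult[OF Mon_tb[of 1 n j] Mon_mult[OF Mon_cbp u(1)]] R(3)] mn R m1 u(2)
        by (simp add: D_def)
    qed
  qed
qed

lemma D_left_small:
  assumes g: "g \<in> gens (m - 1) n" and x: "x \<in> D m n"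
    and IH: "\<And>u. 2 \<le> m \<Longrightarrow> u \<in> Mon (m - 1) n \<Longrightarrow> u \<in> D (m - 1) n"
  shows "g * x \<in> D m n"
proof -
  from x consider "x = z" | "x \<in> DI m n" | "x \<in> DII m n" unfolding D_def by blast
  then show ?thesis
  proof cases
    case 1
    then show ?thesis using gen_N_z(2)[OF g mR mn(3)] by (simp add: D_def)
  next
    case 2
    then show ?thesis using DI_left[OF Mon_gen[OF g]] by (simp add: D_def)
  next
    case 3
    then obtain u j a where u: "u \<in> Mon (m - 1) n" "j \<in> {1..n}" "x = cp a m * (e2 m j * u)"
      unfolding DII_def by blast
    have R: "m \<in> {1..R}" "j \<in> {1..T}" using u mn by auto
    have gu: "g * u \<in> Mon (m - 1) n" by (rule Mon.gen[OF g u(1)])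
    from g show ?thesis
    proof (cases rule: gens_cases)
      case (s i)
      have i: "i \<in> {1..R}" "Suc i \<in> {1..R}" "i \<noteq> m" "Suc i \<noteq> m" using s mn by auto
      have 1: "s i * cp a m = cp a m * s i" "s i * e2 m j = e2 m j * s i"
        using t_c[OF i(1,2) R(1)] t_e2[OF i(1,2) R] i by (auto simp: V.tr_Suc cp_def Transposition.transpose_def)
      have "g * x = cp a m * (e2 m j * (g * u))"
        unfolding u(3) s(3) by (simp add: mult.assoc mult_eq_left[OF 1(1)] mult_eq_left[OF 1(2)])
      then show ?thesis using DII_I[OF gu u(2)] by (simp add: D_def)
    next
      case (sb i)
      have i: "i \<in> {1..T}" "Suc i \<in> {1..T}" using sb mn by auto
      have 1: "sb i * cp a m = cp a m * sb i" "sb i * e2 m j = e2 m (Transposition.transpose i (Suc i) j) * sb i"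
        using tb_c[OF i(1,2) R(1)] tb_e2[OF i(1,2) R] by (auto simp: W.tr_Suc cp_def)
      have "g * x = cp a m * (e2 m (Transposition.transpose i (Suc i) j) * (g * u))"
        unfolding u(3) sb(3) by (simp add: mult.assoc mult_eq_left[OF 1(1)] mult_eq_left[OF 1(2)])
      moreover have "Transposition.transpose i (Suc i) j \<in> {1..n}"
        using sb u by (auto simp: Transposition.transpose_def)
      ultimately show ?thesis using DII_I[OF gu] by (simp add: D_def)
    next
      case (c i)
      have i: "i \<in> {1..R}" "i \<noteq> m" "m \<noteq> i" using c mn by auto
      have "pm (g * x) (cp a m * (c i * (e2 m j * u)))"
        using cp_swap[OF i(1) R(1) i(2), of True] unfolding u(3) c(3) by (simp add: cp_def)
      also have "cp a m * (c i * (e2 m j * u)) = cp a m * (e2 m j * (g * u))"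
        using cp_e2[OF R(1) i(1,3) R(2), of True u] c(3) by (simp add: cp_def)
      finally show ?thesis using DII_pm[OF _ DII_I[OF gu u(2)]] by (simp add: D_def)
    next
      case (cb i)
      have i: "i \<in> {1..T}" using cb mn by auto
      have "pm (cb i * cp a m) (cp a m * cb i)"
        using c_cb[of m i] R i by (auto simp: cp_def pm_def N_N')
      from pm_left[OF this, of "e2 m j * u"]
      have pm: "pm (g * x) (cp a m * (cb i * (e2 m j * u)))"
        unfolding u(3) cb(3) by (simp add: mult.assoc)
      show ?thesis
      proof (cases "i = j")
        case True
        then have "cb i * (e2 m j * u) = cp True m * (e2 m j * u)"
          using e2_single(3)[OF R] by (simp add: cp_def flip: mult.assoc)
        then show ?thesis using pm DII_pm[OF _ DII_cp[OF DII_I[OF u(1,2)]]] by (simp add: D_def)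
      next
        case False
        then have "cb i * (e2 m j * u) = e2 m j * (g * u)"
          using cbp_e2[OF R(2) i _ R(1), of True u] cb(3) by (simp add: cbp_def)
        then show ?thesis using pm DII_pm[OF _ DII_I[OF gu u(2)]] by (simp add: D_def)
      qed
    next
      case e
      have m2: "2 \<le> m" using e by simp
      have R1: "1 \<in> {1..R}" "1 \<in> {1..T}" "1 \<noteq> m" "m \<noteq> 1" using e m2 mn by auto
      have x: "g * x = cp a m * (e2 1 1 * (e2 m j * u))"
        using cp_e2[OF R1(1) R(1) R1(3,2)] by (simp add: u(3) e(1) e2_1_1)
      show ?thesis
      proof (cases "j = 1")
        case True
        have "e2 1 1 * (e2 m j * u) = e * (t 1 m * u)"
          using e2_e2_bar(1)[OF R1(1) R(1) R1(3,2)] True by (simp add: e2_1_1 mult_eq_left[of e "e2 m 1"] mult.assoc)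
        then show ?thesis
          unfolding x using D_cp_left[OF D_e_left_aux[OF m2 IH[OF m2] u(1) e(3)]] by simp
      next
        case False
        have "e2 1 1 * (e2 m j * u) = e2 m j * (g * u)"
          using e2_commute[OF R1(1) R(1) R1(3,2) R(2)] False e(1)
          by (simp add: e2_1_1 mult.assoc mult_eq_left[of e "e2 m j" "e2 m j * e"])
        then show ?thesis using x DII_I[OF gu u(2)] by (simp add: D_def)
      qed
    qed
  qed
qed

lemma D_left:
  assumes g: "g \<in> gens m n" and x: "x \<in> D m n"
    and IH: "\<And>u. 2 \<le> m \<Longrightarrow> u \<in> Mon (m - 1) n \<Longrightarrow> u \<in> D (m - 1) n"
  shows "g * x \<in> D m n"
proof -
  consider "g \<in> gens (m - 1) n" | "2 \<le> m" "g = s (m - 1)" | "g = c m" | "m = 1" "1 \<le> n" "g = e"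
    using g mn
  proof (cases rule: gens_cases)
    case (s i)
    then show ?thesis using that(1,2) gens_I(1)[of i "m - 1" n] by (cases "i = m - 1") auto
  next
    case (c i)
    then show ?thesis using that(1,3) gens_I(3)[of i "m - 1" n] by (cases "i = m") auto
  next
    case e
    then show ?thesis using that(1,4) gens_I(5)[of "m - 1" n] by (cases "m = 1") auto
  qed (use that(1) gens_I(2,4) in \<open>auto\<close>)
  then show ?thesis
    using D_left_small[OF _ x IH] D_s_left[OF _ IH x] D_cp_left[OF x, of True] D_e_left_one[OF _ _ x]
    by cases (auto simp: cp_def)
qed

end

theorem Mon_D: "x \<in> Mon m n \<Longrightarrow> 1 \<le> m \<Longrightarrow> m \<le> R \<Longrightarrow> n \<le> T \<Longrightarrow> x \<in> D m n"
proof (induction m arbitrary: x)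
  case (Suc m)
  from Suc.prems(1) show ?case
  proof induction
    case one
    then show ?case using DI_Mon[OF Suc.prems(2-4) Mon.one] by (simp add: D_def)
  next
    case (gen g x)
    show ?case
      by (rule D_left[OF Suc.prems(2-4) gen(1,3)]) (use Suc.IH Suc.prems in auto)
  qed (use D_neg Suc.prems in \<open>auto simp: D_def\<close>)
qed simp

end

section \<open>Normal forms on the other side of the wall, and closing a strand\<close>

context wbc begin

lemma e2_Mon:
  assumes u: "u \<in> Mon m n" and i: "m < i" "i \<le> R" and j: "n < j" "j \<le> T"
  shows "e2 i j * u = u * e2 i j"
  using u
proof induction
  case zero
  then show ?case using e2_single(6,7)[of i j] i j by simp
next
  case (neg x)
  then show ?case using e2_single(5)[of i j] i j
    by (simp add: mult.assoc mult_eq_left[of "e2 i j" N "N * e2 i j"])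
next
  case (gen g x)
  have R: "i \<in> {1..R}" "j \<in> {1..T}" using i j by auto
  have "e2 i j * g = g * e2 i j"
    using gen(1)
  proof (cases rule: gens_cases)
    case (s l)
    then show ?thesis using t_e2[of l "Suc l" i j] R i by (simp add: V.tr_Suc Transposition.transpose_def)
  next
    case (sb l)
    then show ?thesis using tb_e2[of l "Suc l" i j] R j by (simp add: W.tr_Suc Transposition.transpose_def)
  next
    case (c l)
    then show ?thesis using c_e2[of i l j] R i by auto
  next
    case (cb l)
    then show ?thesis using cb_e2[of j l i] R j by auto
  next
    case e
    then show ?thesis using e2_commute[of 1 i 1 j] R i j RT by (auto simp: e2_1_1)
  qed
  then show ?case using gen by (simp add: mult.assoc mult_eq_left[of "e2 i j" g "g * e2 i j"])
qed simp

lemma gens_swap: "wbc.gens sb s cb c e n m = gens m n"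
proof -
  interpret sw: wbc T R sb s cb c e N z qb q by (rule swap)
  show ?thesis unfolding gens_def sw.gens_def by auto
qed

lemma Mon_swap: "wbc.Mon sb s cb c e N z n m = Mon m n"
proof -
  interpret sw: wbc T R sb s cb c e N z qb q by (rule swap)
  have "x \<in> Mon m n" if "x \<in> sw.Mon n m" for x
    using that by induction (auto intro: Mon.intros simp: gens_swap)
  moreover have "x \<in> sw.Mon n m" if "x \<in> Mon m n" for x
    using that by induction (auto intro: sw.Mon.intros simp: gens_swap)
  ultimately show ?thesis by blast
qed

lemma Mon_bar_cases [consumes 1, case_names Z I II]:
  assumes "x \<in> Mon m n" "1 \<le> n" "m \<le> R" "n \<le> T"
  obtains (Z) "x = z"
    | (I) u i a where "u \<in> Mon m (n - 1)" "i \<in> {1..n}" "x = u * (tb i n * cbp a i)"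
    | (II) u i a where "u \<in> Mon m (n - 1)" "i \<in> {1..m}" "x = cbp a n * (e2 i n * u)"
proof -
  interpret sw: wbc T R sb s cb c e N z qb q by (rule swap)
  have "x \<in> sw.D n m" by (rule sw.Mon_D) (use assms in \<open>simp_all add: Mon_swap\<close>)
  moreover have "sw.cp = cbp" by (simp add: fun_eq_iff sw.cp_def cbp_def)
  moreover have "sw.e2 n i = e2 i n" if "i \<in> {1..m}" for i using assms that by (intro e2_swap) auto
  ultimately show ?thesis using that(1) that(2,3)
    unfolding sw.D_def sw.DI_def sw.DII_def Mon_swap by auto
qed

lemma Mon_cases [consumes 1, case_names Z I II]:
  assumes "x \<in> Mon m n" "1 \<le> m" "m \<le> R" "n \<le> T"
  obtains (Z) "x = z"
    | (I) u i a where "u \<in> Mon (m - 1) n" "i \<in> {1..m}" "x = u * (t i m * cp a i)"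
    | (II) u j a where "u \<in> Mon (m - 1) n" "j \<in> {1..n}" "x = cp a m * (e2 m j * u)"
  using Mon_D[OF assms] that unfolding D_def DI_def DII_def by auto

text \<open>The conditional expectation: closing the strand \<open>k + 1\<close> on both sides of the wall.\<close>

lemma cap_bar:
  assumes u: "u \<in> Mon k (Suc k)" and K: "Suc k \<le> R" "Suc k \<le> T"
  shows "\<exists>v\<in>Mon k k. e2 (Suc k) (Suc k) * (u * e2 (Suc k) (Suc k)) = v * e2 (Suc k) (Suc k)"
proof -
  let ?e = "e2 (Suc k) (Suc k)"
  have R: "Suc k \<in> {1..R}" "Suc k \<in> {1..T}" and kR: "k \<le> R" "k \<le> T" using K by auto
  note es = e2_single[OF R]
  have comm: "?e * w = w * ?e" if "w \<in> Mon k k" for w by (rule e2_Mon[OF that]) (use K in auto)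
  have kill: "?e * (cbp a (Suc k) * ?e) = z" for a
    using es(1,3,4) by (cases a) (auto simp: cbp_def)
  show ?thesis
  proof (cases rule: Mon_bar_cases[OF u _ kR(1) K(2), consumes 0, case_names _ Z I II])
    case Z
    show ?thesis unfolding Z by (intro bexI[of _ z] Mon.zero) (simp add: es(6,7))
  next
    case (I w i a)
    have w: "w \<in> Mon k k" using I by simp
    have 0: "?e * (u * ?e) = w * (?e * (tb i (Suc k) * (cbp a i * ?e)))"
      using comm[OF w] I by (simp add: mult.assoc mult_eq_left[of ?e w "w * ?e"])
    show ?thesis
    proof (cases "i = Suc k")
      case True
      then have "?e * (u * ?e) = z"
        unfolding 0 using kill Mon_N_z(2)[OF w] kR by (simp add: W.tr_same)
      then show ?thesis using es(7) by (intro bexI[of _ z] Mon.zero) simp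
    next
      case False
      then have i: "i \<in> {1..k}" "i \<in> {1..T}" "Suc k \<noteq> i" using I K by auto
      have "cbp a i * ?e = ?e * cbp a i" using cbp_e2[OF R(2) i(2,3) R(1), of a 1] by simp
      then have "?e * (u * ?e) = w * ((?e * (tb (Suc k) i * ?e)) * cbp a i)"
        unfolding 0 by (simp add: W.tr_commute[of i] mult.assoc)
      also have "\<dots> = w * (?e * cbp a i)" unfolding e2_tb_e2[OF R(2) i(2,3) R(1)] by simp
      also have "\<dots> = (w * cbp a i) * ?e"
        using cbp_e2[OF R(2) i(2,3) R(1), of a 1] by (simp add: mult.assoc)
      finally show ?thesis using Mon_mult[OF w Mon_cbp[OF i(1)] kR] by blast
    qed
  next
    case (II w i a)
    have w: "w \<in> Mon k k" using II by simp
    have i: "i \<in> {1..R}" "Suc k \<noteq> i" "i \<in> {1..k}" "i \<noteq> Suc k" using II K by auto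
    have "?e * (u * ?e) = ?e * (cp a (Suc k) * (e2 i (Suc k) * (?e * w)))"
      using II comm[OF w] e2_cp[OF R, of a] by (simp add: mult.assoc)
    also have "\<dots> = (?e * e2 i (Suc k)) * (cp a (Suc k) * (?e * w))"
      using cp_e2[OF i(1) R(1) i(4) R(2)] by (simp add: mult.assoc)
    also have "\<dots> = ?e * ((t (Suc k) i * cp a (Suc k)) * (?e * w))"
      unfolding e2_e2_bar(1)[OF R(1) i(1,2) R(2)] by (simp add: mult.assoc)
    also have "t (Suc k) i * cp a (Suc k) = cp a i * t (Suc k) i"
      using t_c[OF R(1) i(1) R(1)] by (simp add: cp_def)
    also have "?e * (cp a i * t (Suc k) i * (?e * w)) = cp a i * (?e * (t (Suc k) i * ?e) * w)"
      using cp_e2[OF R(1) i(1,2) R(2)] by (simp add: mult.assoc)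
    also have "\<dots> = (cp a i * w) * ?e"
      unfolding e2_t_e2[OF R(1) i(1,2) R(2)] using comm[OF w] by (simp add: mult.assoc)
    finally show ?thesis using Mon_mult[OF Mon_cp[OF i(3)] w kR] by blast
  qed (use K in auto)
qed

text \<open>Peeling strand k + 1 off the left side turns e u e either into z or into e u' e,
  possibly with a further Clifford factor of a smaller strand, where u' avoids strand k + 1 on the
  left; \<open>cap_bar\<close> then treats the right side.\<close>

lemma cap:
  assumes u: "u \<in> Mon (Suc k) (Suc k)" and K: "Suc k \<le> R" "Suc k \<le> T"
  shows "\<exists>v\<in>Mon k k. e2 (Suc k) (Suc k) * (u * e2 (Suc k) (Suc k)) = v * e2 (Suc k) (Suc k)"
proof -
  let ?e = "e2 (Suc k) (Suc k)"
  have R: "Suc k \<in> {1..R}" "Suc k \<in> {1..T}" and kR: "k \<le> R" "k \<le> T" using K by auto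
  note es = e2_single[OF R]
  have cbM: "cbp a (Suc k) \<in> Mon k (Suc k)" for a by (rule Mon_cbp) simp
  show ?thesis
  proof (cases rule: Mon_cases[OF u _ K, consumes 0, case_names _ Z I II])
    case Z
    show ?thesis unfolding Z by (intro bexI[of _ z] Mon.zero) (simp add: es(6,7))
  next
    case (I w i a)
    have w: "w \<in> Mon k (Suc k)" using I by simp
    show ?thesis
    proof (cases "i = Suc k")
      case True
      have "cp a (Suc k) * ?e = cbp a (Suc k) * ?e" using es(3) by (simp add: cp_def cbp_def)
      then have "?e * (u * ?e) = ?e * ((w * cbp a (Suc k)) * ?e)"
        using I True by (simp add: V.tr_same mult.assoc)
      then show ?thesis using cap_bar[OF Mon_mult[OF w cbM kR(1) K(2)] K] by simp
    next
      case False
      then have i: "i \<in> {1..k}" "i \<in> {1..R}" "Suc k \<noteq> i" using I K by auto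
      have e2M: "e2 i (Suc k) \<in> Mon k (Suc k)" using i K by (intro Mon_e2) auto
      have ce: "cp a i * ?e = ?e * cp a i" using cp_e2[OF R(1) i(2,3) R(2), of a 1] by simp
      have "?e * (u * ?e) = ?e * (w * (t (Suc k) i * ?e)) * cp a i"
        using I ce by (simp add: mult.assoc V.tr_commute[of i])
      also have "t (Suc k) i * ?e = e2 i (Suc k) * ?e" using e2_e2_bar(2)[OF R(1) i(2,3) R(2)] by simp
      finally have 1: "?e * (u * ?e) = ?e * ((w * e2 i (Suc k)) * ?e) * cp a i" by (simp add: mult.assoc)
      obtain v where v: "v \<in> Mon k k" "?e * ((w * e2 i (Suc k)) * ?e) = v * ?e"
        using cap_bar[OF Mon_mult[OF w e2M kR(1) K(2)] K] by blast
      have "?e * (u * ?e) = (v * cp a i) * ?e" unfolding 1 v(2) by (simp add: mult.assoc ce)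
      then show ?thesis using Mon_mult[OF v(1) Mon_cp[OF i(1)] kR] by blast
    qed
  next
    case (II w j a)
    have w: "w \<in> Mon k (Suc k)" using II by simp
    have 0: "?e * (u * ?e) = ?e * (cbp a (Suc k) * (e2 (Suc k) j * (w * ?e)))"
      using II e2_cp[OF R, of a] by (simp add: mult.assoc)
    show ?thesis
    proof (cases "j = Suc k")
      case True
      have "?e * (cbp a (Suc k) * ?e) = z"
        using es(1,3,4) by (cases a) (auto simp: cbp_def)
      then have "?e * (u * ?e) = z * (w * ?e)" unfolding 0 True by (metis mult.assoc)
      also have "\<dots> = z" using Mon_N_z(3)[OF w kR(1) K(2)] es(7) by (simp flip: mult.assoc)
      finally show ?thesis using es(7) by (intro bexI[of _ z] Mon.zero) simp
    next
      case False
      then have j: "j \<in> {1..T}" "j \<noteq> Suc k" "Suc k \<noteq> j" "j \<in> {1..Suc k}" using II K by auto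
      have "?e * (u * ?e) = (?e * e2 (Suc k) j) * (cbp a (Suc k) * (w * ?e))"
        unfolding 0 using cbp_e2[OF j(1) R(2) j(2) R(1)] by (simp add: mult.assoc)
      also have "\<dots> = ?e * ((tb (Suc k) j * (cbp a (Suc k) * w)) * ?e)"
        unfolding e2_e2_bar'(1)[OF R(2) j(1,3) R(1)] by (simp add: mult.assoc)
      finally have 1: "?e * (u * ?e) = ?e * ((tb (Suc k) j * (cbp a (Suc k) * w)) * ?e)" .
      have "tb (Suc k) j \<in> Mon k (Suc k)" using j by (intro Mon_tb) auto
      from cap_bar[OF Mon_mult[OF this Mon_mult[OF cbM w kR(1) K(2)] kR(1) K(2)] K]
      show ?thesis unfolding 1 .
    qed
  qed (use K in auto)
qed

end

section \<open>The action on decorated matchings\<close>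

unbundle permutation_syntax

type_synonym state = "nat perm \<times> (nat \<Rightarrow> bool)"
type_synonym pstate = "(bool \<times> state) option"

fun flip :: "bool \<Rightarrow> pstate \<Rightarrow> pstate" where
  "flip b None = None"
| "flip b (Some (a, x)) = Some (a \<noteq> b, x)"

lemma flip_flip: "flip a (flip b X) = flip (a \<noteq> b) X" 
  by (cases X) auto
lemma flip_None_iff: "flip b X = None \<longleftrightarrow> X = None" 
  by (cases X) auto

text \<open>The two conditions make the sign central and \<open>None\<close> absorbing, as the
  locale \<open>wbc\<close> demands of \<open>N\<close> and \<open>z\<close>.\<close>

typedef pfun = "{f :: pstate \<Rightarrow> pstate. f None = None \<and> (\<forall>b X. f (flip b X) = flip b (f X))}"
  morphisms app Abs_pfun
  by (rule exI[of _ id]) auto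

setup_lifting type_definition_pfun

instantiation pfun :: monoid_mult
begin
lift_definition one_pfun :: pfun is id by auto
lift_definition times_pfun :: "pfun \<Rightarrow> pfun \<Rightarrow> pfun" is "(\<circ>)" by auto
instance by standard (transfer; auto)+
end

lift_definition neg_pfun :: pfun is "flip True" by (auto simp: flip_flip)
lift_definition zero_pfun :: pfun is "\<lambda>_. None" by auto

lift_definition mk_pfun :: "(state \<Rightarrow> pstate) \<Rightarrow> pfun" is
  "\<lambda>h X. case (X :: pstate) of None \<Rightarrow> None | Some (b, x) \<Rightarrow> flip b (h x)"
  by (auto simp: flip_flip split: option.splits) (rule arg_cong[of _ _ "\<lambda>b. flip b _"]; blast)

lemma app_simps:
  "app f None = None" "app f (flip b X) = flip b (app f X)"
  "app (f * g) X = app f (app g X)" "app 1 X = X" "app neg_pfun X = flip True X"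
  "app zero_pfun X = None" "app (mk_pfun h) (Some (b, x)) = flip b (h x)"
  by (transfer; auto)+

lemma app_True: "app f (Some (True, x)) = flip True (app f (Some (False, x)))"
  using app_simps(2)[of f True "Some (False, x)"] by simp

lemma pfun_eqI:
  assumes "\<And>x. app f (Some (False, x)) = app g (Some (False, x))" shows "f = g"
proof -
  have "app f X = app g X" for X
  proof (cases X)
    case (Some bx)
    then show ?thesis using assms app_True[of f] app_True[of g]
      by (cases bx; cases "fst bx") (auto simp del: split_paired_All)
  qed (simp add: app_simps)
  then show ?thesis by (simp add: app_inject[symmetric] fun_eq_iff)
qed

lemma neg_zero_pfun:
  "f * neg_pfun = neg_pfun * f" "f * zero_pfun = zero_pfun" "zero_pfun * f = zero_pfun"
  "neg_pfun * neg_pfun = 1"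
  by (rule pfun_eqI; simp add: app_simps app_True)+

text \<open>The sign of moving a Clifford generator past all decorations at smaller
  positions.\<close>

primrec prefix_parity :: "(nat \<Rightarrow> bool) \<Rightarrow> nat \<Rightarrow> bool" where
  "prefix_parity T 0 = False"
| "prefix_parity T (Suc i) = (prefix_parity T i \<noteq> T i)"

lemma prefix_parity_upd: "prefix_parity (T(i := b)) j = (prefix_parity T j \<noteq> (i < j \<and> T i \<noteq> b))"
  by (induction j) (auto simp: less_Suc_eq)

abbreviation pos :: "nat perm \<Rightarrow> nat \<Rightarrow> nat" where "pos f j \<equiv> inverse f \<langle>$\<rangle> j"

text \<open>A state \<open>(f, T)\<close> is a bipartite matching with decorations: the \<open>i\<close>th endpoint on top left of
  the wall has position \<open>i - 1\<close>, the \<open>j\<close>th endpoint on top right of the wall has label \<open>j - 1\<close>, and all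
  other positions and labels stand for endpoints at the bottom. The strand at position \<open>p\<close> ends at
  label \<open>f p\<close>, and it carries a Clifford generator if \<open>T p\<close>. The decorations are multiplied in the
  order of positions; this determines all signs.\<close>

fun gen_act :: "bc_gen \<Rightarrow> state \<Rightarrow> pstate" where
  "gen_act (S i) (f, T) = Some (T (i - 1) \<and> T i, f * \<langle>i - 1 \<leftrightarrow> i\<rangle>, T(i - 1 := T i, i := T (i - 1)))"
| "gen_act (Sbar j) (f, T) = Some (False, \<langle>j - 1 \<leftrightarrow> j\<rangle> * f, T)"
| "gen_act (C i) (f, T) = Some (prefix_parity T (i - 1) \<noteq> T (i - 1), f, T(i - 1 := \<not> T (i - 1)))"
| "gen_act (Cbar j) (f, T) = (let p = pos f (j - 1) in Some (prefix_parity T p, f, T(p := \<not> T p)))"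
| "gen_act E1 (f, T) = (let p = pos f 0 in if p = 0 then None
     else if T 0 then Some (prefix_parity (T(0 := False)) p, f * \<langle>0 \<leftrightarrow> p\<rangle>, T(0 := False, p := \<not> T p))
     else Some (False, f * \<langle>0 \<leftrightarrow> p\<rangle>, T))"

definition gp :: "bc_gen \<Rightarrow> pfun" where "gp g = mk_pfun (gen_act g)"

lemma app_gp: "app (gp g) (Some (b, x)) = flip b (gen_act g x)"
  by (simp add: gp_def app_simps)

lemma swap_apply: "\<langle>a \<leftrightarrow> b\<rangle> \<langle>$\<rangle> l = (if l = a then b else if l = b then a else l)"
  by auto

lemma pos_apply: "pos f (f \<langle>$\<rangle> i) = i" "f \<langle>$\<rangle> (pos f j) = j"
  by (simp_all add: apply_inverse bij_is_inj bij_is_surj surj_f_inv_f)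

lemma pos_eq_iff: "pos f j = i \<longleftrightarrow> j = f \<langle>$\<rangle> i"
  using pos_apply by metis

lemma prefix_parity_1: "prefix_parity T 1 = T 0" "prefix_parity T (Suc 0) = T 0"
  by (simp_all add: One_nat_def)

lemma apply_eq_iff_pos: "f \<langle>$\<rangle> x = j \<longleftrightarrow> x = pos f j"
  using pos_apply by metis

lemmas act = app_simps app_gp Let_def prefix_parity_upd prefix_parity_1 apply_times swap_apply pos_apply apply_inj

section \<open>Verification of the walled Brauer-Clifford relations for the action\<close>

lemma rel_s:
  assumes "1 \<le> i"
  shows "gp (S i) * gp (S i) = 1" and "gp (Sbar i) * gp (Sbar i) = 1"
    "gp (C i) * gp (C i) = neg_pfun" "gp (Cbar i) * gp (Cbar i) = 1"
  using assms
  by (auto intro!: pfun_eqI perm_eqI simp: act fun_eq_iff)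

lemma rel_braid: "gp (S (Suc i)) * gp (S (Suc (Suc i))) * gp (S (Suc i)) =
    gp (S (Suc (Suc i))) * gp (S (Suc i)) * gp (S (Suc (Suc i)))"
  by (auto intro!: pfun_eqI perm_eqI simp: act fun_eq_iff)

lemma rel_braid_bar: "gp (Sbar (Suc i)) * gp (Sbar (Suc (Suc i))) * gp (Sbar (Suc i)) =
    gp (Sbar (Suc (Suc i))) * gp (Sbar (Suc i)) * gp (Sbar (Suc (Suc i)))"
  by (auto intro!: pfun_eqI perm_eqI simp: act fun_eq_iff)

lemma rel_comm: "Suc i < j \<Longrightarrow> gp (S (Suc i)) * gp (S (Suc j)) = gp (S (Suc j)) * gp (S (Suc i))"
  "Suc i < j \<Longrightarrow> gp (Sbar (Suc i)) * gp (Sbar (Suc j)) = gp (Sbar (Suc j)) * gp (Sbar (Suc i))"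
  by (auto intro!: pfun_eqI perm_eqI simp: act fun_eq_iff)

lemma rel_anti: "i \<noteq> j \<Longrightarrow> gp (C (Suc i)) * gp (C (Suc j)) = neg_pfun * (gp (C (Suc j)) * gp (C (Suc i)))"
  "i \<noteq> j \<Longrightarrow> gp (Cbar (Suc i)) * gp (Cbar (Suc j)) = neg_pfun * (gp (Cbar (Suc j)) * gp (Cbar (Suc i)))"
  by (rule pfun_eqI; auto simp: act fun_upd_twist)+

lemma rel_scs:
  "gp (S (Suc j)) * gp (C (Suc i)) * gp (S (Suc j)) = gp (C (Suc (Transposition.transpose j (Suc j) i)))"
  by (rule pfun_eqI; auto simp: act Transposition.transpose_def intro!: perm_eqI ext; auto split: if_splits)

lemma rel_scs_bar:
  "gp (Sbar (Suc j)) * gp (Cbar (Suc i)) * gp (Sbar (Suc j)) = gp (Cbar (Suc (Transposition.transpose j (Suc j) i)))"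
  by (auto intro!: pfun_eqI perm_eqI simp: act Transposition.transpose_def)

lemma rel_ec: "gp E1 * gp (C 1) = gp E1 * gp (Cbar 1)"
  by (rule pfun_eqI; auto simp: act intro!: ext; auto split: if_splits; metis neq0_conv)

lemma rel_ce: "gp (C 1) * gp E1 = gp (Cbar 1) * gp E1"
  by (rule pfun_eqI) (clarsimp simp: act)

lemma rel_mixed:
  "gp (Sbar j) * gp (C i) = gp (C i) * gp (Sbar j)"
  "gp (S (Suc i)) * gp (Cbar j) = gp (Cbar j) * gp (S (Suc i))"
  "gp (C i) * gp (Cbar j) = neg_pfun * (gp (Cbar j) * gp (C i))"
  "gp (S i) * gp (Sbar j) = gp (Sbar j) * gp (S i)"
  by (rule pfun_eqI; auto simp: act mult.assoc fun_upd_twist intro!: ext; auto split: if_splits)+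

text \<open>One application of e leaves position 0 joined to label 0. The next one would close this
  strand to a loop, which counts as zero with or without a decoration.\<close>

lemma rel_ee: "gp E1 * gp E1 = zero_pfun" "gp E1 * gp (C 1) * gp E1 = zero_pfun"
  by (rule pfun_eqI; auto simp: act)+

lemma rel_se:
  "gp (S (Suc (Suc i))) * gp E1 = gp E1 * gp (S (Suc (Suc i)))"
  "gp (Sbar (Suc (Suc i))) * gp E1 = gp E1 * gp (Sbar (Suc (Suc i)))"
  "gp (C (Suc (Suc i))) * gp E1 = gp E1 * gp (C (Suc (Suc i)))"
  by (rule pfun_eqI; auto simp: act intro!: perm_eqI ext; auto split: if_splits)+

lemma rel_cb_e: "gp (Cbar (Suc (Suc i))) * gp E1 = gp E1 * gp (Cbar (Suc (Suc i)))"
proof (rule pfun_eqI)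
  fix x :: state
  obtain f T where x: "x = (f, T)" by (cases x)
  define p p' where "p = pos f 0" and "p' = pos f (Suc i)"
  have pp: "p \<noteq> p'" unfolding p_def p'_def by (simp add: apply_inj)
  have "pos (f * \<langle>0 \<leftrightarrow> p\<rangle>) (Suc i) = (if p' = 0 then p else p')"
    using pp by (simp add: apply_times swap_apply p'_def[symmetric])
  then show "app (gp (Cbar (Suc (Suc i))) * gp E1) (Some (False, x))
      = app (gp E1 * gp (Cbar (Suc (Suc i)))) (Some (False, x))"
    using pp
    by (auto simp: x app_simps app_gp Let_def prefix_parity_upd p_def[symmetric] p'_def[symmetric] fun_upd_twist
        intro!: ext; auto split: if_splits; metis neq0_conv)
qed

lemma rel_ese: "gp E1 * gp (S 1) * gp E1 = gp E1"
  apply (rule pfun_eqI)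
  apply (auto simp: act intro!: perm_eqI ext)
           apply (auto split: if_splits)
     apply (metis neq0_conv)+
  done

lemma pos_facts:
  fixes f :: "nat perm"
  defines "p \<equiv> pos f 0" and "r \<equiv> pos f 1"
  shows "p \<noteq> r" "r \<noteq> p" "f \<langle>$\<rangle> x = 0 \<longleftrightarrow> x = p" "f \<langle>$\<rangle> x = 1 \<longleftrightarrow> x = r" 
    "f \<langle>$\<rangle> p = 0" "f \<langle>$\<rangle> r = 1"
  unfolding p_def r_def by (auto simp: apply_inj pos_apply apply_eq_iff_pos)

lemma rel_ese_bar: "gp E1 * gp (Sbar 1) * gp E1 = gp E1"
proof (rule pfun_eqI)
  fix x :: state
  obtain f T where x: "x = (f, T)" by (cases x)
  define p r where "p = pos f 0" and "r = pos f 1"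
  note pr = pos_facts[of f, folded p_def r_def] p_def[symmetric] r_def[symmetric]
  show "app (gp E1 * gp (Sbar 1) * gp E1) (Some (False, x)) = app (gp E1) (Some (False, x))"
    by (auto simp: x app_simps app_gp Let_def prefix_parity_upd apply_times swap_apply pr 
        intro!: ext perm_eqI; auto split: if_splits; metis neq0_conv)
qed

text \<open>The wall relations affect only the positions 0 and 1 and the positions of the labels 0
  and 1. Testing these four points and one generic point keeps the case analysis bounded.\<close>

lemma fun_eqI_4:
  assumes "F a = G a" "F b = G b" "F p = G p" "F r = G r"
    and "\<And>x. x \<noteq> a \<Longrightarrow> x \<noteq> b \<Longrightarrow> x \<noteq> p \<Longrightarrow> x \<noteq> r \<Longrightarrow> F x = G x"
  shows "F = G"
  using assms by (intro ext) metis

lemma perm_eqI_4: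
  assumes "f \<langle>$\<rangle> a = g \<langle>$\<rangle> a" "f \<langle>$\<rangle> b = g \<langle>$\<rangle> b" "f \<langle>$\<rangle> p = g \<langle>$\<rangle> p" "f \<langle>$\<rangle> r = g \<langle>$\<rangle> r"
    and "\<And>x. x \<noteq> a \<Longrightarrow> x \<noteq> b \<Longrightarrow> x \<noteq> p \<Longrightarrow> x \<noteq> r \<Longrightarrow> f \<langle>$\<rangle> x = g \<langle>$\<rangle> x"
  shows "f = g"
  using assms by (intro perm_eqI) metis

lemma rel_wall_left: "gp E1 * gp (S 1) * gp (Sbar 1) * gp E1 * gp (S 1) =
    gp E1 * gp (S 1) * gp (Sbar 1) * gp E1 * gp (Sbar 1)"
proof (rule pfun_eqI)
  fix x :: state
  obtain f T where x: "x = (f, T)" by (cases x)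
  define p r where "p = pos f 0" and "r = pos f 1"
  note pr = pos_facts[of f, folded p_def r_def] p_def[symmetric] r_def[symmetric]
  show "app (gp E1 * gp (S 1) * gp (Sbar 1) * gp E1 * gp (S 1)) (Some (False, x))
     = app (gp E1 * gp (S 1) * gp (Sbar 1) * gp E1 * gp (Sbar 1)) (Some (False, x))"
    apply (cases "T 0"; cases "T 1"; cases "p = 0"; cases "p = 1"; cases "r = 0"; cases "r = 1"; simp add: x app_simps app_gp Let_def prefix_parity_upd prefix_parity_1 apply_times swap_apply pr;
        insert pr(1,2); (intro conjI)?; (rule perm_eqI_4[where a = 0 and b = 1 and p = p and r = r])?; (rule fun_eqI_4[where a = 0 and b = 1 and p = p and r = r])?; simp add: apply_times swap_apply pr)
    apply (use pr(1) in \<open>metis linorder_neqE_nat less_asym\<close>)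
    done
qed

lemma rel_wall_right: "gp (S 1) * gp E1 * gp (S 1) * gp (Sbar 1) * gp E1 =
    gp (Sbar 1) * gp E1 * gp (S 1) * gp (Sbar 1) * gp E1"
proof (rule pfun_eqI)
  fix x :: state
  obtain f T where x: "x = (f, T)" by (cases x)
  define p r where "p = pos f 0" and "r = pos f 1"
  note pr = pos_facts[of f, folded p_def r_def] p_def[symmetric] r_def[symmetric]
  show "app (gp (S 1) * gp E1 * gp (S 1) * gp (Sbar 1) * gp E1) (Some (False, x))
     = app (gp (Sbar 1) * gp E1 * gp (S 1) * gp (Sbar 1) * gp E1) (Some (False, x))"
    by (cases "T 0"; cases "T 1"; cases "p = 0"; cases "p = 1"; cases "r = 0"; cases "r = 1"; simp add: x app_simps app_gp Let_def prefix_parity_upd prefix_parity_1 apply_times swap_apply pr;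
        insert pr(1,2); (intro conjI)?; (rule perm_eqI_4[where a = 0 and b = 1 and p = p and r = r])?; (rule fun_eqI_4[where a = 0 and b = 1 and p = p and r = r])?; simp add: apply_times swap_apply pr)
qed

lemma Suc_ge_1: "1 \<le> i \<Longrightarrow> (\<And>j. i = Suc j \<Longrightarrow> P) \<Longrightarrow> P" for i :: nat
  by (cases i) auto

lemma wbc_gp:
  assumes "1 \<le> R" "1 \<le> T"
  shows "wbc R T (\<lambda>i. gp (S i)) (\<lambda>i. gp (Sbar i)) (\<lambda>i. gp (C i)) (\<lambda>i. gp (Cbar i)) (gp E1)
    neg_pfun zero_pfun neg_pfun 1"
proof (rule wbc.intro)
  show "gp (S j) * gp (C i) * gp (S j) = gp (C (Transposition.transpose j (Suc j) i))"
    if "1 \<le> j" "1 \<le> i" for i j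
  proof -
    obtain i' j' where "i = Suc i'" "j = Suc j'" using \<open>1 \<le> i\<close> \<open>1 \<le> j\<close> by (metis Suc_ge_1)
    then show ?thesis using rel_scs[of j' i'] by (auto simp: Transposition.transpose_def)
  qed
  show "gp (Sbar j) * gp (Cbar i) * gp (Sbar j) = gp (Cbar (Transposition.transpose j (Suc j) i))"
    if "1 \<le> j" "1 \<le> i" for i j
  proof -
    obtain i' j' where "i = Suc i'" "j = Suc j'" using \<open>1 \<le> i\<close> \<open>1 \<le> j\<close> by (metis Suc_ge_1)
    then show ?thesis using rel_scs_bar[of j' i'] by (auto simp: Transposition.transpose_def)
  qed
  show "symmetric_generators R (\<lambda>i. gp (S i))"
  proof
    show "gp (S i) * gp (S (i + 1)) * gp (S i) = gp (S (i + 1)) * gp (S i) * gp (S (i + 1))" if "1 \<le> i" for i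
      using rel_braid[of "i - 1"] that by (simp flip: Suc_eq_plus1)
    show "gp (S i) * gp (S j) = gp (S j) * gp (S i)" if "1 \<le> i" "i + 1 < j" for i j
      using rel_comm(1)[of "i - 1" "j - 1"] that by simp
  qed (simp_all add: rel_s)
  show "symmetric_generators T (\<lambda>i. gp (Sbar i))"
  proof
    show "gp (Sbar i) * gp (Sbar (i + 1)) * gp (Sbar i) = gp (Sbar (i + 1)) * gp (Sbar i) * gp (Sbar (i + 1))" if "1 \<le> i" for i
      using rel_braid_bar[of "i - 1"] that by (simp flip: Suc_eq_plus1)
    show "gp (Sbar i) * gp (Sbar j) = gp (Sbar j) * gp (Sbar i)" if "1 \<le> i" "i + 1 < j" for i j
      using rel_comm(2)[of "i - 1" "j - 1"] that by simp
  qed (simp_all add: rel_s)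
  show "gp (C i) * gp (C j) = neg_pfun * (gp (C j) * gp (C i))" if "1 \<le> i" "1 \<le> j" "i \<noteq> j" for i j
    using rel_anti(1)[of "i - 1" "j - 1"] that by simp
  show "gp (Cbar i) * gp (Cbar j) = neg_pfun * (gp (Cbar j) * gp (Cbar i))" if "1 \<le> i" "1 \<le> j" "i \<noteq> j" for i j
    using rel_anti(2)[of "i - 1" "j - 1"] that by simp
  show "gp (S i) * gp (Cbar j) = gp (Cbar j) * gp (S i)" if "1 \<le> i" for i j
    using rel_mixed(2)[of "i - 1" j] that by simp
  fix i :: nat assume "1 < i"
  then obtain i' where i: "i = Suc (Suc i')" using less_iff_Suc_add[of 1 i] by auto
  show "gp (S i) * gp E1 = gp E1 * gp (S i)" "gp (Sbar i) * gp E1 = gp E1 * gp (Sbar i)"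
    "gp (C i) * gp E1 = gp E1 * gp (C i)" "gp (Cbar i) * gp E1 = gp E1 * gp (Cbar i)"
    unfolding i by (rule rel_se rel_cb_e)+
qed ((rule rel_s rel_mixed rel_ec rel_ce rel_ee rel_ese rel_ese_bar rel_wall_left rel_wall_right
    neg_zero_pfun assms disjI2 conjI refl; assumption?)+)

section \<open>New models of the relations: images under homomorphisms and products\<close>

lemma wbc_hom:
  assumes "wbc R T s sb c cb e N z q qb"
    and mult: "\<And>x y. h (x * y) = h x * h y" and hom_one: "h 1 = (1 :: 'c::monoid_mult)"
  shows "wbc R T (\<lambda>i. h (s i)) (\<lambda>i. h (sb i)) (\<lambda>i. h (c i)) (\<lambda>i. h (cb i)) (h e) (h N) (h z) (h q) (h qb)"
proof -
  interpret wbc R T s sb c cb e N z q qb by fact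
  have one': "1 = h 1" using hom_one by simp
  show ?thesis
  proof (rule wbc.intro)
    show "symmetric_generators R (\<lambda>i. h (s i))"
      by (rule symmetric_generators.intro; simp only: mult[symmetric] one'; rule arg_cong[of _ _ h];
          rule V.s_square V.s_braid V.s_comm; assumption)
    show "symmetric_generators T (\<lambda>i. h (sb i))"
      by (rule symmetric_generators.intro; simp only: mult[symmetric] one'; rule arg_cong[of _ _ h];
          rule W.s_square W.s_braid W.s_comm; assumption)
    show "h q = 1 \<and> h qb = h N \<or> h q = h N \<and> h qb = 1" using qs hom_one by auto
    show "1 \<le> R" "1 \<le> T" by (rule RT)+
  qed (simp only: mult[symmetric] one'; rule arg_cong[of _ _ h];
      rule c_square cb_square c_anticomm cb_anticomm s_c_s sb_cb_sb e_c c_e1 sb_c s_cb c_cb s_sb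
        e_square e_s_e e_sb_e s_e sb_e c_e cb_e wall_left wall_right e_c_e N_N N_s N_sb N_c N_cb N_e
        z_s z_sb z_c z_cb z_e z_N z_z; assumption?)+
qed

instantiation prod :: (monoid_mult, monoid_mult) monoid_mult
begin
definition one_prod :: "'a \<times> 'b" where "one_prod = (1, 1)"
definition times_prod :: "'a \<times> 'b \<Rightarrow> 'a \<times> 'b \<Rightarrow> 'a \<times> 'b" where
  "times_prod x y = (fst x * fst y, snd x * snd y)"
instance by standard (simp_all add: one_prod_def times_prod_def mult.assoc)
end

text \<open>Applied to left multiplications on the quotient algebra and to signed partial maps, so
  that a single monomial records both an element of the algebra and its action, and a normal form
  holds for both at once.\<close>

lemma wbc_prod:
  assumes "wbc R T s sb c cb e N z N 1" "wbc R T s' sb' c' cb' e' N' z' N' 1"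
  shows "wbc R T (\<lambda>i. (s i, s' i)) (\<lambda>i. (sb i, sb' i)) (\<lambda>i. (c i, c' i)) (\<lambda>i. (cb i, cb' i)) (e, e')
    (N, N') (z, z') (N, N') 1"
proof -
  interpret A: wbc R T s sb c cb e N z N 1 by fact
  interpret B: wbc R T s' sb' c' cb' e' N' z' N' 1 by fact
  note m = times_prod_def one_prod_def fst_conv snd_conv
  show ?thesis
  proof (rule wbc.intro)
    show "symmetric_generators R (\<lambda>i. (s i, s' i))"
      by (rule symmetric_generators.intro; simp only: m prod.inject; rule conjI;
          rule A.V.s_square A.V.s_braid A.V.s_comm B.V.s_square B.V.s_braid B.V.s_comm; assumption)
    show "symmetric_generators T (\<lambda>i. (sb i, sb' i))"
      by (rule symmetric_generators.intro; simp only: m prod.inject; rule conjI;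
          rule A.W.s_square A.W.s_braid A.W.s_comm B.W.s_square B.W.s_braid B.W.s_comm; assumption)
    show "(N, N') = 1 \<and> 1 = (N, N') \<or> (N, N') = (N, N') \<and> 1 = (1 :: 'a \<times> 'b)" by simp
    show "1 \<le> R" "1 \<le> T" by (rule A.RT)+
  qed (simp only: m prod.inject; rule conjI;
      rule A.c_square A.cb_square A.c_anticomm A.cb_anticomm A.s_c_s A.sb_cb_sb A.e_c A.c_e1 A.sb_c
        A.s_cb A.c_cb A.s_sb A.e_square A.e_s_e A.e_sb_e A.s_e A.sb_e A.c_e A.cb_e A.wall_left
        A.wall_right A.e_c_e A.N_N A.N_s A.N_sb A.N_c A.N_cb A.N_e
        A.z_s A.z_sb A.z_c A.z_cb A.z_e A.z_N A.z_z
        B.c_square B.cb_square B.c_anticomm B.cb_anticomm B.s_c_s B.sb_cb_sb B.e_c B.c_e1 B.sb_c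
        B.s_cb B.c_cb B.s_sb B.e_square B.e_s_e B.e_sb_e B.s_e B.sb_e B.c_e B.cb_e B.wall_left
        B.wall_right B.e_c_e B.N_N B.N_s B.N_sb B.N_c B.N_cb B.N_e
        B.z_s B.z_sb B.z_c B.z_cb B.z_e B.z_N B.z_z; assumption?)+
qed

lemma flip_inj: "flip b X = flip b Y \<longleftrightarrow> X = Y"
  by (cases X; cases Y) auto

section \<open>Separating normal forms\<close>

text \<open>Only a homomorphism to signed partial maps is given. The aim is \<open>inj_at\<close>:
  the monomials themselves are nevertheless determined by their action, even on a single suitable
  state.\<close>

locale wbc_act = wbc R T s sb c cb e N z q qb
  for R T s sb c cb and e N z q qb :: "'b::monoid_mult" +
  fixes act :: "'b \<Rightarrow> pfun"
  assumes act_mult: "act (x * y) = act x * act y" and act_one: "act 1 = 1"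
    and act_gens: "act (s i) = gp (S i)" "act (sb i) = gp (Sbar i)" "act (c i) = gp (C i)"
      "act (cb i) = gp (Cbar i)" "act e = gp E1" "act N = neg_pfun" "act z = zero_pfun"
begin

definition run :: "'b \<Rightarrow> bool \<Rightarrow> state \<Rightarrow> pstate" where
  "run u b x = app (act u) (Some (b, x))"

lemma run_simps:
  "run 1 b x = Some (b, x)" "run z b x = None" "run (N * u) b x = flip True (run u b x)"
  by (simp_all add: run_def act_mult act_one act_gens app_simps)

lemma run_mult: "run v b x = Some (b', y) \<Longrightarrow> run (u * v) b x = run u b' y"
  "run v b x = None \<Longrightarrow> run (u * v) b x = None"
  by (simp_all add: run_def act_mult app_simps)

lemma run_gen:
  "run (s i) b x = flip b (gen_act (S i) x)" "run (sb i) b x = flip b (gen_act (Sbar i) x)"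
  "run (c i) b x = flip b (gen_act (C i) x)" "run (cb i) b x = flip b (gen_act (Cbar i) x)"
  "run e b x = flip b (gen_act E1 x)"
  by (simp_all add: run_def act_gens app_gp)

lemma run_flip: "run u b x = flip b (run u False x)"
  using app_simps(2)[of "act u" b "Some (False, x)"] by (simp add: run_def)

lemma run_Some_eq_iff: "run u b x = run v b x \<longleftrightarrow> run u False x = run v False x"
  using flip_inj[of b "run u False x" "run v False x"] run_flip[of u b x] run_flip[of v b x] by simp

text \<open>The last letter acts first on the state, but each letter multiplies the permutation on
  the right; hence g applies the first letter first, as \<open>perm_act\<close> does.
  \<open>Suc\<close> appears because positions start at 0.\<close>

lemma run_s_word:
  assumes "set js \<subseteq> {1..}"
  shows "\<exists>b' g. run (prod_list (map s js)) b (f, U) = Some (b', f * g, \<lambda>l. U (g \<langle>$\<rangle> l)) \<and>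
    (\<forall>l. Suc (g \<langle>$\<rangle> l) = perm_act (Suc l) js)"
  using assms
proof (induction js)
  case Nil
  show ?case by (rule exI[of _ b], rule exI[of _ 1]) (simp add: run_simps perm_act_def)
next
  case (Cons j js)
  then obtain b' g where g: "run (prod_list (map s js)) b (f, U) = Some (b', f * g, \<lambda>l. U (g \<langle>$\<rangle> l))"
    "\<And>l. Suc (g \<langle>$\<rangle> l) = perm_act (Suc l) js" by auto
  obtain j' where j: "j = Suc j'" using Cons.prems by (cases j) auto
  let ?g = "g * \<langle>j' \<leftrightarrow> j\<rangle>"
  have "perm_act (Suc l) (j # js) = Suc (?g \<langle>$\<rangle> l)" for l
  proof -
    have "Transposition.transpose j (Suc j) (Suc l) = Suc (\<langle>j' \<leftrightarrow> j\<rangle> \<langle>$\<rangle> l)"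
      by (simp add: j Transposition.transpose_def swap_apply)
    then show ?thesis by (simp add: perm_act_def apply_times g(2)[unfolded perm_act_def])
  qed
  moreover have "\<exists>b''. run (prod_list (map s (j # js))) b (f, U)
      = Some (b'', f * ?g, \<lambda>l. U (?g \<langle>$\<rangle> l))"
    by (auto simp: run_mult(1)[OF g(1)] run_gen j mult.assoc fun_eq_iff apply_times swap_apply)
  ultimately show ?case by metis
qed

lemma run_t:
  assumes "1 \<le> i" "1 \<le> j"
  shows "\<exists>b'. run (t i j) b (f, U) = Some (b', f * \<langle>i - 1 \<leftrightarrow> j - 1\<rangle>, \<lambda>l. U (\<langle>i - 1 \<leftrightarrow> j - 1\<rangle> \<langle>$\<rangle> l))"
proof -
  have valid: "set (transp_word i j) \<subseteq> {1..}" using assms by (auto simp: transp_word_def)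
  obtain b' g where g: "run (t i j) b (f, U) = Some (b', f * g, \<lambda>l. U (g \<langle>$\<rangle> l))"
    "\<And>l. Suc (g \<langle>$\<rangle> l) = Transposition.transpose i j (Suc l)"
    using run_s_word[OF valid, of b f U] by (auto simp: V.tr_def perm_act_transp_word)
  have "g = \<langle>i - 1 \<leftrightarrow> j - 1\<rangle>"
  proof (rule perm_eqI)
    show "g \<langle>$\<rangle> l = \<langle>i - 1 \<leftrightarrow> j - 1\<rangle> \<langle>$\<rangle> l" for l
      using g(2)[of l] assms by (auto simp: swap_apply Transposition.transpose_def split: if_splits)
  qed
  then show ?thesis using g(1) by auto
qed

lemma run_sb_word:
  assumes "set js \<subseteq> {1..}"
  shows "\<exists>b' g. run (prod_list (map sb js)) b (f, U) = Some (b', g * f, U) \<and>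
    (\<forall>l. Suc (inverse g \<langle>$\<rangle> l) = perm_act (Suc l) js)"
  using assms
proof (induction js)
  case Nil
  show ?case by (rule exI[of _ b], rule exI[of _ 1]) (simp add: run_simps perm_act_def)
next
  case (Cons j js)
  then obtain b' g where g: "run (prod_list (map sb js)) b (f, U) = Some (b', g * f, U)"
    "\<And>l. Suc (inverse g \<langle>$\<rangle> l) = perm_act (Suc l) js" by auto
  obtain j' where j: "j = Suc j'" using Cons.prems by (cases j) auto
  let ?g = "\<langle>j' \<leftrightarrow> j\<rangle> * g"
  have "perm_act (Suc l) (j # js) = Suc (inverse ?g \<langle>$\<rangle> l)" for l
  proof -
    have "Transposition.transpose j (Suc j) (Suc l) = Suc (\<langle>j' \<leftrightarrow> j\<rangle> \<langle>$\<rangle> l)"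
      by (simp add: j Transposition.transpose_def swap_apply)
    then show ?thesis by (simp add: perm_act_def apply_times g(2)[unfolded perm_act_def])
  qed
  moreover have "\<exists>b''. run (prod_list (map sb (j # js))) b (f, U) = Some (b'', ?g * f, U)"
    by (auto simp: run_mult(1)[OF g(1)] run_gen j mult.assoc)
  ultimately show ?case by metis
qed

lemma run_tb:
  assumes "1 \<le> i" "1 \<le> j"
  shows "\<exists>b'. run (tb i j) b (f, U) = Some (b', \<langle>i - 1 \<leftrightarrow> j - 1\<rangle> * f, U)"
proof -
  have valid: "set (transp_word i j) \<subseteq> {1..}" using assms by (auto simp: transp_word_def)
  obtain b' g where g: "run (tb i j) b (f, U) = Some (b', g * f, U)"
    "\<And>l. Suc (inverse g \<langle>$\<rangle> l) = Transposition.transpose i j (Suc l)"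
    using run_sb_word[OF valid, of b f U] by (auto simp: W.tr_def perm_act_transp_word)
  have "inverse g = \<langle>i - 1 \<leftrightarrow> j - 1\<rangle>"
  proof (rule perm_eqI)
    show "inverse g \<langle>$\<rangle> l = \<langle>i - 1 \<leftrightarrow> j - 1\<rangle> \<langle>$\<rangle> l" for l
      using g(2)[of l] assms by (auto simp: swap_apply Transposition.transpose_def split: if_splits)
  qed
  then have "g = \<langle>i - 1 \<leftrightarrow> j - 1\<rangle>" by (metis inverse_swap perm.inverse_inverse)
  then show ?thesis using g(1) by auto
qed

lemma run_cp:
  assumes "1 \<le> i"
  shows "\<exists>b'. run (cp a i) b (f, U) = Some (b', f, U(i - 1 := (U (i - 1) \<noteq> a)))"
  using assms by (cases a) (auto simp: cp_def run_gen run_simps)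

lemma run_cbp:
  assumes "1 \<le> i"
  shows "\<exists>b'. run (cbp a i) b (f, U) = Some (b', f, U(pos f (i - 1) := (U (pos f (i - 1)) \<noteq> a)))"
  using assms by (cases a) (auto simp: cbp_def run_gen run_simps Let_def)

lemma Mon_fixes:
  assumes "u \<in> Mon m n" "run u b (f, U) = Some (b', g, W)" "m \<le> p" "n \<le> f \<langle>$\<rangle> p"
  shows "g \<langle>$\<rangle> p = f \<langle>$\<rangle> p \<and> W p = U p"
  using assms(1,2)
proof (induction arbitrary: b' g W)
  case one then show ?case by (simp add: run_simps)
next
  case zero then show ?case by (simp add: run_simps)
next
  case (neg x)
  then show ?case by (cases "run x b (f, U)") (auto simp: run_simps)
next
  case (gen a x)
  obtain b1 g1 W1 where 1: "run x b (f, U) = Some (b1, g1, W1)"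
    using gen.prems run_mult(2)[of x b "(f, U)" a] by (cases "run x b (f, U)") auto
  from gen.IH[OF 1] have IH: "g1 \<langle>$\<rangle> p = f \<langle>$\<rangle> p" "W1 p = U p" by auto
  have r: "run a b1 (g1, W1) = Some (b', g, W)" using gen.prems run_mult(1)[OF 1] by simp
  have pp: "pos g1 l \<noteq> p" if "l < n" for l
    using that IH assms(4) pos_apply(2)[of g1 l] by auto
  from gen.hyps(1) show ?case
  proof (cases rule: gens_cases)
    case (s i)
    then have "p \<noteq> i" "p \<noteq> i - 1" using assms(3) by auto
    then show ?thesis using s r IH by (auto simp: run_gen apply_times swap_apply)
  next
    case (sb i)
    then show ?thesis using r IH assms(4) by (auto simp: run_gen apply_times swap_apply)
  next
    case (c i)
    then have "p \<noteq> i - 1" using assms(3) by auto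
    then show ?thesis using c r IH by (auto simp: run_gen)
  next
    case (cb i)
    then have "i - 1 < n" by auto
    then show ?thesis using cb r IH pp[of "i - 1"] by (auto simp: run_gen Let_def)
  next
    case e
    then show ?thesis using r IH assms(3) pp[of 0]
      by (auto simp: run_gen Let_def apply_times swap_apply split: if_splits)
  qed
qed

lemma Mon_fixes_bar:
  assumes "u \<in> Mon 0 n" "run u b (f, U) = Some (b', g, W)" "n \<le> l"
  shows "pos g l = pos f l \<and> W (pos g l) = U (pos f l)"
  using assms(1,2)
proof (induction arbitrary: b' g W)
  case one then show ?case by (simp add: run_simps)
next
  case zero then show ?case by (simp add: run_simps)
next
  case (neg x)
  then show ?case by (cases "run x b (f, U)") (auto simp: run_simps)
next
  case (gen a x)
  obtain b1 g1 W1 where 1: "run x b (f, U) = Some (b1, g1, W1)"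
    using gen.prems run_mult(2)[of x b "(f, U)" a] by (cases "run x b (f, U)") auto
  from gen.IH[OF 1] have IH: "pos g1 l = pos f l" "W1 (pos f l) = U (pos f l)" by auto
  have r: "run a b1 (g1, W1) = Some (b', g, W)" using gen.prems run_mult(1)[OF 1] by simp
  have pp: "pos g1 i \<noteq> pos f l" if "i < n" for i
    using that IH(1) assms(3) apply_inj[of "inverse g1" i l] by auto
  from gen.hyps(1) show ?case
  proof (cases rule: gens_cases)
    case (sb i)
    then have "l \<noteq> i" "l \<noteq> i - 1" using assms(3) by auto
    then show ?thesis using sb r IH by (auto simp: run_gen apply_times swap_apply)
  next
    case (cb i)
    then have "i - 1 < n" by auto
    then show ?thesis using cb r IH pp[of "i - 1"] by (auto simp: run_gen Let_def)
  qed auto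
qed

text \<open>The action of e overwrites only the strand at position 0, whose label reappears at the
  former position of label 0. Knowing that label and the decoration beforehand, one recovers first
  that position and then the state.\<close>

lemma run_e_inj:
  assumes "run e b (f, U) = run e b' (g, W)" "f \<langle>$\<rangle> 0 = g \<langle>$\<rangle> 0" "f \<langle>$\<rangle> 0 \<noteq> 0" "U 0 = W 0"
  shows "b = b' \<and> f = g \<and> U = W"
proof -
  define p p' where "p = pos f 0" and "p' = pos g 0"
  have p0: "p \<noteq> 0" "p' \<noteq> 0" using assms(2,3) by (auto simp: p_def p'_def pos_eq_iff)
  note d = p_def[symmetric] p'_def[symmetric]
  have fg: "f * \<langle>0 \<leftrightarrow> p\<rangle> = g * \<langle>0 \<leftrightarrow> p'\<rangle>"
    using assms(1,4) p0 by (auto simp: run_gen Let_def d split: if_splits)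
  have "(f * \<langle>0 \<leftrightarrow> p\<rangle>) \<langle>$\<rangle> p = (f * \<langle>0 \<leftrightarrow> p\<rangle>) \<langle>$\<rangle> p'"
    by (subst (2) fg) (simp add: apply_times assms(2))
  then have pp: "p = p'" by (simp add: apply_inj)
  have "f * \<langle>0 \<leftrightarrow> p\<rangle> * \<langle>0 \<leftrightarrow> p\<rangle> = g * \<langle>0 \<leftrightarrow> p\<rangle> * \<langle>0 \<leftrightarrow> p\<rangle>" using fg pp by simp
  then have 1: "f = g" by (simp add: mult.assoc)
  have 2: "U = W"
  proof (cases "U 0")
    case True
    then have "U(0 := False, p := \<not> U p) = W(0 := False, p := \<not> W p)"
      using assms(1,4) p0 pp by (auto simp: run_gen Let_def d split: if_splits)
    then have "U x = W x" for x
      using True assms(4) p0 by (cases "x = p"; cases "x = 0") (auto simp: fun_eq_iff split: if_splits)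
    then show ?thesis by auto
  next
    case False
    then show ?thesis using assms(1,4) p0 by (auto simp: run_gen Let_def d split: if_splits)
  qed
  have "b = b'" using assms(1) p0 by (auto simp: run_gen Let_def 1[symmetric] 2[symmetric] d(1) split: if_splits)
  then show ?thesis using 1 2 by blast
qed

lemma run_I:
  assumes f: "\<forall>p<m. n \<le> f \<langle>$\<rangle> p" and i: "i \<in> {1..m}"
  shows "\<exists>b' g W. run (t i m * cp a i) False (f, U) = Some (b', g, W) \<and> (\<forall>p<m. n \<le> g \<langle>$\<rangle> p) \<and>
    g \<langle>$\<rangle> (m - 1) = f \<langle>$\<rangle> (i - 1) \<and> W (m - 1) = (U (i - 1) \<noteq> a)"
proof -
  have i1: "1 \<le> i" "1 \<le> m" using i by auto
  obtain b1 where 1: "run (cp a i) False (f, U) = Some (b1, f, U(i - 1 := (U (i - 1) \<noteq> a)))"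
    using run_cp[OF i1(1)] by blast
  obtain b2 where "run (t i m) b1 (f, U(i - 1 := (U (i - 1) \<noteq> a))) = Some (b2, f * \<langle>i - 1 \<leftrightarrow> m - 1\<rangle>,
      \<lambda>l. (U(i - 1 := (U (i - 1) \<noteq> a))) (\<langle>i - 1 \<leftrightarrow> m - 1\<rangle> \<langle>$\<rangle> l))"
    using run_t[OF i1] by blast
  with run_mult(1)[OF 1, of "t i m"] show ?thesis using f i by (auto simp: apply_times swap_apply)
qed

lemma run_I_bar:
  assumes i: "i \<in> {1..n}"
  shows "\<exists>b' g W. run (tb i n * cbp a i) False (f, U) = Some (b', g, W) \<and>
    pos g (n - 1) = pos f (i - 1) \<and> W (pos g (n - 1)) = (U (pos f (i - 1)) \<noteq> a)"
proof -
  have i1: "1 \<le> i" "1 \<le> n" using i by auto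
  let ?U = "U(pos f (i - 1) := (U (pos f (i - 1)) \<noteq> a))"
  obtain b1 where 1: "run (cbp a i) False (f, U) = Some (b1, f, ?U)"
    using run_cbp[OF i1(1)] by blast
  obtain b2 where "run (tb i n) b1 (f, ?U) = Some (b2, \<langle>i - 1 \<leftrightarrow> n - 1\<rangle> * f, ?U)"
    using run_tb[OF i1] by blast
  with run_mult(1)[OF 1, of "tb i n"] show ?thesis using i by (auto simp: apply_times swap_apply)
qed

lemma run_cancel:
  assumes "w' * w = 1" "run (w * u) b x = run (w * v) b' x'" shows "run u b x = run v b' x'"
  using arg_cong[OF assms(2), of "app (act w')"] arg_cong[OF assms(1), of act]
  by (simp add: run_def act_mult act_one app_simps) (metis app_simps(3,4))

text \<open>The first part describes the state that e meets, as needed for \<open>run_e_inj\<close>: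
  position 0 has a label of at least n, so no loop is closed. The second part reads the index j and
  the decoration off the image.\<close>

lemma run_II:
  assumes u: "run u False (f, U) = Some (b, g, W)" and g: "n \<le> g \<langle>$\<rangle> (m - 1)"
    and m: "1 \<le> m" and j: "j \<in> {1..n}"
  shows "\<exists>b' g' W'. run (t 1 m * (tb 1 j * u)) False (f, U) = Some (b', g', W')
      \<and> g' \<langle>$\<rangle> 0 = g \<langle>$\<rangle> (m - 1) \<and> W' 0 = W (m - 1)"
    "\<exists>b' g' W'. run (cp a m * (e2 m j * u)) False (f, U) = Some (b', g', W')
      \<and> g' \<langle>$\<rangle> (m - 1) = j - 1 \<and> W' (m - 1) = a"
proof -
  have j1: "1 \<le> j" using j by auto
  obtain b1 where 1: "run (tb 1 j) b (g, W) = Some (b1, \<langle>0 \<leftrightarrow> j - 1\<rangle> * g, W)"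
    using run_tb[of 1 j b g W] j1 by auto
  define g1 where "g1 = \<langle>0 \<leftrightarrow> j - 1\<rangle> * g"
  have g1: "g1 \<langle>$\<rangle> (m - 1) = g \<langle>$\<rangle> (m - 1)" using g j by (auto simp: g1_def apply_times swap_apply)
  obtain b2 where 2: "run (t 1 m) b1 (g1, W) = Some (b2, g1 * \<langle>0 \<leftrightarrow> m - 1\<rangle>, \<lambda>l. W (\<langle>0 \<leftrightarrow> m - 1\<rangle> \<langle>$\<rangle> l))"
    using run_t[of 1 m b1 g1 W] m by auto
  define g2 W2 where "g2 = g1 * \<langle>0 \<leftrightarrow> m - 1\<rangle>" and "W2 = (\<lambda>l. W (\<langle>0 \<leftrightarrow> m - 1\<rangle> \<langle>$\<rangle> l))"
  have g2: "g2 \<langle>$\<rangle> 0 = g \<langle>$\<rangle> (m - 1)" "W2 0 = W (m - 1)"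
    using g1 by (auto simp: g2_def W2_def apply_times)
  have r2: "run (t 1 m * (tb 1 j * u)) False (f, U) = Some (b2, g2, W2)"
    using run_mult(1)[OF run_mult(1)[OF u, of "tb 1 j", unfolded 1 g1_def[symmetric]], of "t 1 m"] 2
    by (simp add: g2_def W2_def)
  then show "\<exists>b' g' W'. run (t 1 m * (tb 1 j * u)) False (f, U) = Some (b', g', W')
      \<and> g' \<langle>$\<rangle> 0 = g \<langle>$\<rangle> (m - 1) \<and> W' 0 = W (m - 1)" using g2 by blast
  have g20: "g2 \<langle>$\<rangle> 0 \<noteq> 0" using g2 g j by auto
  then have p: "pos g2 0 \<noteq> 0" by (auto simp: pos_eq_iff)
  then obtain b3 W3 where 3: "run e b2 (g2, W2) = Some (b3, g2 * \<langle>0 \<leftrightarrow> pos g2 0\<rangle>, W3)" "\<not> W3 0"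
    by (cases "W2 0") (auto simp: run_gen Let_def)
  define g3 where "g3 = g2 * \<langle>0 \<leftrightarrow> pos g2 0\<rangle>"
  have g3: "g3 \<langle>$\<rangle> 0 = 0" by (simp add: g3_def apply_times pos_apply)
  obtain b4 where 4: "run (t 1 m) b3 (g3, W3) = Some (b4, g3 * \<langle>0 \<leftrightarrow> m - 1\<rangle>, \<lambda>l. W3 (\<langle>0 \<leftrightarrow> m - 1\<rangle> \<langle>$\<rangle> l))"
    using run_t[of 1 m b3 g3 W3] m by auto
  define g4 W4 where "g4 = g3 * \<langle>0 \<leftrightarrow> m - 1\<rangle>" and "W4 = (\<lambda>l. W3 (\<langle>0 \<leftrightarrow> m - 1\<rangle> \<langle>$\<rangle> l))"
  have g4: "g4 \<langle>$\<rangle> (m - 1) = 0" "\<not> W4 (m - 1)"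
    using g3 3(2) by (auto simp: g4_def W4_def apply_times)
  obtain b5 where 5: "run (tb 1 j) b4 (g4, W4) = Some (b5, \<langle>0 \<leftrightarrow> j - 1\<rangle> * g4, W4)"
    using run_tb[of 1 j b4 g4 W4] j1 by auto
  define g5 where "g5 = \<langle>0 \<leftrightarrow> j - 1\<rangle> * g4"
  have g5: "g5 \<langle>$\<rangle> (m - 1) = j - 1" using g4 by (simp add: g5_def apply_times)
  obtain b6 where 6: "run (cp a m) b5 (g5, W4) = Some (b6, g5, W4(m - 1 := (W4 (m - 1) \<noteq> a)))"
    using run_cp[OF m] by blast
  have "cp a m * (e2 m j * u) = cp a m * (tb 1 j * (t 1 m * (e * (t 1 m * (tb 1 j * u)))))"
    by (simp add: e2_def mult.assoc)
  moreover have "run (cp a m * (tb 1 j * (t 1 m * (e * (t 1 m * (tb 1 j * u)))))) False (f, U)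
      = Some (b6, g5, W4(m - 1 := (W4 (m - 1) \<noteq> a)))"
  proof -
    have 3: "run (e * (t 1 m * (tb 1 j * u))) False (f, U) = Some (b3, g3, W3)"
      using run_mult(1)[OF r2, of e] 3(1) by (simp add: g3_def)
    have 4: "run (t 1 m * (e * (t 1 m * (tb 1 j * u)))) False (f, U) = Some (b4, g4, W4)"
      using run_mult(1)[OF 3, of "t 1 m"] 4 by (simp add: g4_def W4_def)
    have 5: "run (tb 1 j * (t 1 m * (e * (t 1 m * (tb 1 j * u))))) False (f, U) = Some (b5, g5, W4)"
      using run_mult(1)[OF 4, of "tb 1 j"] 5 by (simp add: g5_def)
    show ?thesis using run_mult(1)[OF 5, of "cp a m"] 6 by simp
  qed
  ultimately show "\<exists>b' g' W'. run (cp a m * (e2 m j * u)) False (f, U) = Some (b', g', W')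
      \<and> g' \<langle>$\<rangle> (m - 1) = j - 1 \<and> W' (m - 1) = a"
    using g4 g5 by auto
qed

lemma cp_inverse: "1 \<le> i \<Longrightarrow> i \<le> R \<Longrightarrow> \<exists>w. w * cp a i = 1"
  using c_square[of i] qs N_N by (cases a) (auto simp: cp_def intro: exI[of _ "q * c i"] exI[of _ 1] simp: mult.assoc)

text \<open>The state is generic: no left endpoint among the first m is joined to a right endpoint
  among the first n, so that no loop can close unless the monomial closes it by itself.\<close>

definition inj_at :: "nat \<Rightarrow> nat \<Rightarrow> bool" where
  "inj_at m n \<longleftrightarrow> (\<forall>u\<in>Mon m n. \<forall>v\<in>Mon m n. \<forall>f U. (\<forall>p<m. n \<le> f \<langle>$\<rangle> p) \<longrightarrow>
    (run u False (f, U) = None \<longrightarrow> u = z) \<and>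
    (run u False (f, U) = run v False (f, U) \<longrightarrow> run u False (f, U) \<noteq> None \<longrightarrow> u = v))"

lemma inj_at_zero:
  assumes "inj_at m n" "u \<in> Mon m n" "\<forall>p<m. n \<le> f \<langle>$\<rangle> p" "run u b (f, U) = None"
  shows "u = z"
proof -
  have "run u False (f, U) = None" using assms(4) run_flip[of u b "(f, U)"] by (simp add: flip_None_iff)
  then show ?thesis using assms(1-3) unfolding inj_at_def by blast
qed

lemma inj_at_eq:
  assumes "inj_at m n" "u \<in> Mon m n" "v \<in> Mon m n" "\<forall>p<m. n \<le> f \<langle>$\<rangle> p"
    "run u b (f, U) = run v b (f, U)" "run u b (f, U) \<noteq> None"
  shows "u = v"
proof -
  have "run u False (f, U) \<noteq> None" using assms(6) run_flip[of u b "(f, U)"] by (simp add: flip_None_iff)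
  moreover have "run u False (f, U) = run v False (f, U)" using assms(5) run_Some_eq_iff by blast
  ultimately show ?thesis using assms(1-4) unfolding inj_at_def by blast
qed

lemma run_not_None: "run (w * (w' * u)) b x \<noteq> None \<Longrightarrow> run u b x \<noteq> None"
  by (metis run_mult(2))

lemma Mon_0_0:
  assumes "u \<in> Mon 0 0" shows "u = 1 \<or> u = N \<or> u = z"
  using assms by induction (auto simp: N_N z_N gens_def)

text \<open>Without strands on the left only the form with a strand running through occurs. Its
  index and decoration are read off at the label n, which the remaining monomial cannot
  reach.\<close>

lemma inj_at_0: "n \<le> T \<Longrightarrow> inj_at 0 n"
proof (induction n)
  case 0
  show ?case unfolding inj_at_def
    by (auto dest!: Mon_0_0 simp: run_simps) (auto simp: run_def act_gens app_simps act_one)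
next
  case (Suc n)
  then have IH: "inj_at 0 n" by simp
  show ?case unfolding inj_at_def
  proof (intro ballI allI impI)
    fix u v f U assume u: "u \<in> Mon 0 (Suc n)" and v: "v \<in> Mon 0 (Suc n)"
    define isI where "isI u u0 i a b g W \<longleftrightarrow> u0 \<in> Mon 0 n \<and> i \<in> {1..Suc n} \<and> u = u0 * (tb i (Suc n) * cbp a i) \<and>
       run (tb i (Suc n) * cbp a i) False (f, U) = Some (b, g, W) \<and> run u False (f, U) = run u0 b (g, W) \<and>
       (\<forall>b' g' W'. run u False (f, U) = Some (b', g', W') \<longrightarrow>
          pos g' n = pos f (i - 1) \<and> W' (pos g' n) = (U (pos f (i - 1)) \<noteq> a))" for u u0 i a b g W
    have isI_D: "u0 \<in> Mon 0 n" "i \<in> {1..Suc n}" "u = u0 * (tb i (Suc n) * cbp a i)"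
       "run (tb i (Suc n) * cbp a i) False (f, U) = Some (b, g, W)" "run u False (f, U) = run u0 b (g, W)"
       "\<And>b' g' W'. run u False (f, U) = Some (b', g', W') \<Longrightarrow> pos g' n = pos f (i - 1)"
       "\<And>b' g' W'. run u False (f, U) = Some (b', g', W') \<Longrightarrow> W' (pos g' n) = (U (pos f (i - 1)) \<noteq> a)"
      if "isI u u0 i a b g W" for u u0 i a b g W
      using that unfolding isI_def by blast+
    have dec: "u = z \<or> (\<exists>u0 i a b g W. isI u u0 i a b g W)"
      if "u \<in> Mon 0 (Suc n)" for u
      using that
    proof (cases rule: Mon_bar_cases[OF that _ _ Suc.prems, consumes 0, case_names _ _ Z I II])
      case (I u0 i a)
      obtain b g W where g: "run (tb i (Suc n) * cbp a i) False (f, U) = Some (b, g, W)"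
        "pos g n = pos f (i - 1)" "W (pos g n) = (U (pos f (i - 1)) \<noteq> a)"
        using run_I_bar[OF I(2), of a f U] unfolding diff_Suc_1 by blast
      have r: "run u False (f, U) = run u0 b (g, W)" using run_mult(1)[OF g(1)] I(3) by simp
      have "pos g' n = pos f (i - 1) \<and> W' (pos g' n) = (U (pos f (i - 1)) \<noteq> a)"
        if h: "run u False (f, U) = Some (b', g', W')" for b' g' W'
      proof -
        have "pos g' n = pos g n \<and> W' (pos g' n) = W (pos g n)"
          using I(1) h r by (intro Mon_fixes_bar[of u0 n b g W b' g' W' n]) simp_all
        then show ?thesis using g(2,3) by metis
      qed
      then have "isI u u0 i a b g W" using I g r unfolding isI_def by simp
      then show ?thesis by blast
    qed auto
    show "(run u False (f, U) = None \<longrightarrow> u = z) \<and>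
       (run u False (f, U) = run v False (f, U) \<longrightarrow> run u False (f, U) \<noteq> None \<longrightarrow> u = v)"
    proof (intro conjI impI)
      assume n: "run u False (f, U) = None"
      from dec[OF u] show "u = z"
      proof (elim disjE exE)
        fix u0 i a b g W assume h: "isI u u0 i a b g W"
        have "u0 = z" using inj_at_zero[OF IH isI_D(1)[OF h], of g b W] isI_D(5)[OF h] n by simp
        moreover have "tb i (Suc n) * cbp a i \<in> Mon 0 (Suc n)"
          using isI_D(2)[OF h] Suc.prems by (intro Mon_mult Mon_tb Mon_cbp) auto
        ultimately show "u = z" using isI_D(3)[OF h] Mon_N_z(3) Suc.prems by auto
      qed
    next
      assume e: "run u False (f, U) = run v False (f, U)" and n: "run u False (f, U) \<noteq> None"
      then obtain b' g' W' where r: "run u False (f, U) = Some (b', g', W')" by (cases "run u False (f, U)") auto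
      have r': "run v False (f, U) = Some (b', g', W')" using e r by simp
      have nz: "u \<noteq> z" "v \<noteq> z" using r r' by (auto simp: run_simps)
      obtain u0 i a b g W where h: "isI u u0 i a b g W" using dec[OF u] nz by blast
      obtain v0 i2 a2 b2 g2 W2 where k: "isI v v0 i2 a2 b2 g2 W2" using dec[OF v] nz by blast
      have "pos f (i - 1) = pos f (i2 - 1)" using isI_D(6)[OF h r] isI_D(6)[OF k r'] by simp
      then have i: "i2 = i" using isI_D(2)[OF h] isI_D(2)[OF k] by (auto simp: apply_inj)
      have a: "a2 = a" using isI_D(7)[OF h r] isI_D(7)[OF k r'] unfolding i by blast
      have x: "b2 = b" "g2 = g" "W2 = W" using isI_D(4)[OF h] isI_D(4)[OF k] unfolding i a by auto
      have "run u0 b (g, W) = Some (b', g', W')" "run v0 b (g, W) = Some (b', g', W')"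
        using isI_D(5)[OF h] isI_D(5)[OF k] r r' unfolding x by simp_all
      then have "u0 = v0" using inj_at_eq[OF IH isI_D(1)[OF h] isI_D(1)[OF k], of g b W] by simp
      then show "u = v" using isI_D(3)[OF h] isI_D(3)[OF k] unfolding i a by simp
    qed
  qed
qed

text \<open>The label at position m of the image tells the two normal forms apart: a strand running
  through keeps a label of at least n from the generic state, whereas a strand joined to the other
  side gets a label below n. The index and decoration are then visible, and the induction hypothesis
  compares the rest.\<close>

lemma inj_at: "m \<le> R \<Longrightarrow> n \<le> T \<Longrightarrow> inj_at m n"
proof (induction m)
  case 0
  then show ?case by (rule_tac inj_at_0)
next
  case (Suc m)
  then have IH: "inj_at m n" by simp
  have M: "1 \<le> Suc m" by simp
  have S1: "Suc m - 1 = m" by simp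
  show ?case unfolding inj_at_def
  proof (intro ballI allI impI)
    fix u v f U assume u: "u \<in> Mon (Suc m) n" and v: "v \<in> Mon (Suc m) n"
      and f: "\<forall>p<Suc m. n \<le> f \<langle>$\<rangle> p"
    have fm: "\<forall>p<m. n \<le> f \<langle>$\<rangle> p" "n \<le> f \<langle>$\<rangle> m" using f by auto
    define isI where "isI u u0 i a b g W \<longleftrightarrow> u0 \<in> Mon m n \<and> i \<in> {1..Suc m} \<and> u = u0 * (t i (Suc m) * cp a i) \<and>
       run (t i (Suc m) * cp a i) False (f, U) = Some (b, g, W) \<and> run u False (f, U) = run u0 b (g, W) \<and>
       (\<forall>p<m. n \<le> g \<langle>$\<rangle> p) \<and> (\<forall>b' g' W'. run u False (f, U) = Some (b', g', W') \<longrightarrow>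
          g' \<langle>$\<rangle> m = f \<langle>$\<rangle> (i - 1) \<and> W' m = (U (i - 1) \<noteq> a))" for u u0 i a b g W
    define isII where "isII u u0 j a \<longleftrightarrow> u0 \<in> Mon m n \<and> j \<in> {1..n} \<and> u = cp a (Suc m) * (e2 (Suc m) j * u0) \<and>
       (run u False (f, U) = None \<longrightarrow> run u0 False (f, U) = None) \<and>
       (\<forall>b' g' W'. run u False (f, U) = Some (b', g', W') \<longrightarrow> g' \<langle>$\<rangle> m = j - 1 \<and> W' m = a)" for u u0 j a
    have isI_D: "u0 \<in> Mon m n" "i \<in> {1..Suc m}" "u = u0 * (t i (Suc m) * cp a i)"
       "run (t i (Suc m) * cp a i) False (f, U) = Some (b, g, W)" "run u False (f, U) = run u0 b (g, W)"
       "\<forall>p<m. n \<le> g \<langle>$\<rangle> p"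
       "\<And>b' g' W'. run u False (f, U) = Some (b', g', W') \<Longrightarrow> g' \<langle>$\<rangle> m = f \<langle>$\<rangle> (i - 1)"
       "\<And>b' g' W'. run u False (f, U) = Some (b', g', W') \<Longrightarrow> W' m = (U (i - 1) \<noteq> a)"
      if "isI u u0 i a b g W" for u u0 i a b g W
      using that unfolding isI_def by blast+
    have isII_D: "u0 \<in> Mon m n" "j \<in> {1..n}" "u = cp a (Suc m) * (e2 (Suc m) j * u0)"
       "run u False (f, U) = None \<Longrightarrow> run u0 False (f, U) = None"
       "\<And>b' g' W'. run u False (f, U) = Some (b', g', W') \<Longrightarrow> g' \<langle>$\<rangle> m = j - 1"
       "\<And>b' g' W'. run u False (f, U) = Some (b', g', W') \<Longrightarrow> W' m = a"
      if "isII u u0 j a" for u u0 j a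
      using that unfolding isII_def by blast+
    have dec: "u = z \<or> (\<exists>u0 i a b g W. isI u u0 i a b g W) \<or> (\<exists>u0 j a. isII u u0 j a)"
      if "u \<in> Mon (Suc m) n" for u
      using that
    proof (cases rule: Mon_cases[OF that M Suc.prems, consumes 0, case_names Z I II])
      case (I u0 i a)
      obtain b g W where g: "run (t i (Suc m) * cp a i) False (f, U) = Some (b, g, W)"
        "\<forall>p<Suc m. n \<le> g \<langle>$\<rangle> p" "g \<langle>$\<rangle> m = f \<langle>$\<rangle> (i - 1)" "W m = (U (i - 1) \<noteq> a)"
        using run_I[OF f I(2), of a U] unfolding diff_Suc_1 by blast
      have r: "run u False (f, U) = run u0 b (g, W)" using run_mult(1)[OF g(1)] I(3) by simp
      have "g' \<langle>$\<rangle> m = f \<langle>$\<rangle> (i - 1) \<and> W' m = (U (i - 1) \<noteq> a)"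
        if h: "run u False (f, U) = Some (b', g', W')" for b' g' W'
      proof -
        have "g' \<langle>$\<rangle> m = g \<langle>$\<rangle> m \<and> W' m = W m"
          using I(1) h r g(2) by (intro Mon_fixes[of u0 m n b g W b' g' W' m]) simp_all
        then show ?thesis using g(3,4) by metis
      qed
      then have "isI u u0 i a b g W" using I g r unfolding isI_def by simp
      then show ?thesis by blast
    next
      case (II u0 j a)
      have u0: "u0 \<in> Mon m n" using II by simp
      have ne: "run u0 False (f, U) = None" if "run u False (f, U) = None"
      proof (rule ccontr)
        assume "run u0 False (f, U) \<noteq> None"
        then obtain b g W where g: "run u0 False (f, U) = Some (b, g, W)" by (cases "run u0 False (f, U)") auto
        have "n \<le> g \<langle>$\<rangle> (Suc m - 1)" using Mon_fixes[OF u0 g, of m] fm by simp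
        from run_II(2)[OF g this _ II(2), of a] that II(3) show False by auto
      qed
      have "g' \<langle>$\<rangle> m = j - 1 \<and> W' m = a" if h: "run u False (f, U) = Some (b', g', W')" for b' g' W'
      proof -
        have "run u0 False (f, U) \<noteq> None" using h II(3) run_not_None by (metis option.distinct(1))
        then obtain b g W where g: "run u0 False (f, U) = Some (b, g, W)" by (cases "run u0 False (f, U)") auto
        have "n \<le> g \<langle>$\<rangle> (Suc m - 1)" using Mon_fixes[OF u0 g, of m] fm by simp
        from run_II(2)[OF g this _ II(2), of a] h II(3) show ?thesis by auto
      qed
      then have "isII u u0 j a" using II ne unfolding isII_def by simp
      then show ?thesis by blast
    qed auto
    have absorb: "x \<in> Mon R T \<Longrightarrow> z * x = z \<and> x * z = z" for x using Mon_N_z by blast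
    show "(run u False (f, U) = None \<longrightarrow> u = z) \<and>
       (run u False (f, U) = run v False (f, U) \<longrightarrow> run u False (f, U) \<noteq> None \<longrightarrow> u = v)"
    proof (intro conjI impI)
      assume n: "run u False (f, U) = None"
      from dec[OF u] show "u = z"
      proof (elim disjE exE)
        fix u0 i a b g W assume h: "isI u u0 i a b g W"
        have "u0 = z" using inj_at_zero[OF IH isI_D(1,6)[OF h], of b W] isI_D(5)[OF h] n by simp
        moreover have "t i (Suc m) * cp a i \<in> Mon R T"
          using isI_D(2)[OF h] Suc.prems by (intro Mon_mult Mon_t Mon_cp) auto
        ultimately show "u = z" using absorb[of "t i (Suc m) * cp a i"] isI_D(3)[OF h] by simp
      next
        fix u0 j a assume h: "isII u u0 j a"
        have "u0 = z" using inj_at_zero[OF IH isII_D(1)[OF h] fm(1) isII_D(4)[OF h n]] .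
        moreover have "e2 (Suc m) j \<in> Mon R T" "cp a (Suc m) \<in> Mon R T"
          using isII_D(2)[OF h] Suc.prems by (auto intro!: Mon_e2 Mon_cp)
        ultimately show "u = z" using absorb[of "e2 (Suc m) j"] absorb[of "cp a (Suc m)"] isII_D(3)[OF h] by simp
      qed
    next
      assume e: "run u False (f, U) = run v False (f, U)" and n: "run u False (f, U) \<noteq> None"
      then obtain b' g' W' where r: "run u False (f, U) = Some (b', g', W')" by (cases "run u False (f, U)") auto
      have r': "run v False (f, U) = Some (b', g', W')" using e r by simp
      have nz: "u \<noteq> z" "v \<noteq> z" using r r' by (auto simp: run_simps)
      have I_lab: "n \<le> g' \<langle>$\<rangle> m" if "isI w w0 i a b g W" "run w False (f, U) = Some (b', g', W')" for w w0 i a b g W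
      proof -
        have "i - 1 < Suc m" using isI_D(2)[OF that(1)] by auto
        then show ?thesis using isI_D(7)[OF that] f by simp
      qed
      have II_lab: "g' \<langle>$\<rangle> m < n" if "isII w w0 j a" "run w False (f, U) = Some (b', g', W')" for w w0 j a
        using isII_D(5)[OF that] isII_D(2)[OF that(1)] by auto
      from dec[OF u] dec[OF v] nz consider
        (I) u0 i a b g W v0 i2 a2 b2 g2 W2 where "isI u u0 i a b g W" "isI v v0 i2 a2 b2 g2 W2"
        | (II) u0 j a v0 j2 a2 where "isII u u0 j a" "isII v v0 j2 a2"
        | (bad) "n \<le> g' \<langle>$\<rangle> m" "g' \<langle>$\<rangle> m < n"
        using I_lab[OF _ r] I_lab[OF _ r'] II_lab[OF _ r] II_lab[OF _ r'] by metis
      then show "u = v"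
      proof cases
        case (I u0 i a b g W v0 i2 a2 b2 g2 W2)
        have "f \<langle>$\<rangle> (i - 1) = f \<langle>$\<rangle> (i2 - 1)" using isI_D(7)[OF I(1) r] isI_D(7)[OF I(2) r'] by simp
        then have i: "i2 = i" using isI_D(2)[OF I(1)] isI_D(2)[OF I(2)] by (auto simp: apply_inj)
        have a: "a2 = a" using isI_D(8)[OF I(1) r] isI_D(8)[OF I(2) r'] unfolding i by blast
        have x: "b2 = b" "g2 = g" "W2 = W" using isI_D(4)[OF I(1)] isI_D(4)[OF I(2)] unfolding i a by auto
        have "run u0 b (g, W) = Some (b', g', W')" "run v0 b (g, W) = Some (b', g', W')"
          using isI_D(5)[OF I(1)] isI_D(5)[OF I(2)] r r' unfolding x by simp_all
        then have "u0 = v0"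
          using inj_at_eq[OF IH isI_D(1)[OF I(1)] isI_D(1)[OF I(2)] isI_D(6)[OF I(1)], of b W] by simp
        then show "u = v" using isI_D(3)[OF I(1)] isI_D(3)[OF I(2)] unfolding i a by simp
      next
        case (II u0 j a v0 j2 a2)
        have "j - 1 = j2 - 1" using isII_D(5)[OF II(1) r] isII_D(5)[OF II(2) r'] by simp
        then have j: "j2 = j" using isII_D(2)[OF II(1)] isII_D(2)[OF II(2)] by auto
        have a: "a2 = a" using isII_D(6)[OF II(1) r] isII_D(6)[OF II(2) r'] by simp
        have jn: "j \<in> {1..n}" by (rule isII_D(2)[OF II(1)])
        have u0: "u0 \<in> Mon m n" "v0 \<in> Mon m n" using isII_D(1)[OF II(1)] isII_D(1)[OF II(2)] .
        have uv0: "u = cp a (Suc m) * (e2 (Suc m) j * u0)" "v = cp a (Suc m) * (e2 (Suc m) j * v0)"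
          using isII_D(3)[OF II(1)] isII_D(3)[OF II(2)] unfolding j a .
        have uv: "u = cp a (Suc m) * (tb 1 j * (t 1 (Suc m) * (e * (t 1 (Suc m) * (tb 1 j * u0)))))"
          "v = cp a (Suc m) * (tb 1 j * (t 1 (Suc m) * (e * (t 1 (Suc m) * (tb 1 j * v0)))))"
          using uv0 by (simp_all add: e2_def mult.assoc)
        have jT: "1 \<in> {1..T}" "j \<in> {1..T}" "1 \<in> {1..R}" "Suc m \<in> {1..R}"
          using jn Suc.prems by auto
        obtain w where w: "w * cp a (Suc m) = 1" using cp_inverse[of "Suc m" a] Suc.prems by auto
        \<comment> \<open>The factors to the left of e are invertible and drop out. Those between e
          and \<open>u0\<close> can be cancelled only after \<open>run_e_inj\<close>.\<close>
        from e[unfolded uv] have e1: "run (e * (t 1 (Suc m) * (tb 1 j * u0))) False (f, U)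
            = run (e * (t 1 (Suc m) * (tb 1 j * v0))) False (f, U)"
          using run_cancel[OF w] run_cancel[OF W.tr_square[OF jT(1,2)]] run_cancel[OF V.tr_square[OF jT(3,4)]]
          by blast
        have "\<exists>b1 g1 W1. run (t 1 (Suc m) * (tb 1 j * x)) False (f, U) = Some (b1, g1, W1) \<and>
            g1 \<langle>$\<rangle> 0 = f \<langle>$\<rangle> m \<and> W1 0 = U m \<and> run x False (f, U) \<noteq> None"
          if x: "x \<in> Mon m n" "run (cp a (Suc m) * (e2 (Suc m) j * x)) False (f, U) \<noteq> None" for x
        proof -
          have "run x False (f, U) \<noteq> None" using x(2) run_not_None by blast
          then obtain b g W where g: "run x False (f, U) = Some (b, g, W)" by (cases "run x False (f, U)") auto
          have fix': "g \<langle>$\<rangle> m = f \<langle>$\<rangle> m \<and> W m = U m" using Mon_fixes[OF x(1) g, of m] fm by simp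
          then show ?thesis using run_II(1)[OF g _ M jn] fm g by simp
        qed
        moreover have "run (cp a (Suc m) * (e2 (Suc m) j * u0)) False (f, U) \<noteq> None"
          "run (cp a (Suc m) * (e2 (Suc m) j * v0)) False (f, U) \<noteq> None"
          using uv0 r r' by simp_all
        ultimately obtain b1 g1 W1 b2 g2 W2 where
          1: "run (t 1 (Suc m) * (tb 1 j * u0)) False (f, U) = Some (b1, g1, W1)"
            "g1 \<langle>$\<rangle> 0 = f \<langle>$\<rangle> m" "W1 0 = U m" "run u0 False (f, U) \<noteq> None" and
          2: "run (t 1 (Suc m) * (tb 1 j * v0)) False (f, U) = Some (b2, g2, W2)"
            "g2 \<langle>$\<rangle> 0 = f \<langle>$\<rangle> m" "W2 0 = U m"
          using u0 by metis
        have "b1 = b2 \<and> g1 = g2 \<and> W1 = W2"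
        proof (rule run_e_inj)
          show "run e b1 (g1, W1) = run e b2 (g2, W2)" using e1 run_mult(1)[OF 1(1)] run_mult(1)[OF 2(1)] by simp
          show "g1 \<langle>$\<rangle> 0 \<noteq> 0" using 1 fm jn by auto
        qed (use 1 2 in auto)
        then have "run (t 1 (Suc m) * (tb 1 j * u0)) False (f, U) = run (t 1 (Suc m) * (tb 1 j * v0)) False (f, U)"
          using 1 2 by simp
        then have "run u0 False (f, U) = run v0 False (f, U)"
          using run_cancel[OF W.tr_square[OF jT(1,2)]] run_cancel[OF V.tr_square[OF jT(3,4)]] by blast
        then have "u0 = v0" using inj_at_eq[OF IH u0 fm(1) _ 1(4)] by blast
        then show "u = v" using uv by simp
      qed auto
    qed
  qed
qed

end

section \<open>Evaluation of noncommutative polynomials\<close>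

abbreviation lookup where "lookup \<equiv> Poly_Mapping.lookup"
abbreviation keys where "keys \<equiv> Poly_Mapping.keys"
abbreviation single where "single \<equiv> Poly_Mapping.single"

lemma poly_mapping_sum_single:
  fixes p :: "'w \<Rightarrow>\<^sub>0 'a::comm_monoid_add"
  shows "p = (\<Sum>w\<in>keys p. single w (lookup p w))"
proof (rule poly_mapping_eqI)
  fix k
  have "lookup (\<Sum>w\<in>keys p. single w (lookup p w)) k = (\<Sum>w\<in>keys p. if w = k then lookup p w else 0)"
    by (simp add: lookup_sum lookup_single when_def)
  also have "\<dots> = lookup p k" by (simp add: in_keys_iff)
  finally show "lookup p k = lookup (\<Sum>w\<in>keys p. single w (lookup p w)) k" by simp
qed

lemma poly_mapping_single_induct [case_names single add]:
  fixes p :: "'w \<Rightarrow>\<^sub>0 'a::comm_monoid_add"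
  assumes "\<And>w a. P (single w a)" "\<And>p q. P p \<Longrightarrow> P q \<Longrightarrow> P (p + q)"
  shows "P p"
proof -
  have "P (\<Sum>w\<in>A. single w (lookup p w))" if "finite A" for A
    using that by induction (use assms assms(1)[of undefined 0] in auto)
  from this[of "keys p"] poly_mapping_sum_single[of p] show ?thesis by simp
qed

definition word :: "('g \<Rightarrow> 'c::monoid_mult) \<Rightarrow> 'g free_word \<Rightarrow> 'c" where
  "word g w = prod_list (map g (letters w))"

lemma word_simps: "word g 0 = 1" "word g (u + v) = word g u * word g v" "word g (Word [x]) = g x"
  by (simp_all add: word_def zero_free_word_def plus_free_word_def)

locale central_hom =
  fixes emb :: "'a::comm_ring_1 \<Rightarrow> 'c::ring_1"
  assumes emb_add: "emb (a + b) = emb a + emb b" and emb_mult: "emb (a * b) = emb a * emb b"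
    and emb_1: "emb 1 = 1" and emb_central: "emb a * x = x * emb a"
begin

lemma emb_0: "emb 0 = 0"
  using emb_add[of 0 0] by simp

definition ev :: "('g \<Rightarrow> 'c) \<Rightarrow> ('g, 'a) free_algebra \<Rightarrow> 'c" where
  "ev g p = (\<Sum>w\<in>keys p. emb (lookup p w) * word g w)"

lemma ev_superset: "finite A \<Longrightarrow> keys p \<subseteq> A \<Longrightarrow> ev g p = (\<Sum>w\<in>A. emb (lookup p w) * word g w)"
  unfolding ev_def by (rule sum.mono_neutral_left) (auto simp: emb_0 in_keys_iff)

lemma ev_add: "ev g (p + q) = ev g p + ev g q"
proof -
  have "keys (p + q) \<subseteq> keys p \<union> keys q" by (rule Poly_Mapping.keys_add)
  then show ?thesis
    by (simp add: ev_superset[of "keys p \<union> keys q"] lookup_add emb_add distrib_right sum.distrib)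
qed

lemma ev_single: "ev g (single w a) = emb a * word g w"
  by (simp add: ev_def emb_0)

lemma ev_mult: "ev g (p * q) = ev g p * ev g q"
proof (induction p rule: poly_mapping_single_induct)
  case (single u a)
  show ?case
  proof (induction q rule: poly_mapping_single_induct)
    case (single v b)
    show ?case by (simp add: mult_single ev_single emb_mult word_simps mult.assoc)
        (metis emb_central mult.assoc)
  qed (simp add: ev_add distrib_left)
qed (simp add: ev_add distrib_right)

lemma ev_simps:
  "ev g 0 = 0" "ev g 1 = 1" "ev g (- p) = - ev g p" "ev g (p - q) = ev g p - ev g q"
  "ev g (scalar a) = emb a" "ev g (var x) = g x" "ev g (p ^ n) = ev g p ^ n"
  "ev g (sum h A) = (\<Sum>i\<in>A. ev g (h i))" "ev g (prod_list ps) = prod_list (map (ev g) ps)"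
proof -
  show 0: "ev g 0 = 0" by (simp add: ev_def)
  show 1: "ev g 1 = 1"
    using ev_single[of g 0 1] by (simp add: emb_1 word_simps)
  show m: "ev g (- p) = - ev g p" for p
    using ev_add[of g p "- p"] 0 by (simp add: add_eq_0_iff)
  show "ev g (p - q) = ev g p - ev g q"
    using ev_add[of g p "- q"] m by simp
  show "ev g (scalar a) = emb a" "ev g (var x) = g x"
    by (simp_all add: scalar_def var_def ev_single word_simps emb_1)
  show "ev g (p ^ n) = ev g p ^ n" by (induction n) (simp_all add: 1 ev_mult)
  show "ev g (sum h A) = (\<Sum>i\<in>A. ev g (h i))"
    by (induction A rule: infinite_finite_induct) (simp_all add: 0 ev_add)
  show "ev g (prod_list ps) = prod_list (map (ev g) ps)"
    by (induction ps) (simp_all add: 1 ev_mult)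
qed

end

section \<open>The ring of linear operators on functions on states\<close>

definition sgn_val :: "(state \<Rightarrow> 'a::comm_ring_1) \<Rightarrow> pstate \<Rightarrow> 'a" where
  "sgn_val \<phi> X = (case X of None \<Rightarrow> 0 | Some (b, y) \<Rightarrow> if b then - \<phi> y else \<phi> y)"

text \<open>Functions need no condition of finite support, at the price that a partial map acts by
  pull-back. Additivity of the operators makes the ring distributive, and homogeneity makes the
  scalars central.\<close>

typedef (overloaded) 'a lin = "{F :: (state \<Rightarrow> 'a::comm_ring_1) \<Rightarrow> state \<Rightarrow> 'a.
    (\<forall>f g. F (\<lambda>x. f x + g x) = (\<lambda>x. F f x + F g x)) \<and> (\<forall>a f. F (\<lambda>x. a * f x) = (\<lambda>x. a * F f x))}"
  morphisms lapp Abs_lin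
  by (rule exI[of _ "\<lambda>f. f"]) auto

setup_lifting type_definition_lin

text \<open>The product of two operators is their composition in reversed order, as operators act on
  functions on states and not on states.\<close>

instantiation lin :: (comm_ring_1) ring_1
begin
lift_definition zero_lin :: "'a lin" is "\<lambda>f x. 0" by auto
lift_definition one_lin :: "'a lin" is "\<lambda>f. f" by auto
lift_definition plus_lin :: "'a lin \<Rightarrow> 'a lin \<Rightarrow> 'a lin" is "\<lambda>F G f x. F f x + G f x"
  by (auto simp: algebra_simps)
lift_definition minus_lin :: "'a lin \<Rightarrow> 'a lin \<Rightarrow> 'a lin" is "\<lambda>F G f x. F f x - G f x"
  by (auto simp: algebra_simps)
lift_definition uminus_lin :: "'a lin \<Rightarrow> 'a lin" is "\<lambda>F f x. - F f x"
  by (auto simp: algebra_simps)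
lift_definition times_lin :: "'a lin \<Rightarrow> 'a lin \<Rightarrow> 'a lin" is "\<lambda>F G f. G (F f)"
  by auto
instance
proof
  fix a b c :: "'a lin"
  note s = lapp_inject[symmetric] fun_eq_iff zero_lin.rep_eq one_lin.rep_eq plus_lin.rep_eq
    minus_lin.rep_eq uminus_lin.rep_eq times_lin.rep_eq
  have lapp: "lapp F (\<lambda>x. f x + g x) = (\<lambda>x. lapp F f x + lapp F g x)"
    "lapp F (\<lambda>x. 0) = (\<lambda>x. 0)" for F :: "'a lin" and f g
  proof -
    show "lapp F (\<lambda>x. f x + g x) = (\<lambda>x. lapp F f x + lapp F g x)" using lapp[of F] by simp
    have "\<And>a f. lapp F (\<lambda>x. a * f x) = (\<lambda>x. a * lapp F f x)" using lapp[of F] by simp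
    from this[of 0 "\<lambda>_. 0"] show "lapp F (\<lambda>x. 0) = (\<lambda>x. 0)" by simp
  qed
  have "lapp (0 :: 'a lin) (\<lambda>_. 1) undefined \<noteq> lapp 1 (\<lambda>_. 1) undefined"
    by (simp add: zero_lin.rep_eq one_lin.rep_eq)
  then show "(0 :: 'a lin) \<noteq> 1" by auto
  show "a * b * c = a * (b * c)" "1 * a = a" "a * 1 = a" "a + b + c = a + (b + c)" "a + b = b + a"
    "0 + a = a" "- a + a = 0" "a - b = a + - b" by (simp_all add: s)
  show "(a + b) * c = a * c + b * c" "a * (b + c) = a * b + a * c" by (simp_all add: s lapp)
qed
end

lift_definition scal :: "'a::comm_ring_1 \<Rightarrow> 'a lin" is "\<lambda>a f x. a * f x"
  by (auto simp: algebra_simps)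

lemma sgn_val_flip: "sgn_val \<phi> (flip b X) = (if b then - sgn_val \<phi> X else sgn_val \<phi> X)"
  by (cases X) (auto simp: sgn_val_def)

lift_definition linrep :: "pfun \<Rightarrow> 'a::comm_ring_1 lin" is
  "\<lambda>h \<phi> x. sgn_val \<phi> (h (Some (False, x)))"
  by (auto simp: sgn_val_def fun_eq_iff algebra_simps split: option.splits)

lemma lapp_simps:
  "lapp 0 f x = 0" "lapp 1 f x = f x" "lapp (F + G) f x = lapp F f x + lapp G f x"
  "lapp (F - G) f x = lapp F f x - lapp G f x" "lapp (- F) f x = - lapp F f x"
  "lapp (F * G) f = lapp G (lapp F f)" "lapp (scal a) f x = a * f x"
  "lapp (linrep h) \<phi> x = sgn_val \<phi> (app h (Some (False, x)))"
  by (transfer; simp)+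

lemma lapp_scal: "lapp (scal a) f = (\<lambda>x. a * f x)"
  by transfer simp

lemma lapp_sum: "lapp (sum F A) f x = (\<Sum>i\<in>A. lapp (F i) f x)"
  by (induction A rule: infinite_finite_induct) (simp_all add: lapp_simps)

lemma lapp_scale: "lapp F (\<lambda>x. a * f x) = (\<lambda>x. a * lapp F f x)"
  by transfer auto

lemma lin_eqI: "(\<And>f x. lapp F f x = lapp G f x) \<Longrightarrow> F = G"
  by (simp add: lapp_inject[symmetric] fun_eq_iff)

lemma linrep_hom:
  "linrep (f * g) = (linrep f * linrep g :: 'a::comm_ring_1 lin)" "linrep 1 = (1 :: 'a lin)"
  "linrep neg_pfun = (- 1 :: 'a lin)" "linrep zero_pfun = (0 :: 'a lin)"
proof -
  show "linrep (f * g) = (linrep f * linrep g :: 'a lin)"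
  proof (rule lin_eqI)
    fix \<phi> :: "state \<Rightarrow> 'a" and x
    show "lapp (linrep (f * g)) \<phi> x = lapp (linrep f * linrep g) \<phi> x"
    proof (cases "app g (Some (False, x))")
      case (Some by')
      obtain b y where "by' = (b, y)" by (cases by')
      moreover have "app f (Some (b, y)) = flip b (app f (Some (False, y)))"
        using app_simps(2)[of f b "Some (False, y)"] by simp
      ultimately show ?thesis using Some
        by (simp add: lapp_simps app_simps sgn_val_flip) (simp add: sgn_val_def lapp_simps)
    qed (simp add: lapp_simps app_simps sgn_val_def)
  qed
qed (rule lin_eqI; simp add: lapp_simps app_simps sgn_val_def)+

interpretation scal: central_hom "scal :: 'a::comm_ring_1 \<Rightarrow> 'a lin"
  by unfold_locales (rule lin_eqI; simp add: lapp_simps lapp_scal lapp_scale algebra_simps)+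

definition rho :: "(bc_gen, 'a::comm_ring_1) free_algebra \<Rightarrow> 'a lin" where
  "rho = scal.ev (\<lambda>g. linrep (gp g))"

lemma linrep_word: "word (\<lambda>g. linrep (gp g)) w = linrep (word gp w)"
proof -
  have "prod_list (map (\<lambda>g. linrep (gp g)) xs) = linrep (prod_list (map gp xs))" for xs
    by (induction xs) (simp_all add: linrep_hom)
  then show ?thesis by (simp add: word_def)
qed

lemma lapp_rho: "lapp (rho p) \<phi> x = (\<Sum>w\<in>keys p. lookup p w * sgn_val \<phi> (app (word gp w) (Some (False, x))))"
proof -
  have "sgn_val (\<lambda>x. a * \<phi> x) X = a * sgn_val \<phi> X" for a :: 'a and X
    by (auto simp: sgn_val_def split: option.splits)
  then show ?thesis
    by (simp add: rho_def scal.ev_def lapp_sum lapp_simps lapp_scal linrep_word)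
qed

section \<open>Presented superalgebras\<close>

lemmas free_ops = free_carrier_0 free_carrier_1 free_carrier_mult free_carrier_add free_carrier_uminus
  free_carrier_scalar

lemma carrier_free_words: "p \<in> carrier (free_superalgebra ogen G) \<longleftrightarrow> (\<forall>w\<in>keys p. set (letters w) \<subseteq> G)"
  by (simp add: carrier_free_superalgebra)

lemma a_minus_free:
  assumes "p \<in> carrier (free_superalgebra ogen G)" "q \<in> carrier (free_superalgebra ogen G)"
  shows "p \<ominus>\<^bsub>free_superalgebra ogen G\<^esub> q = p - q"
proof -
  interpret F: ring "free_superalgebra ogen G" by (rule ring_free_superalgebra)
  have "\<ominus>\<^bsub>free_superalgebra ogen G\<^esub> q = - q"
    using assms(2) by (intro F.minus_equality) (auto simp: free_superalgebra_simps free_carrier_uminus)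
  then show ?thesis by (simp add: a_minus_def free_superalgebra_simps)
qed

locale presentation =
  fixes ogen :: "'g \<Rightarrow> bool" and G :: "'g set"
    and Rel :: "(('g, 'a::comm_ring_1) free_algebra \<times> ('g, 'a) free_algebra) set"
  assumes Rel: "\<And>p q. (p, q) \<in> Rel \<Longrightarrow> p - q \<in> carrier (free_superalgebra ogen G)"
begin

abbreviation "F \<equiv> free_superalgebra ogen G"
abbreviation "I \<equiv> relation_ideal ogen G Rel"
abbreviation "Q \<equiv> presented_superalgebra ogen G Rel"
abbreviation "cls \<equiv> presented_class ogen G Rel"

sublocale F: ring F by (rule ring_free_superalgebra)
sublocale I: ideal I F by (rule ring_presented_superalgebra(1)[OF Rel])

lemma I_carrier: "p \<in> I \<Longrightarrow> p \<in> carrier F"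
  by (rule I.a_Hcarr)

lemma I_ops:
  "0 \<in> I" "p \<in> I \<Longrightarrow> q \<in> I \<Longrightarrow> p + q \<in> I" "p \<in> I \<Longrightarrow> - p \<in> I" "p \<in> I \<Longrightarrow> q \<in> I \<Longrightarrow> p - q \<in> I"
  "a \<in> carrier F \<Longrightarrow> p \<in> I \<Longrightarrow> a * p \<in> I" "a \<in> carrier F \<Longrightarrow> p \<in> I \<Longrightarrow> p * a \<in> I"
proof -
  show 0: "0 \<in> I" using I.zero_closed by (simp add: free_superalgebra_simps)
  show add: "p + q \<in> I" if "p \<in> I" "q \<in> I" for p q
    using I.a_closed[OF that] by (simp add: free_superalgebra_simps)
  show l: "a * p \<in> I" if "a \<in> carrier F" "p \<in> I" for a p
    using I.I_l_closed[OF that(2,1)] by (simp add: free_superalgebra_simps)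
  show "p * a \<in> I" if "a \<in> carrier F" "p \<in> I"
    using I.I_r_closed[OF that(2,1)] by (simp add: free_superalgebra_simps)
  show neg: "- p \<in> I" if "p \<in> I" for p
    using l[OF free_carrier_uminus[OF free_carrier_1] that] by simp
  show "p - q \<in> I" if "p \<in> I" "q \<in> I"
    using add[OF that(1) neg[OF that(2)]] by simp
qed

lemma Rel_I: "(p, q) \<in> Rel \<Longrightarrow> p - q \<in> I"
  unfolding relation_ideal_def using F.genideal_self[of "{p - q |p q. (p, q) \<in> Rel}"] Rel by blast

lemma I_least:
  assumes "ideal J F" "\<And>p q. (p, q) \<in> Rel \<Longrightarrow> p - q \<in> J" shows "I \<subseteq> J"
  unfolding relation_ideal_def using assms by (intro F.genideal_minimal) auto

lemma cls_eq_iff: "p \<in> carrier F \<Longrightarrow> q \<in> carrier F \<Longrightarrow> cls p = cls q \<longleftrightarrow> p - q \<in> I"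
  using F.quotient_eq_iff_same_a_r_cos[OF I.ideal_axioms, of p q] a_minus_free[of p ogen G q]
  unfolding presented_class_def by simp

lemma Q_simps:
  "carrier Q = cls ` carrier F" "\<one>\<^bsub>Q\<^esub> = cls 1"
  "even_part Q = cls ` even_part F" "odd_part Q = cls ` odd_part F"
proof -
  show "carrier Q = cls ` carrier F" 
    unfolding presented_superalgebra_def quotient_superalgebra_def presented_class_def FactRing_def
      A_RCOSETS_def' by auto
  show "\<one>\<^bsub>Q\<^esub> = cls 1"
    unfolding presented_superalgebra_def quotient_superalgebra_def presented_class_def FactRing_def
    by (simp add: free_superalgebra_simps)
  show "even_part Q = cls ` even_part F" "odd_part Q = cls ` odd_part F"
    by (simp_all add: presented_superalgebra_def quotient_superalgebra_def presented_class_def)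
qed

lemma Q_ops:
  assumes "p \<in> carrier F" "q \<in> carrier F"
  shows "cls p \<oplus>\<^bsub>Q\<^esub> cls q = cls (p + q)" "cls p \<otimes>\<^bsub>Q\<^esub> cls q = cls (p * q)"
  using I.a_rcos_sum[OF assms] I.rcoset_mult_add[OF assms]
  by (simp_all add: presented_superalgebra_def quotient_superalgebra_def presented_class_def FactRing_def
      free_superalgebra_simps)

lemma cls_self: "p \<in> carrier F \<Longrightarrow> p \<in> cls p"
  unfolding presented_class_def by (rule I.a_rcos_self)

lemma cls_mem:
  assumes "p \<in> carrier F" "q \<in> cls p" shows "q \<in> carrier F \<and> cls q = cls p"
proof -
  obtain i where i: "i \<in> I" "q = i + p"
    using assms(2) unfolding presented_class_def a_r_coset_def' by (auto simp: free_superalgebra_simps)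
  then have "q \<in> carrier F" using assms(1) I_carrier by (auto intro: free_carrier_add)
  then show ?thesis using i assms(1) by (simp add: cls_eq_iff)
qed

text \<open>In the quotient the scalar multiple is a union over all representatives; each of them
  contributes the same coset.\<close>

lemma Q_smult:
  assumes "p \<in> carrier F" shows "a \<odot>\<^bsub>Q\<^esub> cls p = cls (scalar a * p)"
proof -
  have eq: "cls (scalar a * x) = cls (scalar a * p)" if "x \<in> cls p" for x
  proof -
    have x: "x \<in> carrier F" "cls x = cls p" using cls_mem[OF assms that] by auto
    have "scalar a * x - scalar a * p = scalar a * (x - p)" by (simp add: algebra_simps)
    also have "\<dots> \<in> I" using x cls_eq_iff[OF x(1) assms] by (intro I_ops(5) free_carrier_scalar) auto
    finally show ?thesis
      using x assms by (subst cls_eq_iff) (auto intro!: free_carrier_mult free_carrier_scalar)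
  qed
  have "a \<odot>\<^bsub>Q\<^esub> cls p = (\<Union>x\<in>cls p. cls (scalar a * x))"
    by (simp add: presented_superalgebra_def quotient_superalgebra_def presented_class_def
        free_superalgebra_def Let_def)
  then show ?thesis using eq cls_self[OF assms] by blast
qed

end

lemma (in presentation) ev_I:
  assumes "central_hom emb" and rel: "\<And>p q. (p, q) \<in> Rel \<Longrightarrow> central_hom.ev emb g p = central_hom.ev emb g q"
    and "p \<in> I"
  shows "central_hom.ev emb g p = 0"
proof -
  interpret h: central_hom emb by (rule assms(1))
  let ?J = "{p \<in> carrier F. h.ev g p = 0}"
  have "ideal ?J F"
  proof (rule idealI)
    show "subgroup ?J (add_monoid F)"
    proof
      fix x assume "x \<in> ?J"
      moreover from this have "\<ominus>\<^bsub>F\<^esub> x = - x"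
        by (intro F.minus_equality) (auto simp: free_superalgebra_simps free_carrier_uminus)
      ultimately show "inv\<^bsub>add_monoid F\<^esub> x \<in> ?J"
        by (simp add: a_inv_def h.ev_simps free_carrier_uminus)
    qed (auto simp: free_superalgebra_simps h.ev_simps h.ev_add free_ops)
  qed (auto simp: free_superalgebra_simps h.ev_simps h.ev_mult free_ops intro: F.ring_axioms)
  moreover have "p - q \<in> ?J" if "(p, q) \<in> Rel" for p q
    using Rel[OF that] rel[OF that] by (simp add: h.ev_simps)
  ultimately have "I \<subseteq> ?J" by (rule I_least)
  then show ?thesis using assms(3) by blast
qed

typedef 'x endo = "UNIV :: ('x \<Rightarrow> 'x) set" morphisms eapp Abs_endo by simp

setup_lifting type_definition_endo

instantiation endo :: (type) monoid_mult
begin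
lift_definition one_endo :: "'x endo" is id .
lift_definition times_endo :: "'x endo \<Rightarrow> 'x endo \<Rightarrow> 'x endo" is "(\<circ>)" .
instance by standard (transfer; simp add: comp_assoc)+
end

lemma endo_eqI: "(\<And>X. eapp f X = eapp g X) \<Longrightarrow> f = g"
  by transfer auto

section \<open>The quotient algebra as a monoid of left multiplications\<close>

context presentation begin

text \<open>The quotient is a record structure and not a type, while \<open>wbc\<close> needs a type
  of class \<open>monoid_mult\<close>; left multiplications on cosets supply one. Acting as the
  identity elsewhere keeps \<open>lmul\<close> multiplicative and sends 1 to 1.\<close>

definition lmul :: "('g, 'a) free_algebra \<Rightarrow> ('g, 'a) free_algebra set endo" where
  "lmul p = Abs_endo (\<lambda>X. if X \<in> cls ` carrier F then cls (p * (SOME x. x \<in> carrier F \<and> cls x = X)) else X)"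

lemma eapp_lmul:
  assumes "p \<in> carrier F" "q \<in> carrier F"
  shows "eapp (lmul p) (cls q) = cls (p * q)"
proof -
  define x where "x = (SOME x. x \<in> carrier F \<and> cls x = cls q)"
  have x: "x \<in> carrier F" "cls x = cls q"
    using someI[of "\<lambda>x. x \<in> carrier F \<and> cls x = cls q" q] assms(2) unfolding x_def by auto
  have "x - q \<in> I" using cls_eq_iff[OF x(1) assms(2)] x(2) by simp
  then have "p * x - p * q \<in> I" using I_ops(5)[OF assms(1)] by (simp flip: right_diff_distrib)
  then have "cls (p * x) = cls (p * q)" using assms x by (subst cls_eq_iff) (auto intro: free_ops)
  then show ?thesis using assms(2) by (simp add: lmul_def Abs_endo_inverse x_def)
qed

lemma lmul_mult:
  assumes "p \<in> carrier F" "q \<in> carrier F"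
  shows "lmul p * lmul q = lmul (p * q)"
proof (rule endo_eqI)
  fix X
  show "eapp (lmul p * lmul q) X = eapp (lmul (p * q)) X"
  proof (cases "X \<in> cls ` carrier F")
    case True
    then show ?thesis using assms
      by (auto simp: times_endo.rep_eq eapp_lmul free_ops mult.assoc)
  qed (simp add: times_endo.rep_eq lmul_def Abs_endo_inverse)
qed

lemma lmul_1: "lmul 1 = 1"
proof (rule endo_eqI)
  fix X
  show "eapp (lmul 1) X = eapp 1 X"
  proof (cases "X \<in> cls ` carrier F")
    case True
    then show ?thesis by (auto simp: one_endo.rep_eq eapp_lmul free_ops)
  qed (simp add: one_endo.rep_eq lmul_def Abs_endo_inverse)
qed

lemma lmul_eq_iff:
  assumes "p \<in> carrier F" "q \<in> carrier F"
  shows "lmul p = lmul q \<longleftrightarrow> p - q \<in> I"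
proof
  assume "lmul p = lmul q"
  then have "cls (p * 1) = cls (q * 1)" using eapp_lmul assms free_carrier_1 by metis
  then show "p - q \<in> I" using cls_eq_iff[OF assms] by simp
next
  assume pq: "p - q \<in> I"
  show "lmul p = lmul q"
  proof (rule endo_eqI)
    fix X
    show "eapp (lmul p) X = eapp (lmul q) X"
    proof (cases "X \<in> cls ` carrier F")
      case True
      then obtain x where x: "x \<in> carrier F" "X = cls x" by auto
      have "p * x - q * x \<in> I" using I_ops(6)[OF x(1) pq] by (simp add: left_diff_distrib)
      then show ?thesis using x assms by (simp add: eapp_lmul cls_eq_iff free_ops)
    qed (simp add: lmul_def Abs_endo_inverse)
  qed
qed

end

section \<open>Agreement of the presentation with the locale \<open>wbc\<close>\<close>

context
  fixes R T :: nat and h :: "bc_gen \<Rightarrow> 'b::ring_1"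
  assumes W: "wbc R T (\<lambda>i. h (S i)) (\<lambda>i. h (Sbar i)) (\<lambda>i. h (C i)) (\<lambda>i. h (Cbar i)) (h E1) (- 1) 0 (- 1) 1"
begin

interpretation wbc R T "\<lambda>i. h (S i)" "\<lambda>i. h (Sbar i)" "\<lambda>i. h (C i)" "\<lambda>i. h (Cbar i)" "h E1" "- 1" 0 "- 1" 1
  by (rule W)

lemma clifford_sat:
  "(a, b) \<in> clifford_rels R (- 1) (\<lambda>i. h (S i)) (\<lambda>i. h (C i)) \<Longrightarrow> a = b"
proof (induction rule: clifford_rels.cases)
  case (conj i js)
  have "perm_act i js = fold (\<lambda>l. Transposition.transpose l (Suc l)) js i"
    by (simp add: perm_act_def)
  moreover have "prod_list (map (\<lambda>i. h (S i)) (rev js)) * h (C i) * prod_list (map (\<lambda>i. h (S i)) js)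
      = h (C (fold (\<lambda>l. Transposition.transpose l (Suc l)) js i))"
    by (rule V.conj_word[where X = "{1..R}"])
      (use conj in \<open>auto simp: s_c_s Transposition.transpose_def\<close>)
  ultimately show ?case using conj by (simp add: perm_prod_def)
qed (auto intro: V.s_square V.s_braid V.s_comm2 c_square c_anticomm[simplified])

lemma clifford_sat_bar:
  "(a, b) \<in> clifford_rels T 1 (\<lambda>i. h (Sbar i)) (\<lambda>i. h (Cbar i)) \<Longrightarrow> a = b"
proof (induction rule: clifford_rels.cases)
  case (conj i js)
  have "perm_act i js = fold (\<lambda>l. Transposition.transpose l (Suc l)) js i"
    by (simp add: perm_act_def)
  moreover have "prod_list (map (\<lambda>i. h (Sbar i)) (rev js)) * h (Cbar i) * prod_list (map (\<lambda>i. h (Sbar i)) js)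
      = h (Cbar (fold (\<lambda>l. Transposition.transpose l (Suc l)) js i))"
    by (rule W.conj_word[where X = "{1..T}"])
      (use conj in \<open>auto simp: sb_cb_sb Transposition.transpose_def\<close>)
  ultimately show ?case using conj by (simp add: perm_prod_def)
qed (auto intro: W.s_square W.s_braid W.s_comm2 cb_square cb_anticomm[simplified])

lemma mixed_sat:
  "(a, b) \<in> mixed_rels R T (\<lambda>i. h (S i)) (\<lambda>i. h (Sbar i)) (h E1) (\<lambda>i. h (C i)) (\<lambda>i. h (Cbar i)) \<Longrightarrow> a = b"
proof (induction rule: mixed_rels.cases)
  case e_cb_e
  then show ?case using e_c_e e_c by simp
qed (auto intro: e_c c_e1 sb_c s_cb c_cb[simplified] s_sb e_square e_s_e e_sb_e s_e sb_e c_e cb_e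
    wall_left wall_right e_c_e)

lemma bc_rels_sat: "(a, b) \<in> bc_rels R T h \<Longrightarrow> a = b"
  unfolding bc_rels_def using clifford_sat clifford_sat_bar mixed_sat by blast

end

context central_hom begin

lemma ev_perm_prod: "ev g (perm_prod s js) = perm_prod (\<lambda>i. ev g (s i)) js"
  by (simp add: perm_prod_def ev_simps comp_def)

lemma clifford_rels_map:
  "(a, b) \<in> clifford_rels n q s c \<Longrightarrow>
    (ev g a, ev g b) \<in> clifford_rels n (ev g q) (\<lambda>i. ev g (s i)) (\<lambda>i. ev g (c i))"
  by (induction rule: clifford_rels.cases)
    (auto simp: ev_mult ev_simps ev_perm_prod intro: clifford_rels.intros)

lemma mixed_rels_map:
  "(a, b) \<in> mixed_rels r t s sb e c cb \<Longrightarrow>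
    (ev g a, ev g b) \<in> mixed_rels r t (\<lambda>i. ev g (s i)) (\<lambda>i. ev g (sb i)) (ev g e)
      (\<lambda>i. ev g (c i)) (\<lambda>i. ev g (cb i))"
  by (induction rule: mixed_rels.cases)
    (auto simp: ev_mult ev_simps intro: mixed_rels.intros)

lemma bc_rels_map: "(a, b) \<in> bc_rels r t f \<Longrightarrow> (ev g a, ev g b) \<in> bc_rels r t (\<lambda>x. ev g (f x))"
  unfolding bc_rels_def
  using clifford_rels_map[of a b r "- 1" "\<lambda>i. f (S i)" "\<lambda>i. f (C i)" g]
    clifford_rels_map[of a b t 1 "\<lambda>i. f (Sbar i)" "\<lambda>i. f (Cbar i)" g]
    mixed_rels_map[of a b r t "\<lambda>i. f (S i)" "\<lambda>i. f (Sbar i)" "f E1" "\<lambda>i. f (C i)" "\<lambda>i. f (Cbar i)" g]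
  by (auto simp: ev_simps)

end

lemma wbc_lin:
  assumes "1 \<le> R" "1 \<le> T"
  shows "wbc R T (\<lambda>i. linrep (gp (S i)) :: 'a::comm_ring_1 lin) (\<lambda>i. linrep (gp (Sbar i)))
    (\<lambda>i. linrep (gp (C i))) (\<lambda>i. linrep (gp (Cbar i))) (linrep (gp E1)) (- 1) 0 (- 1) 1"
  using wbc_hom[OF wbc_gp[OF assms], of "linrep :: pfun \<Rightarrow> 'a lin"] by (simp add: linrep_hom)

locale BC_presentation =
  fixes R T :: nat and ty :: "'a::comm_ring_1 itself"
  assumes RT: "1 \<le> R" "1 \<le> T"
begin

sublocale presentation bc_odd "bc_gens R T" "bc_rels R T var :: ((bc_gen, 'a) free_algebra \<times> _) set"
  by unfold_locales (use RT in \<open>auto intro: bc_rels_carrier\<close>)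

lemma var_carrier:
  "1 \<le> i \<Longrightarrow> i < R \<Longrightarrow> var (S i) \<in> carrier F" "1 \<le> i \<Longrightarrow> i < T \<Longrightarrow> var (Sbar i) \<in> carrier F"
  "1 \<le> i \<Longrightarrow> i \<le> R \<Longrightarrow> var (C i) \<in> carrier F" "1 \<le> i \<Longrightarrow> i \<le> T \<Longrightarrow> var (Cbar i) \<in> carrier F"
  "var E1 \<in> carrier F"
  by (auto simp: bc_gens_def intro!: free_carrier_var)

lemma lmul_rel: "(a, b) \<in> bc_rels R T var \<Longrightarrow> lmul a = lmul b"
proof -
  assume ab: "(a, b) \<in> bc_rels R T var"
  have "a \<in> carrier F \<and> b \<in> carrier F"
    by (rule bc_rels_closed[OF ring_closed_free ab]) (use RT in \<open>auto intro: free_carrier_var\<close>)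
  then show "lmul a = lmul b" using Rel_I[OF ab] by (simp add: lmul_eq_iff)
qed

lemma wbc_lmul:
  "wbc R T (\<lambda>i. lmul (var (S i))) (\<lambda>i. lmul (var (Sbar i))) (\<lambda>i. lmul (var (C i))) (\<lambda>i. lmul (var (Cbar i)))
    (lmul (var E1)) (lmul (- 1)) (lmul 0) (lmul (- 1)) 1"
proof -
  have cl: "lmul a = lmul b" if "(a, b) \<in> clifford_rels R (- 1) (\<lambda>i. var (S i)) (\<lambda>i. var (C i))" for a b
    using that by (intro lmul_rel) (simp add: bc_rels_def)
  have clb: "lmul a = lmul b" if "(a, b) \<in> clifford_rels T 1 (\<lambda>i. var (Sbar i)) (\<lambda>i. var (Cbar i))" for a b
    using that by (intro lmul_rel) (simp add: bc_rels_def)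
  have mx: "lmul a = lmul b" if "(a, b) \<in> mixed_rels R T (\<lambda>i. var (S i)) (\<lambda>i. var (Sbar i)) (var E1)
      (\<lambda>i. var (C i)) (\<lambda>i. var (Cbar i))" for a b
    using that by (intro lmul_rel) (simp add: bc_rels_def)
  note ca = lmul_mult free_ops var_carrier
  show ?thesis
  proof (rule wbc.intro)
    show "symmetric_generators R (\<lambda>i. lmul (var (S i)))"
      by unfold_locales (simp_all add: ca lmul_1[symmetric]; rule cl; rule clifford_rels.intros; simp)+
    show "symmetric_generators T (\<lambda>i. lmul (var (Sbar i)))"
      by unfold_locales (simp_all add: ca lmul_1[symmetric]; rule clb; rule clifford_rels.intros; simp)+
    show "lmul (- 1) = 1 \<and> 1 = lmul (- 1) \<or> lmul (- 1) = lmul (- 1) \<and> 1 = (1 :: (bc_gen, 'a) free_algebra set endo)" by simp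
    show "1 \<le> R" "1 \<le> T" by (rule RT)+
    fix i j :: nat
    show "lmul (var (C i)) * lmul (var (C i)) = lmul (- 1)" if "1 \<le> i" "i \<le> R"
      using that by (simp add: ca) (rule cl, rule clifford_rels.intros)
    show "lmul (var (Cbar i)) * lmul (var (Cbar i)) = 1" if "1 \<le> i" "i \<le> T"
      using that by (simp add: ca lmul_1[symmetric]) (rule clb, rule clifford_rels.intros)
    show "lmul (var (C i)) * lmul (var (C j)) = lmul (- 1) * (lmul (var (C j)) * lmul (var (C i)))"
      if "1 \<le> i" "i \<le> R" "1 \<le> j" "j \<le> R" "i \<noteq> j"
      using that by (simp add: ca) (rule cl, rule clifford_rels.intros)
    show "lmul (var (Cbar i)) * lmul (var (Cbar j)) = lmul (- 1) * (lmul (var (Cbar j)) * lmul (var (Cbar i)))"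
      if "1 \<le> i" "i \<le> T" "1 \<le> j" "j \<le> T" "i \<noteq> j"
      using that by (simp add: ca) (rule clb, rule clifford_rels.intros)
    show "lmul (var (S j)) * lmul (var (C i)) * lmul (var (S j)) = lmul (var (C (Transposition.transpose j (Suc j) i)))"
      if "1 \<le> j" "j < R" "1 \<le> i" "i \<le> R"
      using that cl[OF clifford_rels.conj[of i R "[j]"]] by (simp add: ca perm_prod_def perm_act_def)
    show "lmul (var (Sbar j)) * lmul (var (Cbar i)) * lmul (var (Sbar j)) = lmul (var (Cbar (Transposition.transpose j (Suc j) i)))"
      if "1 \<le> j" "j < T" "1 \<le> i" "i \<le> T"
      using that clb[OF clifford_rels.conj[of i T "[j]"]] by (simp add: ca perm_prod_def perm_act_def)
    show "lmul (- 1) * lmul (- 1) = (1 :: (bc_gen, 'a) free_algebra set endo)" by (simp add: ca lmul_1[symmetric])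
  qed (simp add: ca RT; rule mx; rule mixed_rels.intros; assumption?)+
qed

end

section \<open>Faithfulness\<close>

text \<open>Serves to cancel e_{k+1}: evaluated at f, the product w e_{k+1} shows the action of w at
  a state which is again generic, now for k strands.\<close>

lemma (in wbc_act) run_e2_generic:
  assumes f: "\<And>p. p \<le> k \<Longrightarrow> k < f \<langle>$\<rangle> p"
  shows "\<exists>b g W. run (e2 (Suc k) (Suc k)) False (f, U) = Some (b, g, W) \<and> (\<forall>p<k. k \<le> g \<langle>$\<rangle> p)"
proof -
  let ?\<tau> = "\<langle>0 \<leftrightarrow> k\<rangle>"
  define f2 where "f2 = ?\<tau> * f * ?\<tau>"
  define P where "P = pos f2 0"
  obtain b1 where 1: "run (tb 1 (Suc k)) False (f, U) = Some (b1, ?\<tau> * f, U)"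
    using run_tb[of 1 "Suc k"] by fastforce
  obtain b2 U2 where 2: "run (t 1 (Suc k)) b1 (?\<tau> * f, U) = Some (b2, f2, U2)"
    using run_t[of 1 "Suc k" b1 "?\<tau> * f" U] by (auto simp: f2_def)
  have f2: "k < f2 \<langle>$\<rangle> p" if "p \<le> k" for p
    using f[of "?\<tau> \<langle>$\<rangle> p"] that by (auto simp: f2_def apply_times swap_apply split: if_splits)
  have P: "\<not> P \<le> k" using f2[of P] by (auto simp: P_def pos_apply)
  obtain b3 U3 where 3: "run e b2 (f2, U2) = Some (b3, f2 * \<langle>0 \<leftrightarrow> P\<rangle>, U3)"
    using P by (cases "U2 0") (auto simp: run_gen Let_def P_def)
  obtain b4 U4 where 4: "run (t 1 (Suc k)) b3 (f2 * \<langle>0 \<leftrightarrow> P\<rangle>, U3) = Some (b4, f2 * \<langle>0 \<leftrightarrow> P\<rangle> * ?\<tau>, U4)"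
    using run_t[of 1 "Suc k" b3 "f2 * \<langle>0 \<leftrightarrow> P\<rangle>" U3] by auto
  obtain b5 where 5: "run (tb 1 (Suc k)) b4 (f2 * \<langle>0 \<leftrightarrow> P\<rangle> * ?\<tau>, U4)
      = Some (b5, ?\<tau> * (f2 * \<langle>0 \<leftrightarrow> P\<rangle> * ?\<tau>), U4)"
    using run_tb[of 1 "Suc k" b4 "f2 * \<langle>0 \<leftrightarrow> P\<rangle> * ?\<tau>" U4] by auto
  have "run (e2 (Suc k) (Suc k)) False (f, U) = Some (b5, ?\<tau> * (f2 * \<langle>0 \<leftrightarrow> P\<rangle> * ?\<tau>), U4)"
    unfolding e2_def using 5
    by (simp only: run_mult(1)[OF 1] run_mult(1)[OF 2] run_mult(1)[OF 3] run_mult(1)[OF 4])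
  moreover have "k \<le> (?\<tau> * (f2 * \<langle>0 \<leftrightarrow> P\<rangle> * ?\<tau>)) \<langle>$\<rangle> p" if "p < k" for p
    using f2[of p] f2[of k] P that by (auto simp: apply_times swap_apply)
  ultimately show ?thesis by blast
qed

text \<open>Supplies generic states, as the first m labels are pushed beyond L. The second
  conclusion keeps the points fixed that the next transposition moves.\<close>

lemma exists_shift:
  "m \<le> L \<Longrightarrow> \<exists>f :: nat perm. (\<forall>p<m. f \<langle>$\<rangle> p = p + L) \<and> (\<forall>p\<ge>L + m. f \<langle>$\<rangle> p = p)"
proof (induction m)
  case 0
  show ?case by (rule exI[of _ 1]) simp
next
  case (Suc m)
  then obtain f :: "nat perm" where f: "\<forall>p<m. f \<langle>$\<rangle> p = p + L" "\<forall>p\<ge>L + m. f \<langle>$\<rangle> p = p" by auto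
  show ?case
    by (rule exI[of _ "f * \<langle>m \<leftrightarrow> m + L\<rangle>"]) (use f Suc.prems in \<open>auto simp: apply_times swap_apply less_Suc_eq\<close>)
qed

context BC_presentation begin

definition hg :: "bc_gen \<Rightarrow> (bc_gen, 'a) free_algebra set endo \<times> pfun" where
  "hg g = (lmul (var g), gp g)"

sublocale P: wbc_act R T "\<lambda>i. hg (S i)" "\<lambda>i. hg (Sbar i)" "\<lambda>i. hg (C i)" "\<lambda>i. hg (Cbar i)" "hg E1"
  "(lmul (- 1), neg_pfun)" "(lmul 0, zero_pfun)" "(lmul (- 1), neg_pfun)" 1 snd
proof -
  interpret wbc R T "\<lambda>i. hg (S i)" "\<lambda>i. hg (Sbar i)" "\<lambda>i. hg (C i)" "\<lambda>i. hg (Cbar i)" "hg E1"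
    "(lmul (- 1), neg_pfun)" "(lmul 0, zero_pfun)" "(lmul (- 1), neg_pfun)" 1
    unfolding hg_def by (rule wbc_prod[OF wbc_lmul wbc_gp[OF RT]])
  show "wbc_act R T (\<lambda>i. hg (S i)) (\<lambda>i. hg (Sbar i)) (\<lambda>i. hg (C i)) (\<lambda>i. hg (Cbar i)) (hg E1)
    (lmul (- 1), neg_pfun) (lmul 0, zero_pfun) (lmul (- 1), neg_pfun) 1 snd"
    by unfold_locales (simp_all add: hg_def times_prod_def one_prod_def)
qed

lemma word_hg:
  assumes "set (letters w) \<subseteq> bc_gens R T"
  shows "word hg w = (lmul (single w 1), word gp w)" "single w (a :: 'a) \<in> carrier F"
proof -
  have mono: "single (Word xs) (1 :: 'a) \<in> carrier F" if "set xs \<subseteq> bc_gens R T" for xs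
    using that by (simp add: carrier_free_words)
  have "prod_list (map hg xs) = (lmul (single (Word xs) 1), prod_list (map gp xs))"
    if "set xs \<subseteq> bc_gens R T" for xs
    using that
  proof (induction xs)
    case Nil
    have "(single (Word []) 1 :: (bc_gen, 'a) free_algebra) = 1" by (simp flip: zero_free_word_def)
    then have "lmul (single (Word []) 1 :: (bc_gen, 'a) free_algebra) = 1" by (simp only: lmul_1)
    then show ?case by (simp add: one_prod_def)
  next
    case (Cons x xs)
    have "(var x :: (bc_gen, 'a) free_algebra) * single (Word xs) 1 = single (Word (x # xs)) 1"
      by (simp add: var_def mult_single plus_free_word_def)
    moreover have "(var x :: (bc_gen, 'a) free_algebra) \<in> carrier F"
      using Cons.prems by (intro free_carrier_var) auto
    ultimately show ?case using Cons mono[of xs]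
      by (simp add: times_prod_def hg_def lmul_mult)
  qed
  from this[OF assms] show "word hg w = (lmul (single w 1), word gp w)" by (simp add: word_def)
  show "single w a \<in> carrier F" using assms by (simp add: carrier_free_words)
qed

lemma word_Mon:
  assumes "set (letters w) \<subseteq> bc_gens m n" "1 \<le> m" "1 \<le> n"
  shows "word hg w \<in> P.Mon m n"
proof -
  have "hg g \<in> P.gens m n" if "g \<in> bc_gens m n" for g
    using that assms(2,3) by (auto simp: bc_gens_def P.gens_def)
  then have "prod_list (map hg xs) \<in> P.Mon m n" if "set xs \<subseteq> bc_gens m n" for xs
    using that by (induction xs) (auto intro: P.Mon.intros)
  then show ?thesis using assms(1) by (simp add: word_def)
qed

lemma bc_gens_mono: "m \<le> m' \<Longrightarrow> n \<le> n' \<Longrightarrow> bc_gens m n \<subseteq> bc_gens m' n'"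
  by (auto simp: bc_gens_def)

text \<open>Induction on the number of words in p. A word that annihilates the state lies in the
  ideal. Any other word shares its image, up to sign, with a second word; by \<open>inj_at\<close>
  the two agree up to sign modulo the ideal, and the coefficient of one is shifted to the
  other.\<close>

lemma faithful_generic:
  assumes mn: "1 \<le> m" "m \<le> R" "1 \<le> n" "n \<le> T" and f: "\<forall>i<m. n \<le> f \<langle>$\<rangle> i"
    and "\<forall>w\<in>keys p. set (letters w) \<subseteq> bc_gens m n"
    and "\<And>\<phi>. lapp (rho p) \<phi> (f, U) = (0 :: 'a)"
  shows "p \<in> I"
  using assms(6,7)
proof (induction "card (keys p)" arbitrary: p rule: less_induct)
  case less
  define X where "X w = app (word gp w) (Some (False, f, U))" for w
  have lapp: "lapp (rho p) \<phi> (f, U) = (\<Sum>w\<in>keys p. lookup p w * sgn_val \<phi> (X w))"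
    for p :: "(bc_gen, 'a) free_algebra" and \<phi>
    by (simp add: lapp_rho X_def)
  have lapp1: "lapp (rho (single w a)) \<phi> (f, U) = a * sgn_val \<phi> (X w)" for w and a :: 'a and \<phi>
    by (simp add: lapp)
  have rho_diff: "rho (p - q) = rho p - rho q" for p q :: "(bc_gen, 'a) free_algebra"
    by (simp add: rho_def scal.ev_simps)
  have words: "word hg w \<in> P.Mon m n" "word hg w = (lmul (single w 1), word gp w)"
    "P.run (word hg w) False (f, U) = X w" "single w (a :: 'a) \<in> carrier F"
    if "set (letters w) \<subseteq> bc_gens m n" for w a
  proof -
    have w: "set (letters w) \<subseteq> bc_gens R T" using that bc_gens_mono[OF mn(2,4)] by blast
    show "word hg w \<in> P.Mon m n" using that mn by (intro word_Mon)
    show 1: "word hg w = (lmul (single w 1), word gp w)" "single w a \<in> carrier F" using word_hg[OF w] by auto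
    show "P.run (word hg w) False (f, U) = X w" by (simp add: P.run_def 1 X_def)
  qed
  note inj = P.inj_at[OF mn(2,4)]
  show ?case
  proof (cases "keys p = {}")
    case True
    then show ?thesis by (simp add: I_ops)
  next
    case False
    then obtain u where u: "u \<in> keys p" by blast
    note ul = less.prems(1)[rule_format, OF u]
    define a where "a = lookup p u"
    \<comment> \<open>Here q lies in the ideal, acts by zero on the state, and contains u with the
      coefficient that u has in p. Subtracting it removes u and brings in no new word.\<close>
    have red: "p \<in> I" if q: "q \<in> I" "keys (p - q) \<subseteq> keys p - {u}" "\<And>\<phi>. lapp (rho q) \<phi> (f, U) = 0" for q
    proof -
      have "card (keys (p - q)) < card (keys p)"
        using q(2) u by (intro psubset_card_mono) auto
      then have "p - q \<in> I"
        using q(2,3) less.prems by (intro less.hyps) (auto simp: rho_diff lapp_simps)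
      then show "p \<in> I" using I_ops(2)[OF _ q(1)] by fastforce
    qed
    have scale: "single w a' \<in> carrier F" "scalar b * single w a' = single w (b * a')"
      if "set (letters w) \<subseteq> bc_gens m n" for w and a' b :: 'a
      using words(4)[OF that] by (simp_all add: scalar_def mult_single)
    show ?thesis
    proof (cases "X u")
      case None
      then have "word hg u = (lmul 0, zero_pfun)"
        using P.inj_at_zero[OF inj words(1)[OF ul] f, of False U] words(3)[OF ul] by simp
      then have "lmul (single u (1 :: 'a)) = lmul 0" using words(2)[OF ul] by simp
      then have "single u (1 :: 'a) - 0 \<in> I"
        using lmul_eq_iff[of "single u 1" 0] words(4)[OF ul] free_carrier_0 by blast
      then have "scalar a * single u 1 \<in> I" by (intro I_ops(5) free_carrier_scalar) simp
      then have "single u a \<in> I" using scale(2)[OF ul] by simp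
      then show ?thesis
      proof (rule red)
        show "keys (p - single u a) \<subseteq> keys p - {u}"
          by (auto simp: in_keys_iff lookup_minus lookup_single a_def when_def split: if_splits)
        show "lapp (rho (single u a)) \<phi> (f, U) = 0" for \<phi> by (simp add: lapp1 None sgn_val_def)
      qed
    next
      case (Some by')
      obtain b y where by': "by' = (b, y)" by (cases by')
      \<comment> \<open>Tested against the indicator function of the image y of u, the word u
        contributes its coefficient up to sign, which is not zero; so another word must reach y as
        well.\<close>
      define \<delta> :: "state \<Rightarrow> 'a" where "\<delta> = (\<lambda>x. if x = y then 1 else 0)"
      have "\<exists>v\<in>keys p - {u}. sgn_val \<delta> (X v) \<noteq> 0"
      proof (rule ccontr)
        assume "\<not> ?thesis"
        then have "(\<Sum>w\<in>keys p - {u}. lookup p w * sgn_val \<delta> (X w)) = 0" by (intro sum.neutral) auto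
        then have "lookup p u * sgn_val \<delta> (X u) = 0"
          using less.prems(2)[of \<delta>] u by (simp add: lapp sum.remove[of _ u])
        moreover have "sgn_val \<delta> (X u) = (if b then - 1 else 1)" by (simp add: Some by' sgn_val_def \<delta>_def)
        moreover have "lookup p u \<noteq> 0" using u by (simp add: in_keys_iff)
        ultimately show False by (simp split: if_splits)
      qed
      then obtain v where v: "v \<in> keys p" "v \<noteq> u" "sgn_val \<delta> (X v) \<noteq> 0" by blast
      obtain b' where Xv: "X v = Some (b', y)"
      proof (cases "X v")
        case None
        then show ?thesis using v(3) by (simp add: sgn_val_def)
      next
        case (Some z)
        then show ?thesis using v(3) that by (cases z) (simp add: sgn_val_def \<delta>_def split: if_splits)
      qed
      note vl = less.prems(1)[rule_format, OF v(1)]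
      define \<epsilon> :: 'a where "\<epsilon> = (if b = b' then 1 else - 1)"
      have "single u 1 - single v \<epsilon> \<in> I"
      proof (cases "b = b'")
        case True
        then have "word hg u = word hg v"
          using P.inj_at_eq[OF inj words(1)[OF ul] words(1)[OF vl] f, of False U]
            words(3)[OF ul] words(3)[OF vl] Some by' Xv by simp
        then have "lmul (single u (1 :: 'a)) = lmul (single v 1)" using words(2)[OF ul] words(2)[OF vl] by simp
        then show ?thesis using lmul_eq_iff[of "single u 1" "single v 1"] words(4)[OF ul] words(4)[OF vl] True
          by (simp add: \<epsilon>_def)
      next
        case False
        have "word hg u = (lmul (- 1), neg_pfun) * word hg v"
        proof (rule P.inj_at_eq[OF inj words(1)[OF ul] P.Mon.neg[OF words(1)[OF vl]] f])
          show "P.run (word hg u) False (f, U) = P.run ((lmul (- 1), neg_pfun) * word hg v) False (f, U)"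
            "P.run (word hg u) False (f, U) \<noteq> None"
            using words(3)[OF ul] words(3)[OF vl] Some by' Xv False by (auto simp: P.run_simps)
        qed
        then have "lmul (single u (1 :: 'a)) = lmul (- 1) * lmul (single v 1)"
          using words(2)[OF ul] words(2)[OF vl] by (simp add: times_prod_def)
        also have "\<dots> = lmul (- single v 1)"
          using words(4)[OF vl] by (simp add: lmul_mult free_ops)
        finally have "single u 1 - - single v 1 \<in> I"
          using lmul_eq_iff[of "single u 1" "- single v 1"] words(4)[OF ul] words(4)[OF vl]
          by (simp add: free_ops)
        then show ?thesis using False by (simp add: \<epsilon>_def single_uminus)
      qed
      then have "scalar a * (single u 1 - single v \<epsilon>) \<in> I" by (intro I_ops(5) free_carrier_scalar)
      then have "single u a - single v (a * \<epsilon>) \<in> I"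
        using scale(2)[OF ul] scale(2)[OF vl] by (simp add: right_diff_distrib)
      then show ?thesis
      proof (rule red)
        show "keys (p - (single u a - single v (a * \<epsilon>))) \<subseteq> keys p - {u}"
          using v by (auto simp: in_keys_iff lookup_minus lookup_single a_def when_def split: if_splits)
        show "lapp (rho (single u a - single v (a * \<epsilon>))) \<phi> (f, U) = 0" for \<phi>
          by (simp add: rho_diff lapp_simps lapp1 Some by' Xv sgn_val_def \<epsilon>_def)
      qed
    qed
  qed
qed

lemma rho_ops:
  "rho 0 = (0 :: 'a lin)" "rho 1 = (1 :: 'a lin)" "rho (p + q) = (rho p + rho q :: 'a lin)"
  "rho (p - q) = (rho p - rho q :: 'a lin)" "rho (- p) = (- rho p :: 'a lin)"
  "rho (p * q) = (rho p * rho q :: 'a lin)" "rho (p ^ i) = (rho p ^ i :: 'a lin)"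
  "rho (scalar a) = scal (a :: 'a)" "rho (var g) = (linrep (gp g) :: 'a lin)"
  "rho (sum h A) = (\<Sum>i\<in>A. rho (h i) :: 'a lin)"
  by (simp_all add: rho_def scal.ev_simps scal.ev_add scal.ev_mult)

lemma rho_rel:
  assumes "(a, b) \<in> bc_rels R T var" shows "rho a = (rho b :: 'a lin)"
proof -
  have "(rho a, rho b) \<in> bc_rels R T (\<lambda>x. rho (var x) :: 'a lin)"
    unfolding rho_def by (rule scal.bc_rels_map[OF assms])
  then show ?thesis using bc_rels_sat[OF wbc_lin[OF RT]] by (simp add: rho_ops)
qed

theorem I_eq_kernel: "p \<in> carrier F \<Longrightarrow> p \<in> I \<longleftrightarrow> rho p = (0 :: 'a lin)"
proof
  assume p: "p \<in> carrier F" and r: "rho p = 0"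
  obtain f :: "nat perm" where f: "\<forall>q<R. f \<langle>$\<rangle> q = q + (R + T)" using exists_shift[of R "R + T"] by auto
  show "p \<in> I"
    by (rule faithful_generic[of R T f p "\<lambda>_. False"]) (use RT f p r in \<open>auto simp: carrier_free_words lapp_simps\<close>)
next
  show "p \<in> I \<Longrightarrow> rho p = 0"
    unfolding rho_def by (rule ev_I[OF scal.central_hom_axioms]) (use rho_rel in \<open>simp_all add: rho_def\<close>)
qed

lemma cls_eq_rho: "p \<in> carrier F \<Longrightarrow> q \<in> carrier F \<Longrightarrow> cls p = cls q \<longleftrightarrow> rho p = (rho q :: 'a lin)"
  using I_eq_kernel[OF rc_diff[OF ring_closed_free, of p bc_odd "bc_gens R T" q]]
  by (simp add: cls_eq_iff rho_ops)

end

section \<open>Jucys-Murphy elements\<close>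

locale wbc_ring = wbc R T s sb c cb e "- 1" 0 q qb
  for R T :: nat and s sb c cb :: "nat \<Rightarrow> 'b::ring_1" and e q qb :: 'b
begin

lemma swap_ring: "wbc_ring T R sb s cb c e qb q"
  by (simp add: wbc_ring_def swap)

text \<open>For q = - 1 this is x + c x c, for q = 1 it is x - c x c: the combinations in the
  unbarred and the barred Jucys-Murphy elements. Both anticommute with c_i.\<close>

definition phi :: "nat \<Rightarrow> 'b \<Rightarrow> 'b" where "phi i x = x - q * (c i * (x * c i))"
definition phib :: "nat \<Rightarrow> 'b \<Rightarrow> 'b" where "phib j x = x - qb * (cb j * (x * cb j))"

text \<open>\<open>y\<^bsub>k+1\<^esub>\<close> is \<open>Z (k + 1) k k\<close>, and its conjugate by \<open>s\<^bsub>k+1\<^esub>\<close> without the correction term is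
  \<open>Z (k + 2) k k\<close>; likewise for the barred version \<open>Zb\<close>.\<close>

definition Z :: "nat \<Rightarrow> nat \<Rightarrow> nat \<Rightarrow> 'b" where
  "Z i m n = (\<Sum>j=1..n. phi i (e2 i j)) - (\<Sum>j=1..m. phi i (t j i))"
definition Zb :: "nat \<Rightarrow> nat \<Rightarrow> nat \<Rightarrow> 'b" where
  "Zb j m n = (\<Sum>i=1..m. phib j (e2 i j)) - (\<Sum>i=1..n. phib j (tb i j))"

lemma phib_swap: "wbc_ring.phi cb qb = phib"
proof -
  interpret sw: wbc_ring T R sb s cb c e qb q by (rule swap_ring)
  show ?thesis by (simp add: fun_eq_iff phib_def sw.phi_def)
qed

lemma phi_swap: "wbc_ring.phib c q = phi"
proof -
  interpret sw: wbc_ring T R sb s cb c e qb q by (rule swap_ring)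
  show ?thesis by (simp add: fun_eq_iff phi_def sw.phib_def)
qed

lemma Zb_swap:
  assumes "j \<in> {1..T}" "m \<le> R" shows "wbc_ring.Z sb s cb e qb j n m = Zb j m n"
proof -
  interpret sw: wbc_ring T R sb s cb c e qb q by (rule swap_ring)
  show ?thesis unfolding Zb_def sw.Z_def phib_swap using assms
    by (intro arg_cong2[of _ _ _ _ minus] sum.cong refl) (auto simp: e2_swap)
qed

text \<open>Moving a past c_i may cost a sign, but c_i occurs twice.\<close>

lemma phi_conj:
  assumes "a * x = x' * a" "a * c i = c i' * a \<or> a * c i = - (c i' * a)"
  shows "a * phi i x = phi i' x' * a"
proof -
  have "a * (c i * (x * c i)) = c i' * (x' * c i') * a"
    using assms(2)
  proof
    assume 1: "a * c i = c i' * a"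
    show ?thesis by (simp add: mult.assoc mult_eq_left[OF 1] mult_eq_left[OF assms(1)] 1)
  next
    assume 1: "a * c i = - (c i' * a)"
    show ?thesis using mult_eq_left[OF 1] mult_eq_left[OF assms(1)]
      by (simp add: mult.assoc 1)
  qed
  then show ?thesis unfolding phi_def using qs assms(1) by (elim disjE conjE) (simp_all add: algebra_simps)
qed

lemma phi_diff: "phi i x - phi i y = phi i (x - y)"
  by (simp add: phi_def algebra_simps)

lemma phi_zero:
  assumes "w * c i = c i * w"
  shows "x * w = 0 \<Longrightarrow> phi i x * w = 0" "w * x = 0 \<Longrightarrow> w * phi i x = 0"
proof -
  assume 1: "x * w = 0"
  have "x * (c i * w) = 0" using mult_eq_left[OF 1] assms[symmetric] by simp
  then have "q * (c i * (x * c i)) * w = 0" by (simp add: mult.assoc)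
  then show "phi i x * w = 0" using 1 by (simp add: phi_def left_diff_distrib)
next
  assume 1: "w * x = 0"
  have "w * (c i * (x * c i)) = 0" using mult_eq_left[OF assms] mult_eq_left[OF 1] by (simp add: mult.assoc)
  then have "w * (q * (c i * (x * c i))) = 0" using qs by (elim disjE conjE) simp_all
  then show "w * phi i x = 0" using 1 by (simp add: phi_def right_diff_distrib)
qed

lemma c_phi: assumes "i \<in> {1..R}" shows "c i * phi i x = - (phi i x * c i)"
proof -
  have 1: "c i * c i = q" using c_square assms by simp
  show ?thesis unfolding phi_def using qs
    by (elim disjE conjE) (simp_all add: algebra_simps 1 mult_eq_left[OF 1])
qed

lemma c_c: "i \<in> {1..R} \<Longrightarrow> j \<in> {1..R} \<Longrightarrow> i \<noteq> j \<Longrightarrow> c i * c j = - (c j * c i)"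
  using c_anticomm[of i j] by simp
lemma cb_c: "i \<in> {1..R} \<Longrightarrow> j \<in> {1..T} \<Longrightarrow> cb j * c i = - (c i * cb j)"
  using c_cb[of i j] by simp

text \<open>For a = j the generator does not commute with the two summands of \<open>phi\<close>
  separately but exchanges them. The same happens in \<open>cb_phi_e2\<close> for b = j.\<close>

lemma c_phi_t:
  assumes "i \<in> {1..R}" "j \<in> {1..R}" "a \<in> {1..R}" "a \<noteq> i" "j \<noteq> i"
  shows "c a * phi i (t j i) = phi i (t j i) * c a"
proof (cases "a = j")
  case False
  then have "t j i * c a = c a * t j i" using t_c[of j i a] assms by simp
  then show ?thesis using assms c_c[of a i] by (intro phi_conj) auto
next
  case True
  have 1: "t j i * c j = c i * t j i" "t j i * c i = c j * t j i" using t_c[of j i] assms by auto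
  have 2: "c j * c i = - (c i * c j)" using assms by (intro c_c) auto
  have 3: "c i * c i = q" "c j * c j = q" using c_square assms by auto
  show ?thesis unfolding True phi_def using qs mult_eq_left[OF 2]
    by (elim disjE conjE)
      (simp_all add: algebra_simps 1 2 3 mult_eq_left[OF 1(1)] mult_eq_left[OF 1(2)] mult_eq_left[OF 3(1)] mult_eq_left[OF 3(2)])
qed

lemma cb_phi_e2:
  assumes "i \<in> {1..R}" "j \<in> {1..T}" "b \<in> {1..T}"
  shows "cb b * phi i (e2 i j) = phi i (e2 i j) * cb b"
proof (cases "b = j")
  case False
  then have "cb b * e2 i j = e2 i j * cb b" using cb_e2[of j b i] assms by simp
  then show ?thesis using assms cb_c[of i b] by (intro phi_conj) auto
next
  case True
  have 1: "cb j * e2 i j = c i * e2 i j" "e2 i j * cb j = e2 i j * c i" using e2_single assms by auto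
  have 2: "cb j * c i = - (c i * cb j)" "c i * cb j = - (cb j * c i)" using assms by (simp_all add: cb_c)
  have 3: "c i * c i = q" using c_square assms by auto
  have "cb j * (c i * (e2 i j * c i)) = - (q * (e2 i j * c i))"
    using mult_eq_left[OF 2(1)] by (simp add: mult.assoc mult_eq_left[OF 1(1)] mult_eq_left[OF 3])
  moreover have "e2 i j * (c i * cb j) = - (e2 i j * q)"
    by (simp add: 2(2) mult_eq_left[OF 1(2)]) (simp add: mult.assoc 3)
  ultimately show ?thesis unfolding True phi_def using qs
    by (elim disjE conjE) (simp_all add: algebra_simps 1)
qed

text \<open>Permutations only permute the summands, and Clifford generators commute with each of
  them. The generator e is different: with it only a combination of two summands commutes.\<close>

lemma Z_commute:
  assumes i: "m < i" "i \<le> R" and n: "n \<le> T" and u: "u \<in> Mon m n"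
  shows "u * Z i m n = Z i m n * u"
  using u
proof induction
  case (neg u)
  then show ?case by simp
next
  case (gen g u)
  note ir = atLeastAtMost_iff
  have i': "i \<in> {1..R}" using i by simp
  have *: "g * Z i m n = Z i m n * g"
    if "\<And>j. j \<in> {1..n} \<Longrightarrow> g * phi i (e2 i j) = phi i (e2 i (f j)) * g"
      "\<And>j. j \<in> {1..m} \<Longrightarrow> g * phi i (t j i) = phi i (t (h j) i) * g"
      "\<And>j. j \<in> {1..n} \<Longrightarrow> f j \<in> {1..n} \<and> f (f j) = j" "\<And>j. j \<in> {1..m} \<Longrightarrow> h j \<in> {1..m} \<and> h (h j) = j"
    for f h
  proof -
    have "(\<Sum>j=1..n. phi i (e2 i (f j))) = (\<Sum>j=1..n. phi i (e2 i j))"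
      by (rule sum.reindex_bij_witness[of _ f f]) (use that(3) in auto)
    moreover have "(\<Sum>j=1..m. phi i (t (h j) i)) = (\<Sum>j=1..m. phi i (t j i))"
      by (rule sum.reindex_bij_witness[of _ h h]) (use that(4) in auto)
    moreover have "g * Z i m n = ((\<Sum>j=1..n. phi i (e2 i (f j))) - (\<Sum>j=1..m. phi i (t (h j) i))) * g"
      by (simp add: Z_def right_diff_distrib left_diff_distrib sum_distrib_left sum_distrib_right that(1,2))
    ultimately show ?thesis by (simp add: Z_def)
  qed
  have gZ: "g * Z i m n = Z i m n * g"
    using gen(1)
  proof (cases rule: gens_cases)
    case (s l)
    let ?p = "Transposition.transpose l (Suc l)"
    have g: "g = t l (Suc l)" using s V.tr_Suc by simp
    have l: "l \<in> {1..R}" "Suc l \<in> {1..R}" using s i by auto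
    have pi: "?p i = i" using s i by (auto simp: Transposition.transpose_def)
    show ?thesis
    proof (rule *[of "\<lambda>j. j" ?p])
      fix j
      show "g * phi i (e2 i j) = phi i (e2 i j) * g" if "j \<in> {1..n}"
        unfolding g using t_e2[OF l, of i j] t_c[OF l i'] that i' n pi by (intro phi_conj) auto
      show "g * phi i (t j i) = phi i (t (?p j) i) * g" if "j \<in> {1..m}"
        unfolding g using V.tr_tr[OF l, of j i] t_c[OF l i'] that i i' pi by (intro phi_conj) auto
      show "?p j \<in> {1..m} \<and> ?p (?p j) = j" if "j \<in> {1..m}"
        using that s by (auto simp: Transposition.transpose_def)
    qed auto
  next
    case (sb l)
    let ?p = "Transposition.transpose l (Suc l)"
    have g: "g = tb l (Suc l)" using sb W.tr_Suc by simp
    have l: "l \<in> {1..T}" "Suc l \<in> {1..T}" using sb n by auto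
    show ?thesis
    proof (rule *[of ?p "\<lambda>j. j"])
      fix j
      show "g * phi i (e2 i j) = phi i (e2 i (?p j)) * g" if "j \<in> {1..n}"
        unfolding g using tb_e2[OF l, of i j] tb_c[OF l i'] that i' n by (intro phi_conj) auto
      show "g * phi i (t j i) = phi i (t j i) * g" if "j \<in> {1..m}"
        unfolding g using t_tb[of j i l "Suc l"] tb_c[OF l i'] l that i i' by (intro phi_conj) auto
      show "?p j \<in> {1..n} \<and> ?p (?p j) = j" if "j \<in> {1..n}"
        using that sb by (auto simp: Transposition.transpose_def)
    qed auto
  next
    case (c a)
    have a: "a \<in> {1..R}" "a \<noteq> i" using c i by auto
    show ?thesis
    proof (rule *[of "\<lambda>j. j" "\<lambda>j. j"])
      fix j
      show "g * phi i (e2 i j) = phi i (e2 i j) * g" if "j \<in> {1..n}"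
        unfolding c using c_e2[of i a j] c_c[of a i] a i' that n by (intro phi_conj) auto
      show "g * phi i (t j i) = phi i (t j i) * g" if "j \<in> {1..m}"
        unfolding c using a i i' that by (intro c_phi_t) auto
    qed auto
  next
    case (cb b)
    have b: "b \<in> {1..T}" using cb n by auto
    show ?thesis
    proof (rule *[of "\<lambda>j. j" "\<lambda>j. j"])
      fix j
      show "g * phi i (e2 i j) = phi i (e2 i j) * g" if "j \<in> {1..n}"
        unfolding cb using b i' that n by (intro cb_phi_e2) auto
      show "g * phi i (t j i) = phi i (t j i) * g" if "j \<in> {1..m}"
        unfolding cb using t_cb[of j i b] cb_c[of i b] b i i' that by (intro phi_conj) auto
    qed auto
  next
    case e
    have one: "1 \<in> {1..R}" "1 \<in> {1..T}" "1 \<noteq> i" using e i n by auto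
    have ge: "g = e2 1 1" using e by (simp add: e2_1_1)
    have gc: "g * c i = c i * g" using c_e2[of 1 i 1] one i' ge by simp
    \<comment> \<open>The commutator with e kills every summand with j other than 1. The two
      summands left combine to \<open>phi\<close> of e_{i,1} - (1 i), which e annihilates from both
      sides because e e_{i,1} = e (1 i) and e_{i,1} e = (1 i) e.\<close>
    define D where "D x = x * g - g * x" for x
    have D: "D (x - y) = D x - D y" "D (sum f A) = (\<Sum>a\<in>A. D (f a))" for x y and f :: "nat \<Rightarrow> 'b" and A
      by (simp_all add: D_def algebra_simps sum_subtractf sum_distrib_left sum_distrib_right)
    have 1: "D (phi i (e2 i j)) = (if j = 1 then D (phi i (e2 i 1)) else 0)" if "j \<in> {1..n}" for j
    proof (cases "j = 1")
      case False
      then have "g * e2 i j = e2 i j * g" using e2_commute[of i 1 j 1] one i' that n ge by simp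
      then show ?thesis using phi_conj[of g "e2 i j" "e2 i j" i i] gc False by (simp add: D_def)
    qed simp
    have 2: "D (phi i (t j i)) = (if j = 1 then D (phi i (t 1 i)) else 0)" if "j \<in> {1..m}" for j
    proof (cases "j = 1")
      case False
      then have "g * t j i = t j i * g" using t_e2[of j i 1 1] one i i' that ge by simp
      then show ?thesis using phi_conj[of g "t j i" "t j i" i i] gc False by (simp add: D_def)
    qed simp
    have 3: "D (phi i (e2 i 1 - t 1 i)) = 0"
    proof -
      have "(e2 i 1 - t 1 i) * g = 0" "g * (e2 i 1 - t 1 i) = 0"
        using e2_e2_bar[of 1 i 1] one i' by (simp_all add: ge algebra_simps)
      then show ?thesis using phi_zero[OF gc] by (simp add: D_def)
    qed
    have "D (Z i m n) = (\<Sum>j=1..n. if j = 1 then D (phi i (e2 i 1)) else 0)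
        - (\<Sum>j=1..m. if j = 1 then D (phi i (t 1 i)) else 0)"
      unfolding Z_def D using 1 2 by simp
    also have "\<dots> = D (phi i (e2 i 1 - t 1 i))" using e by (simp add: D flip: phi_diff)
    finally show ?thesis using 3 by (simp add: D_def)
  qed
  show ?case using gen(3) mult_eq_left[OF gZ] by (simp add: mult.assoc)
qed simp_all

text \<open>Passes from monomials to \<open>Z\<close>, which is a combination of monomials; with
  \<open>Z_commute\<close> it makes two Jucys-Murphy elements commute.\<close>

lemma commute_Z:
  assumes i: "i \<le> m'" "i \<ge> 1" "m < i" and n: "n \<le> n'" "m' \<le> R" "n' \<le> T"
    and a: "\<And>u. u \<in> Mon m' n' \<Longrightarrow> a * u = u * a"
  shows "a * Z i m n = Z i m n * a"
proof -
  have "a * c i = c i * a" using Mon_gen[of "c i" m' n'] i by (intro a) (auto simp: gens_def)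
  then have "a * phi i u = phi i u * a" if "u \<in> Mon m' n'" for u
    using a[OF that] by (intro phi_conj) auto
  moreover have "e2 i j \<in> Mon m' n'" if "j \<in> {1..n}" for j using that i n by (intro Mon_e2) auto
  moreover have "t j i \<in> Mon m' n'" if "j \<in> {1..m}" for j using that i by (intro Mon_t) auto
  ultimately show ?thesis
    by (simp add: Z_def right_diff_distrib left_diff_distrib sum_distrib_left sum_distrib_right)
qed

end

section \<open>The affine relations\<close>

locale wbc_ring_shift = wbc_ring R T s sb c cb e q qb
  for R T :: nat and s sb c cb :: "nat \<Rightarrow> 'b::ring_1" and e q qb :: 'b +
  fixes k :: nat
  assumes k: "Suc k \<le> R" "Suc k \<le> T"
begin

abbreviation "K \<equiv> Suc k"
definition E :: 'b where "E = e2 K K"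
definition X :: 'b where "X = Z K k k"
definition Xb :: 'b where "Xb = Zb K k k"

lemma K: "K \<in> {1..R}" "K \<in> {1..T}"
  using k by auto

lemma swap_shift: "wbc_ring_shift T R sb s cb c e qb q k"
  using swap_ring k by (simp add: wbc_ring_shift_def wbc_ring_shift_axioms_def)

lemma swap_eqs: "wbc_ring_shift.E sb s e k = E" "wbc_ring_shift.X sb s cb e qb k = Xb" "wbc_ring_shift.Xb sb s c e q k = X"
proof -
  interpret sw: wbc_ring_shift T R sb s cb c e qb q k by (rule swap_shift)
  show "sw.E = E" using K by (simp add: E_def sw.E_def e2_swap)
  show "sw.X = Xb" using K by (simp add: Xb_def sw.X_def Zb_swap)
  have "wbc_ring.Z s sb c e q K k k = sw.Zb K k k" using K by (intro sw.Zb_swap) auto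
  then show "sw.Xb = X" by (simp add: X_def sw.Xb_def)
qed

lemma E_rels:
  "E * E = 0" "E * c K = E * cb K" "c K * E = cb K * E" "E * (c K * E) = 0"
  using e2_single[OF K] by (simp_all add: E_def)

lemma s_wall: "K < R \<Longrightarrow> s K = t K (Suc K)" 
  by (simp add: V.tr_Suc)
lemma sb_wall: "K < T \<Longrightarrow> sb K = tb K (Suc K)" 
  by (simp add: W.tr_Suc)

text \<open>With F = e_{K+1,K+1}, the two relations reduce to E F sb_K = E F s_K and sb_K F E = s_K
  F E. Both follow from the commutation of e_{K+1,K} with e_{K,K+1}.\<close>

lemma wall_E:
  assumes "K < R" "K < T"
  shows "E * s K * sb K * E * s K = E * s K * sb K * E * sb K" "s K * E * s K * sb K * E = sb K * E * s K * sb K * E"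
proof -
  let ?F = "e2 (Suc K) (Suc K)"
  have R: "K \<in> {1..R}" "Suc K \<in> {1..R}" "K \<in> {1..T}" "Suc K \<in> {1..T}" "K \<noteq> Suc K" "Suc K \<noteq> K" using assms by auto
  note st = s_wall[OF assms(1)] sb_wall[OF assms(2)]
  have sq: "s K * s K = 1" "sb K * sb K = 1" using assms V.s_square W.s_square by auto
  have sc: "s K * sb K = sb K * s K" using assms s_sb by auto
  have 1: "s K * E = e2 (Suc K) K * s K" "s K * e2 (Suc K) K = E * s K" "s K * ?F = e2 K (Suc K) * s K" "s K * e2 K (Suc K) = ?F * s K"
    "sb K * E = e2 K (Suc K) * sb K" "sb K * e2 K (Suc K) = E * sb K" "sb K * ?F = e2 (Suc K) K * sb K" "sb K * e2 (Suc K) K = ?F * sb K"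
    using t_e2[OF R(1,2)] tb_e2[OF R(3,4)] R by (auto simp: E_def st)
  have 2: "E * s K = E * e2 (Suc K) K" "s K * E = e2 (Suc K) K * E" "E * sb K = E * e2 K (Suc K)" "sb K * E = e2 K (Suc K) * E"
    using e2_e2_bar[OF R(1,2,5,3)] e2_e2_bar'[OF R(3,4,5,1)] by (simp_all add: E_def st)
  have 3: "e2 (Suc K) K * e2 K (Suc K) = e2 K (Suc K) * e2 (Suc K) K" using R by (intro e2_commute) auto
  have 4: "E * ?F = ?F * E" unfolding E_def using R by (intro e2_commute) auto
  have 5: "E * s K * sb K * E = E * ?F * s K * sb K"
    by (simp only: mult.assoc 1(5) mult_eq_left[OF 1(4)])
  have 6: "E * ?F * sb K = E * ?F * s K"
  proof -
    have "E * (?F * sb K) = E * (sb K * e2 (Suc K) K)" by (simp only: 1)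
    also have "\<dots> = E * (e2 K (Suc K) * e2 (Suc K) K)" using mult_eq_left[OF 2(3)] by (simp add: mult.assoc)
    also have "\<dots> = E * (e2 (Suc K) K * e2 K (Suc K))" by (simp only: 3)
    also have "\<dots> = E * (s K * e2 K (Suc K))" using mult_eq_left[OF 2(1)] by (simp add: mult.assoc)
    also have "\<dots> = E * (?F * s K)" by (simp only: 1)
    finally show ?thesis by (simp add: mult.assoc)
  qed
  have "E * s K * sb K * E * s K = E * ?F * sb K" unfolding 5
    by (simp add: mult.assoc mult_eq_left[OF sc] sq)
  moreover have "E * s K * sb K * E * sb K = E * ?F * s K" unfolding 5 by (simp add: mult.assoc sq)
  ultimately show "E * s K * sb K * E * s K = E * s K * sb K * E * sb K" using 6 by simp
  have 7: "E * s K * sb K * E = s K * (sb K * (?F * E))"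
  proof -
    have "s K * (sb K * (?F * E)) = s K * (sb K * (E * ?F))" by (simp only: 4)
    also have "\<dots> = s K * e2 K (Suc K) * sb K * ?F" by (simp add: mult.assoc mult_eq_left[OF 1(5)])
    also have "\<dots> = ?F * s K * e2 (Suc K) K * sb K" by (simp only: mult.assoc 1(7) mult_eq_left[OF 1(4)])
    also have "\<dots> = ?F * E * s K * sb K" by (simp add: mult.assoc mult_eq_left[OF 1(2)])
    finally show ?thesis unfolding 5 by (simp add: 4)
  qed
  have 8: "sb K * (?F * E) = s K * (?F * E)"
  proof -
    have "sb K * (?F * E) = e2 (Suc K) K * (sb K * E)" by (simp add: mult_eq_left[OF 1(7)] mult.assoc)
    also have "\<dots> = e2 K (Suc K) * e2 (Suc K) K * E" by (simp only: 2 3 flip: mult.assoc)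
    also have "\<dots> = e2 K (Suc K) * (s K * E)" by (simp only: 2 mult.assoc)
    also have "\<dots> = s K * (?F * E)" by (simp add: mult_eq_left[OF 1(3)] mult.assoc)
    finally show ?thesis .
  qed
  have "s K * (E * s K * sb K * E) = sb K * (?F * E)" unfolding 7 by (simp add: mult_eq_left[OF sq(1)])
  moreover have "sb K * (E * s K * sb K * E) = s K * (?F * E)" unfolding 7
    by (simp add: mult_eq_left[OF sc[symmetric]] mult.assoc mult_eq_left[OF sq(2)])
  ultimately show "s K * E * s K * sb K * E = sb K * E * s K * sb K * E" using 8 by (simp add: mult.assoc)
qed

lemma wbc_shifted:
  "wbc (R - k) (T - k) (\<lambda>i. s (k + i)) (\<lambda>i. sb (k + i)) (\<lambda>i. c (k + i)) (\<lambda>i. cb (k + i)) E (- 1) 0 q qb"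
proof (rule wbc.intro)
  show "symmetric_generators (R - k) (\<lambda>i. s (k + i))"
  proof
    show "s (k + i) * s (k + j) = s (k + j) * s (k + i)" if "1 \<le> i" "i + 1 < j" "j < R - k" for i j
      using V.s_comm[of "k + i" "k + j"] that by simp
  qed (use V.s_square V.s_braid in \<open>auto simp: add.assoc[symmetric] less_diff_conv\<close>)
  show "symmetric_generators (T - k) (\<lambda>i. sb (k + i))"
  proof
    show "sb (k + i) * sb (k + j) = sb (k + j) * sb (k + i)" if "1 \<le> i" "i + 1 < j" "j < T - k" for i j
      using W.s_comm[of "k + i" "k + j"] that by simp
  qed (use W.s_square W.s_braid in \<open>auto simp: add.assoc[symmetric] less_diff_conv\<close>)
  show "1 \<le> R - k" "1 \<le> T - k" using k by auto
  show "q = 1 \<and> qb = - 1 \<or> q = - 1 \<and> qb = 1" by (rule qs)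
  fix i j :: nat
  have tp: "Transposition.transpose (k + j) (Suc (k + j)) (k + i) = k + Transposition.transpose j (Suc j) i"
    by (auto simp: Transposition.transpose_def)
  show "s (k + j) * c (k + i) * s (k + j) = c (k + Transposition.transpose j (Suc j) i)"
    if "1 \<le> j" "j < R - k" "1 \<le> i" "i \<le> R - k"
    using s_c_s[of "k + j" "k + i"] that by (simp add: tp)
  show "sb (k + j) * cb (k + i) * sb (k + j) = cb (k + Transposition.transpose j (Suc j) i)"
    if "1 \<le> j" "j < T - k" "1 \<le> i" "i \<le> T - k"
    using sb_cb_sb[of "k + j" "k + i"] that by (simp add: tp)
  show "E * s (k + 1) * E = E" if "2 \<le> R - k"
    using e2_t_e2[of K "Suc K" K] s_wall K that by (simp add: E_def mult.assoc flip: Suc_eq_plus1)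
  show "E * sb (k + 1) * E = E" if "2 \<le> T - k"
    using e2_tb_e2[of K "Suc K" K] sb_wall K that by (simp add: E_def mult.assoc flip: Suc_eq_plus1)
  show "s (k + i) * E = E * s (k + i)" if "1 < i" "i < R - k"
    using t_e2[of "k + i" "Suc (k + i)" K K] K that by (simp add: E_def V.tr_Suc)
  show "sb (k + i) * E = E * sb (k + i)" if "1 < i" "i < T - k"
    using tb_e2[of "k + i" "Suc (k + i)" K K] K that by (simp add: E_def W.tr_Suc)
  show "c (k + i) * E = E * c (k + i)" if "1 < i" "i \<le> R - k"
    unfolding E_def using K that by (intro c_e2) auto
  show "cb (k + i) * E = E * cb (k + i)" if "1 < i" "i \<le> T - k"
    unfolding E_def using K that by (intro cb_e2) auto
  show "E * s (k + 1) * sb (k + 1) * E * s (k + 1) = E * s (k + 1) * sb (k + 1) * E * sb (k + 1)"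
    "s (k + 1) * E * s (k + 1) * sb (k + 1) * E = sb (k + 1) * E * s (k + 1) * sb (k + 1) * E"
    if "2 \<le> R - k" "2 \<le> T - k" using wall_E that by (simp_all flip: Suc_eq_plus1)
  show "E * c (k + 1) * E = 0" using E_rels(4) by (simp add: mult.assoc flip: Suc_eq_plus1)
  show "c (k + i) * c (k + j) = - 1 * (c (k + j) * c (k + i))"
    if "1 \<le> i" "i \<le> R - k" "1 \<le> j" "j \<le> R - k" "i \<noteq> j"
    by (rule c_anticomm) (use that in auto)
  show "cb (k + i) * cb (k + j) = - 1 * (cb (k + j) * cb (k + i))"
    if "1 \<le> i" "i \<le> T - k" "1 \<le> j" "j \<le> T - k" "i \<noteq> j"
    by (rule cb_anticomm) (use that in auto)
  show "sb (k + j) * c (k + i) = c (k + i) * sb (k + j)" if "1 \<le> j" "j < T - k" "1 \<le> i" "i \<le> R - k"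
    by (rule sb_c) (use that in auto)
  show "s (k + i) * cb (k + j) = cb (k + j) * s (k + i)" if "1 \<le> i" "i < R - k" "1 \<le> j" "j \<le> T - k"
    by (rule s_cb) (use that in auto)
  show "c (k + i) * cb (k + j) = - 1 * (cb (k + j) * c (k + i))" if "1 \<le> i" "i \<le> R - k" "1 \<le> j" "j \<le> T - k"
    by (rule c_cb) (use that in auto)
  show "s (k + i) * sb (k + j) = sb (k + j) * s (k + i)" if "1 \<le> i" "i < R - k" "1 \<le> j" "j < T - k"
    by (rule s_sb) (use that in auto)
  show "c (k + i) * c (k + i) = q" if "1 \<le> i" "i \<le> R - k" using that by (intro c_square) auto
  show "cb (k + i) * cb (k + i) = qb" if "1 \<le> i" "i \<le> T - k" using that by (intro cb_square) auto
  show "E * c (k + 1) = E * cb (k + 1)" "c (k + 1) * E = cb (k + 1) * E"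
    using E_rels by (simp_all flip: Suc_eq_plus1)
qed (simp_all add: E_rels)

section \<open>The affine relations among y, its barred version, e and the finite generators\<close>

lemma X_c: "X * c K = - (c K * X)"
  using c_phi[OF K(1)]
  by (simp add: X_def Z_def left_diff_distrib right_diff_distrib sum_distrib_left sum_distrib_right sum_negf)

lemma X_c': assumes "K < j" "j \<le> R" shows "X * c j = c j * X"
proof -
  have cc: "c j * c K = - (c K * c j)" using assms by (intro c_c) auto
  have "c j * phi K (e2 K a) = phi K (e2 K a) * c j" if "a \<in> {1..k}" for a
    using c_e2[of K j a] assms K that cc by (intro phi_conj) auto
  moreover have "c j * phi K (t a K) = phi K (t a K) * c j" if "a \<in> {1..k}" for a
    using t_c[of a K j] assms K that cc by (intro phi_conj) auto
  ultimately show ?thesis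
    by (simp add: X_def Z_def left_diff_distrib right_diff_distrib sum_distrib_left sum_distrib_right)
qed

lemma X_cb: assumes "K \<le> j" "j \<le> T" shows "X * cb j = cb j * X"
proof -
  have cc: "cb j * c K = - (c K * cb j)" using assms K by (intro cb_c) auto
  have "cb j * phi K (e2 K a) = phi K (e2 K a) * cb j" if "a \<in> {1..k}" for a
    using assms K that by (intro cb_phi_e2) auto
  moreover have "cb j * phi K (t a K) = phi K (t a K) * cb j" if "a \<in> {1..k}" for a
    using t_cb[of a K j] assms K that cc by (intro phi_conj) auto
  ultimately show ?thesis
    by (simp add: X_def Z_def left_diff_distrib right_diff_distrib sum_distrib_left sum_distrib_right)
qed

lemma X_s: assumes "K < j" "j < R" shows "s j * X = X * s j"
  unfolding X_def by (rule commute_Z[of K K k k k]) (use s_Mon[of _ K k j] assms k in auto)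

lemma X_sb: assumes "k < j" "j < T" shows "X * sb j = sb j * X"
proof -
  interpret sw: wbc_ring_shift T R sb s cb c e qb q k by (rule swap_shift)
  have "sb j * X = X * sb j" unfolding X_def
    by (rule commute_Z[of K K k k k]) (use sw.s_Mon[of _ k K j] Mon_swap[of k K] assms k in auto)
  then show ?thesis by simp
qed

lemma sZs: assumes "K < R" shows "s K * X * s K = Z (Suc K) k k"
proof -
  have R: "K \<in> {1..R}" "Suc K \<in> {1..R}" using assms by auto
  note st = s_wall[OF assms]
  have sc: "s K * c K = c (Suc K) * s K" using t_c[OF R R(1)] st by simp
  have "s K * phi K (e2 K a) = phi (Suc K) (e2 (Suc K) a) * s K" if "a \<in> {1..k}" for a
    using t_e2[OF R, of K a] R K that sc by (intro phi_conj) (auto simp: st)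
  moreover have "s K * phi K (t a K) = phi (Suc K) (t a (Suc K)) * s K" if "a \<in> {1..k}" for a
    using V.tr_tr[OF R, of a K] R K that sc by (intro phi_conj) (auto simp: st)
  ultimately have "s K * X = Z (Suc K) k k * s K"
    by (simp add: X_def Z_def left_diff_distrib right_diff_distrib sum_distrib_left sum_distrib_right)
  then show ?thesis using V.s_square[of K] assms by (simp add: mult.assoc)
qed

text \<open>The correction term is \<open>phi\<close> of s_K, the transposition summand that turns
  \<open>Z (Suc K) k k\<close> into \<open>Z (Suc K) K k\<close>. The latter commutes with
  \<open>Mon K k\<close>, where the monomials of y live.\<close>

lemma X_X2:
  assumes "K < R" "X2 = s K * X * s K - (1 + q * (c K * c (Suc K))) * s K"
  shows "X * X2 = X2 * X"
proof -
  have R: "K \<in> {1..R}" "Suc K \<in> {1..R}" using assms by auto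
  have sc: "s K * c (Suc K) = c K * s K" using t_c[OF R R(2)] s_wall[OF assms(1)] by simp
  have cc: "c (Suc K) * c K = - (c K * c (Suc K))" using R by (intro c_c) auto
  have "phi (Suc K) (s K) = (1 + q * (c K * c (Suc K))) * s K"
    by (simp add: phi_def sc algebra_simps mult_eq_left[OF cc])
  then have "X2 = Z (Suc K) K k"
    unfolding assms(2) sZs[OF assms(1)] by (simp add: Z_def s_wall[OF assms(1)] algebra_simps)
  moreover have "Z (Suc K) K k * X = X * Z (Suc K) K k" unfolding X_def
    by (rule commute_Z[of K K k k k]) (use Z_commute[of K "Suc K" k] assms(1) k in auto)
  ultimately show ?thesis by simp
qed

lemma E_sXs: assumes "K < R" shows "E * s K * X * s K = s K * X * s K * E"
proof -
  have R: "K \<in> {1..R}" "Suc K \<in> {1..R}" using assms by auto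
  have Ec: "E * c (Suc K) = c (Suc K) * E" unfolding E_def using c_e2[of K "Suc K" K] R K by simp
  have "E * phi (Suc K) (e2 (Suc K) a) = phi (Suc K) (e2 (Suc K) a) * E" if "a \<in> {1..k}" for a
    using e2_commute[of K "Suc K" K a] R K that Ec unfolding E_def by (intro phi_conj) auto
  moreover have "E * phi (Suc K) (t a (Suc K)) = phi (Suc K) (t a (Suc K)) * E" if "a \<in> {1..k}" for a
    using t_e2[of a "Suc K" K K] R K that Ec unfolding E_def by (intro phi_conj) auto
  ultimately have "E * Z (Suc K) k k = Z (Suc K) k k * E"
    by (simp add: Z_def left_diff_distrib right_diff_distrib sum_distrib_left sum_distrib_right)
  then show ?thesis using sZs[OF assms] by (simp add: mult.assoc)
qed

text \<open>Next to e, an element e_{K,j} acts like the barred transposition (j K), and c_K like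
  cb_K. So e turns the e-summands of y into the transposition summands of its barred version, which
  carry the opposite sign; summed up, this is \<open>E_X\<close>.\<close>

lemma E_phi:
  assumes "j \<in> {1..k}"
  shows "E * phi K (e2 K j) = E * phib K (tb j K)" "phi K (e2 K j) * E = phib K (tb j K) * E"
proof -
  have j: "j \<in> {1..T}" "K \<noteq> j" "j \<noteq> K" using assms k by auto
  have 1: "E * e2 K j = E * tb j K" "e2 K j * E = tb j K * E"
    using e2_e2_bar'[OF K(2) j(1,2) K(1)] W.tr_commute[of K j] by (simp_all add: E_def)
  have 2: "cb K * e2 K j = e2 K j * cb K" using cb_e2[OF j(1) K(2) j(3) K(1)] .
  have 3: "tb j K * c K = c K * tb j K" using tb_c[of j K K] j K by auto
  have 4: "cb K * c K = - (c K * cb K)" using K by (intro cb_c)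
  have "E * (c K * (e2 K j * c K)) = E * (cb K * (e2 K j * c K))"
    using mult_eq_left[OF E_rels(2)] by (simp add: mult.assoc)
  also have "\<dots> = E * tb j K * cb K * c K" using mult_eq_left[OF 2] mult_eq_left[OF 1(1)] by (simp add: mult.assoc)
  also have "\<dots> = - (E * (c K * tb j K * cb K))" by (simp add: mult.assoc 4 mult_eq_left[OF 3])
  also have "\<dots> = - (E * (cb K * (tb j K * cb K)))" using mult_eq_left[OF E_rels(2)] by (simp add: mult.assoc)
  finally have "E * (c K * (e2 K j * c K)) = - (E * (cb K * (tb j K * cb K)))" .
  then show "E * phi K (e2 K j) = E * phib K (tb j K)"
    unfolding phi_def phib_def using qs by (elim disjE conjE) (simp_all add: right_diff_distrib distrib_left 1)
  have "(c K * (e2 K j * c K)) * E = c K * e2 K j * cb K * E" by (simp add: mult.assoc E_rels)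
  also have "\<dots> = c K * cb K * (tb j K * E)" by (simp add: mult.assoc 2[symmetric] mult_eq_left[OF 2[symmetric]] flip: 1)
  also have "\<dots> = - (cb K * (c K * (tb j K * E)))" using mult_eq_left[OF 4] by (simp add: mult.assoc)
  also have "\<dots> = - (cb K * (tb j K * (c K * E)))" by (simp add: mult_eq_left[OF 3] mult.assoc)
  finally have "(c K * (e2 K j * c K)) * E = - ((cb K * (tb j K * cb K)) * E)" by (simp add: mult.assoc E_rels)
  then show "phi K (e2 K j) * E = phib K (tb j K) * E"
    unfolding phi_def phib_def using qs by (elim disjE conjE) (simp_all add: left_diff_distrib distrib_right 1)
qed

lemma E_phi': 
  assumes "i \<in> {1..k}"
  shows "E * phib K (e2 i K) = E * phi K (t i K)" "phib K (e2 i K) * E = phi K (t i K) * E"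
proof -
  interpret sw: wbc_ring_shift T R sb s cb c e qb q k by (rule swap_shift)
  have "wbc.e2 sb s e K i = e2 i K" using assms k by (intro e2_swap) auto
  then show "E * phib K (e2 i K) = E * phi K (t i K)" "phib K (e2 i K) * E = phi K (t i K) * E"
    using sw.E_phi[OF assms] by (simp_all add: swap_eqs phib_swap phi_swap)
qed

lemma E_X: "E * Xb = - (E * X)" "Xb * E = - (X * E)"
  by (simp_all add: X_def Xb_def Z_def Zb_def left_diff_distrib right_diff_distrib sum_distrib_left
      sum_distrib_right E_phi E_phi')

text \<open>Letting the first sum of \<open>Zb\<close> run to K instead of k adds exactly the
  summand of e_{K,K}. The longer sum commutes with \<open>Mon K k\<close> and hence with y.\<close>

lemma X_Xb: "X * (Xb + phib K E) = (Xb + phib K E) * X"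
proof -
  interpret sw: wbc_ring_shift T R sb s cb c e qb q k by (rule swap_shift)
  have eq: "Zb K K k = Xb + phib K E" by (simp add: Xb_def Zb_def E_def)
  have "u * Zb K K k = Zb K K k * u" if "u \<in> Mon K k" for u
    using sw.Z_commute[of k K K u] k that Mon_swap[of k K] Zb_swap[of K K k] by simp
  then have "Zb K K k * X = X * Zb K K k"
    unfolding X_def by (intro commute_Z[of K K k k k]) (use k in auto)
  then show ?thesis by (simp add: eq)
qed

lemma X_Mon: "u \<in> Mon k k \<Longrightarrow> u * X = X * u"
  unfolding X_def using k by (intro Z_commute) auto

lemma Xb_Mon: "u \<in> Mon k k \<Longrightarrow> u * Xb = Xb * u"
proof -
  interpret sw: wbc_ring_shift T R sb s cb c e qb q k by (rule swap_shift)
  show "u \<in> Mon k k \<Longrightarrow> u * Xb = Xb * u"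
    using sw.X_Mon[of u] Mon_swap[of k k] by (simp add: swap_eqs)
qed

lemma E_Mon: "u \<in> Mon k k \<Longrightarrow> u * E = E * u"
  unfolding E_def using e2_Mon[of u k k K K] k by simp

end

section \<open>Powers of y and of its barred version between two copies of e\<close>

lemma bar_coeff_top: "bar_coeff om n n = - 1"
  by (cases n) auto

text \<open>Two multiplications by \<open>Xb\<close> turn E X^{2i+1} into E X^{2i+3} plus a multiple
  \<open>om (2 * i + 1)\<close> of E X. The first part is the index shift in
  \<open>bar_coeff\<close>, with leading coefficient - 1 throughout; the second parts add up to the
  new coefficient of index 0.\<close>

lemma bar_power:
  fixes E :: "'b::ring_1"
  assumes E_Xb: "\<And>p. E * X ^ p * Xb = - (E * X ^ Suc p) - om p * E"
    and even: "\<And>p. even p \<Longrightarrow> om p = 0"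
  shows "E * Xb ^ (2 * n + 1) = (\<Sum>i\<le>n. bar_coeff om n i * (E * X ^ (2 * i + 1)))"
proof (induction n)
  case 0
  show ?case using E_Xb[of 0] even[of 0] by simp
next
  case (Suc n)
  have "E * X ^ (2 * i + 1) * Xb * Xb = E * X ^ (2 * Suc i + 1) + om (2 * i + 1) * (E * X)" for i
  proof -
    have "E * X ^ (2 * i + 1) * Xb * Xb = - (E * X ^ (2 * i + 2) * Xb) - om (2 * i + 1) * (E * X ^ 0 * Xb)"
      unfolding E_Xb[of "2 * i + 1"] by (simp add: left_diff_distrib mult.assoc)
    then show ?thesis unfolding E_Xb using even[of 0] even[of "2 * i + 2"] by simp
  qed
  then have "bar_coeff om n i * (E * X ^ (2 * i + 1)) * Xb * Xb =
      bar_coeff om (Suc n) (Suc i) * (E * X ^ (2 * Suc i + 1)) + bar_coeff om n i * om (2 * i + 1) * (E * X)"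
    if "i \<le> n" for i
    using that bar_coeff_top[of om n] by (simp add: mult.assoc algebra_simps)
  then have "(\<Sum>i\<le>n. bar_coeff om n i * (E * X ^ (2 * i + 1))) * Xb * Xb =
      (\<Sum>i\<le>n. bar_coeff om (Suc n) (Suc i) * (E * X ^ (2 * Suc i + 1))) + bar_coeff om (Suc n) 0 * (E * X)"
    by (simp add: sum_distrib_right sum.distrib del: bar_coeff.simps power_Suc) (simp add: sum_distrib_right)
  moreover have "E * Xb ^ (2 * Suc n + 1) = E * Xb ^ (2 * n + 1) * Xb * Xb"
    using power_add[of Xb "2 * n + 1" 2] by (simp add: mult.assoc power2_eq_square)
  ultimately show ?case unfolding Suc.IH
    by (subst sum.atMost_Suc_shift) (simp add: add.commute del: bar_coeff.simps)
qed

context wbc_ring_shift begin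

lemma power_comm: assumes "a * x = x * a" shows "a * x ^ p = x ^ p * (a :: 'b)"
  by (induction p) (simp_all add: mult.assoc mult_eq_left[OF assms] flip: power_Suc2)

lemma X_power_c: "X ^ p * c K = (if even p then c K * X ^ p else - (c K * X ^ p))"
  by (induction p) (auto simp: mult.assoc X_c mult_eq_left[OF X_c])

lemma Xb_c: "Xb * c K = c K * Xb"
proof -
  interpret sw: wbc_ring_shift T R sb s cb c e qb q k by (rule swap_shift)
  show ?thesis using sw.X_cb[of K] k by (simp add: swap_eqs)
qed

lemma phib_E: "phib K E = E - qb * (c K * (E * c K))"
  using E_rels mult_eq_left[OF E_rels(3)] by (simp add: phib_def mult.assoc)

context
  assumes two: "\<And>x :: 'b. x + x = 0 \<Longrightarrow> x = 0"
begin

text \<open>In E c X^p c E the inner generators can be moved together as c, which passes the even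
  power without sign and gives q, or as cb, which commutes with X and gives qb. As qb = - q, twice
  the product vanishes.\<close>

lemma E_X_even_E: assumes "even p" shows "E * X ^ p * E = 0"
proof -
  have Xcb: "cb K * X ^ p = X ^ p * cb K" using X_cb[of K] k by (intro power_comm) auto
  have cc: "c K * c K = q" "cb K * cb K = qb" using c_square[of K] cb_square[of K] k by auto
  have "E * c K * X ^ p * (c K * E) = E * (X ^ p * (c K * (c K * E)))"
    using assms mult_eq_left[OF X_power_c[of p]] by (simp add: mult.assoc)
  also have "\<dots> = q * (E * X ^ p * E)" using mult_eq_left[OF cc(1)] qs by (auto simp: mult.assoc)
  finally have "q * (E * X ^ p * E) = E * c K * X ^ p * (c K * E)" ..
  also have "\<dots> = E * (X ^ p * (cb K * (cb K * E)))"
    unfolding E_rels(2,3) by (simp add: mult.assoc mult_eq_left[OF Xcb])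
  also have "\<dots> = qb * (E * X ^ p * E)" using mult_eq_left[OF cc(2)] qs by (auto simp: mult.assoc)
  finally have "q * (E * X ^ p * E) = qb * (E * X ^ p * E)" .
  moreover have "y = 0" if "q * y = qb * y" for y
    using that qs two[of y] by (elim disjE conjE) (simp_all add: eq_neg_iff_add_eq_0 neg_eq_iff_add_eq_0)
  ultimately show ?thesis by blast
qed

lemma X_power_Xb: "X ^ p * (Xb + phib K E) = (Xb + phib K E) * X ^ p"
  using power_comm[OF X_Xb[symmetric], of p] by simp

text \<open>Removes the Clifford term of \<open>phib K E\<close> in \<open>E_X_Xb\<close>. For p >
  0, evaluating E X^{p-1} (Xb + phib E) c E with the commuting factors in either order gives E X^p c
  E and its negative.\<close>

lemma E_X_c_E: "E * X ^ p * c K * E = 0"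
proof (cases p)
  case 0
  then show ?thesis using E_rels(4) by (simp add: mult.assoc)
next
  case (Suc p)
  have cc: "c K * (c K * y) = q * y" "cb K * (cb K * y) = qb * y" for y
    using c_square[of K] cb_square[of K] k mult_eq_left[of "c K" "c K" q y] mult_eq_left[of "cb K" "cb K" qb y] by auto
  have EE: "E * (E * y) = 0" "E * (c K * (E * y)) = 0" for y
    using mult_eq_left[OF E_rels(1)] mult_eq_left[of E "c K * E" 0 y] E_rels(4) by (simp_all add: mult.assoc)
  have q: "a * (q * b) = q * (a * b)" "a * (qb * b) = qb * (a * b)" "q * (qb * b) = - b" "qb * (q * b) = - b" for a b :: 'b
    using qs by auto
  have "E * X ^ p * (Xb + phib K E) * (c K * E) = E * X ^ p * Xb * (c K * E)"
    unfolding phib_E using E_rels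
    by (simp add: algebra_simps E_rels) (simp add: q cc E_rels)
  also have "\<dots> = E * X ^ Suc p * (c K * E)"
  proof -
    have "Xb * (c K * E) = X * (c K * E)"
      using mult_eq_left[OF Xb_c] mult_eq_left[OF X_c, of E] by (simp add: mult.assoc E_X)
    then show ?thesis by (simp add: mult.assoc power_commutes) (simp add: power_commutes flip: mult.assoc)
  qed
  finally have 1: "E * X ^ p * (Xb + phib K E) * (c K * E) = E * X ^ Suc p * (c K * E)" .
  have "E * (Xb + phib K E) * X ^ p * (c K * E) = E * Xb * X ^ p * (c K * E)"
    unfolding phib_E by (simp add: algebra_simps EE E_rels q)
  also have "\<dots> = - (E * X ^ Suc p * (c K * E))" by (simp add: E_X mult.assoc)
  finally have "E * X ^ Suc p * (c K * E) = - (E * X ^ Suc p * (c K * E))"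
    using 1 X_power_Xb[of p] by (simp add: mult.assoc)
  then have "E * X ^ Suc p * (c K * E) = 0" using two eq_neg_iff_add_eq_0 by blast
  then show ?thesis using Suc by (simp add: mult.assoc)
qed

lemma E_X_Xb: "E * X ^ p * Xb = - (E * X ^ Suc p) - E * X ^ p * E"
proof -
  have EE: "E * (E * y) = 0" "E * (c K * (E * y)) = 0" for y
    using mult_eq_left[OF E_rels(1)] mult_eq_left[of E "c K * E" 0 y] E_rels(4) by (simp_all add: mult.assoc)
  have E0: "E * (X ^ p * (c K * (E * y))) = 0" for y
    using E_X_c_E[of p] mult_eq_left[of "E * X ^ p * c K" E 0 y] by (simp add: mult.assoc)
  have q: "a * (qb * b) = qb * (a * b)" for a b :: 'b using qs by auto
  have "E * (X ^ p * (Xb + phib K E)) = E * X ^ p * Xb + E * X ^ p * E"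
    unfolding phib_E by (simp add: algebra_simps q E0)
  moreover have "E * ((Xb + phib K E) * X ^ p) = - (E * X ^ Suc p)"
    unfolding phib_E by (simp add: algebra_simps q EE E_rels) (simp add: mult_eq_left[OF E_X(1)] mult.assoc)
  ultimately show ?thesis unfolding X_power_Xb by (simp add: eq_diff_eq)
qed

end

text \<open>Straightening the zigzag gives one E from each summand of \<open>phi\<close>: in the
  decorated one, both decorations move to the other end, where their product qb cancels the factor -
  q.\<close>

lemma E_phi_e2_E: assumes j: "j \<in> {1..k}" shows "E * phi K (e2 K j) * E = E + E"
proof -
  have j': "j \<in> {1..T}" "K \<noteq> j" using j k by auto
  have E1: "E * (e2 K j * E) = E"
    using e2_e2_bar'(2)[OF K(2) j' K(1)] e2_tb_e2[OF K(2) j' K(1)] by (simp add: E_def)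
  have cb: "cb K * e2 K j = e2 K j * cb K" using cb_e2[of j K K] K j' by simp
  have "E * (c K * (e2 K j * (c K * E))) = E * (cb K * (e2 K j * (cb K * E)))"
    using mult_eq_left[OF E_rels(2)] by (simp add: E_rels mult.assoc)
  also have "\<dots> = E * (e2 K j * (cb K * (cb K * E)))" by (simp add: mult_eq_left[OF cb] mult.assoc)
  also have "cb K * (cb K * E) = qb * E" using mult_eq_left[OF cb_square[of K]] k by simp
  finally have "E * (c K * (e2 K j * (c K * E))) = qb * E"
    using qs E1 by auto
  then have "E * (q * (c K * (e2 K j * (c K * E)))) = - E" using qs by auto
  then show ?thesis by (simp add: phi_def algebra_simps E1)
qed

text \<open>Each e_{K,j} contributes 2 E and each transposition - 2 E, with k of either kind. Thus
  \<omega>_{1,k+1} vanishes.\<close>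

lemma E_X_E: "E * X * E = 0"
proof -
  interpret sw: wbc_ring_shift T R sb s cb c e qb q k by (rule swap_shift)
  have 2: "E * phi K (t j K) * E = E + E" if j: "j \<in> {1..k}" for j
    using sw.E_phi_e2_E[OF j] e2_swap[of j K] K j k E_phi'[OF j] by (simp add: swap_eqs phib_swap)
  show ?thesis
    by (simp add: X_def Z_def left_diff_distrib right_diff_distrib sum_distrib_left sum_distrib_right E_phi_e2_E 2)
qed

lemma affine_sat:
  assumes q: "q = - 1" and two: "\<And>x :: 'b. x + x = 0 \<Longrightarrow> x = 0"
    and om: "\<And>n. E * X ^ (2 * n + 1) * E = om (2 * n + 1) * E"
    and omb: "\<And>n. 1 \<le> n \<Longrightarrow> E * Xb ^ n * E = omb n * E"
    and omb_even: "\<And>n. 1 \<le> n \<Longrightarrow> omb (2 * n) = 0"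
    and omb_odd: "\<And>n. omb (2 * n + 1) = (\<Sum>i\<le>n. bar_coeff om n i * om (2 * i + 1))"
    and ab: "(a, b) \<in> affine_rels (R - k) (T - k) (\<lambda>i. s (k + i)) (\<lambda>i. sb (k + i)) E
      (\<lambda>i. c (k + i)) (\<lambda>i. cb (k + i)) X Xb om omb"
  shows "a = b"
  using ab
proof cases
  interpret sw: wbc_ring_shift T R sb s cb c e qb q k by (rule swap_shift)
  have q': "q * y = - y" "qb * y = y" for y using qs q by auto
  have K1: "k + 1 = K" "k + 2 = Suc K" by simp_all
  {
    case (x1_x2 x2)
    then show ?thesis using X_X2[of x2] by (simp add: K1 q')
  next
    case (x_c i)
    then show ?thesis using X_c X_c'[of "k + i"] by (cases "i = 1") (auto simp: K1)
  next
    case (s_x j)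
    then show ?thesis using X_s[of "k + j"] by simp
  next
    case (xb1_xb2 xb2)
    then show ?thesis using sw.X_X2[of xb2] by (simp add: K1 q' swap_eqs)
  next
    case (xb_cb i)
    then show ?thesis using sw.X_c sw.X_c'[of "k + i"] by (cases "i = 1") (auto simp: K1 swap_eqs)
  next
    case (sb_xb j)
    then show ?thesis using sw.X_s[of "k + j"] by (simp add: swap_eqs)
  next
    case e_x_xb
    then show ?thesis using E_X by (simp add: distrib_left)
  next
    case x_xb_e
    then show ?thesis using E_X by (simp add: distrib_right)
  next
    case e_sxs
    then show ?thesis using E_sXs by (simp add: K1)
  next
    case e_sbxbsb
    then show ?thesis using sw.E_sXs by (simp add: K1 swap_eqs)
  next
    case (x_xb eb)
    have "E + Xb - eb = Xb + phib K E" unfolding phib_E using x_xb by (simp add: K1 q' mult.assoc)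
    then show ?thesis unfolding x_xb(1,2) using X_Xb by (simp only:)
  next
    case (x_cb i)
    then show ?thesis using X_cb[of "k + i"] by simp
  next
    case (xb_c i)
    then show ?thesis using sw.X_cb[of "k + i"] by (simp add: swap_eqs)
  next
    case (x_sb i)
    then show ?thesis using X_sb[of "k + i"] by simp
  next
    case (xb_s i)
    then show ?thesis using sw.X_sb[of "k + i"] by (simp add: swap_eqs)
  next
    case (e_xodd_e n)
    then show ?thesis using om by simp
  next
    case (e_xeven_e n)
    then show ?thesis using E_X_even_E[OF two, of "2 * n"] by simp
  next
    case (e_xb_e n)
    then show ?thesis using omb by simp
  next
    case (omb_even n)
    then show ?thesis using assms(5) by simp
  next
    case (omb_odd n)
    then show ?thesis using assms(6) by simp
  }
qed

lemma E_Xb_odd_E: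
  assumes two: "\<And>x :: 'b. x + x = 0 \<Longrightarrow> x = 0"
    and om: "\<And>n. E * X ^ (2 * n + 1) * E = om (2 * n + 1) * E" and even: "\<And>n. even n \<Longrightarrow> om n = 0"
  shows "E * Xb ^ (2 * n + 1) * E = (\<Sum>i\<le>n. bar_coeff om n i * om (2 * i + 1)) * E"
proof -
  have om': "E * X ^ p * E = om p * E" for p
  proof (cases "even p")
    case True
    then show ?thesis using E_X_even_E[OF two, of p] even[of p] by simp
  next
    case False
    then obtain n where "p = 2 * n + 1" by (rule oddE)
    then show ?thesis using om[of n] by simp
  qed
  have "E * Xb ^ (2 * n + 1) = (\<Sum>i\<le>n. bar_coeff om n i * (E * X ^ (2 * i + 1)))"
    using E_X_Xb[OF two] om' even by (intro bar_power) auto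
  then show ?thesis
    by (simp add: sum_distrib_right mult.assoc om'[unfolded mult.assoc] del: power_Suc)
qed

end

section \<open>Parity\<close>

lemma carrier_free_induct [consumes 1, case_names scalar var add]:
  assumes "p \<in> carrier (free_superalgebra ogen G)"
    and "\<And>a. P (scalar a)" and "\<And>g p. g \<in> G \<Longrightarrow> p \<in> carrier (free_superalgebra ogen G) \<Longrightarrow> P p \<Longrightarrow> P (var g * p)"
    and "\<And>p q. p \<in> carrier (free_superalgebra ogen G) \<Longrightarrow> q \<in> carrier (free_superalgebra ogen G) \<Longrightarrow>
      P p \<Longrightarrow> P q \<Longrightarrow> P (p + q)"
  shows "P (p :: ('g, 'a::comm_ring_1) free_algebra)"
proof -
  have w: "P (single (Word xs) a) \<and> single (Word xs) a \<in> carrier (free_superalgebra ogen G)"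
    if "set xs \<subseteq> G" for xs a
    using that
  proof (induction xs)
    case Nil
    show ?case using assms(2)[of a] free_carrier_scalar[of a ogen G] by (simp add: scalar_def zero_free_word_def)
  next
    case (Cons x xs)
    have "single (Word (x # xs)) a = var x * single (Word xs) a"
      by (simp add: var_def mult_single plus_free_word_def)
    moreover have "(var x :: ('g, 'a) free_algebra) \<in> carrier (free_superalgebra ogen G)" using Cons.prems by (intro free_carrier_var) auto
    ultimately show ?case using Cons assms(3)[of x] by (simp add: free_ops)
  qed
  have "P (\<Sum>w\<in>A. single w (lookup p w)) \<and> (\<Sum>w\<in>A. single w (lookup p w)) \<in> carrier (free_superalgebra ogen G)"
    if "finite A" "A \<subseteq> keys p" for A
    using that
  proof induction
    case empty
    show ?case using assms(2)[of 0] by (simp add: scalar_def free_ops)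
  next
    case (insert x A)
    have "set (letters x) \<subseteq> G" using insert.prems assms(1) by (auto simp: carrier_free_words)
    then show ?case using w[of "letters x"] insert assms(4) by (simp add: free_ops)
  qed
  from this[of "keys p"] poly_mapping_sum_single[of p] show ?thesis by simp
qed

lemma carrier_free_mono: "G \<subseteq> H \<Longrightarrow> p \<in> carrier (free_superalgebra ogen G) \<Longrightarrow> p \<in> carrier (free_superalgebra ogen H)"
  by (auto simp: carrier_free_words)

definition homogeneous :: "('g \<Rightarrow> bool) \<Rightarrow> bool \<Rightarrow> ('g, 'a::comm_ring_1) free_algebra \<Rightarrow> bool" where
  "homogeneous ogen b p \<longleftrightarrow> (\<forall>w\<in>keys p. odd (length (filter ogen (letters w))) = b)"

lemma homogeneous_ops:
  fixes p q :: "('g, 'a::comm_ring_1) free_algebra"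
  shows "homogeneous ogen b (0 :: ('g, 'a) free_algebra)" "homogeneous ogen False (1 :: ('g, 'a) free_algebra)"
  "homogeneous ogen False (scalar a :: ('g, 'a) free_algebra)"
  "homogeneous ogen (ogen g) (var g :: ('g, 'a) free_algebra)"
  "homogeneous ogen b p \<Longrightarrow> homogeneous ogen b q \<Longrightarrow> homogeneous ogen b (p + q)"
  "homogeneous ogen b p \<Longrightarrow> homogeneous ogen b (- p)"
  "homogeneous ogen b p \<Longrightarrow> homogeneous ogen b q \<Longrightarrow> homogeneous ogen b (p - q)"
proof -
  show "homogeneous ogen False (scalar a :: ('g, 'a) free_algebra)" for a :: 'a
    by (auto simp: homogeneous_def scalar_def zero_free_word_def split: if_splits)
  from this[of 1] show "homogeneous ogen False (1 :: ('g, 'a) free_algebra)" by (simp add: scalar_def)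
  show add: "homogeneous ogen b p \<Longrightarrow> homogeneous ogen b q \<Longrightarrow> homogeneous ogen b (p + q)" for p q :: "('g, 'a) free_algebra"
    using Poly_Mapping.keys_add[of p q] unfolding homogeneous_def by blast
  show neg: "homogeneous ogen b p \<Longrightarrow> homogeneous ogen b (- p)" for p :: "('g, 'a) free_algebra"
    by (simp add: homogeneous_def)
  show "homogeneous ogen b p \<Longrightarrow> homogeneous ogen b q \<Longrightarrow> homogeneous ogen b (p - q)"
    using add[of p "- q"] neg[of q] by simp
qed (auto simp: homogeneous_def var_def split: if_splits)

lemma homogeneous_mult:
  assumes "homogeneous ogen b p" "homogeneous ogen b' q" shows "homogeneous ogen (b \<noteq> b') (p * q)"
proof -
  have "odd (length (filter ogen (letters w))) = (b \<noteq> b')" if "w \<in> keys (p * q)" for w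
  proof -
    obtain u v where "w = u + v" "u \<in> keys p" "v \<in> keys q" using keys_mult[of p q] \<open>w \<in> keys (p * q)\<close> by blast
    then show ?thesis using assms by (auto simp: homogeneous_def plus_free_word_def)
  qed
  then show ?thesis by (simp add: homogeneous_def)
qed

lemma homogeneous_even_mult:
  "homogeneous ogen False p \<Longrightarrow> homogeneous ogen False q \<Longrightarrow> homogeneous ogen False (p * q)"
  "homogeneous ogen b p \<Longrightarrow> homogeneous ogen b q \<Longrightarrow> homogeneous ogen False (p * q)"
  using homogeneous_mult[of ogen False p False q] homogeneous_mult[of ogen b p b q] by simp_all

lemma homogeneous_sum: "(\<And>i. i \<in> A \<Longrightarrow> homogeneous ogen b (h i)) \<Longrightarrow> homogeneous ogen b (sum h A)"
  by (induction A rule: infinite_finite_induct) (simp_all add: homogeneous_ops)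

lemma homogeneous_power: "homogeneous ogen False p \<Longrightarrow> homogeneous ogen False (p ^ n)"
  by (induction n) (simp_all add: homogeneous_ops homogeneous_even_mult)

lemma homogeneous_var: "ogen g = b \<Longrightarrow> homogeneous ogen b (var g)"
  using homogeneous_ops(4)[of ogen g] by simp

lemma even_odd_split:
  assumes "p \<in> carrier (free_superalgebra ogen G)"
  obtains p0 p1 where "p = p0 + p1" "homogeneous ogen False p0" "homogeneous ogen True p1"
    "p0 \<in> carrier (free_superalgebra ogen G)" "p1 \<in> carrier (free_superalgebra ogen G)"
proof -
  have "\<exists>p0 p1. p = p0 + p1 \<and> homogeneous ogen False p0 \<and> homogeneous ogen True p1 \<and>
    p0 \<in> carrier (free_superalgebra ogen G) \<and> p1 \<in> carrier (free_superalgebra ogen G)"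
    using assms
  proof (induction rule: carrier_free_induct)
    case (scalar a)
    show ?case by (intro exI[of _ "scalar a"] exI[of _ 0]) (simp add: homogeneous_ops free_ops)
  next
    case (var g p)
    then obtain p0 p1 where p: "p = p0 + p1" "homogeneous ogen False p0" "homogeneous ogen True p1"
      "p0 \<in> carrier (free_superalgebra ogen G)" "p1 \<in> carrier (free_superalgebra ogen G)" by blast
    note c = free_carrier_mult[OF free_carrier_var[OF var(1)]]
    note h = homogeneous_mult[OF homogeneous_ops(4)[of ogen g]]
    show ?case
    proof (cases "ogen g")
      case True
      then show ?thesis using p c[OF p(4)] c[OF p(5)] h[OF p(2)] h[OF p(3)]
        by (intro exI[of _ "var g * p1"] exI[of _ "var g * p0"]) (simp add: algebra_simps)
    next
      case False
      then show ?thesis using p c[OF p(4)] c[OF p(5)] h[OF p(2)] h[OF p(3)]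
        by (intro exI[of _ "var g * p0"] exI[of _ "var g * p1"]) (simp add: algebra_simps)
    qed
  next
    case (add p q)
    then obtain p0 p1 q0 q1 where "p = p0 + p1" "homogeneous ogen False p0" "homogeneous ogen True p1"
      "p0 \<in> carrier (free_superalgebra ogen G)" "p1 \<in> carrier (free_superalgebra ogen G)"
      "q = q0 + q1" "homogeneous ogen False q0" "homogeneous ogen True q1"
      "q0 \<in> carrier (free_superalgebra ogen G)" "q1 \<in> carrier (free_superalgebra ogen G)" by blast
    then show ?case
      by (intro exI[of _ "p0 + q0"] exI[of _ "p1 + q1"]) (simp add: homogeneous_ops free_ops)
  qed
  then show ?thesis using that by blast
qed

lemma even_odd_part_free:
  "even_part (free_superalgebra ogen G) = {p \<in> carrier (free_superalgebra ogen G). homogeneous ogen False p}"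
  "odd_part (free_superalgebra ogen G) = {p \<in> carrier (free_superalgebra ogen G). homogeneous ogen True p}"
  by (auto simp: free_superalgebra_def Let_def homogeneous_def)

lemma bc_transp_word: "bc_transp i j = prod_list (map (\<lambda>l. var (S l)) (transp_word i j))"
    "bc_transp_bar i j = prod_list (map (\<lambda>l. var (Sbar l)) (transp_word i j))"
  by (simp_all add: bc_transp_def bc_transp_bar_def transp_def perm_prod_def)

lemma prod_list_carrier:
  "(\<And>x. x \<in> set xs \<Longrightarrow> h x \<in> carrier (free_superalgebra ogen G)) \<Longrightarrow> prod_list (map h xs) \<in> carrier (free_superalgebra ogen G)"
  by (induction xs) (simp_all add: free_ops)

lemma prod_list_homogeneous:
  "(\<And>x. x \<in> set xs \<Longrightarrow> homogeneous ogen False (h x)) \<Longrightarrow> homogeneous ogen False (prod_list (map h xs))"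
  by (induction xs) (simp_all add: homogeneous_ops homogeneous_even_mult)

lemma bc_elements_homogeneous:
  "homogeneous bc_odd False (bc_transp i j :: (bc_gen, 'a::comm_ring_1) free_algebra)"
  "homogeneous bc_odd False (bc_transp_bar i j :: (bc_gen, 'a) free_algebra)"
  "homogeneous bc_odd False (bc_e2 i j :: (bc_gen, 'a) free_algebra)"
  "homogeneous bc_odd False (bc_e i :: (bc_gen, 'a) free_algebra)"
  "homogeneous bc_odd False (bc_y i :: (bc_gen, 'a) free_algebra)"
  "homogeneous bc_odd False (bc_y_bar i :: (bc_gen, 'a) free_algebra)"
proof -
  note h = homogeneous_ops homogeneous_even_mult homogeneous_var homogeneous_sum
  have cxc: "homogeneous bc_odd False (var (C i) * p * var (C i))" "homogeneous bc_odd False (var (Cbar i) * p * var (Cbar i))"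
    if "homogeneous bc_odd False p" for i and p :: "(bc_gen, 'a) free_algebra"
    using homogeneous_mult[OF homogeneous_mult[OF homogeneous_ops(4) that] homogeneous_ops(4), of "C i" "C i"]
      homogeneous_mult[OF homogeneous_mult[OF homogeneous_ops(4) that] homogeneous_ops(4), of "Cbar i" "Cbar i"] by simp_all
  show t: "homogeneous bc_odd False (bc_transp i j :: (bc_gen, 'a) free_algebra)" for i j
    unfolding bc_transp_word by (intro prod_list_homogeneous homogeneous_var) simp
  show tb: "homogeneous bc_odd False (bc_transp_bar i j :: (bc_gen, 'a) free_algebra)" for i j
    unfolding bc_transp_word by (intro prod_list_homogeneous homogeneous_var) simp
  show e2: "homogeneous bc_odd False (bc_e2 i j :: (bc_gen, 'a) free_algebra)" for i j
    unfolding bc_e2_def by (intro h t tb) simp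
  then show "homogeneous bc_odd False (bc_e i :: (bc_gen, 'a) free_algebra)" by (simp add: bc_e_def)
  show "homogeneous bc_odd False (bc_y i :: (bc_gen, 'a) free_algebra)"
    unfolding bc_y_def bc_L_def bc_ebar2_def by (intro homogeneous_ops homogeneous_sum cxc t e2)
  show "homogeneous bc_odd False (bc_y_bar i :: (bc_gen, 'a) free_algebra)"
    unfolding bc_y_bar_def bc_L_bar_def bc_ebar2_def by (intro homogeneous_ops homogeneous_sum cxc tb e2)
qed

lemma bc_elements_carrier:
  assumes "i \<in> {1..m}" "i \<in> {1..n}"
  shows "(bc_e i :: (bc_gen, 'a::comm_ring_1) free_algebra) \<in> carrier (free_superalgebra bc_odd (bc_gens m n))" (is "_ \<in> ?C")
    "(bc_y i :: (bc_gen, 'a) free_algebra) \<in> carrier (free_superalgebra bc_odd (bc_gens m n))"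
    "(bc_y_bar i :: (bc_gen, 'a) free_algebra) \<in> carrier (free_superalgebra bc_odd (bc_gens m n))"
proof -
  have C: "ring_closed ?C" by (rule ring_closed_free)
  have v: "var (C j) \<in> ?C" "var (Cbar i) \<in> ?C" "var E1 \<in> ?C" if "j \<in> {1..i}" for j
    using assms that by (auto intro!: free_carrier_var simp: bc_gens_def)
  have tw: "set (transp_word j l) \<subseteq> {1..<i}" if "j \<in> {1..i}" "l \<in> {1..i}" for j l
    using that by (auto simp: transp_word_def)
  have t: "bc_transp j l \<in> ?C" "bc_transp_bar j l \<in> ?C" if "j \<in> {1..i}" "l \<in> {1..i}" for j l
    unfolding bc_transp_word
    by (rule prod_list_carrier; rule free_carrier_var; use assms tw[OF that] in \<open>fastforce simp: bc_gens_def\<close>)+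
  have e2: "bc_e2 j l \<in> ?C" if "j \<in> {1..i}" "l \<in> {1..i}" for j l
    unfolding bc_e2_def using that v t by (intro rc_basic(5)[OF C]) auto
  have eb: "bc_ebar2 j l \<in> ?C" if "j \<in> {1..i}" "l \<in> {1..i}" for j l
    unfolding bc_ebar2_def using that v e2 by (intro rc_basic(5)[OF C]) auto
  note rc = rc_basic(4,5)[OF C] rc_diff[OF C] rc_sum[OF C]
  show "bc_e i \<in> ?C" unfolding bc_e_def using e2 assms by simp
  show "bc_y i \<in> ?C" unfolding bc_y_def bc_L_def by (intro rc v t e2 eb) (use assms in auto)
  show "bc_y_bar i \<in> ?C" unfolding bc_y_bar_def bc_L_bar_def by (intro rc v t e2 eb) (use assms in auto)
qed

section \<open>Homogeneity of the relation ideal\<close>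

context BC_presentation begin

abbreviation "lg g \<equiv> (linrep (gp g) :: 'a lin)"
definition sg :: "bc_gen \<Rightarrow> 'a lin" where "sg g = (if bc_odd g then - lg g else lg g)"

text \<open>The two sides of every relation have the same parity, so the relations survive a change
  of sign of all Clifford generators.\<close>

lemma wbc_signed:
  "wbc R T (\<lambda>i. sg (S i)) (\<lambda>i. sg (Sbar i)) (\<lambda>i. sg (C i)) (\<lambda>i. sg (Cbar i)) (sg E1) (- 1) 0 (- 1) 1"
proof -
  interpret L: wbc R T "\<lambda>i. lg (S i)" "\<lambda>i. lg (Sbar i)" "\<lambda>i. lg (C i)" "\<lambda>i. lg (Cbar i)" "lg E1" "- 1" 0 "- 1" 1
    by (rule wbc_lin[OF RT])
  show ?thesis
  proof (rule wbc.intro)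
    fix i j :: nat
    show "sg (C i) * sg (C j) = - 1 * (sg (C j) * sg (C i))" if "1 \<le> i" "i \<le> R" "1 \<le> j" "j \<le> R" "i \<noteq> j"
      using L.c_anticomm[OF that] by (simp add: sg_def)
    show "sg (Cbar i) * sg (Cbar j) = - 1 * (sg (Cbar j) * sg (Cbar i))" if "1 \<le> i" "i \<le> T" "1 \<le> j" "j \<le> T" "i \<noteq> j"
      using L.cb_anticomm[OF that] by (simp add: sg_def)
    show "sg (C i) * sg (Cbar j) = - 1 * (sg (Cbar j) * sg (C i))" if "1 \<le> i" "i \<le> R" "1 \<le> j" "j \<le> T"
      using L.c_cb[OF that] by (simp add: sg_def)
    show "sg (S j) * sg (C i) * sg (S j) = sg (C (Transposition.transpose j (Suc j) i))"
      if "1 \<le> j" "j < R" "1 \<le> i" "i \<le> R" using L.s_c_s[OF that] by (simp add: sg_def)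
    show "sg (Sbar j) * sg (Cbar i) * sg (Sbar j) = sg (Cbar (Transposition.transpose j (Suc j) i))"
      if "1 \<le> j" "j < T" "1 \<le> i" "i \<le> T" using L.sb_cb_sb[OF that] by (simp add: sg_def)
    show "sg (Sbar j) * sg (C i) = sg (C i) * sg (Sbar j)" if "1 \<le> j" "j < T" "1 \<le> i" "i \<le> R"
      using L.sb_c[OF that] by (simp add: sg_def)
    show "sg (S i) * sg (Cbar j) = sg (Cbar j) * sg (S i)" if "1 \<le> i" "i < R" "1 \<le> j" "j \<le> T"
      using L.s_cb[OF that] by (simp add: sg_def)
    show "sg (S i) * sg (Sbar j) = sg (Sbar j) * sg (S i)" if "1 \<le> i" "i < R" "1 \<le> j" "j < T"
      using L.s_sb[OF that] by (simp add: sg_def)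
    show "sg (S i) * sg E1 = sg E1 * sg (S i)" if "1 < i" "i < R" using L.s_e[OF that] by (simp add: sg_def)
    show "sg (Sbar i) * sg E1 = sg E1 * sg (Sbar i)" if "1 < i" "i < T" using L.sb_e[OF that] by (simp add: sg_def)
    show "sg (C i) * sg E1 = sg E1 * sg (C i)" if "1 < i" "i \<le> R" using L.c_e[OF that] by (simp add: sg_def)
    show "sg (Cbar i) * sg E1 = sg E1 * sg (Cbar i)" if "1 < i" "i \<le> T" using L.cb_e[OF that] by (simp add: sg_def)
    show "symmetric_generators R (\<lambda>i. sg (S i))" "symmetric_generators T (\<lambda>i. sg (Sbar i))"
      using L.s_gens L.sb_gens by (simp_all add: sg_def)
    show "sg E1 * sg (S 1) * sg (Sbar 1) * sg E1 * sg (S 1) = sg E1 * sg (S 1) * sg (Sbar 1) * sg E1 * sg (Sbar 1)"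
      "sg (S 1) * sg E1 * sg (S 1) * sg (Sbar 1) * sg E1 = sg (Sbar 1) * sg E1 * sg (S 1) * sg (Sbar 1) * sg E1"
      if "2 \<le> R" "2 \<le> T" using L.wall_left[OF that] L.wall_right[OF that] by (simp_all add: sg_def)
    show "- 1 = (1 :: 'a lin) \<and> 1 = (- 1 :: 'a lin) \<or> - 1 = (- 1 :: 'a lin) \<and> 1 = (1 :: 'a lin)" by simp
    show "sg E1 * sg (C 1) * sg E1 = 0" using L.e_c_e by (simp add: sg_def)
  qed (use RT in \<open>simp_all add: sg_def L.c_square L.cb_square L.e_c L.c_e1 L.e_square L.e_s_e L.e_sb_e\<close>)
qed

text \<open>The representation twisted by the parity automorphism; it shows that the ideal of relations is
  homogeneous.\<close>

definition rho' :: "(bc_gen, 'a) free_algebra \<Rightarrow> 'a lin" where "rho' = scal.ev sg"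

lemma rho'_ops:
  "rho' (p + q) = rho' p + rho' q" "rho' (p * q) = rho' p * rho' q" "rho' (scalar a) = scal a" "rho' (var g) = sg g"
  by (simp_all add: rho'_def scal.ev_simps scal.ev_add scal.ev_mult)

lemma rho'_homogeneous:
  assumes "homogeneous bc_odd b p" shows "rho' p = (if b then - rho p else rho p)"
proof -
  have "word sg (Word xs) = (if odd (length (filter bc_odd xs)) then - word lg (Word xs) else word lg (Word xs))" for xs
    by (induction xs) (auto simp: word_def sg_def)
  then have "word sg w = (if b then - word lg w else word lg w)" if "w \<in> keys p" for w
    using assms that by (cases w) (auto simp: homogeneous_def)
  then show ?thesis by (cases b) (simp_all add: rho'_def rho_def scal.ev_def sum_negf)
qed

lemma rho'_I: assumes "p \<in> I" shows "rho' p = 0"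
  unfolding rho'_def
proof (rule ev_I[OF scal.central_hom_axioms _ assms])
  fix p q :: "(bc_gen, 'a) free_algebra"
  assume "(p, q) \<in> bc_rels R T var"
  then have "(rho' p, rho' q) \<in> bc_rels R T (\<lambda>x. rho' (var x))"
    unfolding rho'_def by (rule scal.bc_rels_map)
  then show "scal.ev sg p = scal.ev sg q"
    using bc_rels_sat[OF wbc_signed] by (simp add: rho'_ops flip: rho'_def)
qed

end

section \<open>The elements \<open>\<omega>\<close>\<close>

locale BC_shift = BC_presentation R T ty for R T :: nat and ty :: "'a::comm_ring_1 itself" +
  fixes k :: nat
  assumes k: "1 \<le> k" "Suc k \<le> R" "Suc k \<le> T" and half: "(2 :: 'a) dvd 1"
begin

sublocale L: wbc_ring_shift R T "\<lambda>i. lg (S i)" "\<lambda>i. lg (Sbar i)" "\<lambda>i. lg (C i)" "\<lambda>i. lg (Cbar i)" "lg E1" "- 1" 1 k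
  unfolding wbc_ring_shift_def wbc_ring_def wbc_ring_shift_axioms_def using wbc_lin[OF RT] k by simp

abbreviation "A \<equiv> carrier (free_superalgebra bc_odd (bc_gens k k)) :: (bc_gen, 'a) free_algebra set"

lemma A_F: "w \<in> A \<Longrightarrow> w \<in> carrier F"
  by (rule carrier_free_mono[OF bc_gens_mono]) (use k in auto)

lemma two: "x + x = 0 \<Longrightarrow> x = (0 :: 'a lin)"
proof -
  assume x: "x + x = 0"
  obtain h :: 'a where h: "1 = 2 * h" using half by (rule dvdE)
  have "x = scal (2 * h) * x" using h by (metis scal.emb_1 mult_1_left)
  also have "\<dots> = scal h * (x + x)" by (simp only: mult_2 scal.emb_add distrib_left distrib_right)
  finally show "x = 0" using x by simp
qed

lemma rho_transp: "rho (bc_transp i j) = L.t i j" "rho (bc_transp_bar i j) = L.tb i j"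
  by (simp_all add: bc_transp_word L.V.tr_def L.W.tr_def rho_def scal.ev_simps comp_def)

lemma rho_e2: "rho (bc_e2 i j) = L.e2 i j"
  by (simp add: bc_e2_def L.e2_def rho_ops rho_transp)

lemma rho_elements: "rho (bc_e (Suc k)) = L.E" "rho (bc_y (Suc k)) = L.X" "rho (bc_y_bar (Suc k)) = L.Xb"
proof -
  show "rho (bc_e (Suc k)) = L.E" by (simp add: bc_e_def rho_e2 L.E_def)
  have 1: "{1..<Suc k} = {1..k}" by auto
  show "rho (bc_y (Suc k)) = L.X"
    unfolding bc_y_def bc_L_def bc_ebar2_def 1
    by (simp add: rho_ops rho_e2 rho_transp L.X_def L.Z_def L.phi_def sum.distrib sum_distrib_left sum_distrib_right mult.assoc)
  \<comment> \<open>The summands of y_bar are conjugated by c_i, those of \<open>Zb\<close> by cb_K;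
    at the ends of e_{i,K} these agree.\<close>
  have "lg (C i) * L.e2 i L.K * lg (C i) = lg (Cbar L.K) * L.e2 i L.K * lg (Cbar L.K)" if "i \<in> {1..k}" for i
    using L.e2_single(2,3)[of i L.K] that k by (simp add: mult.assoc)
  then show "rho (bc_y_bar (Suc k)) = L.Xb"
    unfolding bc_y_bar_def bc_L_bar_def bc_ebar2_def 1
    by (simp add: rho_ops rho_e2 rho_transp L.Xb_def L.Zb_def L.phib_def sum.distrib sum_subtractf
        sum_distrib_left sum_distrib_right mult.assoc)
qed

lemma elements_carrier:
  "(bc_e (Suc k) :: (bc_gen, 'a) free_algebra) \<in> carrier F" "(bc_y (Suc k) :: (bc_gen, 'a) free_algebra) \<in> carrier F"
  "(bc_y_bar (Suc k) :: (bc_gen, 'a) free_algebra) \<in> carrier F"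
  using bc_elements_carrier[of "Suc k" R T] k by auto

lemma gens_lg: "g \<in> bc_gens m n \<Longrightarrow> 1 \<le> m \<Longrightarrow> 1 \<le> n \<Longrightarrow> lg g \<in> L.gens m n"
  by (auto simp: bc_gens_def L.gens_def)

lemma L_Mon_rho: "u \<in> L.Mon k k \<Longrightarrow> \<exists>p\<in>A. rho p = u"
proof (induction rule: L.Mon.induct)
  case one
  show ?case by (rule bexI[of _ 1]) (simp_all add: rho_ops free_ops)
next
  case zero
  show ?case by (rule bexI[of _ 0]) (simp_all add: rho_ops free_ops)
next
  case (neg x)
  then obtain p where "p \<in> A" "rho p = x" by blast
  then show ?case by (intro bexI[of _ "- p"]) (simp_all add: rho_ops free_ops)
next
  case (gen g x)
  then obtain p where p: "p \<in> A" "rho p = x" by blast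
  have "L.gens k k = lg ` bc_gens k k"
    using k by (auto simp: L.gens_def bc_gens_def image_Un image_image)
  then obtain h where h: "h \<in> bc_gens k k" "g = lg h" using gen(1) by blast
  show ?case by (rule bexI[of _ "var h * p"]) (use h p in \<open>simp_all add: rho_ops free_ops free_carrier_var\<close>)
qed

lemma Mon_commute_A:
  assumes "\<And>u. u \<in> L.Mon k k \<Longrightarrow> u * x = x * u" "w \<in> A"
  shows "rho w * x = x * rho w"
  using assms(2)
proof (induction rule: carrier_free_induct)
  case (scalar a)
  show ?case by (simp add: rho_ops scal.emb_central)
next
  case (var g p)
  have "lg g * x = x * lg g"
    using L.Mon_gen[OF gens_lg[OF var(1)]] k by (intro assms(1)) auto
  then show ?case using var(3) mult_eq_left[of "lg g" x "x * lg g" "rho p"] by (simp add: rho_ops mult.assoc)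
qed (simp add: rho_ops algebra_simps)

lemma A_commute: "w \<in> A \<Longrightarrow> rho w * L.E = L.E * rho w" "w \<in> A \<Longrightarrow> rho w * L.X = L.X * rho w" "w \<in> A \<Longrightarrow> rho w * L.Xb = L.Xb * rho w"
  by (rule Mon_commute_A; simp add: L.E_Mon L.X_Mon L.Xb_Mon)+

lemma cap_exists:
  assumes "p \<in> carrier (free_superalgebra bc_odd (bc_gens (Suc k) (Suc k)))"
  shows "\<exists>w\<in>A. L.E * rho p * L.E = rho w * L.E"
proof -
  \<comment> \<open>As \<open>cap\<close> speaks of monomials, the letters of p are moved one by one
    into a monomial u that is quantified inside the induction.\<close>
  have "\<forall>u\<in>L.Mon L.K L.K. \<exists>w\<in>A. L.E * (u * (rho p * L.E)) = rho w * L.E"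
    using assms
  proof (induction rule: carrier_free_induct)
    case (scalar a)
    show ?case
    proof
      fix u assume "u \<in> L.Mon L.K L.K"
      then obtain v where "v \<in> L.Mon k k" "L.E * (u * L.E) = v * L.E"
        using L.cap[of u k] k unfolding L.E_def by auto
      moreover from this obtain w where "w \<in> A" "rho w = v" using L_Mon_rho by blast
      moreover have "L.E * (u * (scal a * L.E)) = scal a * (L.E * (u * L.E))"
        by (simp add: scal.emb_central mult.assoc)
      ultimately show "\<exists>w\<in>A. L.E * (u * (rho (scalar a) * L.E)) = rho w * L.E"
        by (intro bexI[of _ "scalar a * w"]) (simp_all add: rho_ops mult.assoc free_ops)
    qed
  next
    case (var g p)
    have "lg g \<in> L.Mon L.K L.K" using var(1) gens_lg[of g L.K L.K] L.Mon_gen by simp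
    then have "u * lg g \<in> L.Mon L.K L.K" if "u \<in> L.Mon L.K L.K" for u using that k by (intro L.Mon_mult) auto
    then show ?case using var(3) by (fastforce simp: rho_ops mult.assoc)
  next
    case (add p q)
    show ?case
    proof
      fix u assume "u \<in> L.Mon L.K L.K"
      then obtain v w where "v \<in> A" "L.E * (u * (rho p * L.E)) = rho v * L.E" "w \<in> A" "L.E * (u * (rho q * L.E)) = rho w * L.E"
        using add by blast
      then show "\<exists>w\<in>A. L.E * (u * (rho (p + q) * L.E)) = rho w * L.E"
        by (intro bexI[of _ "v + w"]) (simp_all add: rho_ops distrib_left distrib_right free_ops)
    qed
  qed
  from bspec[OF this L.Mon.one] show ?thesis by (simp add: mult.assoc)
qed

text \<open>At a state f far from the first k + 1 labels, e_{k+1} gives a state generic for k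
  strands. Since operators act by pull-back, w e_{k+1} = 0 at f says that w acts by zero at that
  state, and \<open>faithful_generic\<close> applies.\<close>

lemma cap_unique:
  assumes w: "w \<in> A" and 0: "rho w * L.E = 0"
  shows "rho w = 0"
proof -
  have h: "linrep (snd (P.t i j)) = L.t i j" "linrep (snd (P.tb i j)) = L.tb i j" for i j
  proof -
    have "linrep (snd (prod_list (map (\<lambda>l. hg (h l)) xs))) = (prod_list (map (\<lambda>l. lg (h l)) xs))" for h :: "nat \<Rightarrow> bc_gen" and xs
      by (induction xs) (simp_all add: one_prod_def times_prod_def hg_def linrep_hom)
    then show "linrep (snd (P.t i j)) = L.t i j" "linrep (snd (P.tb i j)) = L.tb i j"
      by (simp_all add: P.V.tr_def P.W.tr_def L.V.tr_def L.W.tr_def)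
  qed
  have E: "L.E = linrep (snd (P.e2 L.K L.K))"
  proof -
    have "snd (hg E1) = gp E1" by (simp add: hg_def)
    then show ?thesis using h by (simp add: L.E_def P.e2_def L.e2_def times_prod_def linrep_hom)
  qed
  obtain f :: "nat perm" where f: "\<forall>p<L.K. f \<langle>$\<rangle> p = p + L.K" using exists_shift[of L.K L.K] by auto
  obtain b g W where bgW: "P.run (P.e2 L.K L.K) False (f, \<lambda>_. False) = Some (b, g, W)" "\<forall>p<k. k \<le> g \<langle>$\<rangle> p"
    using P.run_e2_generic[of k f "\<lambda>_. False"] f by fastforce
  have "lapp (rho w) \<phi> (g, W) = 0" for \<phi>
  proof -
    have "0 = lapp (rho w * L.E) \<phi> (f, \<lambda>_. False)" using 0 by (simp add: lapp_simps)
    also have "\<dots> = sgn_val (lapp (rho w) \<phi>) (Some (b, g, W))"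
      using bgW(1) by (simp add: lapp_simps E P.run_def)
    finally show ?thesis by (simp add: sgn_val_def split: if_splits)
  qed
  then have "w \<in> I"
    using faithful_generic[of k k g w W] k w bgW(2) by (simp add: carrier_free_words)
  then show ?thesis using I_eq_kernel[OF A_F[OF w]] by simp
qed

text \<open>Splitting w by parity, let P be e p e minus the even part of w e, and Q the odd part of
  w e. The representation kills P - Q and its twisted form kills P + Q, so 2 Q is killed, and the
  even part of w suffices.\<close>

lemma cap_even:
  assumes "p \<in> carrier (free_superalgebra bc_odd (bc_gens (Suc k) (Suc k)))" "homogeneous bc_odd False p"
  shows "\<exists>w\<in>A. homogeneous bc_odd False w \<and> L.E * rho p * L.E = rho w * L.E"
proof -
  obtain w where w: "w \<in> A" "L.E * rho p * L.E = rho w * L.E" using cap_exists[OF assms(1)] by blast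
  obtain w0 w1 where s: "w = w0 + w1" "homogeneous bc_odd False w0" "homogeneous bc_odd True w1" "w0 \<in> A" "w1 \<in> A"
    using even_odd_split[OF w(1)] by blast
  let ?e = "bc_e (Suc k) :: (bc_gen, 'a) free_algebra"
  have p: "p \<in> carrier F" by (rule carrier_free_mono[OF bc_gens_mono assms(1)]) (use k in auto)
  note c = elements_carrier p A_F[OF s(4)] A_F[OF s(5)]
  have he: "homogeneous bc_odd False ?e" by (rule bc_elements_homogeneous)
  let ?P = "?e * p * ?e - w0 * ?e" and ?Q = "w1 * ?e"
  have P: "homogeneous bc_odd False ?P"
    using he assms(2) s(2) by (intro homogeneous_ops homogeneous_even_mult)
  have Q: "homogeneous bc_odd True ?Q" using homogeneous_mult[OF s(3) he] by simp
  have "rho (?P - ?Q) = 0"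
    using w(2) unfolding s(1) by (simp add: rho_ops rho_elements algebra_simps)
  moreover have "?P - ?Q \<in> carrier F" using c by (intro rc_diff[OF ring_closed_free]) (simp_all add: free_ops)
  ultimately have "?P - ?Q \<in> I" by (simp add: I_eq_kernel)
  then have "rho' (?P + (- ?Q)) = 0" using rho'_I by simp
  moreover have "rho' (?P + (- ?Q)) = rho ?P + rho ?Q"
    unfolding rho'_ops(1) rho'_homogeneous[OF P] rho'_homogeneous[OF homogeneous_ops(6)[OF Q]] by (simp add: rho_ops)
  ultimately have "rho ?P + rho ?Q = 0" by simp
  with \<open>rho (?P - ?Q) = 0\<close> have "rho ?Q = 0" using two[of "rho ?Q"] by (simp add: rho_ops)
  then show ?thesis using w(2) s by (intro bexI[of _ w0]) (auto simp: rho_ops rho_elements distrib_right)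
qed

text \<open>A representative in the free algebra, chosen even; only its class is determined, by
  \<open>cap_unique\<close>.\<close>

definition om :: "nat \<Rightarrow> (bc_gen, 'a) free_algebra" where
  "om a = (SOME w. w \<in> A \<and> homogeneous bc_odd False w \<and> L.E * L.X ^ a * L.E = rho w * L.E)"
definition omb :: "nat \<Rightarrow> (bc_gen, 'a) free_algebra" where
  "omb a = (SOME w. w \<in> A \<and> homogeneous bc_odd False w \<and> L.E * L.Xb ^ a * L.E = rho w * L.E)"

lemma om: "om a \<in> A" "homogeneous bc_odd False (om a)" "L.E * L.X ^ a * L.E = rho (om a) * L.E"
  and omb: "omb a \<in> A" "homogeneous bc_odd False (omb a)" "L.E * L.Xb ^ a * L.E = rho (omb a) * L.E"
proof -
  have c: "bc_y (Suc k) ^ a \<in> carrier (free_superalgebra bc_odd (bc_gens (Suc k) (Suc k)))"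
    "bc_y_bar (Suc k) ^ a \<in> carrier (free_superalgebra bc_odd (bc_gens (Suc k) (Suc k)))"
    by (rule rc_power[OF ring_closed_free]; rule bc_elements_carrier; simp)+
  have "\<exists>w. w \<in> A \<and> homogeneous bc_odd False w \<and> L.E * L.X ^ a * L.E = rho w * L.E"
    using cap_even[OF c(1)] by (auto simp: rho_ops rho_elements homogeneous_power bc_elements_homogeneous)
  from someI_ex[OF this]
  show "om a \<in> A" "homogeneous bc_odd False (om a)" "L.E * L.X ^ a * L.E = rho (om a) * L.E"
    unfolding om_def by blast+
  have "\<exists>w. w \<in> A \<and> homogeneous bc_odd False w \<and> L.E * L.Xb ^ a * L.E = rho w * L.E"
    using cap_even[OF c(2)] by (auto simp: rho_ops rho_elements homogeneous_power bc_elements_homogeneous)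
  from someI_ex[OF this]
  show "omb a \<in> A" "homogeneous bc_odd False (omb a)" "L.E * L.Xb ^ a * L.E = rho (omb a) * L.E"
    unfolding omb_def by blast+
qed

end

context central_hom begin

lemma ev_bar_coeff: "ev g (bar_coeff om n i) = bar_coeff (\<lambda>a. ev g (om a)) n i"
  by (induction om n i rule: bar_coeff.induct) (auto simp: ev_simps ev_mult)

lemma affine_rels_map:
  assumes "(a, b) \<in> affine_rels r t s sb e c cb x xb om omb"
  shows "(ev g a, ev g b) \<in> affine_rels r t (\<lambda>i. ev g (s i)) (\<lambda>i. ev g (sb i)) (ev g e)
    (\<lambda>i. ev g (c i)) (\<lambda>i. ev g (cb i)) (ev g x) (ev g xb) (\<lambda>a. ev g (om a)) (\<lambda>a. ev g (omb a))"
  using assms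
proof cases
  case (x_c i)
  then show ?thesis using affine_rels.x_c[of i r "ev g x" "\<lambda>i. ev g (c i)"] by (auto simp: ev_simps ev_mult)
next
  case (xb_cb i)
  then show ?thesis using affine_rels.xb_cb[of i t "ev g xb" "\<lambda>i. ev g (cb i)"] by (auto simp: ev_simps ev_mult)
qed (auto simp: ev_simps ev_mult ev_add ev_bar_coeff simp del: power_Suc intro: affine_rels.intros)

lemma ev_hom:
  assumes "\<And>x y. h (x + y) = h x + h y" "\<And>x y. h (x * y) = h x * h y" "h 1 = 1" "\<And>a. h (emb a) = emb' a"
    and emb': "central_hom emb'"
  shows "h (ev g p) = central_hom.ev emb' (\<lambda>x. h (g x)) p"
proof -
  interpret h: central_hom emb' by (rule emb')
  have w: "h (word g w) = word (\<lambda>x. h (g x)) w" for w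
  proof -
    have "h (prod_list (map g xs)) = prod_list (map (\<lambda>x. h (g x)) xs)" for xs
      by (induction xs) (simp_all add: assms)
    then show ?thesis by (simp add: word_def)
  qed
  show ?thesis
    by (induction p rule: poly_mapping_single_induct) (simp_all add: ev_single h.ev_single ev_add h.ev_add assms w)
qed

end

interpretation free: central_hom "scalar :: 'a::comm_ring_1 \<Rightarrow> ('g, 'a) free_algebra"
proof
  fix a b :: 'a and x :: "('g, 'a) free_algebra"
  show "scalar (a + b) = (scalar a + scalar b :: ('g, 'a) free_algebra)" by (simp add: scalar_def single_add)
  show "scalar (a * b) = (scalar a * scalar b :: ('g, 'a) free_algebra)" by (simp add: scalar_def mult_single)
  show "scalar 1 = (1 :: ('g, 'a) free_algebra)" by (simp add: scalar_def)
  show "scalar a * x = x * scalar a"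
    by (induction x rule: poly_mapping_single_induct)
      (simp_all add: scalar_def mult_single mult.commute distrib_left distrib_right)
qed

section \<open>The chosen elements represent the \<omega>'s of the statement\<close>

context BC_shift begin

lemma BC_eq: "BC R T = Q" "BC_class R T = (cls :: (bc_gen, 'a) free_algebra \<Rightarrow> _)"
  by (simp_all add: BC_def BC_class_def)

lemma BC_sub_ops:
  fixes x y :: "(bc_gen, 'a) free_algebra set"
  shows "\<one>\<^bsub>BC R T\<^esub> \<in> (BC_sub R T k :: (bc_gen, 'a) free_algebra set set)"
    "x \<in> BC_sub R T k \<Longrightarrow> a \<odot>\<^bsub>BC R T\<^esub> x \<in> BC_sub R T k"
    "x \<in> BC_sub R T k \<Longrightarrow> y \<in> BC_sub R T k \<Longrightarrow> x \<oplus>\<^bsub>BC R T\<^esub> y \<in> BC_sub R T k"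
    "x \<in> BC_sub R T k \<Longrightarrow> y \<in> BC_sub R T k \<Longrightarrow> x \<otimes>\<^bsub>BC R T\<^esub> y \<in> BC_sub R T k"
  unfolding BC_sub_def by (rule generated_subalgebra.intros; assumption?)+

lemmas BC_sub_ops' = BC_sub_ops[unfolded BC_eq(1)]

text \<open>The subalgebra is generated with c_1 and cb_1 only, whereas \<open>A\<close> uses all
  Clifford generators up to k; conjugation by s_i leads from c_i to c_{i+1}.\<close>

lemma C_sub:
  "i \<in> {1..k} \<Longrightarrow> cls (var (C i) :: (bc_gen, 'a) free_algebra) \<in> BC_sub R T k"
  "i \<in> {1..k} \<Longrightarrow> cls (var (Cbar i) :: (bc_gen, 'a) free_algebra) \<in> BC_sub R T k"
proof -
  have step: "cls (var x' :: (bc_gen, 'a) free_algebra) \<in> BC_sub R T k"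
    if "cls (var x :: (bc_gen, 'a) free_algebra) \<in> BC_sub R T k" "cls (var y :: (bc_gen, 'a) free_algebra) \<in> BC_sub R T k"
      "x \<in> bc_gens R T" "x' \<in> bc_gens R T" "y \<in> bc_gens R T" "lg x' = lg y * lg x * lg y" for x x' y
  proof -
    have v: "(var z :: (bc_gen, 'a) free_algebra) \<in> carrier F" if "z \<in> {x, x', y}" for z
      using that \<open>x \<in> bc_gens R T\<close> \<open>x' \<in> bc_gens R T\<close> \<open>y \<in> bc_gens R T\<close> by (intro free_carrier_var) auto
    have "cls (var x' :: (bc_gen, 'a) free_algebra) = cls (var y * var x * var y)"
      using v that(6) by (subst cls_eq_rho) (simp_all add: rho_ops free_ops)
    also have "\<dots> = (cls (var y) \<otimes>\<^bsub>Q\<^esub> cls (var x)) \<otimes>\<^bsub>Q\<^esub> cls (var y)"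
      using v by (simp add: Q_ops free_ops)
    also have "\<dots> \<in> BC_sub R T k" using that(1,2) by (intro BC_sub_ops')
    finally show ?thesis .
  qed
  have gen: "cls (var g :: (bc_gen, 'a) free_algebra) \<in> BC_sub R T k"
    if "g \<in> {E1, C 1, Cbar 1} \<union> S ` {1..<k} \<union> Sbar ` {1..<k}" for g
    using that unfolding BC_sub_def BC_eq by (intro generated_subalgebra.incl) blast
  have "1 \<le> i \<Longrightarrow> i \<le> k \<Longrightarrow> cls (var (C i) :: (bc_gen, 'a) free_algebra) \<in> BC_sub R T k \<and>
      cls (var (Cbar i) :: (bc_gen, 'a) free_algebra) \<in> BC_sub R T k"
  proof (induction i rule: nat_induct_at_least)
    case base
    show ?case using gen by blast
  next
    case (Suc i)
    have 1: "lg (C (Suc i)) = lg (S i) * lg (C i) * lg (S i)" "lg (Cbar (Suc i)) = lg (Sbar i) * lg (Cbar i) * lg (Sbar i)"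
      using L.s_c_s[of i i] L.sb_cb_sb[of i i] Suc k by simp_all
    show ?case
      using Suc k step[OF _ gen[of "S i"] _ _ _ 1(1)] step[OF _ gen[of "Sbar i"] _ _ _ 1(2)] by (simp add: bc_gens_def)
  qed
  then show "i \<in> {1..k} \<Longrightarrow> cls (var (C i) :: (bc_gen, 'a) free_algebra) \<in> BC_sub R T k"
    "i \<in> {1..k} \<Longrightarrow> cls (var (Cbar i) :: (bc_gen, 'a) free_algebra) \<in> BC_sub R T k" by auto
qed

lemma A_sub: assumes "w \<in> A" shows "cls w \<in> BC_sub R T k"
  using assms
proof (induction rule: carrier_free_induct)
  case (scalar a)
  have eq: "cls (scalar a) = a \<odot>\<^bsub>Q\<^esub> \<one>\<^bsub>Q\<^esub>" using Q_smult[of 1 a] by (simp add: Q_simps free_ops)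
  show ?case unfolding eq by (rule BC_sub_ops'(2)[OF BC_sub_ops'(1)])
next
  case (var g p)
  have g: "(var g :: (bc_gen, 'a) free_algebra) \<in> carrier F" by (rule A_F[OF free_carrier_var[OF var(1)]])
  have "cls (var g :: (bc_gen, 'a) free_algebra) \<in> BC_sub R T k"
  proof (cases "g \<in> C ` {1..k} \<union> Cbar ` {1..k}")
    case True
    then show ?thesis using C_sub by blast
  next
    case False
    then have "g \<in> {E1, C 1, Cbar 1} \<union> S ` {1..<k} \<union> Sbar ` {1..<k}" using var(1) by (auto simp: bc_gens_def)
    then show ?thesis unfolding BC_sub_def BC_eq by (intro generated_subalgebra.incl) blast
  qed
  then show ?case using BC_sub_ops'(4) var(3) Q_ops(2)[OF g A_F[OF var(2)]] by metis
next
  case (add p q)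
  then show ?case using BC_sub_ops'(3) Q_ops(1)[OF A_F[OF add(1)] A_F[OF add(2)]] by metis
qed

lemma sub_A: assumes "x \<in> BC_sub R T k" shows "\<exists>w\<in>A. x = cls w"
  using assms unfolding BC_sub_def BC_eq
proof (induction rule: generated_subalgebra.induct)
  case one
  show ?case by (rule bexI[of _ 1]) (simp_all add: Q_simps free_ops)
next
  case (incl h)
  then obtain g where g: "h = cls (var g)" "g \<in> {E1, C 1, Cbar 1} \<union> S ` {1..<k} \<union> Sbar ` {1..<k}" by blast
  then have "g \<in> bc_gens k k" using k by (auto simp: bc_gens_def)
  then show ?case using g(1) by (intro bexI[of _ "var g"] free_carrier_var)
next
  case (add x y)
  then show ?case using Q_ops(1)[OF A_F A_F] free_carrier_add by metis
next
  case (mult x y)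
  then show ?case using Q_ops(2)[OF A_F A_F] free_carrier_mult by metis
next
  case (smult x a)
  then show ?case using Q_smult[OF A_F] free_carrier_mult[OF free_carrier_scalar] by metis
qed

lemma omega_eq:
  assumes "w \<in> A" "p \<in> carrier F" "rho p = rho w * L.E"
  shows "(THE x. x \<in> BC_sub R T k \<and> cls p = x \<otimes>\<^bsub>Q\<^esub> cls (bc_e (Suc k))) = cls w"
proof (rule the_equality)
  have iff: "cls p = cls v \<otimes>\<^bsub>Q\<^esub> cls (bc_e (Suc k)) \<longleftrightarrow> rho p = rho v * L.E" if "v \<in> A" for v
    using A_F[OF that] elements_carrier(1) assms(2) by (simp add: Q_ops cls_eq_rho free_ops rho_ops rho_elements)
  show "cls w \<in> BC_sub R T k \<and> cls p = cls w \<otimes>\<^bsub>Q\<^esub> cls (bc_e (Suc k))"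
    using A_sub iff assms by blast
  fix x assume x: "x \<in> BC_sub R T k \<and> cls p = x \<otimes>\<^bsub>Q\<^esub> cls (bc_e (Suc k))"
  then obtain v where v: "v \<in> A" "x = cls v" using sub_A by blast
  then have "rho (v - w) * L.E = 0" using x iff assms(3) by (simp add: rho_ops left_diff_distrib)
  then have "rho (v - w) = 0" using v(1) assms(1) by (intro cap_unique rc_diff[OF ring_closed_free])
  then show "x = cls w" using v A_F assms(1) by (simp add: cls_eq_rho rho_ops)
qed

lemma BC_omega_eq: "BC_omega R T k a = cls (om a)" "BC_omega_bar R T k a = cls (omb a)"
proof -
  have c: "(bc_e (Suc k) * bc_y (Suc k) ^ a * bc_e (Suc k) :: (bc_gen, 'a) free_algebra) \<in> carrier F"
    "(bc_e (Suc k) * bc_y_bar (Suc k) ^ a * bc_e (Suc k) :: (bc_gen, 'a) free_algebra) \<in> carrier F"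
    by (intro free_carrier_mult rc_power[OF ring_closed_free] elements_carrier)+
  show "BC_omega R T k a = cls (om a)"
    using omega_eq[OF om(1) c(1)] om(3)
    by (simp add: BC_omega_def BC_eq rho_ops rho_elements flip: Suc_eq_plus1)
  show "BC_omega_bar R T k a = cls (omb a)"
    using omega_eq[OF omb(1) c(2)] omb(3)
    by (simp add: BC_omega_bar_def BC_eq rho_ops rho_elements flip: Suc_eq_plus1)
qed

section \<open>Values and commutation rules of the \<omega>'s\<close>

lemma rho_om_0: "even a \<or> a = 1 \<Longrightarrow> rho (om a) = 0"
  using cap_unique[OF om(1), of a] om(3)[of a] L.E_X_even_E[OF two, of a] L.E_X_E by auto

text \<open>Shaped like \<open>aff_omega 0\<close>, which is literally 0 for even a and for a = 1,
  whereas \<open>om a\<close> is then only known to act as 0.\<close>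

definition om' :: "nat \<Rightarrow> (bc_gen, 'a) free_algebra" where
  "om' a = (if even a \<or> a = 1 then 0 else om a)"

lemma om': "om' a \<in> A" "rho (om' a) = rho (om a)"
  using om(1) rho_om_0 by (auto simp: om'_def free_ops rho_ops)

lemma rho_omb_even: "rho (omb (2 * n)) = 0"
proof -
  interpret sw: wbc_ring_shift T R "\<lambda>i. lg (Sbar i)" "\<lambda>i. lg (S i)" "\<lambda>i. lg (Cbar i)" "\<lambda>i. lg (C i)" "lg E1" 1 "- 1" k
    by (rule L.swap_shift)
  show ?thesis
    using sw.E_X_even_E[OF two, of "2 * n"] omb(3)[of "2 * n"] by (intro cap_unique omb) (simp_all add: L.swap_eqs)
qed

text \<open>The recursion is first obtained after multiplication by e; since the sum lies in
  \<open>A\<close>, \<open>cap_unique\<close> removes the factor e.\<close>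

lemma rho_omb_odd: "rho (omb (2 * n + 1)) = (\<Sum>i\<le>n. bar_coeff (\<lambda>a. rho (om' a)) n i * rho (om' (2 * i + 1)))"
proof -
  let ?p = "\<Sum>i\<le>n. bar_coeff om' n i * om' (2 * i + 1)"
  have p: "?p \<in> A"
    by (intro rc_sum[OF ring_closed_free] free_carrier_mult bar_coeff_closed[OF ring_closed_free] om')
  have rp: "rho ?p = (\<Sum>i\<le>n. bar_coeff (\<lambda>a. rho (om' a)) n i * rho (om' (2 * i + 1)))"
    by (simp add: rho_ops) (simp add: rho_def scal.ev_bar_coeff)
  have "L.E * L.Xb ^ (2 * n + 1) * L.E = rho ?p * L.E"
    unfolding rp
  proof (rule L.E_Xb_odd_E[OF two])
    show "L.E * L.X ^ (2 * n + 1) * L.E = rho (om' (2 * n + 1)) * L.E" for n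
      unfolding om'(2) by (rule om(3))
    show "rho (om' n) = 0" if "even n" for n using that by (simp add: om'_def rho_ops)
  qed
  then have "rho (omb (2 * n + 1) - ?p) * L.E = 0"
    unfolding rho_ops(4) left_diff_distrib using omb(3)[of "2 * n + 1"] by (simp only: diff_self)
  then have "rho (omb (2 * n + 1) - ?p) = 0"
    by (intro cap_unique rc_diff[OF ring_closed_free] omb p)
  then show ?thesis unfolding rp[symmetric] rho_ops(4) by (simp only: right_minus_eq)
qed

lemma A_gens_commute:
  assumes w: "w \<in> A" and i: "k < i"
  shows "i < R \<Longrightarrow> rho w * lg (S i) = lg (S i) * rho w" "i < T \<Longrightarrow> rho w * lg (Sbar i) = lg (Sbar i) * rho w"
proof -
  interpret sw: wbc_ring_shift T R "\<lambda>i. lg (Sbar i)" "\<lambda>i. lg (S i)" "\<lambda>i. lg (Cbar i)" "\<lambda>i. lg (C i)" "lg E1" 1 "- 1" k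
    by (rule L.swap_shift)
  show "rho w * lg (S i) = lg (S i) * rho w" if "i < R"
    by (rule Mon_commute_A[OF _ w]) (use L.s_Mon[of _ k k i] that i k in simp)
  show "rho w * lg (Sbar i) = lg (Sbar i) * rho w" if "i < T"
    by (rule Mon_commute_A[OF _ w]) (use sw.s_Mon[of _ k k i] L.Mon_swap[of k k] that i k in simp)
qed

text \<open>Used for x a Clifford generator beyond k, which commutes with even letters and
  anticommutes with odd ones; on even w the twist disappears.\<close>

lemma A_clifford:
  assumes "w \<in> A" and h: "\<And>g. g \<in> bc_gens k k \<Longrightarrow> x * lg g = sg g * x"
  shows "x * rho w = rho' w * x"
  using assms(1)
proof (induction rule: carrier_free_induct)
  case (scalar a)
  show ?case by (simp add: rho_ops rho'_ops scal.emb_central)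
next
  case (var g p)
  then show ?case using mult_eq_left[OF h[OF var(1)], of "rho p"] by (simp add: rho_ops rho'_ops mult.assoc)
qed (simp add: rho_ops rho'_ops algebra_simps)

lemma A_even_clifford:
  assumes w: "w \<in> A" "homogeneous bc_odd False w" and i: "k < i"
  shows "i \<le> R \<Longrightarrow> rho w * lg (C i) = lg (C i) * rho w" "i \<le> T \<Longrightarrow> rho w * lg (Cbar i) = lg (Cbar i) * rho w"
proof -
  have r: "rho' w = rho w" using rho'_homogeneous[OF w(2)] by simp
  show "rho w * lg (C i) = lg (C i) * rho w" if "i \<le> R"
  proof -
    have "lg (C i) * lg g = sg g * lg (C i)" if g: "g \<in> bc_gens k k" for g
    proof (cases g)
      case (S j)
      then show ?thesis using L.t_c[of j "Suc j" i] L.V.tr_Suc[of j] g i k \<open>i \<le> R\<close> by (auto simp: bc_gens_def sg_def)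
    next
      case (Sbar j)
      then show ?thesis using L.sb_c[of j i] g i k \<open>i \<le> R\<close> by (auto simp: bc_gens_def sg_def)
    next
      case E1
      then show ?thesis using L.c_e[of i] g i k \<open>i \<le> R\<close> by (auto simp: bc_gens_def sg_def)
    next
      case (C j)
      then show ?thesis using L.c_anticomm[of i j] g i k \<open>i \<le> R\<close> by (auto simp: bc_gens_def sg_def)
    next
      case (Cbar j)
      then show ?thesis using L.c_cb[of i j] g i k \<open>i \<le> R\<close> by (auto simp: bc_gens_def sg_def)
    qed
    from A_clifford[OF w(1) this] show ?thesis using r by simp
  qed
  show "rho w * lg (Cbar i) = lg (Cbar i) * rho w" if "i \<le> T"
  proof -
    have "lg (Cbar i) * lg g = sg g * lg (Cbar i)" if g: "g \<in> bc_gens k k" for g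
    proof (cases g)
      case (S j)
      then show ?thesis using L.s_cb[of j i] g i k \<open>i \<le> T\<close> by (auto simp: bc_gens_def sg_def)
    next
      case (Sbar j)
      then show ?thesis using L.tb_cb[of j "Suc j" i] L.W.tr_Suc[of j] g i k \<open>i \<le> T\<close> by (auto simp: bc_gens_def sg_def)
    next
      case E1
      then show ?thesis using L.cb_e[of i] g i k \<open>i \<le> T\<close> by (auto simp: bc_gens_def sg_def)
    next
      case (C j)
      then show ?thesis using L.c_cb[of j i] g i k \<open>i \<le> T\<close> by (auto simp: bc_gens_def sg_def)
    next
      case (Cbar j)
      then show ?thesis using L.cb_anticomm[of i j] g i k \<open>i \<le> T\<close> by (auto simp: bc_gens_def sg_def)
    qed
    from A_clifford[OF w(1) this] show ?thesis using r by simp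
  qed
qed

text \<open>By uniqueness, it suffices to compare the two products after multiplication by \<open>e\<close>.\<close>

lemma omega_commute:
  assumes v: "v \<in> A" and w: "w \<in> A" "rho w * L.E = L.E * Y * L.E" "rho v * Y = Y * rho v"
  shows "rho v * rho w = rho w * rho v"
proof -
  note E = A_commute(1)[OF v]
  have "rho v * (rho w * L.E) = L.E * Y * L.E * rho v"
    unfolding w(2) by (simp add: E mult.assoc mult_eq_left[OF E] mult_eq_left[OF w(3)])
  also have "\<dots> = rho w * (L.E * rho v)" unfolding w(2)[symmetric] by (rule mult.assoc)
  also have "\<dots> = rho w * rho v * L.E" by (simp add: E mult.assoc)
  finally have "rho (v * w - w * v) * L.E = 0" by (simp add: rho_ops left_diff_distrib mult.assoc)
  then have "rho (v * w - w * v) = 0"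
    using v w by (intro cap_unique rc_diff[OF ring_closed_free]) (simp_all add: free_ops)
  then show ?thesis by (simp add: rho_ops)
qed

end

section \<open>The homomorphism\<close>

context BC_shift begin

definition aff_sub :: "aff_gen \<Rightarrow> (bc_gen, 'a) free_algebra" where
  "aff_sub g = (case g of
      Fin b \<Rightarrow> (case b of S i \<Rightarrow> var (S (k + i)) | Sbar i \<Rightarrow> var (Sbar (k + i)) | E1 \<Rightarrow> bc_e (Suc k)
        | C i \<Rightarrow> var (C (k + i)) | Cbar i \<Rightarrow> var (Cbar (k + i)))
    | X1 \<Rightarrow> bc_y (Suc k) | X1bar \<Rightarrow> bc_y_bar (Suc k) | Om a \<Rightarrow> om a | Ombar a \<Rightarrow> omb a)"

definition aff_map :: "(aff_gen, 'a) free_algebra \<Rightarrow> (bc_gen, 'a) free_algebra" where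
  "aff_map = free.ev aff_sub"

sublocale aff: presentation aff_odd "aff_gens (R - k) (T - k)" "aff_rels (0 :: 'a) (R - k) (T - k)"
  by unfold_locales (use k in \<open>auto intro: aff_rels_carrier\<close>)

lemma aff_sub_carrier: "g \<in> aff_gens (R - k) (T - k) \<Longrightarrow> aff_sub g \<in> carrier F"
  using elements_carrier A_F om(1) omb(1)
  by (auto simp: aff_gens_def bc_gens_def aff_central_gens_def aff_sub_def intro!: free_carrier_var)

lemma aff_map_carrier: assumes "p \<in> carrier aff.F" shows "aff_map p \<in> carrier F"
  using assms
  by (induction rule: carrier_free_induct)
    (simp_all add: aff_map_def free.ev_simps free.ev_mult free.ev_add aff_sub_carrier free_ops)

lemma aff_sub_homogeneous: "homogeneous bc_odd (aff_odd g) (aff_sub g)"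
  by (auto simp: aff_sub_def om omb intro!: homogeneous_var bc_elements_homogeneous split: aff_gen.split bc_gen.split)

lemma aff_map_homogeneous: assumes "homogeneous aff_odd b p" shows "homogeneous bc_odd b (aff_map p)"
proof -
  have w: "homogeneous bc_odd (odd (length (filter aff_odd xs))) (word aff_sub (Word xs))" for xs
  proof (induction xs)
    case Nil
    show ?case by (simp add: word_def homogeneous_ops)
  next
    case (Cons x xs)
    show ?case using homogeneous_mult[OF aff_sub_homogeneous[of x] Cons] by (cases "aff_odd x") (simp_all add: word_def)
  qed
  have "homogeneous bc_odd b (scalar a * word aff_sub w)" if "w \<in> keys p" for a w
  proof -
    have "homogeneous bc_odd b (word aff_sub w)"
      using w[of "letters w"] assms that by (auto simp: homogeneous_def)
    from homogeneous_mult[OF homogeneous_ops(3) this] show ?thesis by simp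
  qed
  then show ?thesis unfolding aff_map_def free.ev_def by (intro homogeneous_sum)
qed

definition G :: "aff_gen \<Rightarrow> 'a lin" where "G g = rho (aff_sub g)"

lemma rho_aff_map: "rho (aff_map p) = scal.ev G p"
  unfolding aff_map_def G_def by (rule free.ev_hom) (simp_all add: rho_ops scal.central_hom_axioms)

lemma G_simps:
  "G (Fin (S i)) = lg (S (k + i))" "G (Fin (Sbar i)) = lg (Sbar (k + i))" "G (Fin E1) = L.E"
  "G (Fin (C i)) = lg (C (k + i))" "G (Fin (Cbar i)) = lg (Cbar (k + i))" "G X1 = L.X" "G X1bar = L.Xb"
  "G (Om a) = rho (om a)" "G (Ombar a) = rho (omb a)"
  by (simp_all add: G_def aff_sub_def rho_ops rho_elements)

lemma power_comm_lin: assumes "x * (y :: 'a lin) = y * x" shows "x * y ^ p = y ^ p * x"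
  by (induction p) (simp_all add: mult.assoc mult_eq_left[OF assms] flip: power_Suc2)

text \<open>Permutations and Clifford generators have indices beyond k, and w is even; e, y and the
  barred y commute with all of BC_{k,k}; for two \<omega>'s there is
  \<open>omega_commute\<close>.\<close>

lemma central_commute:
  assumes w: "w \<in> A" "homogeneous bc_odd False w" and g: "g \<in> aff_gens (R - k) (T - k)"
  shows "rho w * G g = G g * rho w"
proof -
  note A_commute(1)[OF w(1)] A_commute(2)[OF w(1)] A_commute(3)[OF w(1)]
  note c = this
  have om_w: "rho w * rho (om a) = rho (om a) * rho w" for a
    by (rule omega_commute[OF w(1) om(1) om(3)[symmetric]]) (rule power_comm_lin[OF c(2)])
  have omb_w: "rho w * rho (omb a) = rho (omb a) * rho w" for a
    by (rule omega_commute[OF w(1) omb(1) omb(3)[symmetric]]) (rule power_comm_lin[OF c(3)])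
  show ?thesis
  proof (cases g)
    case (Fin b)
    then have b: "b \<in> bc_gens (R - k) (T - k)" using g by (auto simp: aff_gens_def aff_central_gens_def)
    show ?thesis
    proof (cases b)
      case (S i)
      then show ?thesis using Fin b A_gens_commute(1)[OF w(1), of "k + i"] by (auto simp: bc_gens_def G_simps)
    next
      case (Sbar i)
      then show ?thesis using Fin b A_gens_commute(2)[OF w(1), of "k + i"] by (auto simp: bc_gens_def G_simps)
    next
      case E1
      then show ?thesis using Fin c by (simp add: G_simps)
    next
      case (C i)
      then show ?thesis using Fin b A_even_clifford(1)[OF w, of "k + i"] by (auto simp: bc_gens_def G_simps)
    next
      case (Cbar i)
      then show ?thesis using Fin b A_even_clifford(2)[OF w, of "k + i"] by (auto simp: bc_gens_def G_simps)
    qed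
  qed (use c om_w omb_w in \<open>simp_all add: G_simps\<close>)
qed

lemma G_aff_omega: "scal.ev G (aff_omega 0 a) = rho (om' a)"
  by (simp add: aff_omega_def om'_def scal.ev_simps rho_ops G_simps scal.emb_0)

lemma aff_rel:
  assumes "(p, q) \<in> aff_rels 0 (R - k) (T - k)" shows "scal.ev G p = scal.ev G q"
proof -
  from assms consider "(p, q) \<in> bc_rels (R - k) (T - k) (\<lambda>g. var (Fin g))"
    | z g where "z \<in> aff_central_gens" "g \<in> aff_gens (R - k) (T - k)" "p = var z * var g" "q = var g * var z"
    | "(p, q) \<in> affine_rels (R - k) (T - k) (\<lambda>i. var (Fin (S i))) (\<lambda>i. var (Fin (Sbar i))) (var (Fin E1))
       (\<lambda>i. var (Fin (C i))) (\<lambda>i. var (Fin (Cbar i))) (var X1) (var X1bar)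
       (aff_omega 0) (\<lambda>a. var (Ombar a))"
    unfolding aff_rels_def by blast
  then show ?thesis
  proof cases
    case 1
    have "(scal.ev G p, scal.ev G q) \<in> bc_rels (R - k) (T - k) (\<lambda>g. G (Fin g))"
      using scal.bc_rels_map[OF 1, of G] by (simp add: scal.ev_simps)
    then show ?thesis
      by (rule bc_rels_sat[rotated]) (use L.wbc_shifted in \<open>simp add: G_simps\<close>)
  next
    case 2
    then show ?thesis
      using central_commute[OF om(1,2)] central_commute[OF omb(1,2)]
      by (auto simp: aff_central_gens_def scal.ev_simps scal.ev_mult G_simps)
  next
    case 3
    have "(scal.ev G p, scal.ev G q) \<in> affine_rels (R - k) (T - k) (\<lambda>i. lg (S (k + i))) (\<lambda>i. lg (Sbar (k + i))) L.E
       (\<lambda>i. lg (C (k + i))) (\<lambda>i. lg (Cbar (k + i))) L.X L.Xb (\<lambda>a. rho (om' a)) (\<lambda>a. rho (omb a))"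
      using scal.affine_rels_map[OF 3, of G] by (simp add: scal.ev_simps G_simps G_aff_omega)
    then show ?thesis
    proof (rule L.affine_sat[rotated -1])
      show "L.E * L.X ^ (2 * n + 1) * L.E = rho (om' (2 * n + 1)) * L.E" for n unfolding om'(2) by (rule om(3))
      show "L.E * L.Xb ^ n * L.E = rho (omb n) * L.E" for n by (rule omb(3))
      show "rho (omb (2 * n)) = 0" for n by (rule rho_omb_even)
      show "rho (omb (2 * n + 1)) = (\<Sum>i\<le>n. bar_coeff (\<lambda>a. rho (om' a)) n i * rho (om' (2 * i + 1)))" for n
        by (rule rho_omb_odd)
      show "x = 0" if "x + x = 0" for x :: "'a lin" using that by (rule two)
    qed (rule refl)
  qed
qed

definition \<Phi> :: "(aff_gen, 'a) free_algebra set \<Rightarrow> (bc_gen, 'a) free_algebra set" where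
  "\<Phi> c = cls (aff_map (SOME p. p \<in> carrier aff.F \<and> c = aff.cls p))"

text \<open>The choice of representative is harmless: \<open>aff_rel\<close> makes the evaluation
  vanish on the affine ideal, and faithfulness turns equality of operators into equality of
  classes.\<close>

lemma \<Phi>_cls: assumes "p \<in> carrier aff.F" shows "\<Phi> (aff.cls p) = cls (aff_map p)"
proof -
  define p' where "p' = (SOME p'. p' \<in> carrier aff.F \<and> aff.cls p = aff.cls p')"
  have p': "p' \<in> carrier aff.F" "aff.cls p = aff.cls p'"
    using someI[of "\<lambda>p'. p' \<in> carrier aff.F \<and> aff.cls p = aff.cls p'" p] assms by (simp_all add: p'_def)
  then have "p - p' \<in> aff.I" using aff.cls_eq_iff[OF assms p'(1)] by simp
  then have "scal.ev G (p - p') = 0"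
    by (intro aff.ev_I[OF scal.central_hom_axioms aff_rel])
  then have "rho (aff_map p') = rho (aff_map p)" by (simp add: scal.ev_simps rho_aff_map)
  then show ?thesis unfolding \<Phi>_def p'_def[symmetric]
    using aff_map_carrier[OF assms] aff_map_carrier[OF p'(1)] by (simp add: cls_eq_rho)
qed

lemma \<Phi>_hom: "\<Phi> \<in> superalgebra_hom aff.Q Q"
proof -
  note ops = free.ev_simps free.ev_mult free.ev_add
  have mem: "\<exists>p\<in>carrier aff.F. c = aff.cls p" if "c \<in> carrier aff.Q" for c
    using that by (auto simp: aff.Q_simps)
  have "\<Phi> \<in> ring_hom aff.Q Q"
  proof (rule ring_hom_memI)
    fix c assume "c \<in> carrier aff.Q"
    then obtain p where p: "p \<in> carrier aff.F" "c = aff.cls p" using mem by blast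
    then show "\<Phi> c \<in> carrier Q" by (simp add: \<Phi>_cls Q_simps aff_map_carrier)
    fix d assume "d \<in> carrier aff.Q"
    then obtain q where q: "q \<in> carrier aff.F" "d = aff.cls q" using mem by blast
    show "\<Phi> (c \<otimes>\<^bsub>aff.Q\<^esub> d) = \<Phi> c \<otimes>\<^bsub>Q\<^esub> \<Phi> d" "\<Phi> (c \<oplus>\<^bsub>aff.Q\<^esub> d) = \<Phi> c \<oplus>\<^bsub>Q\<^esub> \<Phi> d"
      using p q aff_map_carrier[OF p(1)] aff_map_carrier[OF q(1)]
      by (simp_all add: aff.Q_ops Q_ops \<Phi>_cls free_ops) (simp_all add: aff_map_def ops)
  next
    show "\<Phi> \<one>\<^bsub>aff.Q\<^esub> = \<one>\<^bsub>Q\<^esub>" by (simp add: aff.Q_simps Q_simps \<Phi>_cls free_ops) (simp add: aff_map_def ops)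
  qed
  moreover have "\<Phi> (a \<odot>\<^bsub>aff.Q\<^esub> c) = a \<odot>\<^bsub>Q\<^esub> \<Phi> c" if c: "c \<in> carrier aff.Q" for a c
  proof -
    obtain p where p: "p \<in> carrier aff.F" "c = aff.cls p" using mem[OF c] by blast
    then show ?thesis using aff_map_carrier[OF p(1)]
      by (simp add: aff.Q_smult Q_smult \<Phi>_cls free_ops) (simp add: aff_map_def ops)
  qed
  moreover have "\<Phi> ` even_part aff.Q \<subseteq> even_part Q" "\<Phi> ` odd_part aff.Q \<subseteq> odd_part Q"
    by (auto simp: aff.Q_simps Q_simps even_odd_part_free \<Phi>_cls aff_map_carrier aff_map_homogeneous)
  ultimately show ?thesis by (simp add: superalgebra_hom_def)
qed

lemma \<Phi>_var: "g \<in> aff_gens (R - k) (T - k) \<Longrightarrow> \<Phi> (aff.cls (var g)) = cls (aff_sub g)"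
  using \<Phi>_cls[OF free_carrier_var] by (simp add: aff_map_def free.ev_simps)

lemma \<Phi>_omega: "\<Phi> (aff.cls (aff_omega 0 a)) = cls (om a)"
proof -
  have "aff_omega (0 :: 'a) a \<in> carrier aff.F"
  proof (cases "even a \<or> a = 1")
    case False
    then obtain n where "a = 2 * n + 1" "n \<ge> 1" by (auto elim!: oddE)
    then have "Om a \<in> aff_gens (R - k) (T - k)" by (auto simp: aff_gens_def aff_central_gens_def)
    then show ?thesis using False by (simp add: aff_omega_def free_carrier_var)
  qed (auto simp: aff_omega_def free_carrier_scalar free_ops)
  moreover from aff_map_carrier[OF this] have "cls (aff_map (aff_omega 0 a)) = cls (om a)"
    using A_F[OF om(1)] by (simp add: cls_eq_rho rho_aff_map G_aff_omega om')
  ultimately show ?thesis by (simp add: \<Phi>_cls)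
qed

end

text \<open>The value w1 = 0 is forced. An algebra homomorphism fixes scalars, while the image of
  \<omega>_1 has to be \<omega>_{1,k+1}, which is 0 by \<open>E_X_E\<close>; and a scalar that acts
  as 0 on all functions on states is 0.\<close>

theorem theorem3p7:
  fixes w1 :: "'a::idom" and r t k :: nat
  assumes half: "(2::'a) dvd 1"
    and w1: "w1 = 0"
    and r: "0 < r" and t: "0 < t" and k: "0 < k"
  shows "\<exists>\<Phi> \<in> superalgebra_hom (BC_aff w1 r t) (BC (r + k) (t + k)).
    (\<forall>i. 1 \<le> i \<and> i < r \<longrightarrow>
      \<Phi> (BC_aff_class w1 r t (var (Fin (S i)))) = BC_class (r + k) (t + k) (var (S (k + i)))) \<and>
    (\<forall>j. 1 \<le> j \<and> j < t \<longrightarrow>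
      \<Phi> (BC_aff_class w1 r t (var (Fin (Sbar j)))) = BC_class (r + k) (t + k) (var (Sbar (k + j)))) \<and>
    \<Phi> (BC_aff_class w1 r t (var (Fin E1))) = BC_class (r + k) (t + k) (bc_e (k + 1)) \<and>
    \<Phi> (BC_aff_class w1 r t (var X1)) = BC_class (r + k) (t + k) (bc_y (k + 1)) \<and>
    \<Phi> (BC_aff_class w1 r t (var X1bar)) = BC_class (r + k) (t + k) (bc_y_bar (k + 1)) \<and>
    (\<forall>l. 1 \<le> l \<and> l \<le> r \<longrightarrow>
      \<Phi> (BC_aff_class w1 r t (var (Fin (C l)))) = BC_class (r + k) (t + k) (var (C (k + l)))) \<and>
    (\<forall>m. 1 \<le> m \<and> m \<le> t \<longrightarrow>
      \<Phi> (BC_aff_class w1 r t (var (Fin (Cbar m)))) = BC_class (r + k) (t + k) (var (Cbar (k + m)))) \<and>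
    (\<forall>a. \<Phi> (BC_aff_class w1 r t (aff_omega w1 a)) = BC_omega (r + k) (t + k) k a) \<and>
    (\<forall>a. 1 \<le> a \<longrightarrow>
      \<Phi> (BC_aff_class w1 r t (var (Ombar a))) = BC_omega_bar (r + k) (t + k) k a)"
proof -
  interpret BC_shift "r + k" "t + k" "TYPE('a)" k
    by unfold_locales (use r t k half in auto)
  have gens: "Fin g \<in> aff_gens r t" if "g \<in> bc_gens r t" for g using that by (simp add: aff_gens_def)
  have mem: "1 \<le> i \<Longrightarrow> i < r \<Longrightarrow> S i \<in> bc_gens r t" "1 \<le> i \<Longrightarrow> i < t \<Longrightarrow> Sbar i \<in> bc_gens r t" "E1 \<in> bc_gens r t"
    "1 \<le> i \<Longrightarrow> i \<le> r \<Longrightarrow> C i \<in> bc_gens r t" "1 \<le> i \<Longrightarrow> i \<le> t \<Longrightarrow> Cbar i \<in> bc_gens r t" for i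
    by (simp_all add: bc_gens_def)
  have X: "X1 \<in> aff_gens r t" "X1bar \<in> aff_gens r t" "1 \<le> a \<Longrightarrow> Ombar a \<in> aff_gens r t" for a
    by (simp_all add: aff_gens_def aff_central_gens_def)
  have eqs: "BC_aff 0 r t = aff.Q" "BC_aff_class (0 :: 'a) r t = aff.cls"
    by (simp_all add: BC_aff_def BC_aff_class_def)
  note vals = \<Phi>_var[unfolded diff_add_inverse2] \<Phi>_omega[unfolded diff_add_inverse2]
  show ?thesis
    unfolding w1 eqs BC_eq BC_omega_eq
    by (rule bexI[OF _ \<Phi>_hom]) (simp add: vals gens mem X aff_sub_def flip: Suc_eq_plus1)
qed

end
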